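(* Suppose that $\beta_1\ne0$ and $\beta_2=\beta_3=0$. Then the Grothendieck ring is $G_0(H_\beta)=R_2':=R_1[x_{\zeta,1}\mid\zeta\in\widehat{\mathbf{K}_0}]$ with relations $$x_{\zeta,1}x_{\zeta',1}=\begin{cases}\mathfrak{s}\,x_{\zeta\zeta',1},&\text{if }(\zeta\zeta')^{n_1}\ne1,\\ n\,\mathfrak{s}\,g_{\zeta\zeta',1,1},&\text{if }(\zeta\zeta')^{n_1}=1.\end{cases}$$
   Context: Let $\mathbf{K}$ be an algebraically closed field of characteristic zero, $\mathbf{K}^*$ its multiplicative group, $n\ge 2$, $q\in\mathbf{K}$ a primitive $n$-th root of unity, $n_1$ an integer with $1\le n_1\le n$ and $2\nmid (n,n_1)$. For $\beta=(\beta_1,\beta_2,\beta_3)\in\mathbf{K}^3$, $H_\beta$ is the Hopf algebra generated by invertible $a,b,c$ and by $x,y$ with relations $ab=ba$, $ac=ca$, $bc=cb$, $xa=qax$, $ya=q^{-1}ay$, $bx=xb$, $cx=xc$, $by=yb$, $cy=yc$, $yx-q^{-n_1}xy=\beta_3(a^{2n_1}-bc)$, $x^n=\beta_1(a^{nn_1}-b^n)$, $y^n=\beta_2(a^{nn_1}-c^n)$, with $a,b,c$ group-like, $\Delta(x)=x\otimes a^{n_1}+b\otimes x$, $\Delta(y)=y\otimes a^{n_1}+c\otimes y$, $\varepsilon(x)=\varepsilon(y)=0$. $G_0(H_\beta)$ is the Grothendieck ring of finite-dimensional left $H_\beta$-modules (relations $[B]=[A]+[C]$ for short exact sequences $0\to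 A\to B\to C\to 0$; product $[M][N]=[M\otimes N]$). For $\gamma_1\in\mathbf{K}^*$ choose an $n$-th root $\sqrt[n]{\gamma_1}$. For $\beta_2=\beta_3=0$: when $\beta_1(\gamma_1^{n_1}-\gamma_2^n)=0$, $V_0(\gamma_1,\gamma_2,\gamma_3;i)=\mathbf{K}$ with $a\cdot1=\sqrt[n]{\gamma_1}q^i$, $b\cdot1=\gamma_2$, $c\cdot1=\gamma_3$, $x\cdot1=y\cdot1=0$; when $\beta_1(\gamma_1^{n_1}-\gamma_2^n)\ne0$, $V_I(\gamma_1,\gamma_2,\gamma_3;i)$ has basis $m_0,\dots,m_{n-1}$ with $am_j=\sqrt[n]{\gamma_1}q^{i-j}m_j$, $bm_j=\gamma_2m_j$, $cm_j=\gamma_3m_j$; $xm_j=m_{j+1}$ ($0\le j\le n-2$), $xm_{n-1}=(\gamma_1^{n_1}-\gamma_2^n)\beta_1m_0$; $ym_j=k_{n-j+1}m_{j-1}$ ($1\le j\le n-1$), $ym_0=k_1m_{n-1}$, where $k_l=q^{(l-1)n_1}\beta_1(\gamma_1^{n_1}-\gamma_2^n)k_1$ for $2\le l\le n$ and $k_1k_2\cdots k_n=0$. Notation: $R_1$ is the subring of $G_0(H_\beta)$ generated by all $[V_0(\gamma_1,\gamma_2,\gamma_3;i)]$ ($\gamma_1,\gamma_2,\gamma_3\in\mathbf{K}^*$, $i\in\mathbb{Z}_n$, whenever defined); $g=[V_0(1,1,1;1)]$; $\mathfrak{s}=\sum_{p=0}^{n-1}g^p$; $g_{\gamma_1,\gamma_2,\gamma_3}=[V_0(\gamma_1,\gamma_2,\gamma_3;0)]$.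 $\bar\omega$ is a primitive $n_1$-th root of unity and $\widehat{\mathbf{K}_0}=(\mathbf{K}^*/\{\bar\omega^r\mid r\in\mathbb{Z}\})\setminus\{\overline1\}$; $x_{\zeta,1}=[V_I(\zeta,1,1;0)]$.
   Formalization: The relations g·x_{ζ,1} = x_{ζ,1} are added to the presentation of R_2' over R_1 (they hold in G_0 but do not follow from the displayed ones); the chosen n-th root of 1 is taken to be 1, and Δ is assumed to be well defined on H_β. *)

theory Defs
  imports
    "Jordan_Normal_Form.Matrix"
    "HOL-Algebra.QuotRing"
    "HOL-Algebra.Generated_Rings"
    "HOL-Algebra.Free_Abelian_Groups"
    "HOL-Algebra.Indexed_Polynomials"
    "HOL-Computational_Algebra.Polynomial"
begin

definition primitive_root :: "nat \<Rightarrow> 'a::field \<Rightarrow> bool" where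
  "primitive_root m z \<longleftrightarrow> m > 0 \<and> z ^ m = 1 \<and> (\<forall>j. 0 < j \<and> j < m \<longrightarrow> z ^ j \<noteq> 1)"


section \<open>The algebra with generators $a^{\pm1}, b^{\pm1}, c^{\pm1}, x, y$\<close>

record 'k hopf_data =
  dn :: nat      \<comment> \<open>$n$\<close>
  dn1 :: nat     \<comment> \<open>$n_1$\<close>
  dq :: 'k
  beta1 :: 'k
  beta2 :: 'k
  beta3 :: 'k

datatype gen = Ga | Ga' | Gb | Gb' | Gc | Gc' | Gx | Gy
  \<comment> \<open>a primed generator is the formal inverse\<close>

text \<open>The free associative unital algebra on \<^typ>\<open>gen\<close>: finitely supported functions on words,
  multiplied by convolution along concatenation.\<close>

type_synonym 'k nc = "gen list \<Rightarrow> 'k"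

definition free_alg :: "'k::field nc ring" where
  "free_alg = \<lparr>carrier = {f. finite {w. f w \<noteq> 0}},
     monoid.mult = (\<lambda>f g w. \<Sum>i\<le>length w. f (take i w) * g (drop i w)),
     one = (\<lambda>w. if w = [] then 1 else 0),
     ring.zero = (\<lambda>_. 0),
     add = (\<lambda>f g w. f w + g w)\<rparr>"

definition word :: "gen list \<Rightarrow> 'k::field nc" where
  "word u = (\<lambda>w. if w = u then 1 else 0)"

definition scal :: "'k::field \<Rightarrow> 'k nc \<Rightarrow> 'k nc" where
  "scal t f = (\<lambda>w. t * f w)"

definition relators :: "'k::field hopf_data \<Rightarrow> 'k nc set" where
  "relators D =
    (let n = dn D; n1 = dn1 D; q = dq D in
     {word [Ga, Ga'] - word [], word [Ga', Ga] - word [],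
      word [Gb, Gb'] - word [], word [Gb', Gb] - word [],
      word [Gc, Gc'] - word [], word [Gc', Gc] - word [],
      word [Ga, Gb] - word [Gb, Ga], word [Ga, Gc] - word [Gc, Ga], word [Gb, Gc] - word [Gc, Gb],
      word [Gx, Ga] - scal q (word [Ga, Gx]),
      word [Gy, Ga] - scal (inverse q) (word [Ga, Gy]),
      word [Gb, Gx] - word [Gx, Gb], word [Gc, Gx] - word [Gx, Gc],
      word [Gb, Gy] - word [Gy, Gb], word [Gc, Gy] - word [Gy, Gc],
      word [Gy, Gx] - scal (inverse (q ^ n1)) (word [Gx, Gy])
        - scal (beta3 D) (word (replicate (2 * n1) Ga) - word [Gb, Gc]),
      word (replicate n Gx)
        - scal (beta1 D) (word (replicate (n * n1) Ga) - word (replicate n Gb)),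
      word (replicate n Gy)
        - scal (beta2 D) (word (replicate (n * n1) Ga) - word (replicate n Gc))})"

definition rel_ideal :: "'k::field hopf_data \<Rightarrow> 'k nc set" where
  "rel_ideal D = Idl\<^bsub>free_alg\<^esub> (relators D)"

definition Halg :: "'k::field hopf_data \<Rightarrow> 'k nc set ring" where
  "Halg D = free_alg Quot (rel_ideal D)"

definition hcls :: "'k::field hopf_data \<Rightarrow> 'k nc \<Rightarrow> 'k nc set" where
  "hcls D f = rel_ideal D +>\<^bsub>free_alg\<^esub> f"


section \<open>Comultiplication and counit\<close>

text \<open>The tensor square of the free algebra: finitely supported functions on pairs of words;
  the pair \<^term>\<open>(u, v)\<close> stands for $u \otimes v$.\<close>

type_synonym 'k nc2 = "gen list \<times> gen list \<Rightarrow> 'k"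

definition free_alg2 :: "'k::field nc2 ring" where
  "free_alg2 = \<lparr>carrier = {f. finite {p. f p \<noteq> 0}},
     monoid.mult = (\<lambda>f g (u, v). \<Sum>i\<le>length u. \<Sum>j\<le>length v.
               f (take i u, take j v) * g (drop i u, drop j v)),
     one = (\<lambda>p. if p = ([], []) then 1 else 0),
     ring.zero = (\<lambda>_. 0),
     add = (\<lambda>f g p. f p + g p)\<rparr>"

definition pure_tensor :: "'k::field nc \<Rightarrow> 'k nc \<Rightarrow> 'k nc2" where
  "pure_tensor f g = (\<lambda>(u, v). f u * g v)"

fun comult_gen :: "'k::field hopf_data \<Rightarrow> gen \<Rightarrow> 'k nc2" where
  "comult_gen D Gx =
     pure_tensor (word [Gx]) (word (replicate (dn1 D) Ga))
       \<oplus>\<^bsub>free_alg2\<^esub> pure_tensor (word [Gb]) (word [Gx])"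
| "comult_gen D Gy =
     pure_tensor (word [Gy]) (word (replicate (dn1 D) Ga))
       \<oplus>\<^bsub>free_alg2\<^esub> pure_tensor (word [Gc]) (word [Gy])"
| "comult_gen D g = pure_tensor (word [g]) (word [g])"

fun comult_word :: "'k::field hopf_data \<Rightarrow> gen list \<Rightarrow> 'k nc2" where
  "comult_word D [] = \<one>\<^bsub>free_alg2\<^esub>"
| "comult_word D (g # w) = comult_gen D g \<otimes>\<^bsub>free_alg2\<^esub> comult_word D w"

definition comult :: "'k::field hopf_data \<Rightarrow> 'k nc \<Rightarrow> 'k nc2" where
  "comult D f = (\<lambda>p. \<Sum>w | f w \<noteq> 0. f w * comult_word D w p)"

fun counit_gen :: "gen \<Rightarrow> 'k::field" where
  "counit_gen Gx = 0"
| "counit_gen Gy = 0"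
| "counit_gen g = 1"

definition counit :: "'k::field nc \<Rightarrow> 'k" where
  "counit f = (\<Sum>w | f w \<noteq> 0. f w * (\<Prod>g\<leftarrow>w. counit_gen g))"

text \<open>With $F$ the free algebra and $I$ the ideal of relations, this is
  $I \otimes F + F \otimes I$, the kernel of $F \otimes F \to H_\beta \otimes H_\beta$.\<close>

definition rel_ideal2 :: "'k::field hopf_data \<Rightarrow> 'k nc2 set" where
  "rel_ideal2 D = Idl\<^bsub>free_alg2\<^esub>
     ((\<lambda>r. pure_tensor r (word [])) ` relators D \<union> (\<lambda>r. pure_tensor (word []) r) ` relators D)"

text \<open>The prescribed values on generators define an algebra map
  $\Delta : H_\beta \to H_\beta \otimes H_\beta$, i.e. $H_\beta$ with them is a bialgebra.
  (The counit always respects the relations, coassociativity and counitality hold on generators,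
  and the antipode $S(x) = -b^{-1} x a^{-n_1}$, $S(y) = -c^{-1} y a^{-n_1}$ then exists.)
  Not automatic: $\Delta(x)^n = x^n \otimes a^{n n_1} + b^n \otimes x^n$ needs the vanishing of
  the Gaussian binomial coefficients at $q^{n_1}$, i.e. that $q^{n_1}$ is again a primitive
  $n$-th root of unity; it is proved at the end of this theory for coprime $n$, $n_1$.\<close>

definition is_Hopf :: "'k::field hopf_data \<Rightarrow> bool" where
  "is_Hopf D \<longleftrightarrow> (\<forall>r\<in>relators D. comult D r \<in> rel_ideal2 D)"


section \<open>Finite-dimensional modules\<close>

text \<open>A left $H_\beta$-module structure on $K^d$ is an algebra homomorphism
  $H_\beta \to M_d(K)$; every finite-dimensional module is isomorphic to one of these.
  Extensionality makes equality of modules meaningful.\<close>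

type_synonym 'k hmod = "nat \<times> ('k nc set \<Rightarrow> 'k mat)"

definition hmods :: "'k::field hopf_data \<Rightarrow> 'k hmod set" where
  "hmods D = {(d, \<rho>).
     \<rho> \<in> ring_hom (Halg D) (ring_mat TYPE('k) d ()) \<and>
     \<rho> \<in> extensional (carrier (Halg D)) \<and>
     (\<forall>t. \<rho> (hcls D (scal t (word []))) = t \<cdot>\<^sub>m 1\<^sub>m d)}"

definition short_exact ::
  "'k::field hopf_data \<Rightarrow> 'k hmod \<Rightarrow> 'k hmod \<Rightarrow> 'k hmod \<Rightarrow> bool" where
  "short_exact D L M N \<longleftrightarrow> (\<exists>F G.
     F \<in> carrier_mat (fst M) (fst L) \<and> G \<in> carrier_mat (fst N) (fst M) \<and>
     (\<forall>h\<in>carrier (Halg D). F * snd L h = snd M h * F \<and> G * snd M h = snd N h * G) \<and>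
     inj_on (\<lambda>v. F *\<^sub>v v) (carrier_vec (fst L)) \<and>
     (\<lambda>v. F *\<^sub>v v) ` carrier_vec (fst L) = {v \<in> carrier_vec (fst M). G *\<^sub>v v = 0\<^sub>v (fst N)} \<and>
     (\<lambda>v. G *\<^sub>v v) ` carrier_vec (fst M) = carrier_vec (fst N))"

definition kron :: "'k::field mat \<Rightarrow> 'k mat \<Rightarrow> 'k mat" where
  "kron A B = mat (dim_row A * dim_row B) (dim_col A * dim_col B)
     (\<lambda>(i, j). A $$ (i div dim_row B, j div dim_col B) * B $$ (i mod dim_row B, j mod dim_col B))"

text \<open>$h$ acts on $M \otimes N$ as $\sum h_{(1)} \otimes h_{(2)}$, computed from the
  comultiplication of any representative of $h$ in the free algebra.\<close>

definition tensor_mod :: "'k::field hopf_data \<Rightarrow> 'k hmod \<Rightarrow> 'k hmod \<Rightarrow> 'k hmod" where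
  "tensor_mod D M N = (fst M * fst N, restrict (\<lambda>h.
     let t = comult D (SOME f. f \<in> h) in
     mat (fst M * fst N) (fst M * fst N) (\<lambda>ij. \<Sum>(u, v) | t (u, v) \<noteq> 0.
       t (u, v) * kron (snd M (hcls D (word u))) (snd N (hcls D (word v))) $$ ij))
     (carrier (Halg D)))"

definition trivial_mod :: "'k::field hopf_data \<Rightarrow> 'k hmod" where
  "trivial_mod D = (1, restrict (\<lambda>h. mat 1 1 (\<lambda>_. counit (SOME f. f \<in> h))) (carrier (Halg D)))"

text \<open>The module on $K^d$ on which each generator \<^term>\<open>g\<close> acts by the matrix \<^term>\<open>E g\<close>
  (meaningful when these matrices satisfy the relations).\<close>

definition mod_of_gens :: "'k::field hopf_data \<Rightarrow> nat \<Rightarrow> (gen \<Rightarrow> 'k mat) \<Rightarrow> 'k hmod" where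
  "mod_of_gens D d E = (d, restrict (\<lambda>h.
     let f = (SOME f. f \<in> h) in
     mat d d (\<lambda>ij. \<Sum>w | f w \<noteq> 0. f w * foldr (\<lambda>g A. E g * A) w (1\<^sub>m d) $$ ij))
     (carrier (Halg D)))"


section \<open>The Grothendieck ring\<close>

text \<open>The free abelian group on the modules, with the bilinear product induced by the tensor
  product; $G_0(H_\beta)$ is its quotient by the subgroup generated by $[B] - [A] - [C]$ for short
  exact sequences.\<close>

definition free_mod_ring :: "'k::field hopf_data \<Rightarrow> ('k hmod \<Rightarrow>\<^sub>0 int) ring" where
  "free_mod_ring D = \<lparr>carrier = {P. Poly_Mapping.keys P \<subseteq> hmods D},
     monoid.mult = (\<lambda>P Q. frag_extend (\<lambda>M. frag_extend (\<lambda>N. frag_of (tensor_mod D M N)) Q) P),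
     one = frag_of (trivial_mod D),
     ring.zero = 0,
     add = (+)\<rparr>"

definition ses_subgroup :: "'k::field hopf_data \<Rightarrow> ('k hmod \<Rightarrow>\<^sub>0 int) set" where
  "ses_subgroup D = generate (add_monoid (free_mod_ring D))
     {frag_of B - (frag_of A + frag_of C) | A B C.
        A \<in> hmods D \<and> B \<in> hmods D \<and> C \<in> hmods D \<and> short_exact D A B C}"

definition G0 :: "'k::field hopf_data \<Rightarrow> ('k hmod \<Rightarrow>\<^sub>0 int) set ring" where
  "G0 D = free_mod_ring D Quot ses_subgroup D"

definition mcls :: "'k::field hopf_data \<Rightarrow> 'k hmod \<Rightarrow> ('k hmod \<Rightarrow>\<^sub>0 int) set" where
  "mcls D M = ses_subgroup D +>\<^bsub>free_mod_ring D\<^esub> frag_of M"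


section \<open>The modules $V_0$ and $V_I$ (for $\beta_2 = \beta_3 = 0$)\<close>

text \<open>\<^term>\<open>rt\<close> is the chosen $n$-th root function.\<close>

definition V0 :: "'k::field hopf_data \<Rightarrow> ('k \<Rightarrow> 'k) \<Rightarrow> 'k \<Rightarrow> 'k \<Rightarrow> 'k \<Rightarrow> int \<Rightarrow> 'k hmod" where
  "V0 D rt \<gamma>1 \<gamma>2 \<gamma>3 i =
    (let \<alpha> = rt \<gamma>1 * dq D powi i in
     mod_of_gens D 1 (\<lambda>g. mat 1 1 (\<lambda>_. case g of
        Ga \<Rightarrow> \<alpha> | Ga' \<Rightarrow> inverse \<alpha> | Gb \<Rightarrow> \<gamma>2 | Gb' \<Rightarrow> inverse \<gamma>2
      | Gc \<Rightarrow> \<gamma>3 | Gc' \<Rightarrow> inverse \<gamma>3 | Gx \<Rightarrow> 0 | Gy \<Rightarrow> 0)))"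

definition VI_scalar :: "'k::field hopf_data \<Rightarrow> 'k \<Rightarrow> 'k \<Rightarrow> 'k" where
  "VI_scalar D \<gamma>1 \<gamma>2 = beta1 D * (\<gamma>1 ^ dn1 D - \<gamma>2 ^ dn D)"

definition VI_k :: "'k::field hopf_data \<Rightarrow> 'k \<Rightarrow> 'k \<Rightarrow> 'k \<Rightarrow> nat \<Rightarrow> 'k" where
  "VI_k D \<gamma>1 \<gamma>2 \<kappa> l =
    (if l = 1 then \<kappa> else dq D ^ ((l - 1) * dn1 D) * VI_scalar D \<gamma>1 \<gamma>2 * \<kappa>)"

text \<open>The condition $k_1 k_2 \cdots k_n = 0$ determines $k_1$ (it forces $k_1 = 0$) whenever
  \<^const>\<open>VI_scalar\<close> is nonzero.\<close>

definition VI_k1 :: "'k::field hopf_data \<Rightarrow> 'k \<Rightarrow> 'k \<Rightarrow> 'k" where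
  "VI_k1 D \<gamma>1 \<gamma>2 = (THE \<kappa>. (\<Prod>l=1..dn D. VI_k D \<gamma>1 \<gamma>2 \<kappa> l) = 0)"

text \<open>Column \<^term>\<open>j\<close> of a matrix is the image of the basis vector $m_j$.\<close>

definition VI :: "'k::field hopf_data \<Rightarrow> ('k \<Rightarrow> 'k) \<Rightarrow> 'k \<Rightarrow> 'k \<Rightarrow> 'k \<Rightarrow> int \<Rightarrow> 'k hmod" where
  "VI D rt \<gamma>1 \<gamma>2 \<gamma>3 i =
    (let n = dn D; k = VI_k D \<gamma>1 \<gamma>2 (VI_k1 D \<gamma>1 \<gamma>2);
         \<alpha> = (\<lambda>j. rt \<gamma>1 * dq D powi (i - int j)) in
     mod_of_gens D n (\<lambda>g. mat n n (\<lambda>(r, j). case g of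
        Ga \<Rightarrow> (if r = j then \<alpha> j else 0)
      | Ga' \<Rightarrow> (if r = j then inverse (\<alpha> j) else 0)
      | Gb \<Rightarrow> (if r = j then \<gamma>2 else 0)
      | Gb' \<Rightarrow> (if r = j then inverse \<gamma>2 else 0)
      | Gc \<Rightarrow> (if r = j then \<gamma>3 else 0)
      | Gc' \<Rightarrow> (if r = j then inverse \<gamma>3 else 0)
      | Gx \<Rightarrow> (if j < n - 1 then (if r = j + 1 then 1 else 0)
               else (if r = 0 then (\<gamma>1 ^ dn1 D - \<gamma>2 ^ n) * beta1 D else 0))
      | Gy \<Rightarrow> (if j = 0 then (if r = n - 1 then k 1 else 0)
               else (if r = j - 1 then k (n - j + 1) else 0)))))"


section \<open>The subring $R_1$ and the named elements of $G_0(H_\beta)$\<close>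

definition R1 :: "'k::field hopf_data \<Rightarrow> ('k \<Rightarrow> 'k) \<Rightarrow> ('k hmod \<Rightarrow>\<^sub>0 int) set set" where
  "R1 D rt = generate_ring (G0 D)
     {mcls D (V0 D rt \<gamma>1 \<gamma>2 \<gamma>3 i) | \<gamma>1 \<gamma>2 \<gamma>3 i.
        \<gamma>1 \<noteq> 0 \<and> \<gamma>2 \<noteq> 0 \<and> \<gamma>3 \<noteq> 0 \<and> beta1 D * (\<gamma>1 ^ dn1 D - \<gamma>2 ^ dn D) = 0}"

definition R1_ring :: "'k::field hopf_data \<Rightarrow> ('k \<Rightarrow> 'k) \<Rightarrow> ('k hmod \<Rightarrow>\<^sub>0 int) set ring" where
  "R1_ring D rt = (G0 D)\<lparr>carrier := R1 D rt\<rparr>"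

definition g_elt :: "'k::field hopf_data \<Rightarrow> ('k \<Rightarrow> 'k) \<Rightarrow> ('k hmod \<Rightarrow>\<^sub>0 int) set" where
  "g_elt D rt = mcls D (V0 D rt 1 1 1 1)"

definition s_elt :: "'k::field hopf_data \<Rightarrow> ('k \<Rightarrow> 'k) \<Rightarrow> ('k hmod \<Rightarrow>\<^sub>0 int) set" where
  "s_elt D rt = (\<Oplus>\<^bsub>G0 D\<^esub> p\<in>{0..dn D - 1}. g_elt D rt [^]\<^bsub>G0 D\<^esub> p)"

definition g3 :: "'k::field hopf_data \<Rightarrow> ('k \<Rightarrow> 'k) \<Rightarrow> 'k \<Rightarrow> 'k \<Rightarrow> 'k \<Rightarrow> ('k hmod \<Rightarrow>\<^sub>0 int) set" where
  "g3 D rt \<gamma>1 \<gamma>2 \<gamma>3 = mcls D (V0 D rt \<gamma>1 \<gamma>2 \<gamma>3 0)"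

definition x_elt :: "'k::field hopf_data \<Rightarrow> ('k \<Rightarrow> 'k) \<Rightarrow> 'k \<Rightarrow> ('k hmod \<Rightarrow>\<^sub>0 int) set" where
  "x_elt D rt \<zeta> = mcls D (VI D rt \<zeta> 1 1 0)"

definition mu_cls :: "'k::field \<Rightarrow> 'k \<Rightarrow> 'k set" where
  "mu_cls \<omega> \<zeta> = {\<zeta> * \<omega> powi r | r. True}"

definition K0hat :: "'k::field \<Rightarrow> 'k set set" where
  "K0hat \<omega> = mu_cls \<omega> ` {\<zeta>. \<zeta> \<noteq> 0} - {mu_cls \<omega> 1}"


section \<open>Polynomial rings and the presentation\<close>

text \<open>The polynomial ring over a commutative ring \<^term>\<open>R\<close> in variables indexed by \<^term>\<open>I\<close>;
  monomials are multisets, as in \<^theory>\<open>HOL-Algebra.Indexed_Polynomials\<close>.\<close>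

definition mpoly_ring :: "'a ring \<Rightarrow> 'i set \<Rightarrow> ('i multiset \<Rightarrow> 'a) ring" where
  "mpoly_ring R I = \<lparr>carrier = ring.indexed_pset R I (carrier R),
     monoid.mult = (\<lambda>p p' m. \<Oplus>\<^bsub>R\<^esub> u\<in>{u. u \<subseteq># m}. p u \<otimes>\<^bsub>R\<^esub> p' (m - u)),
     one = ring.indexed_const R \<one>\<^bsub>R\<^esub>,
     ring.zero = ring.indexed_const R \<zero>\<^bsub>R\<^esub>,
     add = ring.indexed_padd R\<rparr>"

abbreviation pconst ::
  "'k::field hopf_data \<Rightarrow> ('k \<Rightarrow> 'k) \<Rightarrow> ('k hmod \<Rightarrow>\<^sub>0 int) set
     \<Rightarrow> ('k set multiset \<Rightarrow> ('k hmod \<Rightarrow>\<^sub>0 int) set)" where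
  "pconst D rt \<equiv> ring.indexed_const (R1_ring D rt)"

abbreviation pvar ::
  "'k::field hopf_data \<Rightarrow> ('k \<Rightarrow> 'k) \<Rightarrow> 'k set
     \<Rightarrow> ('k set multiset \<Rightarrow> ('k hmod \<Rightarrow>\<^sub>0 int) set)" where
  "pvar D rt \<equiv> ring.indexed_var (R1_ring D rt)"

definition R1_poly ::
  "'k::field hopf_data \<Rightarrow> ('k \<Rightarrow> 'k) \<Rightarrow> 'k
     \<Rightarrow> ('k set multiset \<Rightarrow> ('k hmod \<Rightarrow>\<^sub>0 int) set) ring" where
  "R1_poly D rt \<omega> = mpoly_ring (R1_ring D rt) (K0hat \<omega>)"

text \<open>There is one variable for each class in \<^const>\<open>K0hat\<close>, standing for the chosen representative
  \<^term>\<open>rep\<close> of that class. For an arbitrary \<^term>\<open>\<zeta>\<close> the symbol $x_{\zeta,1}$ stands for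
  $g_{\zeta/\zeta_0,1,1}\, x_{\zeta_0,1}$, where $\zeta_0$ is the representative of the class of
  \<^term>\<open>\<zeta>\<close>.\<close>

definition x_formal ::
  "'k::field hopf_data \<Rightarrow> ('k \<Rightarrow> 'k) \<Rightarrow> 'k \<Rightarrow> ('k set \<Rightarrow> 'k) \<Rightarrow> 'k
     \<Rightarrow> ('k set multiset \<Rightarrow> ('k hmod \<Rightarrow>\<^sub>0 int) set)" where
  "x_formal D rt \<omega> rep \<zeta> =
     pconst D rt (g3 D rt (\<zeta> / rep (mu_cls \<omega> \<zeta>)) 1 1)
       \<otimes>\<^bsub>R1_poly D rt \<omega>\<^esub> pvar D rt (mu_cls \<omega> \<zeta>)"

definition x_relators ::
  "'k::field hopf_data \<Rightarrow> ('k \<Rightarrow> 'k) \<Rightarrow> 'k \<Rightarrow> ('k set \<Rightarrow> 'k)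
     \<Rightarrow> ('k set multiset \<Rightarrow> ('k hmod \<Rightarrow>\<^sub>0 int) set) set" where
  "x_relators D rt \<omega> rep =
     {(pvar D rt C \<otimes>\<^bsub>R1_poly D rt \<omega>\<^esub> pvar D rt C') \<ominus>\<^bsub>R1_poly D rt \<omega>\<^esub>
        (let z = rep C * rep C' in
         if z ^ dn1 D \<noteq> 1
         then pconst D rt (s_elt D rt) \<otimes>\<^bsub>R1_poly D rt \<omega>\<^esub> x_formal D rt \<omega> rep z
         else pconst D rt (add_pow (G0 D) (dn D) (s_elt D rt \<otimes>\<^bsub>G0 D\<^esub> g3 D rt z 1 1)))
      | C C'. C \<in> K0hat \<omega> \<and> C' \<in> K0hat \<omega>}"

text \<open>The $R_1$-module structure of $R_1 x_{\zeta,1}$: since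
  $V_I(\zeta,1,1;i) \cong V_I(\zeta,1,1;0)$ for all $i$, tensoring with $V_0(1,1,1;1)$ fixes
  $x_{\zeta,1}$. This does not follow from \<^const>\<open>x_relators\<close>: by themselves these define an
  algebra that is free over $R_1$ on $1$ and the $x_{\zeta,1}$.\<close>

definition g_relators ::
  "'k::field hopf_data \<Rightarrow> ('k \<Rightarrow> 'k) \<Rightarrow> 'k
     \<Rightarrow> ('k set multiset \<Rightarrow> ('k hmod \<Rightarrow>\<^sub>0 int) set) set" where
  "g_relators D rt \<omega> =
     {(pconst D rt (g_elt D rt) \<otimes>\<^bsub>R1_poly D rt \<omega>\<^esub> pvar D rt C) \<ominus>\<^bsub>R1_poly D rt \<omega>\<^esub> pvar D rt C
      | C. C \<in> K0hat \<omega>}"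

definition pres_ideal ::
  "'k::field hopf_data \<Rightarrow> ('k \<Rightarrow> 'k) \<Rightarrow> 'k \<Rightarrow> ('k set \<Rightarrow> 'k)
     \<Rightarrow> ('k set multiset \<Rightarrow> ('k hmod \<Rightarrow>\<^sub>0 int) set) set" where
  "pres_ideal D rt \<omega> rep =
     Idl\<^bsub>R1_poly D rt \<omega>\<^esub> (x_relators D rt \<omega> rep \<union> g_relators D rt \<omega>)"

definition R2' ::
  "'k::field hopf_data \<Rightarrow> ('k \<Rightarrow> 'k) \<Rightarrow> 'k \<Rightarrow> ('k set \<Rightarrow> 'k)
     \<Rightarrow> ('k set multiset \<Rightarrow> ('k hmod \<Rightarrow>\<^sub>0 int) set) set ring" where
  "R2' D rt \<omega> rep = R1_poly D rt \<omega> Quot pres_ideal D rt \<omega> rep"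


section \<open>The Hopf condition holds for coprime $n$ and $n_1$\<close>

definition splits2 :: "gen list \<times> gen list \<Rightarrow> ((gen list \<times> gen list) \<times> (gen list \<times> gen list)) set" where
  "splits2 p = {(a, b). fst a @ fst b = fst p \<and> snd a @ snd b = snd p}"

lemma splits2_bij:
  "bij_betw (\<lambda>(i, j). ((take i u, take j v), (drop i u, drop j v)))
     ({..length u} \<times> {..length v}) (splits2 (u, v))"
  by (rule bij_betwI[where g = "\<lambda>(a, b). (length (fst a), length (snd a))"])
     (auto simp: splits2_def)

lemma finite_splits2: "finite (splits2 p)"
  using bij_betw_finite[OF splits2_bij[of "fst p" "snd p"]] by simp

lemma fa2_mult: "(f \<otimes>\<^bsub>free_alg2\<^esub> g) p = (\<Sum>(a, b)\<in>splits2 p. f a * g b)"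
proof -
  obtain u v where p: "p = (u, v)" by force
  show ?thesis unfolding p
    apply (subst sum.reindex_bij_betw[OF splits2_bij, symmetric])
    apply (simp add: free_alg2_def sum.cartesian_product split_def)
    done
qed

lemma fa2_assoc:
  "((f \<otimes>\<^bsub>free_alg2\<^esub> g) \<otimes>\<^bsub>free_alg2\<^esub> h) = (f \<otimes>\<^bsub>free_alg2\<^esub> (g \<otimes>\<^bsub>free_alg2\<^esub> h))"
proof
  fix p
  have "((f \<otimes>\<^bsub>free_alg2\<^esub> g) \<otimes>\<^bsub>free_alg2\<^esub> h) p =
    (\<Sum>x\<in>splits2 p. \<Sum>y\<in>splits2 (fst x). f (fst y) * g (snd y) * h (snd x))"
    by (simp add: fa2_mult split_def sum_distrib_right)
  also have "\<dots> = (\<Sum>z\<in>Sigma (splits2 p) (\<lambda>x. splits2 (fst x)). f (fst (snd z)) * g (snd (snd z)) * h (snd (fst z)))"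
    by (subst sum.Sigma) (auto simp: finite_splits2 split_def)
  also have "\<dots> = (\<Sum>z\<in>Sigma (splits2 p) (\<lambda>x. splits2 (snd x)). f (fst (fst z)) * g (fst (snd z)) * h (snd (snd z)))"
    by (rule sum.reindex_bij_witness[where
          i = "\<lambda>((a, r), (b, c)). (((fst a @ fst b, snd a @ snd b), c), (a, b))" and
          j = "\<lambda>((r, c), (a, b)). ((a, (fst b @ fst c, snd b @ snd c)), (b, c))"])
       (auto simp: splits2_def)
  also have "\<dots> = (\<Sum>x\<in>splits2 p. \<Sum>y\<in>splits2 (snd x). f (fst x) * (g (fst y) * h (snd y)))"
    by (subst sum.Sigma) (auto simp: finite_splits2 split_def mult.assoc)
  also have "\<dots> = (f \<otimes>\<^bsub>free_alg2\<^esub> (g \<otimes>\<^bsub>free_alg2\<^esub> h)) p"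
    by (simp add: fa2_mult split_def sum_distrib_left)
  finally show "((f \<otimes>\<^bsub>free_alg2\<^esub> g) \<otimes>\<^bsub>free_alg2\<^esub> h) p = (f \<otimes>\<^bsub>free_alg2\<^esub> (g \<otimes>\<^bsub>free_alg2\<^esub> h)) p" .
qed

lemma fa2_simps:
  "carrier free_alg2 = {f. finite {p. f p \<noteq> 0}}"
  "f \<oplus>\<^bsub>free_alg2\<^esub> g = (\<lambda>p. f p + g p)"
  "\<one>\<^bsub>free_alg2\<^esub> = (\<lambda>p. if p = ([], []) then 1 else 0)"
  "\<zero>\<^bsub>free_alg2\<^esub> = (\<lambda>p. 0)"
  by (simp_all add: free_alg2_def)

lemma fa2_mult_closed:
  assumes "f \<in> carrier free_alg2" "g \<in> carrier free_alg2"
  shows "f \<otimes>\<^bsub>free_alg2\<^esub> g \<in> carrier free_alg2"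
proof -
  have "{p. (f \<otimes>\<^bsub>free_alg2\<^esub> g) p \<noteq> 0} \<subseteq>
    (\<lambda>(a, b). (fst a @ fst b, snd a @ snd b)) ` ({p. f p \<noteq> 0} \<times> {p. g p \<noteq> 0})"
  proof
    fix p assume "p \<in> {p. (f \<otimes>\<^bsub>free_alg2\<^esub> g) p \<noteq> 0}"
    then have "(\<Sum>x\<in>splits2 p. f (fst x) * g (snd x)) \<noteq> 0" by (simp add: fa2_mult split_def)
    then obtain x where x: "x \<in> splits2 p" "f (fst x) * g (snd x) \<noteq> 0"
      by (meson sum.neutral)
    then show "p \<in> (\<lambda>(a, b). (fst a @ fst b, snd a @ snd b)) ` ({p. f p \<noteq> 0} \<times> {p. g p \<noteq> 0})"
      by (intro image_eqI[where x = x]) (auto simp: splits2_def prod_eq_iff)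
  qed
  then show ?thesis using assms by (auto simp: fa2_simps intro: finite_subset)
qed

lemma fa2_one_mult: "\<one>\<^bsub>free_alg2\<^esub> \<otimes>\<^bsub>free_alg2\<^esub> f = f" "f \<otimes>\<^bsub>free_alg2\<^esub> \<one>\<^bsub>free_alg2\<^esub> = f"
proof -
  show "\<one>\<^bsub>free_alg2\<^esub> \<otimes>\<^bsub>free_alg2\<^esub> f = f"
  proof
    fix p
    have "(\<one>\<^bsub>free_alg2\<^esub> \<otimes>\<^bsub>free_alg2\<^esub> f) p = (\<Sum>x\<in>splits2 p. if x = (([], []), p) then f p else 0)"
      unfolding fa2_mult by (rule sum.cong) (auto simp: fa2_simps splits2_def prod_eq_iff)
    then show "(\<one>\<^bsub>free_alg2\<^esub> \<otimes>\<^bsub>free_alg2\<^esub> f) p = f p"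
      by (simp add: finite_splits2) (simp add: splits2_def)
  qed
  show "f \<otimes>\<^bsub>free_alg2\<^esub> \<one>\<^bsub>free_alg2\<^esub> = f"
  proof
    fix p
    have "(f \<otimes>\<^bsub>free_alg2\<^esub> \<one>\<^bsub>free_alg2\<^esub>) p = (\<Sum>x\<in>splits2 p. if x = (p, ([], [])) then f p else 0)"
      unfolding fa2_mult by (rule sum.cong) (auto simp: fa2_simps splits2_def prod_eq_iff)
    then show "(f \<otimes>\<^bsub>free_alg2\<^esub> \<one>\<^bsub>free_alg2\<^esub>) p = f p"
      by (simp add: finite_splits2) (simp add: splits2_def)
  qed
qed

lemma fa2_one_closed: "\<one>\<^bsub>free_alg2\<^esub> \<in> carrier free_alg2"
  by (simp add: fa2_simps)

lemma fa2_add_closed: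
  assumes "f \<in> carrier free_alg2" "g \<in> carrier free_alg2"
  shows "(\<lambda>p. f p + g p) \<in> carrier free_alg2"
proof -
  have "{p. f p + g p \<noteq> 0} \<subseteq> {p. f p \<noteq> 0} \<union> {p. g p \<noteq> 0}" by auto
  then show ?thesis using assms by (auto simp: fa2_simps intro: finite_subset)
qed

lemma ring_fa2: "ring (free_alg2 :: 'a::field nc2 ring)"
proof (rule ringI)
  show "abelian_group (free_alg2 :: 'a nc2 ring)"
  proof (rule abelian_groupI)
    fix f :: "'a nc2" assume "f \<in> carrier free_alg2"
    then show "\<exists>g\<in>carrier free_alg2. g \<oplus>\<^bsub>free_alg2\<^esub> f = \<zero>\<^bsub>free_alg2\<^esub>"
      by (intro bexI[where x = "\<lambda>p. - f p"]) (auto simp: fa2_simps)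
  next
    show "\<zero>\<^bsub>free_alg2\<^esub> \<in> carrier (free_alg2 :: 'a nc2 ring)" by (simp add: fa2_simps)
  qed (auto simp: fa2_simps(2,3,4) fa2_add_closed add.assoc add.commute)
  show "Group.monoid (free_alg2 :: 'a nc2 ring)"
    by (rule monoidI) (simp_all add: fa2_mult_closed fa2_assoc fa2_one_mult fa2_one_closed)
qed (simp_all add: fa2_mult fa2_simps fun_eq_iff split_def sum.distrib distrib_left distrib_right)


lemma word_fin [simp]: "finite {w. word u w \<noteq> (0::'a::field)}"
  by (simp add: word_def)

lemma pure_word: "pure_tensor (word u) (word v) = (\<lambda>p. if p = (u, v) then 1 else 0)"
  by (auto simp: pure_tensor_def word_def fun_eq_iff)

lemma pure_word_closed [simp]: "pure_tensor (word u) (word v) \<in> carrier free_alg2"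
  by (simp add: pure_word fa2_simps)

lemma pure_word_mult:
  "pure_tensor (word u) (word v) \<otimes>\<^bsub>free_alg2\<^esub> pure_tensor (word u') (word v')
     = pure_tensor (word (u @ u')) (word (v @ v'))"
proof
  fix p
  have "(pure_tensor (word u) (word v) \<otimes>\<^bsub>free_alg2\<^esub> pure_tensor (word u') (word v')) p
    = (\<Sum>x\<in>splits2 p. if x = ((u, v), (u', v')) then 1 else 0)"
    unfolding fa2_mult by (rule sum.cong) (auto simp: pure_word split: if_splits)
  also have "\<dots> = pure_tensor (word (u @ u')) (word (v @ v')) p"
    by (simp add: finite_splits2) (auto simp: splits2_def pure_word)
  finally show "(pure_tensor (word u) (word v) \<otimes>\<^bsub>free_alg2\<^esub> pure_tensor (word u') (word v')) p
    = pure_tensor (word (u @ u')) (word (v @ v')) p" .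
qed

definition sc2 :: "'k::field \<Rightarrow> 'k nc2" where
  "sc2 t = (\<lambda>p. if p = ([], []) then t else 0)"

lemma sc2_closed [simp]: "sc2 t \<in> carrier free_alg2"
  by (simp add: fa2_simps sc2_def)

lemma sc2_mult: "sc2 t \<otimes>\<^bsub>free_alg2\<^esub> f = (\<lambda>p. t * f p)" "f \<otimes>\<^bsub>free_alg2\<^esub> sc2 t = (\<lambda>p. t * f p)"
proof -
  show "sc2 t \<otimes>\<^bsub>free_alg2\<^esub> f = (\<lambda>p. t * f p)"
  proof
    fix p
    have "(sc2 t \<otimes>\<^bsub>free_alg2\<^esub> f) p = (\<Sum>x\<in>splits2 p. if x = (([], []), p) then t * f p else 0)"
      unfolding fa2_mult by (rule sum.cong) (auto simp: sc2_def splits2_def prod_eq_iff)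
    then show "(sc2 t \<otimes>\<^bsub>free_alg2\<^esub> f) p = t * f p"
      by (simp add: finite_splits2) (simp add: splits2_def)
  qed
  show "f \<otimes>\<^bsub>free_alg2\<^esub> sc2 t = (\<lambda>p. t * f p)"
  proof
    fix p
    have "(f \<otimes>\<^bsub>free_alg2\<^esub> sc2 t) p = (\<Sum>x\<in>splits2 p. if x = (p, ([], [])) then t * f p else 0)"
      unfolding fa2_mult by (rule sum.cong) (auto simp: sc2_def splits2_def prod_eq_iff)
    then show "(f \<otimes>\<^bsub>free_alg2\<^esub> sc2 t) p = t * f p"
      by (simp add: finite_splits2) (simp add: splits2_def)
  qed
qed

lemma comult_gen_closed [simp]: "comult_gen D g \<in> carrier free_alg2"
  by (cases g) (auto intro!: ring.ring_simprules[OF ring_fa2])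

lemma comult_word_closed [simp]: "comult_word D w \<in> carrier free_alg2"
  by (induction w) (auto intro: fa2_one_closed fa2_mult_closed)

lemma comult_eq_sum:
  assumes "finite A" "{w. f w \<noteq> 0} \<subseteq> A"
  shows "comult D f p = (\<Sum>w\<in>A. f w * comult_word D w p)"
  unfolding comult_def using assms by (intro sum.mono_neutral_left) auto

lemma comult_word' [simp]: "comult D (word w) = comult_word D w"
proof
  fix p
  have "comult D (word w) p = (\<Sum>u\<in>{w}. word w u * comult_word D u p)"
    by (rule comult_eq_sum) (auto simp: word_def)
  then show "comult D (word w) p = comult_word D w p" by (simp add: word_def)
qed

lemma comult_diff:
  assumes "finite {w. f w \<noteq> 0}" "finite {w. g w \<noteq> 0}"
  shows "comult D (f - g) = (\<lambda>p. comult D f p - comult D g p)"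
proof
  fix p
  let ?A = "{w. f w \<noteq> 0} \<union> {w. g w \<noteq> 0}"
  have A: "finite ?A" using assms by simp
  have "comult D (f - g) p = (\<Sum>w\<in>?A. (f - g) w * comult_word D w p)"
    by (rule comult_eq_sum[OF A]) auto
  moreover have "comult D f p = (\<Sum>w\<in>?A. f w * comult_word D w p)"
    by (rule comult_eq_sum[OF A]) auto
  moreover have "comult D g p = (\<Sum>w\<in>?A. g w * comult_word D w p)"
    by (rule comult_eq_sum[OF A]) auto
  ultimately show "comult D (f - g) p = comult D f p - comult D g p"
    by (simp add: sum_subtractf left_diff_distrib)
qed

lemma comult_scal:
  assumes "finite {w. f w \<noteq> 0}"
  shows "comult D (scal t f) = (\<lambda>p. t * comult D f p)"
proof
  fix p
  have "comult D (scal t f) p = (\<Sum>w\<in>{w. f w \<noteq> 0}. scal t f w * comult_word D w p)"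
    by (rule comult_eq_sum[OF assms]) (auto simp: scal_def)
  then show "comult D (scal t f) p = t * comult D f p"
    by (simp add: scal_def comult_def sum_distrib_left mult.assoc)
qed

lemma diff_fin: "finite {w. f w \<noteq> 0} \<Longrightarrow> finite {w. g w \<noteq> 0} \<Longrightarrow> finite {w. (f - g) w \<noteq> (0::'a::field)}"
  by (rule finite_subset[of _ "{w. f w \<noteq> 0} \<union> {w. g w \<noteq> 0}"]) auto

lemma scal_fin: "finite {w. f w \<noteq> 0} \<Longrightarrow> finite {w. scal t f w \<noteq> (0::'a::field)}"
  by (rule finite_subset[of _ "{w. f w \<noteq> 0}"]) (auto simp: scal_def)

lemma relators_fin: "r \<in> relators D \<Longrightarrow> finite {w. r w \<noteq> 0}"
  unfolding relators_def Let_def by (auto intro!: diff_fin scal_fin simp del: minus_apply)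

lemma pure_left_fin: 
  assumes "finite {w. r w \<noteq> 0}"
  shows "pure_tensor r (word []) \<in> carrier free_alg2"
proof -
  have "{p. pure_tensor r (word []) p \<noteq> 0} \<subseteq> (\<lambda>w. (w, [])) ` {w. r w \<noteq> 0}"
    by (auto simp: pure_tensor_def word_def split: if_splits)
  then show ?thesis unfolding fa2_simps using finite_subset assms by blast
qed

lemma pure_right_fin:
  assumes "finite {w. r w \<noteq> 0}"
  shows "pure_tensor (word []) r \<in> carrier free_alg2"
proof -
  have "{p. pure_tensor (word []) r p \<noteq> 0} \<subseteq> (\<lambda>w. ([], w)) ` {w. r w \<noteq> 0}"
    by (auto simp: pure_tensor_def word_def split: if_splits)
  then show ?thesis unfolding fa2_simps using finite_subset assms by blast
qed

lemma ideal2: "ideal (rel_ideal2 D) free_alg2"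
  unfolding rel_ideal2_def
  by (rule ring.genideal_ideal[OF ring_fa2]) (auto dest!: relators_fin intro: pure_left_fin pure_right_fin)

lemma ideal2_incl:
  assumes "r \<in> relators D"
  shows "pure_tensor r (word []) \<in> rel_ideal2 D" "pure_tensor (word []) r \<in> rel_ideal2 D"
  unfolding rel_ideal2_def using assms by (auto simp: genideal_def)

definition qpi :: "'k::field hopf_data \<Rightarrow> 'k nc2 \<Rightarrow> 'k nc2 set" where
  "qpi D f = rel_ideal2 D +>\<^bsub>free_alg2\<^esub> f"

abbreviation "Halg2 D \<equiv> free_alg2 Quot rel_ideal2 D"

lemma ring_HH: "ring (Halg2 D)"
  by (rule ideal.quotient_is_ring[OF ideal2])

lemma qpi_hom: "qpi D \<in> ring_hom free_alg2 (Halg2 D)"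
  unfolding qpi_def[abs_def] by (rule ideal.rcos_ring_hom[OF ideal2])

lemmas qpi_mult = ring_hom_mult[OF qpi_hom]
lemmas qpi_add = ring_hom_add[OF qpi_hom]
lemmas qpi_closed = ring_hom_closed[OF qpi_hom]
lemmas qpi_one = ring_hom_one[OF qpi_hom]

lemma fa2_minus: 
  assumes "f \<in> carrier free_alg2" "g \<in> carrier free_alg2"
  shows "f \<ominus>\<^bsub>free_alg2\<^esub> g = (\<lambda>p. f p - g p)"
proof -
  interpret ring "free_alg2 :: 'a nc2 ring" by (rule ring_fa2)
  have 1: "(\<lambda>p. - g p) \<in> carrier free_alg2" using assms by (simp add: fa2_simps)
  have "(\<lambda>p. - g p) \<oplus>\<^bsub>free_alg2\<^esub> g = \<zero>\<^bsub>free_alg2\<^esub>" by (simp add: fa2_simps)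
  then have "\<ominus>\<^bsub>free_alg2\<^esub> g = (\<lambda>p. - g p)"
    using 1 assms minus_equality by blast
  then show ?thesis by (simp add: a_minus_def fa2_simps)
qed

lemma qpi_eq_iff:
  assumes "f \<in> carrier free_alg2" "g \<in> carrier free_alg2"
  shows "qpi D f = qpi D g \<longleftrightarrow> (\<lambda>p. f p - g p) \<in> rel_ideal2 D"
  unfolding qpi_def fa2_minus[OF assms, symmetric]
  using ring.quotient_eq_iff_same_a_r_cos[OF ring_fa2 ideal2 assms] by blast


definition tens_cls :: "'k::field hopf_data \<Rightarrow> gen list \<Rightarrow> gen list \<Rightarrow> 'k nc2 set" where
  "tens_cls D u v = qpi D (pure_tensor (word u) (word v))"

definition scal_cls :: "'k::field hopf_data \<Rightarrow> 'k \<Rightarrow> 'k nc2 set" where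
  "scal_cls D t = qpi D (sc2 t)"

lemma tens_cls_closed [simp]: "tens_cls D u v \<in> carrier (Halg2 D)"
  by (simp add: tens_cls_def qpi_closed)

lemma scal_cls_closed [simp]: "scal_cls D t \<in> carrier (Halg2 D)"
  by (simp add: scal_cls_def qpi_closed)

lemma tens_cls_mult [simp]: "tens_cls D u v \<otimes>\<^bsub>Halg2 D\<^esub> tens_cls D u' v' = tens_cls D (u @ u') (v @ v')"
  by (simp add: tens_cls_def pure_word_mult flip: qpi_mult)

lemma tens_cls_one: "tens_cls D [] [] = \<one>\<^bsub>Halg2 D\<^esub>"
proof -
  have "pure_tensor (word []) (word []) = (\<one>\<^bsub>free_alg2\<^esub> :: 'a nc2)"
    by (simp add: pure_word fa2_simps)
  then show ?thesis by (simp add: tens_cls_def qpi_one)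
qed

lemma qpi_scal: "f \<in> carrier free_alg2 \<Longrightarrow> qpi D (\<lambda>p. t * f p) = scal_cls D t \<otimes>\<^bsub>Halg2 D\<^esub> qpi D f"
  by (simp add: scal_cls_def sc2_mult flip: qpi_mult)

lemma scal_cls_central: "Z \<in> carrier (Halg2 D) \<Longrightarrow> Z \<otimes>\<^bsub>Halg2 D\<^esub> scal_cls D t = scal_cls D t \<otimes>\<^bsub>Halg2 D\<^esub> Z"
proof -
  assume "Z \<in> carrier (Halg2 D)"
  then obtain f where f: "f \<in> carrier free_alg2" "Z = qpi D f"
    unfolding qpi_def FactRing_def A_RCOSETS_def' by auto
  then show ?thesis by (simp add: scal_cls_def sc2_mult flip: qpi_mult)
qed

lemma scal_cls_mult: "scal_cls D s \<otimes>\<^bsub>Halg2 D\<^esub> scal_cls D t = scal_cls D (s * t)"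
proof -
  have "(\<lambda>p. s * sc2 t p) = sc2 (s * t)" by (auto simp: sc2_def)
  then show ?thesis by (simp add: scal_cls_def sc2_mult(1) flip: qpi_mult)
qed

lemma scal_cls_add: "scal_cls D s \<oplus>\<^bsub>Halg2 D\<^esub> scal_cls D t = scal_cls D (s + t)"
proof -
  have "sc2 s \<oplus>\<^bsub>free_alg2\<^esub> sc2 t = sc2 (s + t)" by (auto simp: sc2_def fa2_simps)
  then show ?thesis by (simp add: scal_cls_def flip: qpi_add)
qed

lemma scal_cls_1: "scal_cls D 1 = \<one>\<^bsub>Halg2 D\<^esub>"
proof -
  have "sc2 1 = (\<one>\<^bsub>free_alg2\<^esub> :: 'a nc2)" by (auto simp: sc2_def fa2_simps)
  then show ?thesis by (simp add: scal_cls_def qpi_one)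
qed

lemma scal_cls_0: "scal_cls D 0 = \<zero>\<^bsub>Halg2 D\<^esub>"
proof -
  have "sc2 0 = (\<zero>\<^bsub>free_alg2\<^esub> :: 'a nc2)" by (auto simp: sc2_def fa2_simps)
  moreover have "qpi D \<zero>\<^bsub>free_alg2\<^esub> = \<zero>\<^bsub>Halg2 D\<^esub>"
    by (rule ring_hom_zero[OF qpi_hom ring_fa2 ring_HH])
  ultimately show ?thesis by (simp add: scal_cls_def)
qed

lemma ring_hom_diff:
  assumes "f \<in> carrier free_alg2" "g \<in> carrier free_alg2"
  shows "qpi D (\<lambda>p. f p - g p) = qpi D f \<ominus>\<^bsub>Halg2 D\<^esub> qpi D g"
proof -
  interpret F: ring "free_alg2 :: 'a nc2 ring" by (rule ring_fa2)
  interpret H: ring "Halg2 D" by (rule ring_HH)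
  have 1: "(\<lambda>p. f p - g p) \<in> carrier free_alg2"
    using F.minus_closed[OF assms] by (simp add: fa2_minus[OF assms])
  have "(\<lambda>p. f p - g p) \<oplus>\<^bsub>free_alg2\<^esub> g = f" by (simp add: fa2_simps)
  then have "qpi D (\<lambda>p. f p - g p) \<oplus>\<^bsub>Halg2 D\<^esub> qpi D g = qpi D f"
    using qpi_add[OF 1 assms(2), of D] by simp
  then show ?thesis
    using qpi_closed[OF 1, of D] qpi_closed[OF assms(2), of D]
    by (simp add: H.minus_eq H.a_assoc H.r_neg flip: \<open>_ = qpi D f\<close>)
qed

lemma rel_EE:
  assumes "word u - scal t (word v) \<in> relators D"
  shows "tens_cls D u [] = scal_cls D t \<otimes>\<^bsub>Halg2 D\<^esub> tens_cls D v []" "tens_cls D [] u = scal_cls D t \<otimes>\<^bsub>Halg2 D\<^esub> tens_cls D [] v"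
proof -
  have "pure_tensor (word u - scal t (word v)) (word []) =
      (\<lambda>p. pure_tensor (word u) (word []) p - (t * pure_tensor (word v) (word []) p))"
    by (auto simp: pure_tensor_def scal_def fun_eq_iff left_diff_distrib)
  then have "qpi D (pure_tensor (word u) (word [])) = qpi D (\<lambda>p. t * pure_tensor (word v) (word []) p)"
    using ideal2_incl(1)[OF assms] 
    by (subst qpi_eq_iff) (auto simp flip: sc2_mult(1) intro: fa2_mult_closed)
  then show "tens_cls D u [] = scal_cls D t \<otimes>\<^bsub>Halg2 D\<^esub> tens_cls D v []" by (simp add: tens_cls_def qpi_scal)
  have "pure_tensor (word []) (word u - scal t (word v)) =
      (\<lambda>p. pure_tensor (word []) (word u) p - (t * pure_tensor (word []) (word v) p))"
    by (auto simp: pure_tensor_def scal_def fun_eq_iff right_diff_distrib)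
  then have "qpi D (pure_tensor (word []) (word u)) = qpi D (\<lambda>p. t * pure_tensor (word []) (word v) p)"
    using ideal2_incl(2)[OF assms]
    by (subst qpi_eq_iff) (auto simp flip: sc2_mult(1) intro: fa2_mult_closed)
  then show "tens_cls D [] u = scal_cls D t \<otimes>\<^bsub>Halg2 D\<^esub> tens_cls D [] v" by (simp add: tens_cls_def qpi_scal)
qed

lemma rel_EE':
  assumes "word u - scal t (word v) \<in> relators D"
  shows "tens_cls D (p @ u @ s) w = scal_cls D t \<otimes>\<^bsub>Halg2 D\<^esub> tens_cls D (p @ v @ s) w"
    and "tens_cls D w (p @ u @ s) = scal_cls D t \<otimes>\<^bsub>Halg2 D\<^esub> tens_cls D w (p @ v @ s)"
proof -
  interpret H: ring "Halg2 D" by (rule ring_HH)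
  have "tens_cls D (p @ u @ s) w = tens_cls D p [] \<otimes>\<^bsub>Halg2 D\<^esub> tens_cls D u [] \<otimes>\<^bsub>Halg2 D\<^esub> tens_cls D s w" by simp
  also have "\<dots> = scal_cls D t \<otimes>\<^bsub>Halg2 D\<^esub> (tens_cls D p [] \<otimes>\<^bsub>Halg2 D\<^esub> tens_cls D v [] \<otimes>\<^bsub>Halg2 D\<^esub> tens_cls D s w)"
    unfolding rel_EE(1)[OF assms]
    by (metis tens_cls_closed H.m_assoc H.m_closed scal_cls_central scal_cls_closed)
  finally show "tens_cls D (p @ u @ s) w = scal_cls D t \<otimes>\<^bsub>Halg2 D\<^esub> tens_cls D (p @ v @ s) w" by simp
  have "tens_cls D w (p @ u @ s) = tens_cls D [] p \<otimes>\<^bsub>Halg2 D\<^esub> tens_cls D [] u \<otimes>\<^bsub>Halg2 D\<^esub> tens_cls D w s" by simp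
  also have "\<dots> = scal_cls D t \<otimes>\<^bsub>Halg2 D\<^esub> (tens_cls D [] p \<otimes>\<^bsub>Halg2 D\<^esub> tens_cls D [] v \<otimes>\<^bsub>Halg2 D\<^esub> tens_cls D w s)"
    unfolding rel_EE(2)[OF assms]
    by (metis tens_cls_closed H.m_assoc H.m_closed scal_cls_central scal_cls_closed)
  finally show "tens_cls D w (p @ u @ s) = scal_cls D t \<otimes>\<^bsub>Halg2 D\<^esub> tens_cls D w (p @ v @ s)" by simp
qed

lemma scal_1: "scal 1 f = f" by (simp add: scal_def)

lemma rel_EE1:
  assumes "word u - word v \<in> relators D"
  shows "tens_cls D (p @ u @ s) w = tens_cls D (p @ v @ s) w"
    and "tens_cls D w (p @ u @ s) = tens_cls D w (p @ v @ s)"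
proof -
  interpret H: ring "Halg2 D" by (rule ring_HH)
  have "word u - scal 1 (word v) \<in> relators D" using assms by (simp add: scal_1)
  from rel_EE'[OF this] show "tens_cls D (p @ u @ s) w = tens_cls D (p @ v @ s) w"
    and "tens_cls D w (p @ u @ s) = tens_cls D w (p @ v @ s)" by (simp_all add: scal_cls_1)
qed

lemma slide:
  assumes "word [s, h] - scal t (word [h, s]) \<in> relators D"
  shows "tens_cls D (s # replicate m h) w = scal_cls D (t ^ m) \<otimes>\<^bsub>Halg2 D\<^esub> tens_cls D (replicate m h @ [s]) w"
    and "tens_cls D w (s # replicate m h) = scal_cls D (t ^ m) \<otimes>\<^bsub>Halg2 D\<^esub> tens_cls D w (replicate m h @ [s])"
proof -
  interpret H: ring "Halg2 D" by (rule ring_HH)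
  show "tens_cls D (s # replicate m h) w = scal_cls D (t ^ m) \<otimes>\<^bsub>Halg2 D\<^esub> tens_cls D (replicate m h @ [s]) w"
  proof (induction m arbitrary: w)
    case (Suc m)
    have "tens_cls D (s # replicate (Suc m) h) w = scal_cls D t \<otimes>\<^bsub>Halg2 D\<^esub> tens_cls D (h # s # replicate m h) w"
      using rel_EE'(1)[OF assms, of "[]" "replicate m h" w] by simp
    also have "tens_cls D (h # s # replicate m h) w = tens_cls D [h] [] \<otimes>\<^bsub>Halg2 D\<^esub> tens_cls D (s # replicate m h) w" by simp
    also have "\<dots> = scal_cls D (t ^ m) \<otimes>\<^bsub>Halg2 D\<^esub> (tens_cls D [h] [] \<otimes>\<^bsub>Halg2 D\<^esub> tens_cls D (replicate m h @ [s]) w)"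
      unfolding Suc by (metis tens_cls_closed H.m_assoc scal_cls_central scal_cls_closed)
    also have "scal_cls D t \<otimes>\<^bsub>Halg2 D\<^esub> \<dots> = scal_cls D (t ^ Suc m) \<otimes>\<^bsub>Halg2 D\<^esub> tens_cls D (replicate (Suc m) h @ [s]) w"
      by (simp add: scal_cls_mult flip: H.m_assoc)
    finally show ?case .
  qed (simp add: scal_cls_1)
  show "tens_cls D w (s # replicate m h) = scal_cls D (t ^ m) \<otimes>\<^bsub>Halg2 D\<^esub> tens_cls D w (replicate m h @ [s])"
  proof (induction m arbitrary: w)
    case (Suc m)
    have "tens_cls D w (s # replicate (Suc m) h) = scal_cls D t \<otimes>\<^bsub>Halg2 D\<^esub> tens_cls D w (h # s # replicate m h)"
      using rel_EE'(2)[OF assms, of w "[]" "replicate m h"] by simp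
    also have "tens_cls D w (h # s # replicate m h) = tens_cls D [] [h] \<otimes>\<^bsub>Halg2 D\<^esub> tens_cls D w (s # replicate m h)" by simp
    also have "\<dots> = scal_cls D (t ^ m) \<otimes>\<^bsub>Halg2 D\<^esub> (tens_cls D [] [h] \<otimes>\<^bsub>Halg2 D\<^esub> tens_cls D w (replicate m h @ [s]))"
      unfolding Suc by (metis tens_cls_closed H.m_assoc scal_cls_central scal_cls_closed)
    also have "scal_cls D t \<otimes>\<^bsub>Halg2 D\<^esub> \<dots> = scal_cls D (t ^ Suc m) \<otimes>\<^bsub>Halg2 D\<^esub> tens_cls D w (replicate (Suc m) h @ [s])"
      by (simp add: scal_cls_mult flip: H.m_assoc)
    finally show ?case .
  qed (simp add: scal_cls_1)
qed

lemma slide1: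
  assumes "word [s, h] - word [h, s] \<in> relators D \<or> word [h, s] - word [s, h] \<in> relators D \<or> s = h"
  shows "tens_cls D (s # replicate m h) w = tens_cls D (replicate m h @ [s]) w"
    and "tens_cls D w (s # replicate m h) = tens_cls D w (replicate m h @ [s])"
proof -
  have 1: "tens_cls D (p @ [s, h] @ z) w = tens_cls D (p @ [h, s] @ z) w" "tens_cls D w (p @ [s, h] @ z) = tens_cls D w (p @ [h, s] @ z)" for p z w
    using assms rel_EE1(1)[of "[s, h]" "[h, s]" D p z w] rel_EE1(1)[of "[h, s]" "[s, h]" D p z w]
      rel_EE1(2)[of "[s, h]" "[h, s]" D w p z] rel_EE1(2)[of "[h, s]" "[s, h]" D w p z] by metis+
  have "tens_cls D (p @ s # replicate m h) w = tens_cls D (p @ replicate m h @ [s]) w" for p w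
  proof (induction m arbitrary: p)
    case (Suc m)
    show ?case using 1(1)[of p "replicate m h" w] Suc[of "p @ [h]"] by simp
  qed simp
  from this[of "[]"] show "tens_cls D (s # replicate m h) w = tens_cls D (replicate m h @ [s]) w" by simp
  have "tens_cls D w (p @ s # replicate m h) = tens_cls D w (p @ replicate m h @ [s])" for p w
  proof (induction m arbitrary: p)
    case (Suc m)
    show ?case using 1(2)[of w p "replicate m h"] Suc[of "p @ [h]"] by simp
  qed simp
  from this[of w "[]"] show "tens_cls D w (s # replicate m h) = tens_cls D w (replicate m h @ [s])" by simp
qed

definition comult_cls :: "'k::field hopf_data \<Rightarrow> gen list \<Rightarrow> 'k nc2 set" where
  "comult_cls D w = qpi D (comult_word D w)"

lemma comult_cls_closed [simp]: "comult_cls D w \<in> carrier (Halg2 D)" by (simp add: comult_cls_def qpi_closed)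

lemma comult_cls_Nil: "comult_cls D [] = tens_cls D [] []" by (simp add: comult_cls_def qpi_one tens_cls_one)

lemma comult_cls_Cons: "comult_cls D (g # w) = qpi D (comult_gen D g) \<otimes>\<^bsub>Halg2 D\<^esub> comult_cls D w"
  by (simp add: comult_cls_def qpi_mult)

lemma comult_cls_append: "comult_cls D (u @ v) = comult_cls D u \<otimes>\<^bsub>Halg2 D\<^esub> comult_cls D v"
proof -
  interpret H: ring "Halg2 D" by (rule ring_HH)
  show ?thesis by (induction u) (simp_all add: comult_cls_Nil tens_cls_one comult_cls_Cons qpi_closed H.m_assoc)
qed

lemma comult_cls_single: "comult_cls D [g] = qpi D (comult_gen D g)"
proof -
  interpret H: ring "Halg2 D" by (rule ring_HH)
  show ?thesis by (simp add: comult_cls_Cons comult_cls_Nil tens_cls_one qpi_closed)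
qed

lemma comult_cls_grouplike:
  assumes "Gx \<notin> set w" "Gy \<notin> set w"
  shows "comult_cls D w = tens_cls D w w"
  using assms
proof (induction w)
  case (Cons g w)
  then have "qpi D (comult_gen D g) = tens_cls D [g] [g]" by (cases g) (auto simp: tens_cls_def)
  with Cons show ?case by (simp add: comult_cls_Cons)
qed (simp add: comult_cls_Nil)

lemma comult_cls_skew:
  "comult_cls D [Gx] = tens_cls D [Gx] (replicate (dn1 D) Ga) \<oplus>\<^bsub>Halg2 D\<^esub> tens_cls D [Gb] [Gx]"
  "comult_cls D [Gy] = tens_cls D [Gy] (replicate (dn1 D) Ga) \<oplus>\<^bsub>Halg2 D\<^esub> tens_cls D [Gc] [Gy]"
  by (simp_all add: comult_cls_single tens_cls_def qpi_add)

lemma comult_rel1: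
  assumes "comult_cls D u = scal_cls D t \<otimes>\<^bsub>Halg2 D\<^esub> comult_cls D v"
  shows "comult D (word u - scal t (word v)) \<in> rel_ideal2 D"
proof -
  have "comult D (word u - scal t (word v)) = (\<lambda>p. comult_word D u p - (t * comult_word D v p))"
    by (simp add: comult_diff comult_scal scal_fin)
  moreover have "(\<lambda>p. t * comult_word D v p) \<in> carrier free_alg2"
    by (auto simp flip: sc2_mult(1) intro: fa2_mult_closed)
  ultimately show ?thesis
    using assms by (simp add: comult_cls_def flip: qpi_eq_iff qpi_scal)
qed


fun qb :: "'k::field \<Rightarrow> nat \<Rightarrow> nat \<Rightarrow> 'k" where
  "qb t m 0 = 1"
| "qb t 0 (Suc k) = 0"
| "qb t (Suc m) (Suc k) = t ^ (m - k) * qb t m k + qb t m (Suc k)"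

lemma qb_gt: "k > m \<Longrightarrow> qb t m k = 0"
  by (induction t m k rule: qb.induct) auto

lemma qb_diag: "qb t m m = 1"
  by (induction m) (auto simp: qb_gt)

lemma qb_rec: "k < m \<Longrightarrow> (1 - t ^ Suc k) * qb t m (Suc k) = (1 - t ^ (m - k)) * qb t m k"
proof (induction m arbitrary: k)
  case (Suc m)
  show ?case
  proof (cases "k = m")
    case True
    have "(1 - t ^ Suc m) = (1 - t) * qb t (Suc m) m"
    proof (cases m)
      case l: (Suc l)
      have "(1 - t ^ Suc l) * qb t m (Suc l) = (1 - t ^ (m - l)) * qb t m l"
        using Suc.IH[of l] l by simp
      then have 1: "(1 - t) * qb t m l = 1 - t ^ m" using l by (simp add: qb_diag del: qb.simps(3))
      have "qb t (Suc m) (Suc l) = t ^ (m - l) * qb t m l + qb t m (Suc l)" by simp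
      then have 2: "qb t (Suc m) m = t * qb t m l + 1"
        using l by (simp add: qb_diag del: qb.simps(3))
      have "(1 - t) * qb t (Suc m) m = t * ((1 - t) * qb t m l) + (1 - t)"
        unfolding 2 by (simp add: algebra_simps)
      then show ?thesis unfolding 1 by (simp add: algebra_simps)
    qed simp
    then show ?thesis using True by (simp add: qb_diag del: qb.simps(3))
  next
    case False
    then have k: "k < m" using Suc by simp
    have A: "(1 - t ^ Suc k) * qb t m (Suc k) = (1 - t ^ (m - k)) * qb t m k" using Suc.IH[OF k] .
    show ?thesis
    proof (cases k)
      case 0
      have "t ^ Suc m = t * t ^ m" by simp
      define w where "w = t ^ m"
      define b where "b = qb t m (Suc 0)"
      have "(1 - t) * b = 1 - w" using A 0 by (simp add: w_def b_def)
      then have "(1 - t) * (w + b) = 1 - t * w"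
        unfolding distrib_left by (simp add: algebra_simps)
      then show ?thesis using 0 by (simp add: w_def b_def)
    next
      case (Suc l)
      have B: "(1 - t ^ k) * qb t m k = (1 - t ^ (m - l)) * qb t m l"
        using Suc.IH[of l] Suc k by simp
      have e1: "qb t (Suc m) (Suc k) = t ^ (m - k) * qb t m k + qb t m (Suc k)" by simp
      have e2: "qb t (Suc m) k = t ^ (m - l) * qb t m l + qb t m k" using Suc by simp
      have e3: "t ^ (m - l) = t * t ^ (m - k)" "Suc m - k = m - l"
        using Suc k by (auto simp: Suc_diff_Suc simp flip: power_Suc)
      have e4: "t ^ (m - l) * t ^ k = t ^ Suc m" using Suc k by (simp flip: power_add)
      define u where "u = t ^ (m - k)"
      define v where "v = t ^ k"
      define a where "a = qb t m k"
      define b where "b = qb t m (Suc k)"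
      define c where "c = qb t m l"
      have 1: "(1 - t * v) * b = (1 - u) * a" and 2: "(1 - v) * a = (1 - t * u) * c"
        using A B e3 by (simp_all add: u_def v_def a_def b_def c_def)
      have "(1 - t * v) * (u * a + b) = (1 - t * v) * u * a + (1 - u) * a"
        unfolding distrib_left 1 by (simp add: mult.assoc)
      also have "\<dots> = t * u * ((1 - v) * a) + (1 - t * u) * a" by (simp add: algebra_simps)
      also have "\<dots> = (1 - t * u) * (t * u * c + a)" unfolding 2 by (simp add: algebra_simps)
      finally have "(1 - t * v) * (u * a + b) = (1 - t * u) * (t * u * c + a)" .
      then show ?thesis unfolding e1 e2 e3(2)
        using e3(1) by (simp add: u_def v_def a_def b_def c_def)
    qed
  qed
qed simp

lemma qb_zero:
  assumes "primitive_root n t" "0 < k" "k < n"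
  shows "qb t n k = 0"
  using assms(2,3)
proof (induction k)
  case (Suc k)
  have "(1 - t ^ Suc k) * qb t n (Suc k) = (1 - t ^ (n - k)) * qb t n k"
    using qb_rec[of k n t] Suc by simp
  also have "\<dots> = 0"
  proof (cases k)
    case 0
    then show ?thesis using assms(1) by (simp add: primitive_root_def)
  next
    case (Suc l)
    then show ?thesis using Suc.IH Suc.prems by simp
  qed
  finally show ?case using assms(1) Suc.prems by (auto simp: primitive_root_def simp del: power_Suc)
qed simp

lemma (in ring) q_binomial:
  fixes T :: "'k::field \<Rightarrow> 'a"
  assumes P: "P \<in> carrier R" and Q: "Q \<in> carrier R" and T: "\<And>s. T s \<in> carrier R"
    and T_mult: "\<And>s u. T s \<otimes> T u = T (s * u)" and T_add: "\<And>s u. T s \<oplus> T u = T (s + u)"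
    and T1: "T 1 = \<one>" and T0: "T 0 = \<zero>"
    and cen: "\<And>Z s. Z \<in> carrier R \<Longrightarrow> Z \<otimes> T s = T s \<otimes> Z"
    and QP: "Q \<otimes> P = T t \<otimes> (P \<otimes> Q)"
  shows "(P \<oplus> Q) [^] m = (\<Oplus>k\<in>{..m}. T (qb t m k) \<otimes> (P [^] k \<otimes> Q [^] (m - k)))"
proof -
  have lc: "Z \<otimes> (T s \<otimes> Y) = T s \<otimes> (Z \<otimes> Y)" if "Z \<in> carrier R" "Y \<in> carrier R" for Z Y s
    using that T by (simp add: cen flip: m_assoc)
  have QjP: "Q [^] j \<otimes> P = T (t ^ j) \<otimes> (P \<otimes> Q [^] j)" for j :: nat
  proof (induction j)
    case (Suc j)
    have "Q [^] Suc j \<otimes> P = Q [^] j \<otimes> (T t \<otimes> (P \<otimes> Q))" using P Q by (simp add: m_assoc QP)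
    also have "\<dots> = T t \<otimes> (Q [^] j \<otimes> P) \<otimes> Q" using P Q T by (simp add: lc m_assoc)
    also have "\<dots> = T t \<otimes> T (t ^ j) \<otimes> (P \<otimes> Q [^] Suc j)" unfolding Suc using P Q T by (simp add: m_assoc)
    finally show ?case by (simp add: T_mult)
  qed (use P T1 in simp)
  have trm: "(T c \<otimes> (P [^] k \<otimes> Q [^] j)) \<otimes> P = T (t ^ j * c) \<otimes> (P [^] Suc k \<otimes> Q [^] j)"
    for c and k j :: nat
  proof -
    have "(T c \<otimes> (P [^] k \<otimes> Q [^] j)) \<otimes> P = T c \<otimes> (P [^] k \<otimes> (T (t ^ j) \<otimes> (P \<otimes> Q [^] j)))"
      using P Q T by (simp add: m_assoc QjP)
    also have "\<dots> = T c \<otimes> T (t ^ j) \<otimes> (P [^] Suc k \<otimes> Q [^] j)"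
      using P Q T by (subst lc) (simp_all add: m_assoc)
    finally show ?thesis by (simp add: T_mult mult.commute)
  qed
  show ?thesis
  proof (induction m)
    case 0
    then show ?case using T1 by simp
  next
    case (Suc m)
    let ?f = "\<lambda>m k. T (qb t m k) \<otimes> (P [^] k \<otimes> Q [^] (m - k))"
    let ?g = "\<lambda>k. T (qb t m k) \<otimes> (P [^] k \<otimes> Q [^] (Suc m - k))"
    have fin1: "(\<Oplus>k\<in>{..m}. ?f m k) \<otimes> Q = (\<Oplus>k\<in>{..m}. ?g k)"
    proof -
      have "(\<Oplus>k\<in>{..m}. ?f m k) \<otimes> Q = (\<Oplus>k\<in>{..m}. ?f m k \<otimes> Q)"
        using P Q T by (intro finsum_ldistr) auto
      also have "\<dots> = (\<Oplus>k\<in>{..m}. ?g k)"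
        using P Q T by (intro finsum_cong') (auto simp: m_assoc Suc_diff_le)
      finally show ?thesis .
    qed
    also have "\<dots> = (\<Oplus>k\<in>{..Suc m}. ?g k)"
      using P Q T T0 by (subst finsum_Suc) (auto simp: qb_gt)
    also have "\<dots> = (\<Oplus>k\<in>{..m}. ?g (Suc k)) \<oplus> ?g 0"
      using P Q T by (intro finsum_Suc2) auto
    finally have Qpart: "(\<Oplus>k\<in>{..m}. ?f m k) \<otimes> Q = (\<Oplus>k\<in>{..m}. ?g (Suc k)) \<oplus> ?g 0" .
    have Ppart: "(\<Oplus>k\<in>{..m}. ?f m k) \<otimes> P
        = (\<Oplus>k\<in>{..m}. T (t ^ (m - k) * qb t m k) \<otimes> (P [^] Suc k \<otimes> Q [^] (m - k)))"
    proof -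
      have "(\<Oplus>k\<in>{..m}. ?f m k) \<otimes> P = (\<Oplus>k\<in>{..m}. ?f m k \<otimes> P)"
        using P Q T by (intro finsum_ldistr) auto
      also have "\<dots> = (\<Oplus>k\<in>{..m}. T (t ^ (m - k) * qb t m k) \<otimes> (P [^] Suc k \<otimes> Q [^] (m - k)))"
        by (intro finsum_cong') (use P Q T in \<open>auto simp: trm simp del: nat_pow_Suc\<close>)
      finally show ?thesis .
    qed
    have "(\<Oplus>k\<in>{..Suc m}. ?f (Suc m) k) = (\<Oplus>k\<in>{..m}. ?f (Suc m) (Suc k)) \<oplus> ?f (Suc m) 0"
      using P Q T by (intro finsum_Suc2) auto
    also have "(\<Oplus>k\<in>{..m}. ?f (Suc m) (Suc k)) = (\<Oplus>k\<in>{..m}.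
        T (t ^ (m - k) * qb t m k) \<otimes> (P [^] Suc k \<otimes> Q [^] (m - k)) \<oplus> ?g (Suc k))"
      by (intro finsum_cong') (use P Q T in \<open>auto simp: l_distr simp flip: T_add simp del: nat_pow_Suc\<close>)
    also have "\<dots> = (\<Oplus>k\<in>{..m}. T (t ^ (m - k) * qb t m k) \<otimes> (P [^] Suc k \<otimes> Q [^] (m - k)))
        \<oplus> (\<Oplus>k\<in>{..m}. ?g (Suc k))"
      using P Q T by (intro finsum_addf) auto
    finally have "(\<Oplus>k\<in>{..Suc m}. ?f (Suc m) k)
      = (\<Oplus>k\<in>{..m}. ?f m k) \<otimes> P \<oplus> (\<Oplus>k\<in>{..m}. ?g (Suc k)) \<oplus> ?g 0"
      unfolding Ppart by simp
    also have "\<dots> = (\<Oplus>k\<in>{..m}. ?f m k) \<otimes> P \<oplus> (\<Oplus>k\<in>{..m}. ?f m k) \<otimes> Q"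
      unfolding Qpart using P Q T by (intro a_assoc) (auto intro!: finsum_closed m_closed)
    also have "\<dots> = (\<Oplus>k\<in>{..m}. ?f m k) \<otimes> (P \<oplus> Q)"
      using P Q T by (intro r_distr[symmetric]) (auto intro!: finsum_closed)
    finally show ?case using Suc by simp
  qed
qed

lemma (in ring) q_binomial_root:
  fixes T :: "'k::field \<Rightarrow> 'a"
  assumes P: "P \<in> carrier R" and Q: "Q \<in> carrier R" and T: "\<And>s. T s \<in> carrier R"
    and T_mult: "\<And>s u. T s \<otimes> T u = T (s * u)" and T_add: "\<And>s u. T s \<oplus> T u = T (s + u)"
    and T1: "T 1 = \<one>" and T0: "T 0 = \<zero>"
    and cen: "\<And>Z s. Z \<in> carrier R \<Longrightarrow> Z \<otimes> T s = T s \<otimes> Z"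
    and QP: "Q \<otimes> P = T t \<otimes> (P \<otimes> Q)" and t: "primitive_root n t"
  shows "(P \<oplus> Q) [^] n = P [^] n \<oplus> Q [^] n"
proof -
  let ?f = "\<lambda>k. T (qb t n k) \<otimes> (P [^] k \<otimes> Q [^] (n - k))"
  obtain m where m: "n = Suc m" using t by (cases n) (auto simp: primitive_root_def)
  have fcl: "?f k \<in> carrier R" for k using P Q T by simp
  have "(P \<oplus> Q) [^] n = (\<Oplus>k\<in>{..Suc m}. ?f k)"
    using q_binomial[OF assms(1-9), of n] m by simp
  also have "\<dots> = ?f (Suc m) \<oplus> (\<Oplus>k\<in>{..m}. ?f k)"
    using P Q T by (intro finsum_Suc) auto
  also have "?f (Suc m) = P [^] n" using m P Q T1 by (simp add: qb_diag del: qb.simps(3))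
  also have "(\<Oplus>k\<in>{..m}. ?f k) = Q [^] n"
  proof -
    have "(\<Oplus>k\<in>{..m}. ?f k) = (\<Oplus>k\<in>{..m}. if k = 0 then Q [^] n else \<zero>)"
    proof (rule finsum_cong')
      fix k assume "k \<in> {..m}"
      then show "?f k = (if k = 0 then Q [^] n else \<zero>)"
        using P Q T T1 T0 m qb_zero[OF t, of k] by auto
    qed (use P Q in auto)
    also have "\<dots> = Q [^] n"
      using Q add.finprod_singleton_swap[of 0 "{..m}" "\<lambda>_. Q [^] n"] by simp
    finally show ?thesis .
  qed
  finally show ?thesis .
qed


definition rel3 :: "gen list \<Rightarrow> 'k::field \<Rightarrow> gen list \<Rightarrow> 'k \<Rightarrow> gen list \<Rightarrow> gen list \<Rightarrow> 'k nc" where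
  "rel3 u t v s a b = word u - scal t (word v) - scal s (word a - word b)"

lemma rel3_EE:
  assumes "rel3 u t v s a b \<in> relators D"
  shows "tens_cls D u [] = scal_cls D t \<otimes>\<^bsub>Halg2 D\<^esub> tens_cls D v [] \<oplus>\<^bsub>Halg2 D\<^esub> scal_cls D s \<otimes>\<^bsub>Halg2 D\<^esub> (tens_cls D a [] \<ominus>\<^bsub>Halg2 D\<^esub> tens_cls D b [])" (is ?th1)
    and "tens_cls D [] u = scal_cls D t \<otimes>\<^bsub>Halg2 D\<^esub> tens_cls D [] v \<oplus>\<^bsub>Halg2 D\<^esub> scal_cls D s \<otimes>\<^bsub>Halg2 D\<^esub> (tens_cls D [] a \<ominus>\<^bsub>Halg2 D\<^esub> tens_cls D [] b)" (is ?th2)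
proof -
  have key: "qpi D U = scal_cls D t \<otimes>\<^bsub>Halg2 D\<^esub> qpi D V \<oplus>\<^bsub>Halg2 D\<^esub> scal_cls D s \<otimes>\<^bsub>Halg2 D\<^esub> (qpi D A \<ominus>\<^bsub>Halg2 D\<^esub> qpi D B)"
    if cl: "U \<in> carrier free_alg2" "V \<in> carrier free_alg2" "A \<in> carrier free_alg2" "B \<in> carrier free_alg2"
      and J: "(\<lambda>p. U p - t * V p - s * (A p - B p)) \<in> rel_ideal2 D" for U V A B
  proof -
    interpret F: ring "free_alg2 :: 'a nc2 ring" by (rule ring_fa2)
    have AB: "(\<lambda>p. A p - B p) \<in> carrier free_alg2"
      using F.minus_closed[OF cl(3,4)] by (simp add: fa2_minus[OF cl(3,4)])
    have sAB: "(\<lambda>p. s * (A p - B p)) \<in> carrier free_alg2"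
      using fa2_mult_closed[OF sc2_closed[of s] AB] by (simp add: sc2_mult)
    have tV: "(\<lambda>p. t * V p) \<in> carrier free_alg2"
      using fa2_mult_closed[OF sc2_closed[of t] cl(2)] by (simp add: sc2_mult)
    have sum: "(\<lambda>p. t * V p + s * (A p - B p)) \<in> carrier free_alg2"
      using fa2_add_closed[OF tV sAB] .
    have eq: "(\<lambda>p. U p - (t * V p + s * (A p - B p))) = (\<lambda>p. U p - t * V p - s * (A p - B p))"
      by (simp add: fun_eq_iff)
    have "qpi D U = qpi D (\<lambda>p. t * V p + s * (A p - B p))"
      using J unfolding qpi_eq_iff[OF cl(1) sum] eq .
    also have "\<dots> = qpi D ((\<lambda>p. t * V p) \<oplus>\<^bsub>free_alg2\<^esub> (\<lambda>p. s * (A p - B p)))"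
      by (simp add: fa2_simps)
    also have "\<dots> = scal_cls D t \<otimes>\<^bsub>Halg2 D\<^esub> qpi D V \<oplus>\<^bsub>Halg2 D\<^esub> scal_cls D s \<otimes>\<^bsub>Halg2 D\<^esub> (qpi D A \<ominus>\<^bsub>Halg2 D\<^esub> qpi D B)"
      by (simp add: qpi_add[OF tV sAB] qpi_scal[OF cl(2)] qpi_scal[OF AB] ring_hom_diff[OF cl(3,4)])
    finally show ?thesis .
  qed
  have 1: "(\<lambda>p. pure_tensor (word u) (word []) p - t * pure_tensor (word v) (word []) p
      - s * (pure_tensor (word a) (word []) p - pure_tensor (word b) (word []) p))
    = pure_tensor (rel3 u t v s a b) (word [])"
    by (auto simp: pure_tensor_def rel3_def scal_def fun_eq_iff algebra_simps)
  show ?th1 unfolding tens_cls_def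
    by (rule key) (use ideal2_incl(1)[OF assms] in \<open>simp_all add: 1\<close>)
  have 2: "(\<lambda>p. pure_tensor (word []) (word u) p - t * pure_tensor (word []) (word v) p
      - s * (pure_tensor (word []) (word a) p - pure_tensor (word []) (word b) p))
    = pure_tensor (word []) (rel3 u t v s a b)"
    by (auto simp: pure_tensor_def rel3_def scal_def fun_eq_iff algebra_simps)
  show ?th2 unfolding tens_cls_def
    by (rule key) (use ideal2_incl(2)[OF assms] in \<open>simp_all add: 2\<close>)
qed

lemma rel3_EE':
  assumes "rel3 u t v s a b \<in> relators D"
  shows "tens_cls D u w = scal_cls D t \<otimes>\<^bsub>Halg2 D\<^esub> tens_cls D v w \<oplus>\<^bsub>Halg2 D\<^esub> scal_cls D s \<otimes>\<^bsub>Halg2 D\<^esub> (tens_cls D a w \<ominus>\<^bsub>Halg2 D\<^esub> tens_cls D b w)" (is ?th1)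
    and "tens_cls D w u = scal_cls D t \<otimes>\<^bsub>Halg2 D\<^esub> tens_cls D w v \<oplus>\<^bsub>Halg2 D\<^esub> scal_cls D s \<otimes>\<^bsub>Halg2 D\<^esub> (tens_cls D w a \<ominus>\<^bsub>Halg2 D\<^esub> tens_cls D w b)" (is ?th2)
proof -
  interpret H: ring "Halg2 D" by (rule ring_HH)
  have *: "(scal_cls D t \<otimes>\<^bsub>Halg2 D\<^esub> X1 \<oplus>\<^bsub>Halg2 D\<^esub> scal_cls D s \<otimes>\<^bsub>Halg2 D\<^esub> (X2 \<ominus>\<^bsub>Halg2 D\<^esub> X3)) \<otimes>\<^bsub>Halg2 D\<^esub> Y =
     scal_cls D t \<otimes>\<^bsub>Halg2 D\<^esub> (X1 \<otimes>\<^bsub>Halg2 D\<^esub> Y) \<oplus>\<^bsub>Halg2 D\<^esub> scal_cls D s \<otimes>\<^bsub>Halg2 D\<^esub> (X2 \<otimes>\<^bsub>Halg2 D\<^esub> Y \<ominus>\<^bsub>Halg2 D\<^esub> X3 \<otimes>\<^bsub>Halg2 D\<^esub> Y)"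
    if "X1 \<in> carrier (Halg2 D)" "X2 \<in> carrier (Halg2 D)" "X3 \<in> carrier (Halg2 D)" "Y \<in> carrier (Halg2 D)" for X1 X2 X3 Y
    using that by (simp add: H.l_distr H.m_assoc H.minus_eq H.l_minus)
  have "tens_cls D u w = tens_cls D u [] \<otimes>\<^bsub>Halg2 D\<^esub> tens_cls D [] w" by simp
  then show ?th1 unfolding rel3_EE(1)[OF assms] by (simp add: *)
  have "tens_cls D w u = tens_cls D [] u \<otimes>\<^bsub>Halg2 D\<^esub> tens_cls D w []" by simp
  then show ?th2 unfolding rel3_EE(2)[OF assms] by (simp add: *)
qed

lemma comult_rel3:
  assumes "comult_cls D u = scal_cls D t \<otimes>\<^bsub>Halg2 D\<^esub> comult_cls D v \<oplus>\<^bsub>Halg2 D\<^esub> scal_cls D s \<otimes>\<^bsub>Halg2 D\<^esub> (comult_cls D a \<ominus>\<^bsub>Halg2 D\<^esub> comult_cls D b)"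
  shows "comult D (rel3 u t v s a b) \<in> rel_ideal2 D"
proof -
  interpret F: ring "free_alg2 :: 'a nc2 ring" by (rule ring_fa2)
  let ?U = "comult_word D u" and ?V = "comult_word D v"
  let ?A = "comult_word D a" and ?B = "comult_word D b"
  have AB: "(\<lambda>p. ?A p - ?B p) \<in> carrier free_alg2"
    using F.minus_closed[of ?A ?B] by (simp add: fa2_minus)
  have sAB: "(\<lambda>p. s * (?A p - ?B p)) \<in> carrier free_alg2"
    using fa2_mult_closed[OF sc2_closed[of s] AB] by (simp add: sc2_mult)
  have tV: "(\<lambda>p. t * ?V p) \<in> carrier free_alg2"
    using fa2_mult_closed[OF sc2_closed[of t], of ?V] by (simp add: sc2_mult)
  have sum: "(\<lambda>p. t * ?V p + s * (?A p - ?B p)) \<in> carrier free_alg2"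
    using fa2_add_closed[OF tV sAB] .
  have "qpi D (\<lambda>p. t * ?V p + s * (?A p - ?B p)) = qpi D ((\<lambda>p. t * ?V p) \<oplus>\<^bsub>free_alg2\<^esub> (\<lambda>p. s * (?A p - ?B p)))"
    by (simp add: fa2_simps)
  also have "\<dots> = qpi D ?U"
    using assms by (simp add: comult_cls_def qpi_add[OF tV sAB] qpi_scal qpi_scal[OF AB] ring_hom_diff)
  finally have "(\<lambda>p. ?U p - (t * ?V p + s * (?A p - ?B p))) \<in> rel_ideal2 D"
    using qpi_eq_iff[OF _ sum, of ?U D] by simp
  moreover have "comult D (rel3 u t v s a b) = (\<lambda>p. ?U p - (t * ?V p + s * (?A p - ?B p)))"
    unfolding rel3_def
    by (simp add: comult_diff comult_scal scal_fin diff_fin fun_eq_iff del: minus_apply)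
  ultimately show ?thesis by simp
qed

lemma relators_mem:
  "word [Gb, Gc] - word [Gc, Gb] \<in> relators D"
  "word [Ga, Gb] - word [Gb, Ga] \<in> relators D" "word [Ga, Gc] - word [Gc, Ga] \<in> relators D"
  "word [Gx, Ga] - scal (dq D) (word [Ga, Gx]) \<in> relators D"
  "word [Gy, Ga] - scal (inverse (dq D)) (word [Ga, Gy]) \<in> relators D"
  "word [Gb, Gx] - word [Gx, Gb] \<in> relators D" "word [Gc, Gx] - word [Gx, Gc] \<in> relators D"
  "word [Gb, Gy] - word [Gy, Gb] \<in> relators D" "word [Gc, Gy] - word [Gy, Gc] \<in> relators D"
  "rel3 [Gy, Gx] (inverse (dq D ^ dn1 D)) [Gx, Gy] (beta3 D) (replicate (2 * dn1 D) Ga) [Gb, Gc] \<in> relators D"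
  by (simp_all add: relators_def Let_def rel3_def)

lemma scal_0: "scal 0 f = (\<lambda>_. 0)" by (simp add: scal_def)

lemma relators_mem_pow:
  "rel3 (replicate (dn D) Gx) 0 [] (beta1 D) (replicate (dn D * dn1 D) Ga) (replicate (dn D) Gb) \<in> relators D"
  "rel3 (replicate (dn D) Gy) 0 [] (beta2 D) (replicate (dn D * dn1 D) Ga) (replicate (dn D) Gc) \<in> relators D"
proof -
  have "f - (\<lambda>_. 0) = f" for f :: "'a nc" by (simp add: fun_eq_iff)
  then show "rel3 (replicate (dn D) Gx) 0 [] (beta1 D) (replicate (dn D * dn1 D) Ga) (replicate (dn D) Gb) \<in> relators D"
    "rel3 (replicate (dn D) Gy) 0 [] (beta2 D) (replicate (dn D * dn1 D) Ga) (replicate (dn D) Gc) \<in> relators D"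
    by (simp_all add: relators_def Let_def rel3_def scal_0)
qed

lemma comult_group_rel:
  assumes "word u - word v \<in> relators D" "Gx \<notin> set u" "Gy \<notin> set u" "Gx \<notin> set v" "Gy \<notin> set v"
  shows "comult D (word u - word v) \<in> rel_ideal2 D"
proof -
  interpret H: ring "Halg2 D" by (rule ring_HH)
  have "tens_cls D u u = tens_cls D v v"
    using rel_EE1(1)[OF assms(1), of "[]" "[]" u] rel_EE1(2)[OF assms(1), of v "[]" "[]"] by simp
  then have "comult_cls D u = scal_cls D 1 \<otimes>\<^bsub>Halg2 D\<^esub> comult_cls D v" using assms by (simp add: comult_cls_grouplike scal_cls_1)
  from comult_rel1[OF this] show ?thesis by (simp add: scal_1)
qed

lemma rep_snoc: "replicate m a @ [a] = a # replicate m a"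
  by (simp add: replicate_append_same)

lemma skew_a:
  assumes s: "comult_cls D [s] = tens_cls D [s] (replicate (dn1 D) Ga) \<oplus>\<^bsub>Halg2 D\<^esub> tens_cls D [e] [s]"
    and sa: "word [s, Ga] - scal p (word [Ga, s]) \<in> relators D"
    and ae: "word [Ga, e] - word [e, Ga] \<in> relators D"
  shows "comult D (word [s, Ga] - scal p (word [Ga, s])) \<in> rel_ideal2 D"
proof (rule comult_rel1)
  interpret H: ring "Halg2 D" by (rule ring_HH)
  have a: "comult_cls D [Ga] = tens_cls D [Ga] [Ga]" by (simp add: comult_cls_grouplike)
  have "comult_cls D [s, Ga] = comult_cls D [s] \<otimes>\<^bsub>Halg2 D\<^esub> comult_cls D [Ga]" using comult_cls_append[of D "[s]" "[Ga]"] by simp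
  also have "\<dots> = tens_cls D [s, Ga] (Ga # replicate (dn1 D) Ga) \<oplus>\<^bsub>Halg2 D\<^esub> tens_cls D [e, Ga] [s, Ga]"
    by (simp add: s a H.l_distr rep_snoc)
  also have "tens_cls D [s, Ga] (Ga # replicate (dn1 D) Ga) = scal_cls D p \<otimes>\<^bsub>Halg2 D\<^esub> tens_cls D [Ga, s] (Ga # replicate (dn1 D) Ga)"
    using rel_EE'(1)[OF sa, of "[]" "[]"] by simp
  also have "tens_cls D [e, Ga] [s, Ga] = scal_cls D p \<otimes>\<^bsub>Halg2 D\<^esub> tens_cls D [Ga, e] [Ga, s]"
    using rel_EE'(2)[OF sa, of "[e, Ga]" "[]" "[]"] rel_EE1(1)[OF ae, of "[]" "[]"] by simp
  also have "scal_cls D p \<otimes>\<^bsub>Halg2 D\<^esub> tens_cls D [Ga, s] (Ga # replicate (dn1 D) Ga) \<oplus>\<^bsub>Halg2 D\<^esub> scal_cls D p \<otimes>\<^bsub>Halg2 D\<^esub> tens_cls D [Ga, e] [Ga, s]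
    = scal_cls D p \<otimes>\<^bsub>Halg2 D\<^esub> (comult_cls D [Ga] \<otimes>\<^bsub>Halg2 D\<^esub> comult_cls D [s])"
    by (simp add: s a H.r_distr)
  also have "comult_cls D [Ga] \<otimes>\<^bsub>Halg2 D\<^esub> comult_cls D [s] = comult_cls D [Ga, s]" using comult_cls_append[of D "[Ga]" "[s]"] by simp
  finally show "comult_cls D [s, Ga] = scal_cls D p \<otimes>\<^bsub>Halg2 D\<^esub> comult_cls D [Ga, s]" .
qed

lemma skew_h:
  assumes s: "comult_cls D [s] = tens_cls D [s] (replicate (dn1 D) Ga) \<oplus>\<^bsub>Halg2 D\<^esub> tens_cls D [e] [s]"
    and hs: "word [h, s] - word [s, h] \<in> relators D"
    and ah: "word [Ga, h] - word [h, Ga] \<in> relators D"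
    and eh: "h = e \<or> word [h, e] - word [e, h] \<in> relators D \<or> word [e, h] - word [h, e] \<in> relators D"
    and h: "h \<noteq> Gx" "h \<noteq> Gy"
  shows "comult D (word [h, s] - word [s, h]) \<in> rel_ideal2 D"
proof -
  interpret H: ring "Halg2 D" by (rule ring_HH)
  have a: "comult_cls D [h] = tens_cls D [h] [h]" using h by (simp add: comult_cls_grouplike)
  have "comult_cls D [h, s] = comult_cls D [h] \<otimes>\<^bsub>Halg2 D\<^esub> comult_cls D [s]" using comult_cls_append[of D "[h]" "[s]"] by simp
  also have "\<dots> = tens_cls D [h, s] (h # replicate (dn1 D) Ga) \<oplus>\<^bsub>Halg2 D\<^esub> tens_cls D [h, e] [h, s]"
    by (simp add: s a H.r_distr)
  also have "tens_cls D [h, s] (h # replicate (dn1 D) Ga) = tens_cls D [s, h] (replicate (dn1 D) Ga @ [h])"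
    using rel_EE1(1)[OF hs, of "[]" "[]"] slide1(2)[of h Ga D "[s, h]" "dn1 D"] ah by simp
  also have "tens_cls D [h, e] [h, s] = tens_cls D [e, h] [s, h]"
    using rel_EE1(2)[OF hs, of "[h, e]" "[]" "[]"] slide1(1)[of h e D 1 "[s, h]"] eh by auto
  also have "tens_cls D [s, h] (replicate (dn1 D) Ga @ [h]) \<oplus>\<^bsub>Halg2 D\<^esub> tens_cls D [e, h] [s, h] = comult_cls D [s] \<otimes>\<^bsub>Halg2 D\<^esub> comult_cls D [h]"
    by (simp add: s a H.l_distr)
  also have "\<dots> = comult_cls D [s, h]" using comult_cls_append[of D "[s]" "[h]"] by simp
  finally have "comult_cls D [h, s] = scal_cls D 1 \<otimes>\<^bsub>Halg2 D\<^esub> comult_cls D [s, h]" by (simp add: scal_cls_1)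
  from comult_rel1[OF this] show ?thesis by (simp add: scal_1)
qed

lemma comult_cls_pow: "comult_cls D (replicate m g) = comult_cls D [g] [^]\<^bsub>Halg2 D\<^esub> m"
proof -
  interpret H: ring "Halg2 D" by (rule ring_HH)
  show ?thesis
  proof (induction m)
    case (Suc m)
    have "comult_cls D (replicate (Suc m) g) = comult_cls D (replicate m g @ [g])" by (simp add: rep_snoc)
    then show ?case using Suc by (simp only: comult_cls_append) simp
  qed (simp add: comult_cls_Nil tens_cls_one)
qed

lemma tens_cls_pow: "tens_cls D (replicate k g) (replicate l h) [^]\<^bsub>Halg2 D\<^esub> m = tens_cls D (replicate (m * k) g) (replicate (m * l) h)"
proof -
  interpret H: ring "Halg2 D" by (rule ring_HH)
  show ?thesis
    by (induction m) (simp_all add: tens_cls_one add.commute flip: replicate_add)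
qed

lemma skew_pow:
  assumes s: "comult_cls D [s] = tens_cls D [s] (replicate (dn1 D) Ga) \<oplus>\<^bsub>Halg2 D\<^esub> tens_cls D [e] [s]"
    and sa: "word [s, Ga] - scal p (word [Ga, s]) \<in> relators D"
    and es: "word [e, s] - word [s, e] \<in> relators D"
    and e: "e \<noteq> Gx" "e \<noteq> Gy"
    and pow: "rel3 (replicate (dn D) s) 0 [] \<beta> (replicate (dn D * dn1 D) Ga) (replicate (dn D) e) \<in> relators D"
    and prim: "primitive_root (dn D) (p ^ dn1 D)"
  shows "comult D (rel3 (replicate (dn D) s) 0 [] \<beta> (replicate (dn D * dn1 D) Ga) (replicate (dn D) e)) \<in> rel_ideal2 D"
proof (rule comult_rel3)
  interpret H: ring "Halg2 D" by (rule ring_HH)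
  let ?n = "dn D" and ?A = "replicate (dn1 D) Ga"
  let ?N = "replicate (dn D * dn1 D) Ga" and ?e = "replicate (dn D) e" and ?s = "replicate (dn D) s"
  have QP: "tens_cls D [e] [s] \<otimes>\<^bsub>Halg2 D\<^esub> tens_cls D [s] ?A = scal_cls D (p ^ dn1 D) \<otimes>\<^bsub>Halg2 D\<^esub> (tens_cls D [s] ?A \<otimes>\<^bsub>Halg2 D\<^esub> tens_cls D [e] [s])"
    using slide(2)[OF sa, of "[e, s]" "dn1 D"] rel_EE1(1)[OF es, of "[]" "[]"] by simp
  have P: "tens_cls D [s] ?A [^]\<^bsub>Halg2 D\<^esub> ?n = tens_cls D ?s ?N"
    using tens_cls_pow[of D 1 s "dn1 D" Ga ?n] by simp
  have Q: "tens_cls D [e] [s] [^]\<^bsub>Halg2 D\<^esub> ?n = tens_cls D ?e ?s"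
    using tens_cls_pow[of D 1 e 1 s ?n] by simp
  have "comult_cls D ?s = (tens_cls D [s] ?A \<oplus>\<^bsub>Halg2 D\<^esub> tens_cls D [e] [s]) [^]\<^bsub>Halg2 D\<^esub> ?n"
    by (simp add: comult_cls_pow s)
  also have "\<dots> = tens_cls D ?s ?N \<oplus>\<^bsub>Halg2 D\<^esub> tens_cls D ?e ?s"
    unfolding P[symmetric] Q[symmetric]
    by (rule H.q_binomial_root[where T = "scal_cls D", OF _ _ _ scal_cls_mult scal_cls_add scal_cls_1 scal_cls_0 scal_cls_central QP prim]) auto
  also have "tens_cls D ?s ?N = scal_cls D \<beta> \<otimes>\<^bsub>Halg2 D\<^esub> (tens_cls D ?N ?N \<ominus>\<^bsub>Halg2 D\<^esub> tens_cls D ?e ?N)"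
    using rel3_EE'(1)[OF pow, of ?N] by (simp add: scal_cls_0)
  also have "tens_cls D ?e ?s = scal_cls D \<beta> \<otimes>\<^bsub>Halg2 D\<^esub> (tens_cls D ?e ?N \<ominus>\<^bsub>Halg2 D\<^esub> tens_cls D ?e ?e)"
    using rel3_EE'(2)[OF pow, of ?e] by (simp add: scal_cls_0)
  also have "scal_cls D \<beta> \<otimes>\<^bsub>Halg2 D\<^esub> (tens_cls D ?N ?N \<ominus>\<^bsub>Halg2 D\<^esub> tens_cls D ?e ?N)
      \<oplus>\<^bsub>Halg2 D\<^esub> scal_cls D \<beta> \<otimes>\<^bsub>Halg2 D\<^esub> (tens_cls D ?e ?N \<ominus>\<^bsub>Halg2 D\<^esub> tens_cls D ?e ?e)
    = scal_cls D \<beta> \<otimes>\<^bsub>Halg2 D\<^esub> (tens_cls D ?N ?N \<ominus>\<^bsub>Halg2 D\<^esub> tens_cls D ?e ?e)"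
    by (simp add: H.minus_eq H.a_assoc H.r_neg1 H.r_neg2 flip: H.r_distr)
  also have "tens_cls D ?N ?N = comult_cls D ?N" by (simp add: comult_cls_grouplike)
  also have "tens_cls D ?e ?e = comult_cls D ?e" using e by (simp add: comult_cls_grouplike)
  finally show "comult_cls D ?s = scal_cls D 0 \<otimes>\<^bsub>Halg2 D\<^esub> comult_cls D [] \<oplus>\<^bsub>Halg2 D\<^esub> scal_cls D \<beta> \<otimes>\<^bsub>Halg2 D\<^esub> (comult_cls D ?N \<ominus>\<^bsub>Halg2 D\<^esub> comult_cls D ?e)"
    by (simp add: scal_cls_0)
qed

lemma (in ring) yx_arith:
  assumes "p1 \<in> carrier R" "p2 \<in> carrier R" "p3 \<in> carrier R" "p4 \<in> carrier R"
    "u \<in> carrier R" "v \<in> carrier R" "w \<in> carrier R" "t \<in> carrier R" "b \<in> carrier R"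
  shows "(t \<otimes> p1 \<oplus> b \<otimes> (u \<ominus> v)) \<oplus> (t \<otimes> p2 \<oplus> (t \<otimes> p3 \<oplus> (t \<otimes> p4 \<oplus> b \<otimes> (v \<ominus> w))))
    = t \<otimes> (p1 \<oplus> (p3 \<oplus> (p2 \<oplus> p4))) \<oplus> b \<otimes> (u \<ominus> w)"
proof -
  have cl: "b \<otimes> (u \<ominus> v) \<in> carrier R" "b \<otimes> (v \<ominus> w) \<in> carrier R" "b \<otimes> (u \<ominus> w) \<in> carrier R"
    using assms by auto
  have 1: "b \<otimes> (u \<ominus> w) = b \<otimes> (u \<ominus> v) \<oplus> b \<otimes> (v \<ominus> w)"
    using assms by (simp add: minus_eq a_assoc r_neg1 r_neg2 flip: r_distr)
  show ?thesis unfolding 1 using assms cl by (simp add: r_distr a_ac del: minus_closed)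
qed

lemma yx_rel:
  assumes "dq D \<noteq> 0"
  shows "comult D (rel3 [Gy, Gx] (inverse (dq D ^ dn1 D)) [Gx, Gy] (beta3 D) (replicate (2 * dn1 D) Ga) [Gb, Gc]) \<in> rel_ideal2 D"
proof (rule comult_rel3)
  interpret H: ring "Halg2 D" by (rule ring_HH)
  let ?A = "replicate (dn1 D) Ga" and ?AA = "replicate (2 * dn1 D) Ga"
  let ?r = "inverse (dq D ^ dn1 D)"
  have AA: "?A @ ?A = ?AA" by (simp add: mult_2 flip: replicate_add)
  have qr: "?r * dq D ^ dn1 D = 1" using assms by simp
  note yx = relators_mem(10)[of D]
  have bc: "tens_cls D [Gc, Gb] w = tens_cls D [Gb, Gc] w" for w
    using rel_EE1(1)[OF relators_mem(1), of D "[]" "[]" w] by simp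
  have "comult_cls D [Gy, Gx] = comult_cls D [Gy] \<otimes>\<^bsub>Halg2 D\<^esub> comult_cls D [Gx]" using comult_cls_append[of D "[Gy]" "[Gx]"] by simp
  also have "\<dots> = tens_cls D [Gy, Gx] ?AA \<oplus>\<^bsub>Halg2 D\<^esub> (tens_cls D [Gy, Gb] (?A @ [Gx])
      \<oplus>\<^bsub>Halg2 D\<^esub> (tens_cls D [Gc, Gx] (Gy # ?A) \<oplus>\<^bsub>Halg2 D\<^esub> tens_cls D [Gc, Gb] [Gy, Gx]))"
    by (simp add: comult_cls_skew H.l_distr H.r_distr H.a_ac AA)
  also have "tens_cls D [Gy, Gx] ?AA = scal_cls D ?r \<otimes>\<^bsub>Halg2 D\<^esub> tens_cls D [Gx, Gy] ?AA
      \<oplus>\<^bsub>Halg2 D\<^esub> scal_cls D (beta3 D) \<otimes>\<^bsub>Halg2 D\<^esub> (tens_cls D ?AA ?AA \<ominus>\<^bsub>Halg2 D\<^esub> tens_cls D [Gb, Gc] ?AA)"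
    by (rule rel3_EE'(1)[OF yx])
  also have "tens_cls D [Gc, Gb] [Gy, Gx] = scal_cls D ?r \<otimes>\<^bsub>Halg2 D\<^esub> tens_cls D [Gb, Gc] [Gx, Gy]
      \<oplus>\<^bsub>Halg2 D\<^esub> scal_cls D (beta3 D) \<otimes>\<^bsub>Halg2 D\<^esub> (tens_cls D [Gb, Gc] ?AA \<ominus>\<^bsub>Halg2 D\<^esub> tens_cls D [Gb, Gc] [Gb, Gc])"
    unfolding bc by (rule rel3_EE'(2)[OF yx])
  also have "tens_cls D [Gc, Gx] (Gy # ?A) = scal_cls D ?r \<otimes>\<^bsub>Halg2 D\<^esub> tens_cls D [Gx, Gc] (?A @ [Gy])"
    using slide(2)[OF relators_mem(5), of D "[Gc, Gx]" "dn1 D"]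
      rel_EE1(1)[OF relators_mem(7), of D "[]" "[]"] by (simp add: power_inverse)
  also have "tens_cls D [Gy, Gb] (?A @ [Gx]) = scal_cls D ?r \<otimes>\<^bsub>Halg2 D\<^esub> tens_cls D [Gb, Gy] (Gx # ?A)"
    using slide(2)[OF relators_mem(4), of D "[Gb, Gy]" "dn1 D"] qr
      rel_EE1(1)[OF relators_mem(8), of D "[]" "[]"]
    by (simp add: scal_cls_mult scal_cls_1 flip: H.m_assoc)
  also have "(scal_cls D ?r \<otimes>\<^bsub>Halg2 D\<^esub> tens_cls D [Gx, Gy] ?AA
      \<oplus>\<^bsub>Halg2 D\<^esub> scal_cls D (beta3 D) \<otimes>\<^bsub>Halg2 D\<^esub> (tens_cls D ?AA ?AA \<ominus>\<^bsub>Halg2 D\<^esub> tens_cls D [Gb, Gc] ?AA))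
    \<oplus>\<^bsub>Halg2 D\<^esub> (scal_cls D ?r \<otimes>\<^bsub>Halg2 D\<^esub> tens_cls D [Gb, Gy] (Gx # ?A)
      \<oplus>\<^bsub>Halg2 D\<^esub> (scal_cls D ?r \<otimes>\<^bsub>Halg2 D\<^esub> tens_cls D [Gx, Gc] (?A @ [Gy])
      \<oplus>\<^bsub>Halg2 D\<^esub> (scal_cls D ?r \<otimes>\<^bsub>Halg2 D\<^esub> tens_cls D [Gb, Gc] [Gx, Gy]
      \<oplus>\<^bsub>Halg2 D\<^esub> scal_cls D (beta3 D) \<otimes>\<^bsub>Halg2 D\<^esub> (tens_cls D [Gb, Gc] ?AA \<ominus>\<^bsub>Halg2 D\<^esub> tens_cls D [Gb, Gc] [Gb, Gc]))))
    = scal_cls D ?r \<otimes>\<^bsub>Halg2 D\<^esub> (tens_cls D [Gx, Gy] ?AA \<oplus>\<^bsub>Halg2 D\<^esub> (tens_cls D [Gx, Gc] (?A @ [Gy])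
        \<oplus>\<^bsub>Halg2 D\<^esub> (tens_cls D [Gb, Gy] (Gx # ?A) \<oplus>\<^bsub>Halg2 D\<^esub> tens_cls D [Gb, Gc] [Gx, Gy])))
      \<oplus>\<^bsub>Halg2 D\<^esub> scal_cls D (beta3 D) \<otimes>\<^bsub>Halg2 D\<^esub> (tens_cls D ?AA ?AA \<ominus>\<^bsub>Halg2 D\<^esub> tens_cls D [Gb, Gc] [Gb, Gc])"
    by (rule H.yx_arith) simp_all
  also have "tens_cls D [Gx, Gy] ?AA \<oplus>\<^bsub>Halg2 D\<^esub> (tens_cls D [Gx, Gc] (?A @ [Gy])
        \<oplus>\<^bsub>Halg2 D\<^esub> (tens_cls D [Gb, Gy] (Gx # ?A) \<oplus>\<^bsub>Halg2 D\<^esub> tens_cls D [Gb, Gc] [Gx, Gy]))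
      = comult_cls D [Gx] \<otimes>\<^bsub>Halg2 D\<^esub> comult_cls D [Gy]"
    by (simp add: comult_cls_skew H.l_distr H.r_distr H.a_ac AA)
  also have "comult_cls D [Gx] \<otimes>\<^bsub>Halg2 D\<^esub> comult_cls D [Gy] = comult_cls D [Gx, Gy]" using comult_cls_append[of D "[Gx]" "[Gy]"] by simp
  also have "tens_cls D ?AA ?AA = comult_cls D ?AA" by (simp add: comult_cls_grouplike)
  also have "tens_cls D [Gb, Gc] [Gb, Gc] = comult_cls D [Gb, Gc]" by (simp add: comult_cls_grouplike)
  finally show "comult_cls D [Gy, Gx] = scal_cls D ?r \<otimes>\<^bsub>Halg2 D\<^esub> comult_cls D [Gx, Gy]
    \<oplus>\<^bsub>Halg2 D\<^esub> scal_cls D (beta3 D) \<otimes>\<^bsub>Halg2 D\<^esub> (comult_cls D ?AA \<ominus>\<^bsub>Halg2 D\<^esub> comult_cls D [Gb, Gc])" .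
qed

lemma primitive_root_dvd: 
  assumes "primitive_root n q" "q ^ m = 1"
  shows "n dvd m"
proof -
  have n: "n > 0" "q ^ n = 1" using assms(1) by (auto simp: primitive_root_def)
  have "q ^ m = (q ^ n) ^ (m div n) * q ^ (m mod n)"
    by (simp flip: power_mult power_add)
  then have "q ^ (m mod n) = 1" using assms(2) n by simp
  then have "m mod n = 0" using assms(1) n unfolding primitive_root_def
    by (metis mod_less_divisor not_gr_zero)
  then show ?thesis by auto
qed

lemma primitive_root_power:
  assumes "primitive_root n q" "coprime n m"
  shows "primitive_root n (q ^ m)"
  unfolding primitive_root_def
proof (intro conjI allI impI)
  show "n > 0" "(q ^ m) ^ n = 1" using assms(1)
    by (auto simp: primitive_root_def simp flip: power_mult) (metis mult.commute power_mult power_one)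
  fix j assume j: "0 < j \<and> j < n"
  show "(q ^ m) ^ j \<noteq> 1"
  proof
    assume "(q ^ m) ^ j = 1"
    then have "n dvd m * j" using primitive_root_dvd[OF assms(1)] by (simp add: power_mult)
    then have "n dvd j" using assms(2) by (simp add: coprime_dvd_mult_right_iff)
    then show False using j by (auto dest: dvd_imp_le)
  qed
qed

lemma primitive_root_inverse: "primitive_root n q \<Longrightarrow> primitive_root n (inverse q)"
  by (auto simp: primitive_root_def power_inverse inverse_eq_1_iff)

theorem is_Hopf_if_coprime:
  assumes q: "primitive_root (dn D) (dq D)" and co: "coprime (dn D) (dn1 D)"
  shows "is_Hopf D"
proof -
  have q0: "dq D \<noteq> 0" using q by (auto simp: primitive_root_def power_0_left split: if_splits)
  have p1: "primitive_root (dn D) (dq D ^ dn1 D)" using primitive_root_power[OF q co] .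
  have p2: "primitive_root (dn D) (inverse (dq D) ^ dn1 D)"
    using primitive_root_power[OF primitive_root_inverse[OF q] co] .
  note m = relators_mem[of D] relators_mem_pow[of D]
  have x: "comult D (word [Gx, Ga] - scal (dq D) (word [Ga, Gx])) \<in> rel_ideal2 D"
    using skew_a[OF comult_cls_skew(1)] m by blast
  have y: "comult D (word [Gy, Ga] - scal (inverse (dq D)) (word [Ga, Gy])) \<in> rel_ideal2 D"
    using skew_a[OF comult_cls_skew(2)] m by blast
  have bx: "comult D (word [Gb, Gx] - word [Gx, Gb]) \<in> rel_ideal2 D"
    and cx: "comult D (word [Gc, Gx] - word [Gx, Gc]) \<in> rel_ideal2 D"
    using skew_h[OF comult_cls_skew(1)] m by blast+
  have by': "comult D (word [Gb, Gy] - word [Gy, Gb]) \<in> rel_ideal2 D"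
    and cy: "comult D (word [Gc, Gy] - word [Gy, Gc]) \<in> rel_ideal2 D"
    using skew_h[OF comult_cls_skew(2)] m by blast+
  have xn: "comult D (rel3 (replicate (dn D) Gx) 0 [] (beta1 D) (replicate (dn D * dn1 D) Ga) (replicate (dn D) Gb)) \<in> rel_ideal2 D"
    using skew_pow[OF comult_cls_skew(1) m(4) m(6) _ _ m(11) p1] by simp
  have yn: "comult D (rel3 (replicate (dn D) Gy) 0 [] (beta2 D) (replicate (dn D * dn1 D) Ga) (replicate (dn D) Gc)) \<in> rel_ideal2 D"
    using skew_pow[OF comult_cls_skew(2) m(5) m(9) _ _ m(12) p2] by simp
  have z: "f - (\<lambda>_. 0) = f" for f :: "'a nc" by (simp add: fun_eq_iff)
  have g: "comult D (word u - word v) \<in> rel_ideal2 D"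
    if "word u - word v \<in> relators D" "set u \<inter> {Gx, Gy} = {}" "set v \<inter> {Gx, Gy} = {}" for u v
    using comult_group_rel[of u v D] that by auto
  show ?thesis unfolding is_Hopf_def
  proof
    fix r assume r: "r \<in> relators D"
    then show "comult D r \<in> rel_ideal2 D"
      unfolding relators_def Let_def
      using x y bx cx by' cy xn yn yx_rel[OF q0] unfolding rel3_def scal_0 z
      by (elim insertE emptyE) (use r in \<open>auto intro!: g simp del: minus_apply\<close>)
  qed
qed

end

theory Submission
  imports Defs "HOL-Library.Function_Algebras" "Jordan_Normal_Form.Determinant"
begin

text \<open>
  The Grothendieck ring is identified with a ring of functions. The group-like generators
  \<open>a, b, c\<close> commute, so the trace of a module on the monomials in them is a sum of characters of
  an abelian group. This trace is additive on short exact sequences (\<open>trch_short_exact\<close>: a matrix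
  splitting and \<open>tr(AB) = tr(BA)\<close>) and multiplicative on tensor products (\<open>trch_tensor\<close>), because
  \<open>a, b, c\<close> are group-like; it does not see \<open>x\<close> and \<open>y\<close>.

  It loses nothing. Since \<open>y\<^sup>n = 0\<close> and \<open>y\<close> commutes with the other generators up to scalars, a
  nonzero module has a common eigenvector of \<open>a, b, c\<close> killed by \<open>y\<close>, and among its images
  under the powers of \<open>x\<close> either a single one spans a copy of \<open>V\<^sub>0\<close> or \<open>n\<close> consecutive ones span a
  copy of \<open>V\<^sub>I\<close> (\<open>simple_submodule\<close>). So, by induction on the
  dimension, every class is an integral combination of the classes of these modules
  (\<open>decomposition\<close>). The character of \<open>V\<^sub>0\<close> is a single group character, that of \<open>V\<^sub>I\<close> the sum over
  an orbit under the multiplication of the value at \<open>a\<close> by \<open>n\<close>-th roots of unity; different orbits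
  are disjoint, and Dedekind's theorem on the independence of characters shows that in
  characteristic zero these functions are linearly independent (\<open>tau_independent\<close>). Hence a
  combination of modules is zero in the Grothendieck group if and only if its trace is zero
  (\<open>ses_iff\<close>), and \<open>G\<^sub>0\<close> is the ring of virtual characters; the map \<open>cls\<close> sends a character to its
  class.

  In this ring \<open>R\<^sub>1\<close> is spanned by the characters of the one-dimensional modules
  (\<open>R1_eq\<close>), the element $x_{\zeta,1}$ is the orbit sum of $(\sqrt[n]{\zeta},1,1)$, and $\mathfrak{s}$ the orbit sum of the
  trivial character. The product of two orbit sums is \<open>n\<close> times an orbit sum
  (\<open>orb_mult_orb\<close>), which gives the multiplication table (\<open>x_elt_mult\<close>), and every orbit sum is a
  one-dimensional character times the $x_{\zeta,1}$ of a chosen representative (\<open>tau_eq_product\<close>), which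
  gives the generation of \<open>G\<^sub>0\<close>.

  For the presentation, the relators reduce a polynomial in the variables to an integral
  combination of constants and of monomials \<open>\<chi> X\<^sub>C\<close>, and \<open>g X\<^sub>C = X\<^sub>C\<close> identifies the characters
  \<open>\<chi>\<close> in one orbit; so one monomial for each \<open>V\<^sub>0\<close> and each \<open>V\<^sub>I\<close> suffices
  (\<open>pols_reduced\<close>). The values of these monomials are the linearly independent functions
  from above. Hence a polynomial with value zero lies in the ideal (\<open>kernel_eq_J\<close>).
\<close>


section \<open>Traces and Kronecker products\<close>

text \<open>The trace of a square matrix.\<close>

definition mtrace :: "'a::comm_monoid_add mat \<Rightarrow> 'a" where
  "mtrace A = (\<Sum>i<dim_row A. A $$ (i, i))"

lemma mtrace_mult_comm:
  fixes A B :: "'a::comm_semiring_0 mat"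
  assumes "A \<in> carrier_mat m n" "B \<in> carrier_mat n m"
  shows "mtrace (A * B) = mtrace (B * A)"
proof -
  have "mtrace (A * B) = (\<Sum>i<m. \<Sum>k<n. A $$ (i, k) * B $$ (k, i))"
    using assms by (auto simp: mtrace_def scalar_prod_def atLeast0LessThan intro!: sum.cong)
  also have "\<dots> = (\<Sum>k<n. \<Sum>i<m. B $$ (k, i) * A $$ (i, k))"
    by (subst sum.swap) (simp add: mult.commute)
  also have "\<dots> = mtrace (B * A)"
    using assms by (auto simp: mtrace_def scalar_prod_def atLeast0LessThan intro!: sum.cong)
  finally show ?thesis .
qed

lemma mtrace_add:
  assumes "A \<in> carrier_mat n n" "B \<in> carrier_mat n n"
  shows "mtrace (A + B) = mtrace A + mtrace B"
  using assms by (auto simp: mtrace_def sum.distrib)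

lemma sum_lessThan_mult_divmod:
  fixes f :: "nat \<Rightarrow> nat \<Rightarrow> 'a::comm_monoid_add"
  shows "(\<Sum>k<m * n. f (k div n) (k mod n)) = (\<Sum>i<m. \<Sum>j<n. f i j)"
proof -
  have lt: "i * n + j < m * n" if "i < m" "j < n" for i j
  proof -
    have "i * n + j < Suc i * n" using that by simp
    also have "\<dots> \<le> m * n" using that by (intro mult_le_mono1) simp
    finally show ?thesis .
  qed
  have "(\<Sum>i<m. \<Sum>j<n. f i j) = (\<Sum>x\<in>{..<m} \<times> {..<n}. f (fst x) (snd x))"
    by (simp add: sum.cartesian_product split_def)
  also have "\<dots> = (\<Sum>k<m * n. f (k div n) (k mod n))"
  proof (rule sum.reindex_bij_witness[where i = "\<lambda>k. (k div n, k mod n)" and j = "\<lambda>(i, j). i * n + j"])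
    fix k assume "k \<in> {..<m * n}"
    then have "k < m * n" and "n > 0" by (auto intro: gr0I)
    then show "(k div n, k mod n) \<in> {..<m} \<times> {..<n}"
      by (simp add: less_mult_imp_div_less)
  qed (auto simp: lt)
  finally show ?thesis by simp
qed

lemma kron_carrier:
  "A \<in> carrier_mat m n \<Longrightarrow> B \<in> carrier_mat p q \<Longrightarrow> kron A B \<in> carrier_mat (m * p) (n * q)"
  by (auto simp: kron_def)

lemma index_kron:
  assumes "A \<in> carrier_mat m n" "B \<in> carrier_mat p q" "i < m * p" "j < n * q"
  shows "kron A B $$ (i, j) = A $$ (i div p, j div q) * B $$ (i mod p, j mod q)"
  using assms by (auto simp: kron_def)

lemma kron_mult:
  fixes A :: "'k::field mat"
  assumes "A \<in> carrier_mat m n" "B \<in> carrier_mat p q" "C \<in> carrier_mat n k" "D \<in> carrier_mat q l"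
  shows "kron A B * kron C D = kron (A * C) (B * D)"
proof (rule eq_matI)
  have AC: "A * C \<in> carrier_mat m k" and BD: "B * D \<in> carrier_mat p l" using assms by auto
  fix i j assume "i < dim_row (kron (A * C) (B * D))" "j < dim_col (kron (A * C) (B * D))"
  then have ij: "i < m * p" "j < k * l" using kron_carrier[OF AC BD] by auto
  have bd: "i div p < m" "i mod p < p" "j div l < k" "j mod l < l"
    using ij by (auto simp: less_mult_imp_div_less intro!: mod_less_divisor gr0I)
  have "(kron A B * kron C D) $$ (i, j) = (\<Sum>x<n * q. kron A B $$ (i, x) * kron C D $$ (x, j))"
    using ij kron_carrier[OF assms(1,2)] kron_carrier[OF assms(3,4)]
    by (auto simp: scalar_prod_def atLeast0LessThan)
  also have "\<dots> = (\<Sum>x<n * q. (\<lambda>u v. (A $$ (i div p, u) * C $$ (u, j div l)) * (B $$ (i mod p, v) * D $$ (v, j mod l))) (x div q) (x mod q))"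
    using ij by (intro sum.cong) (auto simp: index_kron[OF assms(1,2)] index_kron[OF assms(3,4)])
  also have "\<dots> = (\<Sum>u<n. A $$ (i div p, u) * C $$ (u, j div l)) * (\<Sum>v<q. B $$ (i mod p, v) * D $$ (v, j mod l))"
    by (subst sum_lessThan_mult_divmod) (simp add: sum_product)
  also have "\<dots> = kron (A * C) (B * D) $$ (i, j)"
    using assms bd by (simp add: index_kron[OF AC BD ij] scalar_prod_def atLeast0LessThan)
  finally show "(kron A B * kron C D) $$ (i, j) = kron (A * C) (B * D) $$ (i, j)" .
qed (use assms in \<open>auto simp: kron_def\<close>)

lemma kron_one: "kron (1\<^sub>m m) (1\<^sub>m n) = (1\<^sub>m (m * n) :: 'k::field mat)"
proof (rule eq_matI)
  fix i j assume ij: "i < dim_row (1\<^sub>m (m * n) :: 'k mat)" "j < dim_col (1\<^sub>m (m * n) :: 'k mat)"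
  then have "n > 0" by (auto intro: gr0I)
  moreover have "i = j" if "i div n = j div n" "i mod n = j mod n"
    using that by (metis mult_div_mod_eq)
  ultimately show "kron (1\<^sub>m m) (1\<^sub>m n) $$ (i, j) = (1\<^sub>m (m * n) :: 'k mat) $$ (i, j)"
    using ij by (auto simp: kron_def less_mult_imp_div_less)
qed (auto simp: kron_def)

lemma mtrace_kron:
  assumes "A \<in> carrier_mat m m" "B \<in> carrier_mat n n"
  shows "mtrace (kron A B) = mtrace A * mtrace B"
proof -
  have "mtrace (kron A B) = (\<Sum>x<m * n. (\<lambda>i j. A $$ (i, i) * B $$ (j, j)) (x div n) (x mod n))"
    using assms kron_carrier[OF assms] by (auto simp: mtrace_def index_kron[OF assms] intro!: sum.cong)
  also have "\<dots> = mtrace A * mtrace B"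
    using assms by (subst sum_lessThan_mult_divmod) (simp add: mtrace_def sum_product)
  finally show ?thesis .
qed


section \<open>Linear extension of multiplicative matrix-valued maps\<close>

text \<open>The linear extension of \<^term>\<open>W\<close> from a basis indexed by \<^typ>\<open>'p\<close> to the finitely supported
  functions on it.\<close>

definition lin_mat :: "nat \<Rightarrow> ('p \<Rightarrow> 'k::field mat) \<Rightarrow> ('p \<Rightarrow> 'k) \<Rightarrow> 'k mat" where
  "lin_mat d W f = mat d d (\<lambda>ij. \<Sum>p | f p \<noteq> 0. f p * W p $$ ij)"

lemma lin_mat_carrier [simp]: "lin_mat d W f \<in> carrier_mat d d"
  by (simp add: lin_mat_def)

lemma lin_mat_dim [simp]: "dim_row (lin_mat d W f) = d" "dim_col (lin_mat d W f) = d"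
  by (simp_all add: lin_mat_def)

lemma index_lin_mat:
  assumes "finite A" "{p. f p \<noteq> 0} \<subseteq> A" "i < d" "j < d"
  shows "lin_mat d W f $$ (i, j) = (\<Sum>p\<in>A. f p * W p $$ (i, j))"
  using assms by (auto simp: lin_mat_def intro!: sum.mono_neutral_left)

lemma lin_mat_add:
  assumes "finite {p. f p \<noteq> 0}" "finite {p. g p \<noteq> 0}"
  shows "lin_mat d W (\<lambda>p. f p + g p) = lin_mat d W f + lin_mat d W g"
proof (rule eq_matI)
  let ?A = "{p. f p \<noteq> 0} \<union> {p. g p \<noteq> 0}"
  have A: "finite ?A" using assms by simp
  fix i j assume "i < dim_row (lin_mat d W f + lin_mat d W g)" "j < dim_col (lin_mat d W f + lin_mat d W g)"
  then have ij: "i < d" "j < d" by auto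
  have "lin_mat d W (\<lambda>p. f p + g p) $$ (i, j) = (\<Sum>p\<in>?A. (f p + g p) * W p $$ (i, j))"
    by (rule index_lin_mat[OF A _ ij]) auto
  moreover have "lin_mat d W f $$ (i, j) = (\<Sum>p\<in>?A. f p * W p $$ (i, j))"
    by (rule index_lin_mat[OF A _ ij]) auto
  moreover have "lin_mat d W g $$ (i, j) = (\<Sum>p\<in>?A. g p * W p $$ (i, j))"
    by (rule index_lin_mat[OF A _ ij]) auto
  ultimately show "lin_mat d W (\<lambda>p. f p + g p) $$ (i, j) = (lin_mat d W f + lin_mat d W g) $$ (i, j)"
    using ij by (simp add: sum.distrib distrib_right)
qed auto

lemma lin_mat_scale: "lin_mat d W (\<lambda>p. t * f p) = t \<cdot>\<^sub>m lin_mat d W f"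
  by (cases "t = 0") (auto simp: lin_mat_def sum_distrib_left mult.assoc intro!: eq_matI)

lemma lin_mat_basis:
  assumes "W p \<in> carrier_mat d d"
  shows "lin_mat d W (\<lambda>x. if x = p then 1 else 0) = W p"
  using assms by (auto simp: lin_mat_def intro!: eq_matI)

lemma index_lin_mat_mult:
  assumes fin: "finite {p. f p \<noteq> 0}" and W: "\<And>p. W p \<in> carrier_mat d d"
    and F: "F \<in> carrier_mat d r" and ij: "i < d" "j < r"
  shows "(lin_mat d W f * F) $$ (i, j) = (\<Sum>p | f p \<noteq> 0. f p * (W p * F) $$ (i, j))"
proof -
  have "(lin_mat d W f * F) $$ (i, j) = (\<Sum>k<d. \<Sum>p | f p \<noteq> 0. f p * W p $$ (i, k) * F $$ (k, j))"
    using F ij by (simp add: scalar_prod_def atLeast0LessThan index_lin_mat[OF fin] sum_distrib_right)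
  also have "\<dots> = (\<Sum>p | f p \<noteq> 0. \<Sum>k<d. f p * W p $$ (i, k) * F $$ (k, j))"
    by (rule sum.swap)
  also have "\<dots> = (\<Sum>p | f p \<noteq> 0. f p * (W p * F) $$ (i, j))"
    using F ij W[THEN carrier_matD(1)] W[THEN carrier_matD(2)]
    by (simp add: scalar_prod_def atLeast0LessThan sum_distrib_left mult.assoc)
  finally show ?thesis .
qed

lemma index_mult_lin_mat:
  assumes fin: "finite {p. f p \<noteq> 0}" and W: "\<And>p. W p \<in> carrier_mat d d"
    and F: "F \<in> carrier_mat r d" and ij: "i < r" "j < d"
  shows "(F * lin_mat d W f) $$ (i, j) = (\<Sum>p | f p \<noteq> 0. f p * (F * W p) $$ (i, j))"
proof -
  have "(F * lin_mat d W f) $$ (i, j) = (\<Sum>k<d. \<Sum>p | f p \<noteq> 0. f p * (F $$ (i, k) * W p $$ (k, j)))"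
    using F ij by (simp add: scalar_prod_def atLeast0LessThan index_lin_mat[OF fin] sum_distrib_left ac_simps)
  also have "\<dots> = (\<Sum>p | f p \<noteq> 0. \<Sum>k<d. f p * (F $$ (i, k) * W p $$ (k, j)))"
    by (rule sum.swap)
  also have "\<dots> = (\<Sum>p | f p \<noteq> 0. f p * (F * W p) $$ (i, j))"
    using F ij W[THEN carrier_matD(1)] W[THEN carrier_matD(2)]
    by (simp add: scalar_prod_def atLeast0LessThan sum_distrib_left)
  finally show ?thesis .
qed

lemma lin_mat_intertwine:
  assumes "finite {p. f p \<noteq> 0}" "\<And>p. W p \<in> carrier_mat d d" "\<And>p. V p \<in> carrier_mat r r"
    and "F \<in> carrier_mat d r" "\<And>p. W p * F = F * V p"
  shows "lin_mat d W f * F = F * lin_mat r V f"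
proof (rule eq_matI)
  fix i j assume "i < dim_row (F * lin_mat r V f)" "j < dim_col (F * lin_mat r V f)"
  then have ij: "i < d" "j < r" using assms(4) by auto
  show "(lin_mat d W f * F) $$ (i, j) = (F * lin_mat r V f) $$ (i, j)"
    by (simp only: index_lin_mat_mult[OF assms(1,2,4) ij] index_mult_lin_mat[OF assms(1,3,4) ij] assms(5))
qed (use assms(4) in auto)

text \<open>Here \<^term>\<open>m\<close> multiplies basis elements, and \<^term>\<open>h\<close> is the product of \<^term>\<open>f\<close> and \<^term>\<open>g\<close> in
  the algebra of finitely supported functions.\<close>

lemma sum_convolution:
  fixes f g h :: "'p \<Rightarrow> 'k::field"
  assumes fin: "finite {p. f p \<noteq> 0}" "finite {p. g p \<noteq> 0}"
    and conv: "\<And>p. finite {x. m (fst x) (snd x) = p}"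
      "\<And>p. h p = (\<Sum>x | m (fst x) (snd x) = p. f (fst x) * g (snd x))"
  shows "(\<Sum>p | h p \<noteq> 0. h p * F p) = (\<Sum>a | f a \<noteq> 0. \<Sum>b | g b \<noteq> 0. f a * g b * F (m a b))"
proof -
  let ?S = "{p. f p \<noteq> 0} \<times> {p. g p \<noteq> 0}"
  let ?m = "\<lambda>x. m (fst x) (snd x)"
  have S: "finite ?S" using fin by simp
  have h: "h p = (\<Sum>x\<in>{x\<in>?S. ?m x = p}. f (fst x) * g (snd x))" for p
    unfolding conv(2)[of p] by (rule sum.mono_neutral_right[OF conv(1)]) auto
  have "(\<Sum>a | f a \<noteq> 0. \<Sum>b | g b \<noteq> 0. f a * g b * F (m a b)) = (\<Sum>x\<in>?S. f (fst x) * g (snd x) * F (?m x))"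
    by (simp add: sum.cartesian_product split_def)
  also have "\<dots> = (\<Sum>p\<in>?m ` ?S. \<Sum>x\<in>{x\<in>?S. ?m x = p}. f (fst x) * g (snd x) * F (?m x))"
    by (rule sum.image_gen[OF S])
  also have "\<dots> = (\<Sum>p\<in>?m ` ?S. h p * F p)"
    by (intro sum.cong refl) (auto simp: h sum_distrib_right)
  also have "\<dots> = (\<Sum>p | h p \<noteq> 0. h p * F p)"
  proof (rule sum.mono_neutral_right)
    show "{p. h p \<noteq> 0} \<subseteq> ?m ` ?S"
    proof
      fix p assume "p \<in> {p. h p \<noteq> 0}"
      then have "(\<Sum>x\<in>{x\<in>?S. ?m x = p}. f (fst x) * g (snd x)) \<noteq> 0" using h[of p] by simp
      then have "{x\<in>?S. ?m x = p} \<noteq> {}" by (rule contrapos_nn) (simp only: sum.empty)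
      then show "p \<in> ?m ` ?S" by blast
    qed
  qed (use S in auto)
  finally show ?thesis by simp
qed

lemma lin_mat_convolution:
  assumes fin: "finite {p. f p \<noteq> 0}" "finite {p. g p \<noteq> 0}"
    and conv: "\<And>p. finite {x. m (fst x) (snd x) = p}"
      "\<And>p. h p = (\<Sum>x | m (fst x) (snd x) = p. f (fst x) * g (snd x))"
    and W: "\<And>p. W p \<in> carrier_mat d d" "\<And>a b. W (m a b) = W a * W b"
  shows "lin_mat d W h = lin_mat d W f * lin_mat d W g"
proof (rule eq_matI)
  fix i j assume "i < dim_row (lin_mat d W f * lin_mat d W g)" "j < dim_col (lin_mat d W f * lin_mat d W g)"
  then have ij: "i < d" "j < d" by auto
  have "lin_mat d W h $$ (i, j) = (\<Sum>p | h p \<noteq> 0. h p * W p $$ (i, j))"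
    using ij by (simp add: lin_mat_def)
  also have "\<dots> = (\<Sum>a | f a \<noteq> 0. \<Sum>b | g b \<noteq> 0. f a * g b * W (m a b) $$ (i, j))"
    by (rule sum_convolution[OF fin conv])
  also have "\<dots> = (\<Sum>a | f a \<noteq> 0. f a * (\<Sum>b | g b \<noteq> 0. g b * (W a * W b) $$ (i, j)))"
    by (simp add: W(2) sum_distrib_left mult.assoc)
  also have "\<dots> = (\<Sum>a | f a \<noteq> 0. f a * (W a * lin_mat d W g) $$ (i, j))"
    by (simp add: index_mult_lin_mat[OF fin(2) W(1) W(1) ij])
  also have "\<dots> = (lin_mat d W f * lin_mat d W g) $$ (i, j)"
    by (simp add: index_lin_mat_mult[OF fin(1) W(1) lin_mat_carrier ij])
  finally show "lin_mat d W h $$ (i, j) = (lin_mat d W f * lin_mat d W g) $$ (i, j)" .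
qed auto


section \<open>Representations of the algebra by matrices\<close>

text \<open>The ring axioms are inherited along an injective map which respects the operations.\<close>

lemma ring_if_embeds:
  assumes S: "ring S" and h: "\<And>x. x \<in> carrier R \<Longrightarrow> h x \<in> carrier S" and inj: "inj_on h (carrier R)"
    and closed: "\<And>x y. x \<in> carrier R \<Longrightarrow> y \<in> carrier R \<Longrightarrow> x \<otimes>\<^bsub>R\<^esub> y \<in> carrier R"
      "\<And>x y. x \<in> carrier R \<Longrightarrow> y \<in> carrier R \<Longrightarrow> x \<oplus>\<^bsub>R\<^esub> y \<in> carrier R"
      "\<one>\<^bsub>R\<^esub> \<in> carrier R" "\<zero>\<^bsub>R\<^esub> \<in> carrier R"
    and hom: "\<And>x y. x \<in> carrier R \<Longrightarrow> y \<in> carrier R \<Longrightarrow> h (x \<otimes>\<^bsub>R\<^esub> y) = h x \<otimes>\<^bsub>S\<^esub> h y"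
      "\<And>x y. x \<in> carrier R \<Longrightarrow> y \<in> carrier R \<Longrightarrow> h (x \<oplus>\<^bsub>R\<^esub> y) = h x \<oplus>\<^bsub>S\<^esub> h y"
      "h \<one>\<^bsub>R\<^esub> = \<one>\<^bsub>S\<^esub>" "h \<zero>\<^bsub>R\<^esub> = \<zero>\<^bsub>S\<^esub>"
    and neg: "\<And>x. x \<in> carrier R \<Longrightarrow> \<exists>y\<in>carrier R. h y = \<ominus>\<^bsub>S\<^esub> h x"
  shows "ring R"
proof -
  interpret S: ring S by (rule S)
  have eq: "x = y" if "h x = h y" "x \<in> carrier R" "y \<in> carrier R" for x y
    using inj that by (auto dest: inj_onD)
  show ?thesis
  proof (rule ringI)
    show "abelian_group R"
    proof (rule abelian_groupI)
      fix x y z assume "x \<in> carrier R" "y \<in> carrier R" "z \<in> carrier R"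
      then show "x \<oplus>\<^bsub>R\<^esub> y \<oplus>\<^bsub>R\<^esub> z = x \<oplus>\<^bsub>R\<^esub> (y \<oplus>\<^bsub>R\<^esub> z)"
        by (intro eq) (simp_all add: closed hom h S.a_assoc)
    next
      fix x y assume "x \<in> carrier R" "y \<in> carrier R"
      then show "x \<oplus>\<^bsub>R\<^esub> y = y \<oplus>\<^bsub>R\<^esub> x"
        by (intro eq) (simp_all add: closed hom h S.a_comm)
    next
      fix x assume "x \<in> carrier R"
      then show "\<zero>\<^bsub>R\<^esub> \<oplus>\<^bsub>R\<^esub> x = x"
        by (intro eq) (simp_all add: closed hom h)
    next
      fix x assume x: "x \<in> carrier R"
      then obtain y where y: "y \<in> carrier R" "h y = \<ominus>\<^bsub>S\<^esub> h x" using neg by blast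
      have "y \<oplus>\<^bsub>R\<^esub> x = \<zero>\<^bsub>R\<^esub>" using x y by (intro eq) (simp_all add: closed hom h S.l_neg)
      then show "\<exists>y\<in>carrier R. y \<oplus>\<^bsub>R\<^esub> x = \<zero>\<^bsub>R\<^esub>" using y by blast
    qed (auto simp: closed)
    show "Group.monoid R"
    proof (rule monoidI)
      fix x y z assume "x \<in> carrier R" "y \<in> carrier R" "z \<in> carrier R"
      then show "x \<otimes>\<^bsub>R\<^esub> y \<otimes>\<^bsub>R\<^esub> z = x \<otimes>\<^bsub>R\<^esub> (y \<otimes>\<^bsub>R\<^esub> z)"
        by (intro eq) (simp_all add: closed hom h S.m_assoc)
    next
      fix x assume "x \<in> carrier R"
      then show "\<one>\<^bsub>R\<^esub> \<otimes>\<^bsub>R\<^esub> x = x" "x \<otimes>\<^bsub>R\<^esub> \<one>\<^bsub>R\<^esub> = x"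
        by (auto intro!: eq simp: closed hom h)
    qed (auto simp: closed)
  next
    fix x y z assume "x \<in> carrier R" "y \<in> carrier R" "z \<in> carrier R"
    then show "(x \<oplus>\<^bsub>R\<^esub> y) \<otimes>\<^bsub>R\<^esub> z = x \<otimes>\<^bsub>R\<^esub> z \<oplus>\<^bsub>R\<^esub> y \<otimes>\<^bsub>R\<^esub> z"
      "z \<otimes>\<^bsub>R\<^esub> (x \<oplus>\<^bsub>R\<^esub> y) = z \<otimes>\<^bsub>R\<^esub> x \<oplus>\<^bsub>R\<^esub> z \<otimes>\<^bsub>R\<^esub> y"
      by (auto intro!: eq simp: closed hom h S.l_distr S.r_distr)
  qed
qed

lemma finite_append_splits: "finite {x. fst x @ snd x = (w :: gen list)}"
proof (rule finite_subset)
  show "{x. fst x @ snd x = w} \<subseteq> (\<lambda>i. (take i w, drop i w)) ` {..length w}"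
  proof
    fix x assume "x \<in> {x. fst x @ snd x = w}"
    then have "fst x @ snd x = w" by simp
    then show "x \<in> (\<lambda>i. (take i w, drop i w)) ` {..length w}"
      by (intro image_eqI[of _ _ "length (fst x)"]) auto
  qed
qed simp

lemma fa_simps:
  "carrier free_alg = {f. finite {w. f w \<noteq> 0}}"
  "f \<oplus>\<^bsub>free_alg\<^esub> g = (\<lambda>w. f w + g w)"
  "\<one>\<^bsub>free_alg\<^esub> = word []"
  "\<zero>\<^bsub>free_alg\<^esub> = (\<lambda>w. 0)"
  by (simp_all add: free_alg_def word_def)

lemma fa_mult:
  "(f \<otimes>\<^bsub>free_alg\<^esub> g) w = (\<Sum>x | fst x @ snd x = w. f (fst x) * g (snd x))"
proof -
  have "(\<Sum>i\<le>length w. f (take i w) * g (drop i w)) = (\<Sum>x | fst x @ snd x = w. f (fst x) * g (snd x))"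
    by (rule sum.reindex_bij_witness[where j = "\<lambda>i. (take i w, drop i w)" and i = "\<lambda>x. length (fst x)"])
       auto
  then show ?thesis by (simp add: free_alg_def)
qed

lemma fa_mult_closed:
  assumes "f \<in> carrier free_alg" "g \<in> carrier free_alg"
  shows "f \<otimes>\<^bsub>free_alg\<^esub> g \<in> carrier free_alg"
proof -
  have "{w. (f \<otimes>\<^bsub>free_alg\<^esub> g) w \<noteq> 0} \<subseteq> (\<lambda>(u, v). u @ v) ` ({w. f w \<noteq> 0} \<times> {w. g w \<noteq> 0})"
  proof
    fix w assume "w \<in> {w. (f \<otimes>\<^bsub>free_alg\<^esub> g) w \<noteq> 0}"
    then have "(\<Sum>x | fst x @ snd x = w. f (fst x) * g (snd x)) \<noteq> 0" by (simp add: fa_mult)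
    then obtain x where "fst x @ snd x = w" "f (fst x) * g (snd x) \<noteq> 0"
      by (metis (mono_tags, lifting) mem_Collect_eq sum.neutral)
    then show "w \<in> (\<lambda>(u, v). u @ v) ` ({w. f w \<noteq> 0} \<times> {w. g w \<noteq> 0})"
      by (intro image_eqI[of _ _ x]) (auto simp: split_def mem_Times_iff)
  qed
  then show ?thesis using assms by (auto simp: fa_simps intro: finite_subset)
qed

lemma fa_add_closed:
  assumes "f \<in> carrier free_alg" "g \<in> carrier free_alg"
  shows "f \<oplus>\<^bsub>free_alg\<^esub> g \<in> carrier free_alg"
proof -
  have "{p. f p + g p \<noteq> 0} \<subseteq> {p. f p \<noteq> 0} \<union> {p. g p \<noteq> 0}" by auto
  then show ?thesis using assms by (auto simp: fa_simps intro: finite_subset)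
qed

lemma word_closed [simp]: "word w \<in> carrier free_alg"
  by (simp add: fa_simps word_def)

lemma scal_closed: "f \<in> carrier free_alg \<Longrightarrow> scal t f \<in> carrier free_alg"
  by (simp add: fa_simps scal_fin)

text \<open>The free algebra embeds in its tensor square, so it is a ring because the latter is.\<close>

lemma pure_Nil_mult:
  "pure_tensor (f \<otimes>\<^bsub>free_alg\<^esub> g) (word []) =
     pure_tensor f (word []) \<otimes>\<^bsub>free_alg2\<^esub> pure_tensor g (word [])"
proof
  fix p :: "gen list \<times> gen list"
  obtain u v where p: "p = (u, v)" by force
  show "pure_tensor (f \<otimes>\<^bsub>free_alg\<^esub> g) (word []) p =
    (pure_tensor f (word []) \<otimes>\<^bsub>free_alg2\<^esub> pure_tensor g (word [])) p"
  proof (cases "v = []")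
    case False
    then have "word [] (take j v) = (0 :: 'a) \<or> word [] (drop j v) = (0 :: 'a)" for j
      by (auto simp: word_def)
    then have "f a * word [] (take j v) * (g b * word [] (drop j v)) = (0 :: 'a)" for a b j
      by auto
    moreover have "word [] v = (0 :: 'a)" using False by (simp add: word_def)
    ultimately show ?thesis by (simp add: p pure_tensor_def free_alg2_def) (intro sum.neutral ballI; simp)
  qed (simp add: p pure_tensor_def free_alg2_def free_alg_def word_def)
qed

lemma ring_fa: "ring (free_alg :: 'a::field nc ring)"
proof (rule ring_if_embeds[OF ring_fa2, where h = "\<lambda>f. pure_tensor f (word [])"])
  show "inj_on (\<lambda>f. pure_tensor f (word []) :: 'a nc2) (carrier free_alg)"
  proof (rule inj_onI)
    fix f g :: "'a nc" assume "pure_tensor f (word []) = (pure_tensor g (word []) :: 'a nc2)"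
    then have "pure_tensor f (word []) (w, []) = (pure_tensor g (word []) (w, []) :: 'a)" for w by simp
    then show "f = g" by (auto simp: pure_tensor_def word_def)
  qed
  fix f :: "'a nc" assume f: "f \<in> carrier free_alg"
  then show "pure_tensor f (word []) \<in> carrier free_alg2" by (simp add: fa_simps pure_left_fin)
  have n: "(\<lambda>w. - f w) \<in> carrier free_alg" using f by (simp add: fa_simps)
  interpret F2: ring "free_alg2 :: 'a nc2 ring" by (rule ring_fa2)
  have "\<ominus>\<^bsub>free_alg2\<^esub> pure_tensor f (word []) = pure_tensor (\<lambda>w. - f w) (word [])"
  proof (rule F2.minus_equality)
    show "pure_tensor (\<lambda>w. - f w) (word []) \<oplus>\<^bsub>free_alg2\<^esub> pure_tensor f (word []) = \<zero>\<^bsub>free_alg2\<^esub>"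
      by (auto simp: fa2_simps pure_tensor_def)
  qed (use f n in \<open>auto simp: fa_simps(1) intro!: pure_left_fin\<close>)
  then show "\<exists>g\<in>carrier free_alg. pure_tensor g (word []) = \<ominus>\<^bsub>free_alg2\<^esub> pure_tensor f (word [])"
    using n by auto
next
  show "\<zero>\<^bsub>free_alg\<^esub> \<in> carrier free_alg" by (simp add: fa_simps)
next
  fix f g :: "'a nc"
  show "pure_tensor (f \<oplus>\<^bsub>free_alg\<^esub> g) (word []) =
    pure_tensor f (word []) \<oplus>\<^bsub>free_alg2\<^esub> (pure_tensor g (word []) :: 'a nc2)"
    "pure_tensor \<one>\<^bsub>free_alg\<^esub> (word []) = (\<one>\<^bsub>free_alg2\<^esub> :: 'a nc2)"
    "pure_tensor \<zero>\<^bsub>free_alg\<^esub> (word []) = (\<zero>\<^bsub>free_alg2\<^esub> :: 'a nc2)"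
    by (auto simp: fa_simps fa2_simps pure_tensor_def distrib_right word_def)
qed (simp_all add: fa_mult_closed fa_add_closed pure_Nil_mult fa_simps(3))

lemma word_mult_fa: "word u \<otimes>\<^bsub>free_alg\<^esub> word v = (word (u @ v) :: 'k::field nc)"
proof
  fix w
  have "(word u \<otimes>\<^bsub>free_alg\<^esub> word v) w = (\<Sum>x | fst x @ snd x = w. if x = (u, v) then 1 else 0 :: 'k)"
    unfolding fa_mult by (rule sum.cong) (auto simp: word_def)
  also have "\<dots> = word (u @ v) w"
    using finite_append_splits[of w] by (auto simp: word_def)
  finally show "(word u \<otimes>\<^bsub>free_alg\<^esub> word v) w = (word (u @ v) w :: 'k)" .
qed

lemma scal_mult_fa: "scal t (word []) \<otimes>\<^bsub>free_alg\<^esub> f = scal t f"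
proof
  fix w
  have "(scal t (word []) \<otimes>\<^bsub>free_alg\<^esub> f) w = (\<Sum>x | fst x @ snd x = w. if x = ([], w) then t * f w else 0)"
    unfolding fa_mult by (rule sum.cong) (auto simp: word_def scal_def)
  also have "\<dots> = scal t f w"
    using finite_append_splits[of w] by (auto simp: scal_def)
  finally show "(scal t (word []) \<otimes>\<^bsub>free_alg\<^esub> f) w = scal t f w" .
qed

lemma ideal_rel: "ideal (rel_ideal D) free_alg"
  unfolding rel_ideal_def
  by (rule ring.genideal_ideal[OF ring_fa]) (auto dest!: relators_fin simp: fa_simps)

lemma ring_Halg: "ring (Halg D)"
  unfolding Halg_def by (rule ideal.quotient_is_ring[OF ideal_rel])

lemma hcls_hom: "hcls D \<in> ring_hom free_alg (Halg D)"
  unfolding Halg_def hcls_def[abs_def] by (rule ideal.rcos_ring_hom[OF ideal_rel])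

lemma hcls_closed [simp]: "f \<in> carrier free_alg \<Longrightarrow> hcls D f \<in> carrier (Halg D)"
  by (rule ring_hom_closed[OF hcls_hom])

lemma Halg_cases:
  assumes "h \<in> carrier (Halg D)"
  obtains f where "f \<in> carrier free_alg" "h = hcls D f"
  using assms unfolding Halg_def hcls_def FactRing_def A_RCOSETS_def' by auto

lemma some_in_hcls:
  assumes "f \<in> carrier free_alg"
  obtains r where "r \<in> rel_ideal D" "(SOME g. g \<in> hcls D f) = r \<oplus>\<^bsub>free_alg\<^esub> f"
proof -
  interpret I: ideal "rel_ideal D" free_alg by (rule ideal_rel)
  have "f \<in> hcls D f" unfolding hcls_def using assms I.a_rcos_self by blast
  then have "(SOME g. g \<in> hcls D f) \<in> hcls D f" by (rule someI[of "\<lambda>g. g \<in> hcls D f"])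
  then show thesis using that unfolding hcls_def a_r_coset_def' by auto
qed

lemma ring_hom_kills_genideal:
  assumes R: "ring R" and S: "ring S" and h: "h \<in> ring_hom R S" and A: "A \<subseteq> carrier R"
    and kill: "\<And>x. x \<in> A \<Longrightarrow> h x = \<zero>\<^bsub>S\<^esub>" and r: "r \<in> Idl\<^bsub>R\<^esub> A"
  shows "h r = \<zero>\<^bsub>S\<^esub>"
proof -
  interpret h: ring_hom_ring R S h using R S h by (rule ring_hom_ringI2)
  have "Idl\<^bsub>R\<^esub> A \<subseteq> a_kernel R S h"
  proof (rule h.R.genideal_minimal[OF h.kernel_is_ideal])
    show "A \<subseteq> a_kernel R S h" unfolding a_kernel_def' using A kill by blast
  qed
  then show ?thesis using r unfolding a_kernel_def' by blast
qed

text \<open>The action of a word in the generators on $K^d$.\<close>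

definition word_mat :: "nat \<Rightarrow> (gen \<Rightarrow> 'k::field mat) \<Rightarrow> gen list \<Rightarrow> 'k mat" where
  "word_mat d E w = foldr (\<lambda>g A. E g * A) w (1\<^sub>m d)"

lemma word_mat_simps [simp]:
  "word_mat d E [] = 1\<^sub>m d" "word_mat d E (g # w) = E g * word_mat d E w"
  by (simp_all add: word_mat_def)

text \<open>The action on $K^d$ of an element of the free algebra, the generators acting by
  \<^term>\<open>E\<close>.\<close>

definition alg_mat :: "nat \<Rightarrow> (gen \<Rightarrow> 'k::field mat) \<Rightarrow> 'k nc \<Rightarrow> 'k mat" where
  "alg_mat d E = lin_mat d (word_mat d E)"

text \<open>The matrices \<^term>\<open>E\<close> define a module; by \<open>hmods_cases\<close> below every module is of this form.\<close>

definition is_rep :: "'k::field hopf_data \<Rightarrow> nat \<Rightarrow> (gen \<Rightarrow> 'k mat) \<Rightarrow> bool" where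
  "is_rep D d E \<longleftrightarrow> (\<forall>g. E g \<in> carrier_mat d d) \<and> (\<forall>r\<in>relators D. alg_mat d E r = 0\<^sub>m d d)"

lemma word_mat_carrier:
  "(\<And>g. E g \<in> carrier_mat d d) \<Longrightarrow> word_mat d E w \<in> carrier_mat d d"
  by (induction w) (auto intro: mult_carrier_mat)

lemma word_mat_append:
  assumes "\<And>g. E g \<in> carrier_mat d d"
  shows "word_mat d E (u @ v) = word_mat d E u * word_mat d E v"
proof (induction u)
  case (Cons g u)
  then show ?case
    using assms word_mat_carrier[where E = E and w = u, OF assms]
      word_mat_carrier[where E = E and w = v, OF assms]
    by (simp add: assoc_mult_mat[of _ d d _ d _ d])
qed (use word_mat_carrier[where E = E and w = v, OF assms] in auto)

lemma alg_mat_carrier [simp]: "alg_mat d E f \<in> carrier_mat d d"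
  by (simp add: alg_mat_def)

lemma alg_mat_word:
  "(\<And>g. E g \<in> carrier_mat d d) \<Longrightarrow> alg_mat d E (word w) = word_mat d E w"
  unfolding alg_mat_def word_def by (rule lin_mat_basis) (rule word_mat_carrier)

lemma alg_mat_scal: "alg_mat d E (scal t f) = t \<cdot>\<^sub>m alg_mat d E f"
  by (simp add: alg_mat_def scal_def lin_mat_scale)

lemma alg_mat_hom:
  assumes "\<And>g. E g \<in> carrier_mat d d"
  shows "alg_mat d E \<in> ring_hom free_alg (ring_mat TYPE('k::field) d ())"
proof (rule ring_hom_memI)
  fix f g :: "'k nc" assume fg: "f \<in> carrier free_alg" "g \<in> carrier free_alg"
  then have fin: "finite {p. f p \<noteq> 0}" "finite {p. g p \<noteq> 0}" by (auto simp: fa_simps)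
  show "alg_mat d E (f \<otimes>\<^bsub>free_alg\<^esub> g) = alg_mat d E f \<otimes>\<^bsub>ring_mat TYPE('k) d ()\<^esub> alg_mat d E g"
    unfolding alg_mat_def ring_mat_simps
    by (rule lin_mat_convolution[OF fin finite_append_splits])
       (auto simp: fa_mult word_mat_append word_mat_carrier assms)
  show "alg_mat d E (f \<oplus>\<^bsub>free_alg\<^esub> g) = alg_mat d E f \<oplus>\<^bsub>ring_mat TYPE('k) d ()\<^esub> alg_mat d E g"
    using fin by (simp add: alg_mat_def fa_simps ring_mat_simps lin_mat_add)
qed (simp_all add: ring_mat_simps fa_simps(3) alg_mat_word assms)

lemma alg_mat_rel_ideal:
  assumes "is_rep D d E" "r \<in> rel_ideal D"
  shows "alg_mat d E r = 0\<^sub>m d d"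
proof -
  have "alg_mat d E r = \<zero>\<^bsub>ring_mat TYPE('a) d ()\<^esub>"
    by (rule ring_hom_kills_genideal[OF ring_fa ring_mat alg_mat_hom _ _ assms(2)[unfolded rel_ideal_def]])
       (use assms(1) in \<open>auto simp: is_rep_def ring_mat_simps fa_simps dest: relators_fin\<close>)
  then show ?thesis by (simp add: ring_mat_simps)
qed

lemma fst_mod_of_gens [simp]: "fst (mod_of_gens D d E) = d"
  by (simp add: mod_of_gens_def)

lemma snd_mod_of_gens:
  assumes "is_rep D d E" "f \<in> carrier free_alg"
  shows "snd (mod_of_gens D d E) (hcls D f) = alg_mat d E f"
proof -
  obtain r where r: "r \<in> rel_ideal D" "(SOME g. g \<in> hcls D f) = r \<oplus>\<^bsub>free_alg\<^esub> f"
    using some_in_hcls[OF assms(2)] by blast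
  have rc: "r \<in> carrier free_alg" using ideal.Icarr[OF ideal_rel r(1)] .
  have E: "\<And>g. E g \<in> carrier_mat d d" using assms(1) by (simp add: is_rep_def)
  have "snd (mod_of_gens D d E) (hcls D f) = alg_mat d E (r \<oplus>\<^bsub>free_alg\<^esub> f)"
    using assms(2) by (simp add: mod_of_gens_def r(2) alg_mat_def lin_mat_def word_mat_def Let_def)
  also have "\<dots> = alg_mat d E f"
    using ring_hom_add[OF alg_mat_hom[where E = E and d = d] rc assms(2)] E
    by (simp add: ring_mat_simps alg_mat_rel_ideal[OF assms(1) r(1)])
  finally show ?thesis .
qed

lemma mod_of_gens_in_hmods:
  fixes D :: "'k::field hopf_data"
  assumes "is_rep D d E"
  shows "mod_of_gens D d E \<in> hmods D"
proof -
  let ?M = "mod_of_gens D d E"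
  have E: "\<And>g. E g \<in> carrier_mat d d" using assms(1) by (simp add: is_rep_def)
  note hom = alg_mat_hom[where E = E and d = d, OF E]
  have "snd ?M \<in> ring_hom (Halg D) (ring_mat TYPE('k) d ())"
  proof (rule ring_hom_memI)
    fix x assume "x \<in> carrier (Halg D)"
    then show "snd ?M x \<in> carrier (ring_mat TYPE('k) d ())"
      by (auto elim!: Halg_cases simp: snd_mod_of_gens[OF assms] ring_mat_simps)
  next
    fix x y assume "x \<in> carrier (Halg D)" "y \<in> carrier (Halg D)"
    then obtain f g where fg: "f \<in> carrier free_alg" "x = hcls D f" "g \<in> carrier free_alg" "y = hcls D g"
      by (auto elim!: Halg_cases)
    show "snd ?M (x \<otimes>\<^bsub>Halg D\<^esub> y) = snd ?M x \<otimes>\<^bsub>ring_mat TYPE('k) d ()\<^esub> snd ?M y"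
      using fg by (simp add: snd_mod_of_gens[OF assms] fa_mult_closed ring_hom_mult[OF hom]
          flip: ring_hom_mult[OF hcls_hom])
    show "snd ?M (x \<oplus>\<^bsub>Halg D\<^esub> y) = snd ?M x \<oplus>\<^bsub>ring_mat TYPE('k) d ()\<^esub> snd ?M y"
      using fg by (simp add: snd_mod_of_gens[OF assms] fa_add_closed ring_hom_add[OF hom]
          flip: ring_hom_add[OF hcls_hom])
  next
    show "snd ?M \<one>\<^bsub>Halg D\<^esub> = \<one>\<^bsub>ring_mat TYPE('k) d ()\<^esub>"
      using ring_hom_one[OF hom]
      by (simp add: snd_mod_of_gens[OF assms] fa_simps(3) flip: ring_hom_one[OF hcls_hom])
  qed
  moreover have "snd ?M (hcls D (scal t (word []))) = t \<cdot>\<^sub>m 1\<^sub>m d" for t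
    by (simp add: snd_mod_of_gens[OF assms] scal_closed alg_mat_scal alg_mat_word E)
  moreover have "snd ?M \<in> extensional (carrier (Halg D))" by (simp add: mod_of_gens_def)
  ultimately have "(d, snd ?M) \<in> hmods D" unfolding hmods_def by simp
  then show ?thesis by (metis fst_mod_of_gens prod.collapse)
qed

lemma hmods_cases:
  fixes D :: "'k::field hopf_data"
  assumes "M \<in> hmods D"
  obtains d E where "is_rep D d E" "M = mod_of_gens D d E"
proof -
  obtain d \<rho> where M: "M = (d, \<rho>)" by force
  let ?R = "ring_mat TYPE('k) d ()"
  have hom: "\<rho> \<in> ring_hom (Halg D) ?R" and ext: "\<rho> \<in> extensional (carrier (Halg D))"
    and sc: "\<And>t. \<rho> (hcls D (scal t (word []))) = t \<cdot>\<^sub>m 1\<^sub>m d"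
    using assms by (auto simp: M hmods_def)
  interpret R: ring ?R by (rule ring_mat)
  define \<pi> where "\<pi> f = \<rho> (hcls D f)" for f
  have pi: "\<pi> \<in> ring_hom free_alg ?R"
    using ring_hom_trans[OF hcls_hom hom] by (simp add: \<pi>_def[abs_def] comp_def)
  define E where "E g = \<pi> (word [g])" for g
  have E: "E g \<in> carrier_mat d d" for g
    using ring_hom_closed[OF pi, of "word [g]"] by (simp add: E_def ring_mat_simps)
  have word: "\<pi> (word w) = word_mat d E w" for w
  proof (induction w)
    case Nil
    show ?case using ring_hom_one[OF pi] by (simp add: fa_simps ring_mat_simps)
  next
    case (Cons g w)
    have "\<pi> (word (g # w)) = \<pi> (word [g] \<otimes>\<^bsub>free_alg\<^esub> word w)" by (simp add: word_mult_fa)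
    also have "\<dots> = E g * word_mat d E w"
      by (simp add: ring_hom_mult[OF pi] ring_mat_simps Cons E_def[of g])
    finally show ?case by simp
  qed
  have scal: "\<pi> (scal t f) = t \<cdot>\<^sub>m \<pi> f" if "f \<in> carrier free_alg" for t f
  proof -
    have "\<pi> (scal t f) = \<pi> (scal t (word [])) * \<pi> f"
      using that by (simp add: ring_hom_mult[OF pi] scal_closed ring_mat_simps flip: scal_mult_fa[of t f])
    also have "\<dots> = t \<cdot>\<^sub>m \<pi> f"
      using ring_hom_closed[OF pi that]
      by (simp add: \<pi>_def sc ring_mat_simps mult_smult_assoc_mat[of _ d d _ d])
    finally show ?thesis .
  qed
  have ev: "\<pi> f = alg_mat d E f" if "finite S" "{w. f w \<noteq> 0} \<subseteq> S" for S f
    using that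
  proof (induction S arbitrary: f rule: finite_induct)
    case empty
    then have "f = \<zero>\<^bsub>free_alg\<^esub>" by (auto simp: fa_simps)
    moreover have "\<pi> \<zero>\<^bsub>free_alg\<^esub> = 0\<^sub>m d d" "alg_mat d E \<zero>\<^bsub>free_alg\<^esub> = 0\<^sub>m d d"
      using ring_hom_zero[OF pi ring_fa ring_mat] ring_hom_zero[OF alg_mat_hom ring_fa ring_mat] E
      by (auto simp: ring_mat_simps)
    ultimately show ?case by simp
  next
    case (insert w S)
    define f0 where "f0 = f(w := 0)"
    have f0: "f0 \<in> carrier free_alg"
      using insert.prems insert.hyps by (auto simp: fa_simps f0_def intro: finite_subset)
    have f: "f = f0 \<oplus>\<^bsub>free_alg\<^esub> scal (f w) (word w)"
      by (auto simp: fun_eq_iff fa_simps f0_def scal_def word_def)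
    have "\<pi> f0 = alg_mat d E f0"
      using insert.prems by (intro insert.IH) (auto simp: f0_def)
    then show ?case
      by (subst (1 2) f) (simp add: ring_hom_add[OF pi] ring_hom_add[OF alg_mat_hom[where E = E, OF E]]
          f0 scal_closed scal alg_mat_scal word alg_mat_word E)
  qed
  have rep: "is_rep D d E"
    unfolding is_rep_def
  proof (intro conjI allI ballI E)
    fix r assume r: "r \<in> relators D"
    interpret ideal "rel_ideal D" free_alg by (rule ideal_rel)
    have "r \<in> rel_ideal D" using r unfolding rel_ideal_def by (auto simp: genideal_def)
    then have "hcls D r = \<zero>\<^bsub>Halg D\<^esub>"
      unfolding hcls_def Halg_def FactRing_def by (simp add: a_rcos_const)
    then have "\<pi> r = 0\<^sub>m d d"
      using ring_hom_zero[OF hom ring_Halg ring_mat] by (simp add: \<pi>_def ring_mat_simps)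
    then show "alg_mat d E r = 0\<^sub>m d d" using ev[OF relators_fin[OF r], of r] by simp
  qed
  have "M = mod_of_gens D d E"
  proof (unfold M, rule prod_eqI)
    show "snd (d, \<rho>) = snd (mod_of_gens D d E)"
    proof (rule extensionalityI[where A = "carrier (Halg D)"])
      fix x assume "x \<in> carrier (Halg D)"
      then obtain f where f: "f \<in> carrier free_alg" "x = hcls D f" by (rule Halg_cases)
      then show "snd (d, \<rho>) x = snd (mod_of_gens D d E) x"
        using ev[of _ f] by (simp add: snd_mod_of_gens[OF rep] \<pi>_def fa_simps)
    qed (use ext in \<open>simp_all add: mod_of_gens_def\<close>)
  qed simp
  then show thesis using rep that by blast
qed


section \<open>The defining relations as matrix equations\<close>

lemma minus_mat_eq_0_iff:
  fixes A B :: "'k::field mat"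
  assumes "A \<in> carrier_mat m n" "B \<in> carrier_mat m n"
  shows "A - B = 0\<^sub>m m n \<longleftrightarrow> A = B"
proof
  assume eq: "A - B = 0\<^sub>m m n"
  show "A = B"
  proof (rule eq_matI)
    fix i j assume ij: "i < dim_row B" "j < dim_col B"
    have "(A - B) $$ (i, j) = 0\<^sub>m m n $$ (i, j)" by (simp add: eq)
    then show "A $$ (i, j) = B $$ (i, j)" using assms ij by simp
  qed (use assms in auto)
qed (use assms in auto)

lemma alg_mat_diff:
  assumes "finite {w. f w \<noteq> 0}" "finite {w. g w \<noteq> 0}"
  shows "alg_mat d E (f - g) = alg_mat d E f - alg_mat d E g"
proof -
  have "f - g = (\<lambda>w. f w + (- 1) * g w)" by (simp add: fun_eq_iff)
  then have "alg_mat d E (f - g) = alg_mat d E f + alg_mat d E (\<lambda>w. (- 1) * g w)"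
    using lin_mat_add[OF assms(1), of "\<lambda>w. (- 1) * g w" d "word_mat d E"] assms(2)
    by (simp add: alg_mat_def)
  also have "\<dots> = alg_mat d E f - alg_mat d E g"
    using alg_mat_carrier[of d E f] alg_mat_carrier[of d E g]
    unfolding alg_mat_def lin_mat_scale by (auto intro!: eq_matI)
  finally show ?thesis .
qed

lemma is_rep_iff:
  fixes D :: "'k::field hopf_data"
  shows "is_rep D d E \<longleftrightarrow> (\<forall>g. E g \<in> carrier_mat d d) \<and>
    (let W = word_mat d E; n = dn D; n1 = dn1 D; q = dq D in
     W [Ga, Ga'] = 1\<^sub>m d \<and> W [Ga', Ga] = 1\<^sub>m d \<and> W [Gb, Gb'] = 1\<^sub>m d \<and> W [Gb', Gb] = 1\<^sub>m d \<and>
     W [Gc, Gc'] = 1\<^sub>m d \<and> W [Gc', Gc] = 1\<^sub>m d \<and>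
     W [Ga, Gb] = W [Gb, Ga] \<and> W [Ga, Gc] = W [Gc, Ga] \<and> W [Gb, Gc] = W [Gc, Gb] \<and>
     W [Gx, Ga] = q \<cdot>\<^sub>m W [Ga, Gx] \<and> W [Gy, Ga] = inverse q \<cdot>\<^sub>m W [Ga, Gy] \<and>
     W [Gb, Gx] = W [Gx, Gb] \<and> W [Gc, Gx] = W [Gx, Gc] \<and>
     W [Gb, Gy] = W [Gy, Gb] \<and> W [Gc, Gy] = W [Gy, Gc] \<and>
     W [Gy, Gx] - inverse (q ^ n1) \<cdot>\<^sub>m W [Gx, Gy]
       = beta3 D \<cdot>\<^sub>m (W (replicate (2 * n1) Ga) - W [Gb, Gc]) \<and>
     W (replicate n Gx) = beta1 D \<cdot>\<^sub>m (W (replicate (n * n1) Ga) - W (replicate n Gb)) \<and>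
     W (replicate n Gy) = beta2 D \<cdot>\<^sub>m (W (replicate (n * n1) Ga) - W (replicate n Gc)))"
proof (cases "\<forall>g. E g \<in> carrier_mat d d")
  case True
  then have E: "\<And>g. E g \<in> carrier_mat d d" by blast
  have W: "word_mat d E w \<in> carrier_mat d d" for w by (rule word_mat_carrier[where E = E, OF E])
  note alg = alg_mat_diff[OF word_fin word_fin] alg_mat_diff[OF word_fin scal_fin[OF word_fin]]
    alg_mat_diff[OF word_fin scal_fin[OF diff_fin[OF word_fin word_fin]]]
    alg_mat_diff[OF diff_fin[OF word_fin scal_fin[OF word_fin]] scal_fin[OF diff_fin[OF word_fin word_fin]]]
    alg_mat_word[OF E] alg_mat_scal
  have eq: "word_mat d E u - word_mat d E v = 0\<^sub>m d d \<longleftrightarrow> word_mat d E u = word_mat d E v" for u v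
    by (rule minus_mat_eq_0_iff[OF W W])
  have eq1: "word_mat d E u - 1\<^sub>m d = 0\<^sub>m d d \<longleftrightarrow> word_mat d E u = 1\<^sub>m d" for u
    by (rule minus_mat_eq_0_iff[OF W one_carrier_mat])
  have eq2: "word_mat d E u - t \<cdot>\<^sub>m word_mat d E v = 0\<^sub>m d d \<longleftrightarrow> word_mat d E u = t \<cdot>\<^sub>m word_mat d E v" for u v t
    by (rule minus_mat_eq_0_iff[OF W smult_carrier_mat[OF W]])
  have eq3: "word_mat d E u - t \<cdot>\<^sub>m (word_mat d E v - word_mat d E w) = 0\<^sub>m d d
      \<longleftrightarrow> word_mat d E u = t \<cdot>\<^sub>m (word_mat d E v - word_mat d E w)" for u v w t
    by (rule minus_mat_eq_0_iff[OF W smult_carrier_mat[OF minus_carrier_mat[OF W]]])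
  have eq4: "word_mat d E u' - s \<cdot>\<^sub>m word_mat d E u - t \<cdot>\<^sub>m (word_mat d E v - word_mat d E w) = 0\<^sub>m d d
      \<longleftrightarrow> word_mat d E u' - s \<cdot>\<^sub>m word_mat d E u = t \<cdot>\<^sub>m (word_mat d E v - word_mat d E w)" for u' u v w s t
    by (rule minus_mat_eq_0_iff[OF minus_carrier_mat[OF smult_carrier_mat[OF W]] smult_carrier_mat[OF minus_carrier_mat[OF W]]])
  show ?thesis
    unfolding is_rep_def relators_def Let_def ball_simps
    unfolding alg word_mat_simps(1) unfolding eq eq1 eq2 eq3 eq4 using True by blast
qed (auto simp: is_rep_def)

lemma word_mat_scalar:
  "word_mat 1 (\<lambda>g. mat 1 1 (\<lambda>_. e g)) w = mat 1 1 (\<lambda>_. prod_list (map e w))"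
  by (induction w) (auto simp: scalar_prod_def intro!: eq_matI)

lemma is_rep_scalar:
  assumes e: "e Ga * e Ga' = 1" "e Gb * e Gb' = 1" "e Gc * e Gc' = 1" "e Gx = 0" "e Gy = 0" "dn D > 0"
    and eqs: "beta1 D * (e Ga ^ (dn D * dn1 D) - e Gb ^ dn D) = 0"
      "beta2 D * (e Ga ^ (dn D * dn1 D) - e Gc ^ dn D) = 0"
      "beta3 D * (e Ga ^ (2 * dn1 D) - e Gb * e Gc) = 0"
  shows "is_rep D 1 (\<lambda>g. mat 1 1 (\<lambda>_. e g))"
proof -
  have eq: "mat 1 1 (\<lambda>_. x) = mat 1 1 (\<lambda>_. y) \<longleftrightarrow> x = y" for x y :: 'a
    by (metis (no_types, lifting) index_mat(1) less_numeral_extra(1) old.prod.case)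
  have ops: "mat 1 1 (\<lambda>_. x) - mat 1 1 (\<lambda>_. y) = mat 1 1 (\<lambda>_. x - y)"
    "t \<cdot>\<^sub>m mat 1 1 (\<lambda>_. x) = mat 1 1 (\<lambda>_. t * x)" "1\<^sub>m 1 = mat 1 1 (\<lambda>_. 1 :: 'a)" for x y t :: 'a
    by (auto intro!: eq_matI)
  have pw: "prod_list (map e (replicate m g)) = e g ^ m" for m g
    by (induction m) auto
  show ?thesis
    unfolding is_rep_iff Let_def word_mat_scalar ops eq pw
    using assms by (auto simp: mult.commute power_0_left)
qed


section \<open>Tensor products\<close>

text \<open>The action of the tensor square of the free algebra on $K^d \otimes K^{d'}$.\<close>

definition tens_mat :: "nat \<Rightarrow> (gen \<Rightarrow> 'k::field mat) \<Rightarrow> nat \<Rightarrow> (gen \<Rightarrow> 'k mat) \<Rightarrow> 'k nc2 \<Rightarrow> 'k mat" where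
  "tens_mat d E d' E' = lin_mat (d * d') (\<lambda>p. kron (word_mat d E (fst p)) (word_mat d' E' (snd p)))"

lemma kron_word_mat_carrier:
  assumes "\<And>g. E g \<in> carrier_mat d d" "\<And>g. E' g \<in> carrier_mat d' d'"
  shows "kron (word_mat d E u) (word_mat d' E' v) \<in> carrier_mat (d * d') (d * d')"
  by (intro kron_carrier word_mat_carrier assms)

lemma tens_mat_hom:
  fixes E :: "gen \<Rightarrow> 'k::field mat"
  assumes E: "\<And>g. E g \<in> carrier_mat d d" and E': "\<And>g. E' g \<in> carrier_mat d' d'"
  shows "tens_mat d E d' E' \<in> ring_hom free_alg2 (ring_mat TYPE('k) (d * d') ())"
proof (rule ring_hom_memI)
  fix f g :: "'k nc2" assume fg: "f \<in> carrier free_alg2" "g \<in> carrier free_alg2"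
  then have fin: "finite {p. f p \<noteq> 0}" "finite {p. g p \<noteq> 0}" by (auto simp: fa2_simps)
  have set: "{x. (fst (fst x) @ fst (snd x), snd (fst x) @ snd (snd x)) = p} = splits2 p" for p
    by (auto simp: splits2_def)
  show "tens_mat d E d' E' (f \<otimes>\<^bsub>free_alg2\<^esub> g) =
      tens_mat d E d' E' f \<otimes>\<^bsub>ring_mat TYPE('k) (d * d') ()\<^esub> tens_mat d E d' E' g"
    unfolding tens_mat_def ring_mat_simps
  proof (rule lin_mat_convolution[OF fin, where m = "\<lambda>a b. (fst a @ fst b, snd a @ snd b)"])
    show "(f \<otimes>\<^bsub>free_alg2\<^esub> g) p = (\<Sum>x | (fst (fst x) @ fst (snd x), snd (fst x) @ snd (snd x)) = p. f (fst x) * g (snd x))" for p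
      unfolding set by (simp add: fa2_mult split_def)
  qed (simp_all only: set finite_splits2 fst_conv snd_conv word_mat_append[where E = E, OF E]
      word_mat_append[where E = E', OF E'] kron_word_mat_carrier[where E = E and E' = E', OF E E']
      kron_mult[OF word_mat_carrier[where E = E, OF E] word_mat_carrier[where E = E', OF E'] word_mat_carrier[where E = E, OF E] word_mat_carrier[where E = E', OF E']])
  show "tens_mat d E d' E' (f \<oplus>\<^bsub>free_alg2\<^esub> g) =
      tens_mat d E d' E' f \<oplus>\<^bsub>ring_mat TYPE('k) (d * d') ()\<^esub> tens_mat d E d' E' g"
    using fin by (simp add: tens_mat_def fa2_simps ring_mat_simps lin_mat_add)
  show "tens_mat d E d' E' f \<in> carrier (ring_mat TYPE('k) (d * d') ())"
    by (simp add: tens_mat_def ring_mat_simps)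
next
  have "tens_mat d E d' E' \<one>\<^bsub>free_alg2\<^esub> = kron (word_mat d E []) (word_mat d' E' [])"
    unfolding tens_mat_def fa2_simps
    by (subst lin_mat_basis) (use kron_word_mat_carrier[where E = E and E' = E', OF E E', of "[]" "[]"] in auto)
  then show "tens_mat d E d' E' \<one>\<^bsub>free_alg2\<^esub> = \<one>\<^bsub>ring_mat TYPE('k) (d * d') ()\<^esub>"
    by (simp add: ring_mat_simps kron_one)
qed

lemma tens_mat_pure:
  assumes E: "\<And>g. E g \<in> carrier_mat d d" and E': "\<And>g. E' g \<in> carrier_mat d' d'"
    and fin: "finite {p. f p \<noteq> 0}" "finite {p. g p \<noteq> 0}"
  shows "tens_mat d E d' E' (pure_tensor f g) = kron (alg_mat d E f) (alg_mat d' E' g)"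
proof (rule eq_matI)
  note kc = kron_carrier[OF alg_mat_carrier alg_mat_carrier, of d E f d' E' g]
  fix i j assume "i < dim_row (kron (alg_mat d E f) (alg_mat d' E' g))"
    "j < dim_col (kron (alg_mat d E f) (alg_mat d' E' g))"
  then have ij: "i < d * d'" "j < d * d'" using kc by auto
  then have "d' > 0" by (auto intro: gr0I)
  then have bd: "i div d' < d" "j div d' < d" "i mod d' < d'" "j mod d' < d'"
    using ij by (auto simp: less_mult_imp_div_less)
  let ?S = "{p. f p \<noteq> 0} \<times> {p. g p \<noteq> 0}"
  have "tens_mat d E d' E' (pure_tensor f g) $$ (i, j) =
    (\<Sum>p\<in>?S. pure_tensor f g p * kron (word_mat d E (fst p)) (word_mat d' E' (snd p)) $$ (i, j))"
    unfolding tens_mat_def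
    by (rule index_lin_mat) (use fin ij in \<open>auto simp: pure_tensor_def\<close>)
  also have "\<dots> = (\<Sum>p\<in>?S. (f (fst p) * word_mat d E (fst p) $$ (i div d', j div d'))
      * (g (snd p) * word_mat d' E' (snd p) $$ (i mod d', j mod d')))"
    using ij by (intro sum.cong)
      (auto simp: pure_tensor_def index_kron[OF word_mat_carrier[where E = E, OF E] word_mat_carrier[where E = E', OF E']])
  also have "\<dots> = alg_mat d E f $$ (i div d', j div d') * alg_mat d' E' g $$ (i mod d', j mod d')"
    using bd fin by (simp add: alg_mat_def index_lin_mat[OF fin(1)] index_lin_mat[OF fin(2)]
        sum_product sum.cartesian_product split_def)
  also have "\<dots> = kron (alg_mat d E f) (alg_mat d' E' g) $$ (i, j)"
    by (simp add: index_kron[OF alg_mat_carrier alg_mat_carrier ij])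
  finally show "tens_mat d E d' E' (pure_tensor f g) $$ (i, j) = kron (alg_mat d E f) (alg_mat d' E' g) $$ (i, j)" .
qed (use kron_carrier[OF alg_mat_carrier alg_mat_carrier, of d E f d' E' g] in \<open>auto simp: tens_mat_def\<close>)

lemma kron_zero:
  "A \<in> carrier_mat d d \<Longrightarrow> kron A (0\<^sub>m d' d') = 0\<^sub>m (d * d') (d * d')"
  "A \<in> carrier_mat d' d' \<Longrightarrow> kron (0\<^sub>m d d) A = 0\<^sub>m (d * d') (d * d')"
proof -
  show "kron A (0\<^sub>m d' d') = 0\<^sub>m (d * d') (d * d')" if A: "A \<in> carrier_mat d d"
  proof (rule eq_matI)
    fix i j assume ij: "i < dim_row (0\<^sub>m (d * d') (d * d') :: 'a mat)" "j < dim_col (0\<^sub>m (d * d') (d * d') :: 'a mat)"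
    then have "d' > 0" by (auto intro: gr0I)
    then show "kron A (0\<^sub>m d' d') $$ (i, j) = 0\<^sub>m (d * d') (d * d') $$ (i, j)"
      using ij by (simp add: index_kron[OF A zero_carrier_mat])
  qed (use A in \<open>auto simp: kron_def\<close>)
  show "kron (0\<^sub>m d d) A = 0\<^sub>m (d * d') (d * d')" if A: "A \<in> carrier_mat d' d'"
  proof (rule eq_matI)
    fix i j assume ij: "i < dim_row (0\<^sub>m (d * d') (d * d') :: 'a mat)" "j < dim_col (0\<^sub>m (d * d') (d * d') :: 'a mat)"
    then show "kron (0\<^sub>m d d) A $$ (i, j) = 0\<^sub>m (d * d') (d * d') $$ (i, j)"
      by (simp add: index_kron[OF zero_carrier_mat A] less_mult_imp_div_less)
  qed (use A in \<open>auto simp: kron_def\<close>)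
qed

lemma tens_mat_rel_ideal2:
  fixes D :: "'k::field hopf_data"
  assumes rep: "is_rep D d E" "is_rep D d' E'" and r: "r \<in> rel_ideal2 D"
  shows "tens_mat d E d' E' r = 0\<^sub>m (d * d') (d * d')"
proof -
  have E: "\<And>g. E g \<in> carrier_mat d d" and E': "\<And>g. E' g \<in> carrier_mat d' d'"
    using rep by (auto simp: is_rep_def)
  have fin: "finite {w. s w \<noteq> 0}" if "s \<in> relators D" for s
    using relators_fin[OF that] .
  have "tens_mat d E d' E' r = \<zero>\<^bsub>ring_mat TYPE('k) (d * d') ()\<^esub>"
  proof (rule ring_hom_kills_genideal[OF ring_fa2 ring_mat tens_mat_hom[where E = E and E' = E', OF E E'] _ _ r[unfolded rel_ideal2_def]])
    show "(\<lambda>r. pure_tensor r (word [])) ` relators D \<union> (\<lambda>r. pure_tensor (word []) r) ` relators D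
        \<subseteq> carrier free_alg2"
      using fin by (auto intro: pure_left_fin pure_right_fin)
    fix s assume "s \<in> (\<lambda>r. pure_tensor r (word [])) ` relators D \<union> (\<lambda>r. pure_tensor (word []) r) ` relators D"
    then obtain t where t: "t \<in> relators D" "s = pure_tensor t (word []) \<or> s = pure_tensor (word []) t" by blast
    have "alg_mat d E t = 0\<^sub>m d d" "alg_mat d' E' t = 0\<^sub>m d' d'"
      using t(1) rep by (auto simp: is_rep_def)
    then show "tens_mat d E d' E' s = \<zero>\<^bsub>ring_mat TYPE('k) (d * d') ()\<^esub>"
      using t(2) fin[OF t(1)]
      by (auto simp: tens_mat_pure[where E = E and E' = E', OF E E'] ring_mat_simps kron_zero)
  qed
  then show ?thesis by (simp add: ring_mat_simps)
qed

text \<open>The generators act on a tensor product through their coproducts.\<close>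

definition tens_gens ::
  "'k::field hopf_data \<Rightarrow> nat \<Rightarrow> (gen \<Rightarrow> 'k mat) \<Rightarrow> nat \<Rightarrow> (gen \<Rightarrow> 'k mat) \<Rightarrow> gen \<Rightarrow> 'k mat" where
  "tens_gens D d E d' E' g = tens_mat d E d' E' (comult_gen D g)"

lemma tens_gens_carrier [simp]: "tens_gens D d E d' E' g \<in> carrier_mat (d * d') (d * d')"
  by (simp add: tens_gens_def tens_mat_def)

lemma tens_mat_comult_word:
  assumes E: "\<And>g. E g \<in> carrier_mat d d" and E': "\<And>g. E' g \<in> carrier_mat d' d'"
  shows "tens_mat d E d' E' (comult_word D w) = word_mat (d * d') (tens_gens D d E d' E') w"
proof (induction w)
  case Nil
  show ?case using ring_hom_one[OF tens_mat_hom[where E = E and E' = E', OF E E']] by (simp add: ring_mat_simps)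
next
  case (Cons g w)
  then show ?case
    using ring_hom_mult[OF tens_mat_hom[where E = E and E' = E', OF E E'], of "comult_gen D g" "comult_word D w"]
    by (simp add: ring_mat_simps tens_gens_def)
qed

lemma tens_mat_comult:
  assumes E: "\<And>g. E g \<in> carrier_mat d d" and E': "\<And>g. E' g \<in> carrier_mat d' d'"
    and f: "finite {w. f w \<noteq> 0}"
  shows "tens_mat d E d' E' (comult D f) = alg_mat (d * d') (tens_gens D d E d' E') f"
proof (rule eq_matI)
  let ?A = "\<Union>w\<in>{w. f w \<noteq> 0}. {p. comult_word D w p \<noteq> 0}"
  let ?K = "\<lambda>p. kron (word_mat d E (fst p)) (word_mat d' E' (snd p))"
  fix i j assume "i < dim_row (alg_mat (d * d') (tens_gens D d E d' E') f)"
    "j < dim_col (alg_mat (d * d') (tens_gens D d E d' E') f)"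
  then have ij: "i < d * d'" "j < d * d'" by (auto simp: alg_mat_def)
  have fin: "finite {p. comult_word D w p \<noteq> 0}" for w
    using comult_word_closed[of D w] by (simp add: fa2_simps del: comult_word_closed)
  then have A: "finite ?A" using f by simp
  have sub: "{p. comult D f p \<noteq> 0} \<subseteq> ?A"
  proof
    fix p assume "p \<in> {p. comult D f p \<noteq> 0}"
    then have "(\<Sum>w | f w \<noteq> 0. f w * comult_word D w p) \<noteq> 0" by (simp add: comult_def)
    then obtain w where "w \<in> {w. f w \<noteq> 0}" "f w * comult_word D w p \<noteq> 0"
      by (rule sum.not_neutral_contains_not_neutral)
    then show "p \<in> ?A" by (intro UN_I[of w]) auto
  qed
  have "tens_mat d E d' E' (comult D f) $$ (i, j) = (\<Sum>p\<in>?A. comult D f p * ?K p $$ (i, j))"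
    unfolding tens_mat_def by (rule index_lin_mat[OF A sub ij])
  also have "\<dots> = (\<Sum>p\<in>?A. \<Sum>w | f w \<noteq> 0. f w * (comult_word D w p * ?K p $$ (i, j)))"
    by (simp add: comult_def sum_distrib_right mult.assoc)
  also have "\<dots> = (\<Sum>w | f w \<noteq> 0. f w * (\<Sum>p\<in>?A. comult_word D w p * ?K p $$ (i, j)))"
    by (subst sum.swap) (simp add: sum_distrib_left)
  also have "\<dots> = (\<Sum>w | f w \<noteq> 0. f w * tens_mat d E d' E' (comult_word D w) $$ (i, j))"
  proof (intro sum.cong refl arg_cong2[where f = "(*)"])
    fix w assume "w \<in> {w. f w \<noteq> 0}"
    then show "(\<Sum>p\<in>?A. comult_word D w p * ?K p $$ (i, j)) = tens_mat d E d' E' (comult_word D w) $$ (i, j)"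
      unfolding tens_mat_def by (intro index_lin_mat[OF A _ ij, symmetric]) auto
  qed
  also have "\<dots> = alg_mat (d * d') (tens_gens D d E d' E') f $$ (i, j)"
    unfolding tens_mat_comult_word[where E = E and E' = E', OF E E'] alg_mat_def
    by (rule index_lin_mat[OF f _ ij, symmetric]) simp
  finally show "tens_mat d E d' E' (comult D f) $$ (i, j) = alg_mat (d * d') (tens_gens D d E d' E') f $$ (i, j)" .
qed (simp_all add: alg_mat_def tens_mat_def)

lemma is_rep_tens:
  assumes "is_Hopf D" "is_rep D d E" "is_rep D d' E'"
  shows "is_rep D (d * d') (tens_gens D d E d' E')"
proof -
  have E: "\<And>g. E g \<in> carrier_mat d d" and E': "\<And>g. E' g \<in> carrier_mat d' d'"
    using assms by (auto simp: is_rep_def)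
  have "alg_mat (d * d') (tens_gens D d E d' E') r = 0\<^sub>m (d * d') (d * d')" if r: "r \<in> relators D" for r
    using assms(1) r tens_mat_rel_ideal2[OF assms(2,3)] tens_mat_comult[where E = E and E' = E', OF E E' relators_fin[OF r], of D]
    by (simp add: is_Hopf_def)
  then show ?thesis by (simp add: is_rep_def)
qed

lemma tensor_mod_of_gens:
  assumes "is_Hopf D" "is_rep D d E" "is_rep D d' E'"
  shows "tensor_mod D (mod_of_gens D d E) (mod_of_gens D d' E') = mod_of_gens D (d * d') (tens_gens D d E d' E')"
proof (rule prod_eqI)
  let ?T = "tensor_mod D (mod_of_gens D d E) (mod_of_gens D d' E')"
  let ?M = "mod_of_gens D (d * d') (tens_gens D d E d' E')"
  have E: "\<And>g. E g \<in> carrier_mat d d" and E': "\<And>g. E' g \<in> carrier_mat d' d'"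
    using assms by (auto simp: is_rep_def)
  show "fst ?T = fst ?M" by (simp add: tensor_mod_def)
  show "snd ?T = snd ?M"
  proof (rule extensionalityI[where A = "carrier (Halg D)"])
    fix h assume h: "h \<in> carrier (Halg D)"
    then obtain f where f: "f \<in> carrier free_alg" "h = hcls D f" by (rule Halg_cases)
    define f' where "f' = (SOME f. f \<in> h)"
    obtain r where r: "r \<in> rel_ideal D" "f' = r \<oplus>\<^bsub>free_alg\<^esub> f"
      using some_in_hcls[OF f(1)] f(2) f'_def by metis
    have f': "f' \<in> carrier free_alg"
      unfolding r(2) using fa_add_closed[OF ideal.Icarr[OF ideal_rel r(1)] f(1)] .
    have "snd ?T h = tens_mat d E d' E' (comult D f')"
      using h by (auto simp: tensor_mod_def Let_def tens_mat_def lin_mat_def split_def f'_def[symmetric]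
          snd_mod_of_gens[OF assms(2)] snd_mod_of_gens[OF assms(3)] alg_mat_word[where E = E, OF E]
          alg_mat_word[where E = E', OF E'] intro!: eq_matI sum.cong)
    also have "\<dots> = alg_mat (d * d') (tens_gens D d E d' E') f'"
      using f' by (intro tens_mat_comult[where E = E and E' = E'] E E') (simp add: fa_simps)
    also have "\<dots> = snd ?M h"
      using h by (simp add: mod_of_gens_def Let_def f'_def[symmetric] alg_mat_def lin_mat_def word_mat_def)
    finally show "snd ?T h = snd ?M h" .
  qed (simp_all add: tensor_mod_def mod_of_gens_def)
qed

lemma tensor_mod_closed:
  assumes "is_Hopf D" "M \<in> hmods D" "N \<in> hmods D"
  shows "tensor_mod D M N \<in> hmods D"
  using assms by (auto elim!: hmods_cases simp: tensor_mod_of_gens mod_of_gens_in_hmods is_rep_tens)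

lemma trivial_mod_eq: "trivial_mod D = mod_of_gens D 1 (\<lambda>g. mat 1 1 (\<lambda>_. counit_gen g))"
proof -
  have "foldr (\<lambda>g A. mat 1 1 (\<lambda>_. counit_gen g) * A) w (1\<^sub>m 1) $$ (0, 0)
      = (\<Prod>g\<leftarrow>w. counit_gen g :: 'a)" for w
    unfolding word_mat_def[symmetric] word_mat_scalar by simp
  then show ?thesis
    by (auto simp: trivial_mod_def mod_of_gens_def counit_def Let_def fun_eq_iff intro!: eq_matI restrict_ext)
qed

lemma is_rep_counit: "dn D > 0 \<Longrightarrow> is_rep D 1 (\<lambda>g. mat 1 1 (\<lambda>_. counit_gen g))"
  by (rule is_rep_scalar) auto

lemma trivial_mod_closed: "dn D > 0 \<Longrightarrow> trivial_mod D \<in> hmods D"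
  unfolding trivial_mod_eq by (intro mod_of_gens_in_hmods is_rep_counit)


section \<open>Trace characters\<close>

text \<open>The group-like generators.\<close>

definition grp :: "gen \<Rightarrow> bool" where
  "grp g \<longleftrightarrow> g \<noteq> Gx \<and> g \<noteq> Gy"

text \<open>The restriction of the character of a module to the monomials in the group-like generators;
  the letters \<^term>\<open>Gx\<close> and \<^term>\<open>Gy\<close> are skipped, so that it is defined on all words.\<close>

definition trch :: "'k::field hopf_data \<Rightarrow> 'k hmod \<Rightarrow> gen list \<Rightarrow> 'k" where
  "trch D M w = mtrace (snd M (hcls D (word (filter grp w))))"

lemma trch_mod_of_gens:
  assumes "is_rep D d E"
  shows "trch D (mod_of_gens D d E) w = mtrace (word_mat d E (filter grp w))"
  using assms by (simp add: trch_def snd_mod_of_gens[OF assms] alg_mat_word is_rep_def)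

lemma word_mat_tens_grp:
  assumes E: "\<And>g. E g \<in> carrier_mat d d" and E': "\<And>g. E' g \<in> carrier_mat d' d'"
    and "\<forall>g\<in>set w. grp g"
  shows "word_mat (d * d') (tens_gens D d E d' E') w = kron (word_mat d E w) (word_mat d' E' w)"
  using assms(3)
proof (induction w)
  case (Cons g w)
  have "comult_gen D g = pure_tensor (word [g]) (word [g])"
    using Cons.prems by (cases g) (auto simp: grp_def)
  then have "tens_gens D d E d' E' g = kron (alg_mat d E (word [g])) (alg_mat d' E' (word [g]))"
    by (simp add: tens_gens_def tens_mat_pure[where E = E and E' = E', OF E E'])
  also have "\<dots> = kron (E g) (E' g)"
    by (simp add: alg_mat_word[where E = E, OF E] alg_mat_word[where E = E', OF E']
        right_mult_one_mat[OF E] right_mult_one_mat[OF E'])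
  finally have "tens_gens D d E d' E' g = kron (E g) (E' g)" .
  then show ?case
    using Cons kron_mult[OF E E' word_mat_carrier[where E = E, OF E] word_mat_carrier[where E = E', OF E']] by simp
qed (simp add: kron_one)

lemma trch_tensor:
  assumes "is_Hopf D" "M \<in> hmods D" "N \<in> hmods D"
  shows "trch D (tensor_mod D M N) = trch D M * trch D N"
proof
  fix w
  obtain d E where M: "is_rep D d E" "M = mod_of_gens D d E" using hmods_cases[OF assms(2)] .
  obtain d' E' where N: "is_rep D d' E'" "N = mod_of_gens D d' E'" using hmods_cases[OF assms(3)] .
  have E: "\<And>g. E g \<in> carrier_mat d d" and E': "\<And>g. E' g \<in> carrier_mat d' d'"
    using M(1) N(1) by (auto simp: is_rep_def)
  show "trch D (tensor_mod D M N) w = (trch D M * trch D N) w"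
    unfolding M(2) N(2) tensor_mod_of_gens[OF assms(1) M(1) N(1)] times_fun_apply
      trch_mod_of_gens[OF is_rep_tens[OF assms(1) M(1) N(1)]] trch_mod_of_gens[OF M(1)] trch_mod_of_gens[OF N(1)]
    using word_mat_tens_grp[where E = E and E' = E', OF E E', of "filter grp w"]
    by (simp add: mtrace_kron[OF word_mat_carrier[where E = E, OF E] word_mat_carrier[where E = E', OF E']])
qed

lemma trch_trivial:
  assumes "dn D > 0"
  shows "trch D (trivial_mod D) = 1"
proof
  fix w
  have "prod_list (map counit_gen (filter grp w)) = (1 :: 'a)"
  proof (induction w)
    case (Cons g w)
    then show ?case by (cases g) (auto simp: grp_def)
  qed simp
  then show "trch D (trivial_mod D) w = 1 w"
    unfolding trivial_mod_eq trch_mod_of_gens[OF is_rep_counit[OF assms]] word_mat_scalar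
    by (simp add: mtrace_def)
qed

lemma mat_mult_vec_unit_cols:
  fixes A :: "'k::field mat"
  assumes "A \<in> carrier_mat m n" "\<And>j. j < n \<Longrightarrow> v j \<in> carrier_vec k"
    "B \<in> carrier_mat m k" "\<And>j. j < n \<Longrightarrow> B *\<^sub>v v j = col A j"
  shows "B * mat k n (\<lambda>(i, j). v j $ i) = A"
proof (rule eq_matI)
  fix i j assume ij: "i < dim_row A" "j < dim_col A"
  then have j: "j < n" using assms by simp
  have "col (mat k n (\<lambda>(i, j). v j $ i)) j = v j" using assms(2)[OF j] j by (auto intro!: eq_vecI)
  then have "(B * mat k n (\<lambda>(i, j). v j $ i)) $$ (i, j) = (B *\<^sub>v v j) $ i"
    using assms(1-3) ij j by simp
  also have "\<dots> = A $$ (i, j)" unfolding assms(4)[OF j] using assms(1) ij by simp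
  finally show "(B * mat k n (\<lambda>(i, j). v j $ i)) $$ (i, j) = A $$ (i, j)" .
qed (use assms in auto)

lemma mult_mat_unit_vec:
  fixes A :: "'k::field mat"
  assumes "A \<in> carrier_mat m n" "j < n"
  shows "A *\<^sub>v unit_vec n j = col A j"
  using assms by (intro eq_vecI) (auto simp: scalar_prod_right_unit)

text \<open>Over a field a short exact sequence splits: \<^term>\<open>R\<close> is a retraction and \<^term>\<open>S\<close> a section, with
  $FR + SG = 1$.\<close>

lemma exact_splitting:
  fixes F :: "'k::field mat"
  assumes F: "F \<in> carrier_mat d r" and G: "G \<in> carrier_mat s d"
    and inj: "inj_on (\<lambda>v. F *\<^sub>v v) (carrier_vec r)"
    and ker: "(\<lambda>v. F *\<^sub>v v) ` carrier_vec r = {v \<in> carrier_vec d. G *\<^sub>v v = 0\<^sub>v s}"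
    and surj: "(\<lambda>v. G *\<^sub>v v) ` carrier_vec d = carrier_vec s"
  obtains R S where "R \<in> carrier_mat r d" "S \<in> carrier_mat d s" "F * R = 1\<^sub>m d - S * G"
    "G * S = 1\<^sub>m s" "R * F = 1\<^sub>m r" "G * F = 0\<^sub>m s r"
proof -
  have "\<exists>v\<in>carrier_vec d. G *\<^sub>v v = unit_vec s j" for j
    using surj by (metis (no_types, lifting) imageE unit_vec_carrier)
  then obtain v where v: "\<And>j. v j \<in> carrier_vec d" "\<And>j. G *\<^sub>v v j = unit_vec s j" by metis
  define S where "S = mat d s (\<lambda>(i, j). v j $ i)"
  have S: "S \<in> carrier_mat d s" by (simp add: S_def)
  have GS: "G * S = 1\<^sub>m s" unfolding S_def
    by (rule mat_mult_vec_unit_cols[OF _ v(1) G]) (auto simp: v(2))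
  have GF: "G * F = 0\<^sub>m s r"
  proof (rule eq_matI)
    fix i j assume "i < dim_row (0\<^sub>m s r :: 'k mat)" "j < dim_col (0\<^sub>m s r :: 'k mat)"
    then have ij: "i < s" "j < r" by auto
    have "F *\<^sub>v unit_vec r j \<in> {v \<in> carrier_vec d. G *\<^sub>v v = 0\<^sub>v s}"
      unfolding ker[symmetric] by (intro imageI) simp
    moreover have "F *\<^sub>v unit_vec r j = col F j"
      using F ij by (simp add: mult_mat_unit_vec)
    ultimately have "G *\<^sub>v col F j = 0\<^sub>v s" by simp
    moreover have "(G * F) $$ (i, j) = (G *\<^sub>v col F j) $ i" using F G ij by simp
    ultimately show "(G * F) $$ (i, j) = 0\<^sub>m s r $$ (i, j)" using ij by simp
  qed (use F G in auto)
  have P: "1\<^sub>m d - S * G \<in> carrier_mat d d" using S G by (intro minus_carrier_mat mult_carrier_mat)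
  have GP: "G * (1\<^sub>m d - S * G) = 0\<^sub>m s d"
  proof -
    have "G * (1\<^sub>m d - S * G) = G * 1\<^sub>m d - G * (S * G)"
      using G S by (intro mult_minus_distrib_mat) auto
    also have "G * (S * G) = (G * S) * G" using G S by (simp add: assoc_mult_mat[of _ s d _ s _ d])
    finally show ?thesis using G by (simp add: GS)
  qed
  have "\<exists>u\<in>carrier_vec r. F *\<^sub>v u = col (1\<^sub>m d - S * G) j" if j: "j < d" for j
  proof -
    have "G *\<^sub>v col (1\<^sub>m d - S * G) j = col (G * (1\<^sub>m d - S * G)) j"
      using col_mult2[OF G P j] by simp
    also have "\<dots> = 0\<^sub>v s" using j by (simp add: GP)
    finally have "col (1\<^sub>m d - S * G) j \<in> {v \<in> carrier_vec d. G *\<^sub>v v = 0\<^sub>v s}" using col_carrier_vec[OF j P] by simp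
    then show ?thesis unfolding ker[symmetric] by auto
  qed
  then obtain u where u: "\<And>j. j < d \<Longrightarrow> u j \<in> carrier_vec r"
    "\<And>j. j < d \<Longrightarrow> F *\<^sub>v u j = col (1\<^sub>m d - S * G) j" by metis
  define R where "R = mat r d (\<lambda>(i, j). u j $ i)"
  have R: "R \<in> carrier_mat r d" by (simp add: R_def)
  have FR: "F * R = 1\<^sub>m d - S * G" unfolding R_def
    by (rule mat_mult_vec_unit_cols[OF P u(1) F u(2)])
  have FRF: "F * (R * F) = F"
  proof -
    have "F * (R * F) = (F * R) * F" using F R by (simp add: assoc_mult_mat[of _ d r _ d _ r])
    also have "\<dots> = 1\<^sub>m d * F - S * G * F"
      unfolding FR using F G S by (intro minus_mult_distrib_mat) auto
    also have "S * G * F = S * (G * F)" using F G S by (simp add: assoc_mult_mat[of _ d s _ d _ r])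
    also have "1\<^sub>m d * F - S * (G * F) = F" using F S by (auto simp: GF intro!: eq_matI)
    finally show ?thesis .
  qed
  have RF: "R * F = 1\<^sub>m r"
  proof (rule mat_col_eqI)
    fix j assume "j < dim_col (1\<^sub>m r :: 'k mat)"
    then have j: "j < r" by simp
    have RFc: "R * F \<in> carrier_mat r r" using R F by simp
    have "F *\<^sub>v col (R * F) j = col (F * (R * F)) j"
      using col_mult2[OF F RFc j] by simp
    also have "\<dots> = F *\<^sub>v unit_vec r j" using F j by (simp add: FRF mult_mat_unit_vec)
    finally have "col (R * F) j = unit_vec r j"
      by (rule inj_onD[OF inj _ col_carrier_vec[OF j RFc] unit_vec_carrier])
    then show "col (R * F) j = col (1\<^sub>m r) j" using j by simp
  qed (use R F in auto)
  show thesis by (rule that[OF R S FR GS RF GF])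
qed

text \<open>With such a splitting $\mathrm{tr}\,M = \mathrm{tr}(MFR) + \mathrm{tr}(MSG)$, and by cyclicity the
  summands are the traces on the submodule and on the quotient.\<close>

lemma trch_short_exact:
  fixes D :: "'k::field hopf_data"
  assumes ex: "short_exact D L M N" and mods: "L \<in> hmods D" "M \<in> hmods D" "N \<in> hmods D"
  shows "trch D M = trch D L + trch D N"
proof
  fix w
  define h where "h = hcls D (word (filter grp w))"
  have h: "h \<in> carrier (Halg D)" by (simp add: h_def)
  obtain d r s where dims: "fst M = d" "fst L = r" "fst N = s" by blast
  have c: "snd K h \<in> carrier_mat (fst K) (fst K)" if "K \<in> hmods D" for K
    using that h ring_hom_closed[of "snd K" "Halg D" "ring_mat TYPE('k) (fst K) ()" h]
    by (auto simp: hmods_def ring_mat_simps)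
  note c = c[OF mods(1)] c[OF mods(2)] c[OF mods(3)]
  obtain F G where FG: "F \<in> carrier_mat d r" "G \<in> carrier_mat s d"
    "F * snd L h = snd M h * F" "G * snd M h = snd N h * G"
    "inj_on (\<lambda>v. F *\<^sub>v v) (carrier_vec r)"
    "(\<lambda>v. F *\<^sub>v v) ` carrier_vec r = {v \<in> carrier_vec d. G *\<^sub>v v = 0\<^sub>v s}"
    "(\<lambda>v. G *\<^sub>v v) ` carrier_vec d = carrier_vec s"
    using ex h unfolding short_exact_def dims by blast
  obtain R S where RS: "R \<in> carrier_mat r d" "S \<in> carrier_mat d s" "F * R = 1\<^sub>m d - S * G"
    "G * S = 1\<^sub>m s" "R * F = 1\<^sub>m r" "G * F = 0\<^sub>m s r"
    using exact_splitting[OF FG(1,2,5,6,7)] .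
  have 1: "F * R + S * G = 1\<^sub>m d" unfolding RS(3) using RS FG by (auto intro!: eq_matI)
  let ?L = "snd L h" and ?M = "snd M h" and ?N = "snd N h"
  have cs: "?L \<in> carrier_mat r r" "?M \<in> carrier_mat d d" "?N \<in> carrier_mat s s" using c dims by auto
  have "?M = ?M * (F * R + S * G)" unfolding 1 using cs by simp
  also have "\<dots> = ?M * (F * R) + ?M * (S * G)"
    using cs FG RS by (intro mult_add_distrib_mat) auto
  finally have "mtrace ?M = mtrace (?M * (F * R)) + mtrace (?M * (S * G))"
    using mtrace_add[OF mult_carrier_mat[OF cs(2) mult_carrier_mat[OF FG(1) RS(1)]]
        mult_carrier_mat[OF cs(2) mult_carrier_mat[OF RS(2) FG(2)]]] by simp
  also have "?M * (F * R) = F * (?L * R)"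
  proof -
    have "?M * (F * R) = ?M * F * R" by (rule assoc_mult_mat[OF cs(2) FG(1) RS(1), symmetric])
    also have "\<dots> = F * (?L * R)" unfolding FG(3)[symmetric] by (rule assoc_mult_mat[OF FG(1) cs(1) RS(1)])
    finally show ?thesis .
  qed
  also have "mtrace (F * (?L * R)) = mtrace (?L * R * F)"
    using cs FG RS by (intro mtrace_mult_comm) auto
  also have "?L * R * F = ?L" using cs by (simp add: assoc_mult_mat[OF cs(1) RS(1) FG(1)] RS(5))
  also have "mtrace (?M * (S * G)) = mtrace (?M * S * G)"
    by (simp add: assoc_mult_mat[OF cs(2) RS(2) FG(2)])
  also have "\<dots> = mtrace (G * (?M * S))"
    using cs FG RS by (intro mtrace_mult_comm) auto
  also have "G * (?M * S) = ?N"
  proof -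
    have "G * (?M * S) = G * ?M * S" by (rule assoc_mult_mat[OF FG(2) cs(2) RS(2), symmetric])
    also have "\<dots> = ?N * (G * S)" unfolding FG(4) by (rule assoc_mult_mat[OF cs(3) FG(2) RS(2)])
    finally show ?thesis using cs by (simp add: RS)
  qed
  finally show "trch D M w = (trch D L + trch D N) w" by (simp add: trch_def h_def)
qed


section \<open>Eigenvectors and cokernels\<close>

lemma index_mult_mat_vec_sum:
  assumes "A \<in> carrier_mat m n" "v \<in> carrier_vec n" "i < m"
  shows "(A *\<^sub>v v) $ i = (\<Sum>j<n. A $$ (i, j) * v $ j)"
  using assms by (simp add: scalar_prod_def atLeast0LessThan)

lemma mult_mat_vec_smult:
  fixes A :: "'k::field mat"
  shows "A \<in> carrier_mat m n \<Longrightarrow> v \<in> carrier_vec n \<Longrightarrow> A *\<^sub>v (c \<cdot>\<^sub>v v) = c \<cdot>\<^sub>v (A *\<^sub>v v)"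
  by (rule mult_mat_vec)

lemma mult_mat_zero_vec:
  fixes A :: "'k::field mat"
  shows "A \<in> carrier_mat m n \<Longrightarrow> A *\<^sub>v 0\<^sub>v n = 0\<^sub>v m"
  by (intro eq_vecI) auto

lemma zero_smult_vec':
  fixes v :: "'k::field vec"
  shows "v \<in> carrier_vec n \<Longrightarrow> 0 \<cdot>\<^sub>v v = 0\<^sub>v n"
  by (intro eq_vecI) auto

lemma funpow_mat_carrier:
  assumes "A \<in> carrier_mat d d" "v \<in> carrier_vec d"
  shows "((*\<^sub>v) A ^^ j) v \<in> carrier_vec d"
  by (induction j) (use assms in auto)

text \<open>The action on \<^term>\<open>v\<close> of the polynomial in \<^term>\<open>A\<close> whose coefficients, starting with the
  constant one, are listed.\<close>

fun poly_act :: "nat \<Rightarrow> 'k::field mat \<Rightarrow> 'k list \<Rightarrow> 'k vec \<Rightarrow> 'k vec" where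
  "poly_act d A [] v = 0\<^sub>v d"
| "poly_act d A (c # cs) v = c \<cdot>\<^sub>v v + A *\<^sub>v poly_act d A cs v"

lemma poly_act_carrier:
  assumes "A \<in> carrier_mat d d" "v \<in> carrier_vec d"
  shows "poly_act d A cs v \<in> carrier_vec d"
  by (induction cs) (use assms in auto)

lemma poly_act_index:
  assumes A: "A \<in> carrier_mat d d" and v: "v \<in> carrier_vec d" and i: "i < d"
  shows "poly_act d A cs v $ i = (\<Sum>j<length cs. cs ! j * ((*\<^sub>v) A ^^ j) v $ i)"
  using i
proof (induction cs arbitrary: i)
  case (Cons c cs)
  have pc: "poly_act d A cs v \<in> carrier_vec d" by (rule poly_act_carrier[OF A v])
  have "(A *\<^sub>v poly_act d A cs v) $ i = (\<Sum>k<d. A $$ (i, k) * (\<Sum>j<length cs. cs ! j * ((*\<^sub>v) A ^^ j) v $ k))"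
    using Cons by (simp add: index_mult_mat_vec_sum[OF A pc])
  also have "\<dots> = (\<Sum>j<length cs. cs ! j * (\<Sum>k<d. A $$ (i, k) * ((*\<^sub>v) A ^^ j) v $ k))"
    by (simp add: sum_distrib_left sum.swap[of _ "{..<d}"] mult.left_commute)
  also have "\<dots> = (\<Sum>j<length cs. cs ! j * ((*\<^sub>v) A ^^ Suc j) v $ i)"
    using Cons.prems by (simp add: index_mult_mat_vec_sum[OF A funpow_mat_carrier[OF A v]])
  finally have "poly_act d A (c # cs) v $ i
      = c * v $ i + (\<Sum>j<length cs. cs ! j * ((*\<^sub>v) A ^^ Suc j) v $ i)"
    using Cons.prems A v pc by simp
  then show ?case
    by (simp only: length_Cons sum.lessThan_Suc_shift nth_Cons_0 nth_Cons_Suc funpow_0)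
qed simp

text \<open>Division of a polynomial by $X - \alpha$, with its value at $\alpha$ as the remainder.\<close>

lemma poly_act_synthetic_div:
  fixes A :: "'k::field mat"
  assumes A: "A \<in> carrier_mat d d" and v: "v \<in> carrier_vec d"
  shows "\<exists>b bs. length bs = length cs \<and> last (b # bs) = last (c # cs) \<and>
    b = (\<Sum>k<Suc (length cs). (c # cs) ! k * \<alpha> ^ k) \<and>
    poly_act d A (c # cs) v = poly_act d A bs (A *\<^sub>v v - \<alpha> \<cdot>\<^sub>v v) + b \<cdot>\<^sub>v v"
proof (induction cs arbitrary: c)
  case Nil
  show ?case
    by (intro exI[of _ c] exI[of _ "[]"]) (use A v in \<open>auto intro!: eq_vecI\<close>)
next
  case (Cons e es)
  let ?u = "A *\<^sub>v v - \<alpha> \<cdot>\<^sub>v v"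
  obtain b bs where b: "length bs = length es" "last (b # bs) = last (e # es)"
    "b = (\<Sum>k<Suc (length es). (e # es) ! k * \<alpha> ^ k)"
    "poly_act d A (e # es) v = poly_act d A bs ?u + b \<cdot>\<^sub>v v" using Cons by blast
  have u: "?u \<in> carrier_vec d" using A v by auto
  have Av: "A *\<^sub>v v \<in> carrier_vec d" using A v by auto
  let ?p = "poly_act d A bs ?u"
  have p: "?p \<in> carrier_vec d" by (rule poly_act_carrier[OF A u])
  have "poly_act d A (c # e # es) v = c \<cdot>\<^sub>v v + (A *\<^sub>v ?p + b \<cdot>\<^sub>v (A *\<^sub>v v))"
    using b(4) mult_add_distrib_mat_vec[OF A p, of "b \<cdot>\<^sub>v v"] v by (simp add: mult_mat_vec_smult[OF A v])
  also have "\<dots> = poly_act d A (b # bs) ?u + (c + \<alpha> * b) \<cdot>\<^sub>v v"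
    using A v p Av mult_mat_vec_carrier[OF A p] by (intro eq_vecI) (auto simp: algebra_simps)
  finally have 1: "poly_act d A (c # e # es) v = poly_act d A (b # bs) ?u + (c + \<alpha> * b) \<cdot>\<^sub>v v" .
  have 2: "c + \<alpha> * b = (\<Sum>k<Suc (length (e # es)). (c # e # es) ! k * \<alpha> ^ k)"
    unfolding b(3) sum.lessThan_Suc_shift[of _ "length (e # es)"]
    by (simp add: sum_distrib_left mult_ac del: sum.lessThan_Suc)
  show ?case
    by (rule exI[of _ "c + \<alpha> * b"], rule exI[of _ "b # bs"]) (use 1 2 b(1,2) in auto)
qed

lemma eigenvector_if_poly_act_0:
  fixes A :: "'k::alg_closed_field mat"
  assumes A: "A \<in> carrier_mat d d" and U: "U \<subseteq> carrier_vec d"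
    and stable: "\<And>u \<alpha>. u \<in> U \<Longrightarrow> A *\<^sub>v u - \<alpha> \<cdot>\<^sub>v u \<in> U"
    and "v \<in> U" "v \<noteq> 0\<^sub>v d" "last (c # cs) \<noteq> 0" "poly_act d A (c # cs) v = 0\<^sub>v d"
  shows "\<exists>w\<in>U. w \<noteq> 0\<^sub>v d \<and> (\<exists>\<alpha>. A *\<^sub>v w = \<alpha> \<cdot>\<^sub>v w)"
  using assms(4-7)
proof (induction "length cs" arbitrary: c cs v rule: less_induct)
  case less
  have v: "v \<in> carrier_vec d" using less.prems U by auto
  show ?case
  proof (cases cs)
    case Nil
    then have "c \<cdot>\<^sub>v v = 0\<^sub>v d" using less.prems(4) v by (simp add: mult_mat_zero_vec[OF A])
    moreover obtain i where "i < d" "v $ i \<noteq> 0" using less.prems(2) v by (metis eq_vecI carrier_vecD index_zero_vec)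
    ultimately have "c = 0" using v by (metis carrier_vecD index_smult_vec(1) index_zero_vec(1) mult_eq_0_iff)
    then show ?thesis using less.prems(3) Nil by simp
  next
    case (Cons e es)
    have "last (c # cs) = (c # cs) ! length cs"
      by (simp only: last_conv_nth[OF list.distinct(2)] length_Cons diff_Suc_1)
    then have "(c # cs) ! length cs \<noteq> 0" using less.prems(3) by metis
    then obtain \<alpha> where "(\<Sum>k\<le>length cs. (c # cs) ! k * \<alpha> ^ k) = 0"
      using alg_closed[of "length cs" "\<lambda>k. (c # cs) ! k"] Cons by auto
    then have root: "(\<Sum>k<Suc (length cs). (c # cs) ! k * \<alpha> ^ k) = 0" by (simp only: lessThan_Suc_atMost)
    let ?u = "A *\<^sub>v v - \<alpha> \<cdot>\<^sub>v v"
    have u: "?u \<in> U" using stable less.prems(1) .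
    obtain bs where bs: "length bs = length cs" "last (0 # bs) = last (c # cs)"
      "poly_act d A (c # cs) v = poly_act d A bs ?u + 0 \<cdot>\<^sub>v v"
      using poly_act_synthetic_div[OF A v, of cs c \<alpha>] unfolding root by blast
    have eq: "poly_act d A bs ?u = 0\<^sub>v d"
      using bs(3) less.prems(4) poly_act_carrier[OF A subsetD[OF U u], of bs]
      by (simp add: zero_smult_vec'[OF v])
    obtain b bs' where b: "bs = b # bs'" using bs(1) Cons by (cases bs) auto
    show ?thesis
    proof (cases "?u = 0\<^sub>v d")
      case True
      have "A *\<^sub>v v = \<alpha> \<cdot>\<^sub>v v"
      proof (rule eq_vecI)
        fix i assume "i < dim_vec (\<alpha> \<cdot>\<^sub>v v)"
        then have "i < d" using v by simp
        then have "?u $ i = 0" using True by simp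
        then show "(A *\<^sub>v v) $ i = (\<alpha> \<cdot>\<^sub>v v) $ i" using \<open>i < d\<close> v A by simp
      qed (use A v in auto)
      then show ?thesis using less.prems by blast
    next
      case False
      show ?thesis
        by (rule less.hyps[of bs' ?u b]) (use bs b eq False u less.prems in auto)
    qed
  qed
qed

text \<open>The set \<^term>\<open>U\<close> need not be a subspace: the vectors $v, Av, \dots, A^d v$ are linearly
  dependent, and the linear factors of a polynomial in \<^term>\<open>A\<close> that kills \<^term>\<open>v\<close> are applied
  to \<^term>\<open>v\<close> one after the other until the result vanishes.\<close>

lemma eigenvector_in_stable_set:
  fixes A :: "'k::alg_closed_field mat"
  assumes A: "A \<in> carrier_mat d d" and U: "U \<subseteq> carrier_vec d"
    and stable: "\<And>u \<alpha>. u \<in> U \<Longrightarrow> A *\<^sub>v u - \<alpha> \<cdot>\<^sub>v u \<in> U"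
    and vU: "v \<in> U" and v0: "v \<noteq> 0\<^sub>v d"
  obtains w \<alpha> where "w \<in> U" "w \<noteq> 0\<^sub>v d" "A *\<^sub>v w = \<alpha> \<cdot>\<^sub>v w"
proof -
  have v: "v \<in> carrier_vec d" using vU U by auto
  \<comment> \<open>the columns are $v, Av, \dots, A^d v$; a zero row makes the matrix square\<close>
  define B where "B = mat (Suc d) (Suc d) (\<lambda>(i, j). if i < d then ((*\<^sub>v) A ^^ j) v $ i else 0)"
  have B: "B \<in> carrier_mat (Suc d) (Suc d)" by (simp add: B_def)
  have "transpose_mat B *\<^sub>v unit_vec (Suc d) d = 0\<^sub>v (Suc d)"
    using B by (subst mult_mat_unit_vec[of _ "Suc d"]) (auto simp: B_def intro!: eq_vecI)
  moreover have "unit_vec (Suc d) d \<noteq> (0\<^sub>v (Suc d) :: 'k vec)"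
    by (metis index_unit_vec(1) index_zero_vec(1) lessI zero_neq_one)
  ultimately have "det (transpose_mat B) = 0"
    using det_0_iff_vec_prod_zero_field[of "transpose_mat B" "Suc d"] B by (metis transpose_carrier_mat unit_vec_carrier)
  then have "det B = 0" using det_transpose[OF B] by simp
  then obtain c where c: "c \<in> carrier_vec (Suc d)" "c \<noteq> 0\<^sub>v (Suc d)" "B *\<^sub>v c = 0\<^sub>v (Suc d)"
    using det_0_iff_vec_prod_zero_field[OF B] by blast
  have "\<exists>j<Suc d. c $ j \<noteq> 0"
  proof (rule ccontr)
    assume "\<not> ?thesis"
    then have "c = 0\<^sub>v (Suc d)" using c(1) by (intro eq_vecI) auto
    then show False using c(2) by simp
  qed
  then have ne: "{j. j < Suc d \<and> c $ j \<noteq> 0} \<noteq> {}" by blast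
  define k where "k = Max {j. j < Suc d \<and> c $ j \<noteq> 0}"
  have k: "k < Suc d" "c $ k \<noteq> 0" using Max_in[OF _ ne] by (auto simp: k_def)
  have k_max: "c $ j = 0" if "k < j" "j < Suc d" for j
    using that Max_ge[of "{j. j < Suc d \<and> c $ j \<noteq> 0}" j] unfolding k_def by fastforce
  define cs where "cs = map (($) c) [0..<Suc k]"
  have "poly_act d A cs v = 0\<^sub>v d"
  proof (rule eq_vecI)
    fix i assume "i < dim_vec (0\<^sub>v d :: 'k vec)"
    then have i: "i < d" by simp
    have "poly_act d A cs v $ i = (\<Sum>j<Suc k. c $ j * ((*\<^sub>v) A ^^ j) v $ i)"
      unfolding poly_act_index[OF A v i] by (rule sum.cong) (auto simp: cs_def simp del: upt_Suc)
    also have "\<dots> = (\<Sum>j<Suc d. c $ j * ((*\<^sub>v) A ^^ j) v $ i)"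
      by (rule sum.mono_neutral_left) (use k k_max in auto)
    also have "\<dots> = (B *\<^sub>v c) $ i"
      using i by (subst index_mult_mat_vec_sum[OF B c(1)]) (auto simp: B_def mult.commute intro!: sum.cong)
    also have "\<dots> = 0" using c(3) i by simp
    finally show "poly_act d A cs v $ i = 0\<^sub>v d $ i" using i by simp
  qed (use poly_act_carrier[OF A v] in auto)
  moreover have "last cs \<noteq> 0" using k by (simp add: cs_def)
  moreover obtain b bs where "cs = b # bs" by (cases cs) (auto simp: cs_def)
  ultimately show thesis
    using eigenvector_if_poly_act_0[OF A U stable vU v0] that by blast
qed

lemma kernel_element_in_orbit:
  assumes A: "A \<in> carrier_mat d d" and v: "v \<in> carrier_vec d" "v \<noteq> 0\<^sub>v d"
    and "((*\<^sub>v) A ^^ m) v = 0\<^sub>v d"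
  obtains j where "j < m" "((*\<^sub>v) A ^^ j) v \<noteq> 0\<^sub>v d" "((*\<^sub>v) A ^^ Suc j) v = 0\<^sub>v d"
proof -
  define k where "k = (LEAST k. ((*\<^sub>v) A ^^ k) v = 0\<^sub>v d)"
  have k: "((*\<^sub>v) A ^^ k) v = 0\<^sub>v d" unfolding k_def by (rule LeastI) (rule assms(4))
  have le: "k \<le> m" unfolding k_def by (rule Least_le) (rule assms(4))
  obtain j where j: "k = Suc j" using k v by (cases k) auto
  have "((*\<^sub>v) A ^^ j) v \<noteq> 0\<^sub>v d"
    using not_less_Least[of j "\<lambda>k. ((*\<^sub>v) A ^^ k) v = 0\<^sub>v d"] j by (auto simp: k_def[symmetric])
  then show thesis using that[of j] j k le by simp
qed

text \<open>The quotient by the line spanned by \<^term>\<open>w\<close>.\<close>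

lemma line_cokernel:
  fixes w :: "'k::field vec"
  assumes w: "w \<in> carrier_vec (Suc s)" "w \<noteq> 0\<^sub>v (Suc s)"
  obtains H where "H \<in> carrier_mat s (Suc s)"
    "\<And>u. u \<in> carrier_vec (Suc s) \<Longrightarrow> H *\<^sub>v u = 0\<^sub>v s \<longleftrightarrow> (\<exists>c. u = c \<cdot>\<^sub>v w)"
    "(\<lambda>v. H *\<^sub>v v) ` carrier_vec (Suc s) = carrier_vec s"
proof -
  obtain i0 where i0: "i0 < Suc s" "w $ i0 \<noteq> 0"
    using w by (metis eq_vecI carrier_vecD index_zero_vec)
  \<comment> \<open>the increasing enumeration of the coordinates other than \<^term>\<open>i0\<close>\<close>
  define sk where "sk k = (if k < i0 then k else Suc k)" for k
  have sk: "sk k < Suc s" "sk k \<noteq> i0" if "k < s" for k using that i0 by (auto simp: sk_def)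
  have sk_surj: "\<exists>k<s. sk k = l" if "l < Suc s" "l \<noteq> i0" for l
    by (rule exI[of _ "if l < i0 then l else l - 1"]) (use that i0 in \<open>auto simp: sk_def\<close>)
  have sk_inj: "k = l" if "sk k = sk l" for k l using that by (auto simp: sk_def split: if_splits)
  define H where "H = mat s (Suc s) (\<lambda>(k, l). (if l = sk k then 1 else 0) - (if l = i0 then w $ sk k / w $ i0 else 0))"
  have H: "H \<in> carrier_mat s (Suc s)" by (simp add: H_def)
  have Hu: "(H *\<^sub>v u) $ k = u $ sk k - w $ sk k / w $ i0 * u $ i0" if u: "u \<in> carrier_vec (Suc s)" and k: "k < s" for u k
  proof -
    have "(H *\<^sub>v u) $ k = (\<Sum>l<Suc s. (if l = sk k then u $ l else 0) - (if l = i0 then w $ sk k / w $ i0 * u $ l else 0))"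
      unfolding index_mult_mat_vec_sum[OF H u k] using k
      by (intro sum.cong) (auto simp: H_def left_diff_distrib)
    also have "\<dots> = u $ sk k - w $ sk k / w $ i0 * u $ i0"
      unfolding sum_subtractf using sk(1)[OF k] i0(1) by (simp add: sum.delta del: sum.lessThan_Suc)
    finally show ?thesis .
  qed
  show thesis
  proof (rule that[OF H])
    fix u :: "'k vec" assume u: "u \<in> carrier_vec (Suc s)"
    show "H *\<^sub>v u = 0\<^sub>v s \<longleftrightarrow> (\<exists>c. u = c \<cdot>\<^sub>v w)"
    proof
      assume eq: "H *\<^sub>v u = 0\<^sub>v s"
      have "u = (u $ i0 / w $ i0) \<cdot>\<^sub>v w"
      proof (rule eq_vecI)
        fix l assume "l < dim_vec ((u $ i0 / w $ i0) \<cdot>\<^sub>v w)"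
        then have l: "l < Suc s" using w by simp
        show "u $ l = ((u $ i0 / w $ i0) \<cdot>\<^sub>v w) $ l"
        proof (cases "l = i0")
          case False
          then obtain k where k: "k < s" "sk k = l" using sk_surj l by blast
          have "(H *\<^sub>v u) $ k = 0" using eq k by simp
          then show ?thesis using Hu[OF u k(1)] k(2) l w by (simp add: field_simps)
        qed (use i0 w in simp)
      qed (use u w in auto)
      then show "\<exists>c. u = c \<cdot>\<^sub>v w" ..
    next
      assume "\<exists>c. u = c \<cdot>\<^sub>v w"
      then obtain c where c: "u = c \<cdot>\<^sub>v w" ..
      show "H *\<^sub>v u = 0\<^sub>v s"
      proof (rule eq_vecI)
        fix k assume "k < dim_vec (0\<^sub>v s :: 'k vec)"
        then have k: "k < s" by simp
        have "w $ sk k / w $ i0 * (c * w $ i0) = c * w $ sk k" using i0 by simp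
        then show "(H *\<^sub>v u) $ k = 0\<^sub>v s $ k"
          using sk(1)[OF k] i0 w k by (simp only: Hu[OF u k]) (simp add: c)
      qed (simp add: H_def)
    qed
  next
    show "(\<lambda>v. H *\<^sub>v v) ` carrier_vec (Suc s) = carrier_vec s"
    proof
      show "carrier_vec s \<subseteq> (\<lambda>v. H *\<^sub>v v) ` carrier_vec (Suc s)"
      proof
        fix y :: "'k vec" assume y: "y \<in> carrier_vec s"
        define u where "u = vec (Suc s) (\<lambda>l. if l = i0 then 0 else y $ (if l < i0 then l else l - 1))"
        have u: "u \<in> carrier_vec (Suc s)" by (simp add: u_def)
        have "H *\<^sub>v u = y"
        proof (rule eq_vecI)
          fix k assume "k < dim_vec y"
          then have k: "k < s" using y by simp
          have "u $ sk k = y $ k" "u $ i0 = 0"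
            using sk[OF k] i0 by (auto simp: u_def sk_def)
          then show "(H *\<^sub>v u) $ k = y $ k" by (simp add: Hu[OF u k])
        qed (use y in \<open>simp add: H_def\<close>)
        then show "y \<in> (\<lambda>v. H *\<^sub>v v) ` carrier_vec (Suc s)" using u by blast
      qed
    qed (use H in auto)
  qed
qed

text \<open>An injective linear map has a cokernel; by induction on the rank, killing one column at a
  time.\<close>

lemma cokernel_exists:
  fixes F :: "'k::field mat"
  assumes "F \<in> carrier_mat d r" "inj_on (\<lambda>v. F *\<^sub>v v) (carrier_vec r)"
  shows "\<exists>G s. d = r + s \<and> G \<in> carrier_mat s d \<and>
    (\<lambda>v. F *\<^sub>v v) ` carrier_vec r = {v \<in> carrier_vec d. G *\<^sub>v v = 0\<^sub>v s} \<and>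
    (\<lambda>v. G *\<^sub>v v) ` carrier_vec d = carrier_vec s"
  using assms
proof (induction r arbitrary: F)
  case 0
  have "(\<lambda>v. F *\<^sub>v v) ` carrier_vec 0 = {0\<^sub>v d}"
  proof -
    have c0: "carrier_vec 0 = {0\<^sub>v 0 :: 'k vec}" by auto
    show ?thesis unfolding c0 using 0 by (auto intro!: eq_vecI simp: scalar_prod_def)
  qed
  moreover have "(\<lambda>v. 1\<^sub>m d *\<^sub>v v) ` carrier_vec d = (carrier_vec d :: 'k vec set)" by force
  moreover have "{v \<in> carrier_vec d. 1\<^sub>m d *\<^sub>v v = 0\<^sub>v d} = {0\<^sub>v d :: 'k vec}" by auto
  ultimately show ?case
    by (intro exI[of _ "1\<^sub>m d"] exI[of _ d]) simp
next
  case (Suc r)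
  define F' where "F' = mat d r (\<lambda>(i, j). F $$ (i, j))"
  have F': "F' \<in> carrier_mat d r" by (simp add: F'_def)
  define f where "f = col F r"
  have f: "f \<in> carrier_vec d" unfolding f_def by (rule col_carrier_vec[OF lessI Suc.prems(1)])
  have split: "F *\<^sub>v c = F' *\<^sub>v vec r (($) c) + (c $ r) \<cdot>\<^sub>v f" if c: "c \<in> carrier_vec (Suc r)" for c
  proof (rule eq_vecI)
    fix i assume "i < dim_vec (F' *\<^sub>v vec r (($) c) + (c $ r) \<cdot>\<^sub>v f)"
    then have i: "i < d" using f by simp
    have "(F *\<^sub>v c) $ i = (\<Sum>j<Suc r. F $$ (i, j) * c $ j)"
      by (rule index_mult_mat_vec_sum[OF Suc.prems(1) c i])
    also have "\<dots> = (\<Sum>j<r. F' $$ (i, j) * vec r (($) c) $ j) + c $ r * f $ i"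
      using i Suc.prems(1) by (simp add: F'_def f_def)
    also have "\<dots> = (F' *\<^sub>v vec r (($) c) + (c $ r) \<cdot>\<^sub>v f) $ i"
      using i f index_mult_mat_vec_sum[OF F' vec_carrier i, of "($) c"] by simp
    finally show "(F *\<^sub>v c) $ i = (F' *\<^sub>v vec r (($) c) + (c $ r) \<cdot>\<^sub>v f) $ i" .
  qed (use Suc.prems(1) f in auto)
  define ext where "ext v a = vec (Suc r) (\<lambda>j. if j < r then v $ j else a)" for v :: "'k vec" and a
  have ext: "ext v a \<in> carrier_vec (Suc r)" "vec r (($) (ext v a)) = v" "ext v a $ r = a"
    if "v \<in> carrier_vec r" for v a using that by (auto simp: ext_def intro!: eq_vecI)
  have F_ext: "F *\<^sub>v ext v a = F' *\<^sub>v v + a \<cdot>\<^sub>v f" if "v \<in> carrier_vec r" for v a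
    using split[OF ext(1)] ext(2,3) that by simp
  have inj': "inj_on (\<lambda>v. F' *\<^sub>v v) (carrier_vec r)"
  proof (rule inj_onI)
    fix u v :: "'k vec" assume uv: "u \<in> carrier_vec r" "v \<in> carrier_vec r" "F' *\<^sub>v u = F' *\<^sub>v v"
    then have "F *\<^sub>v ext u 0 = F *\<^sub>v ext v 0" by (simp add: F_ext)
    then have "ext u 0 = ext v 0" using Suc.prems(2) ext(1) uv by (auto dest: inj_onD)
    then show "u = v" using ext(2) uv by metis
  qed
  obtain G' s' where G': "d = r + s'" "G' \<in> carrier_mat s' d"
    "(\<lambda>v. F' *\<^sub>v v) ` carrier_vec r = {v \<in> carrier_vec d. G' *\<^sub>v v = 0\<^sub>v s'}"
    "(\<lambda>v. G' *\<^sub>v v) ` carrier_vec d = carrier_vec s'"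
    using Suc.IH[OF F' inj'] by blast
  define w where "w = G' *\<^sub>v f"
  have w: "w \<in> carrier_vec s'" using G'(2) f by (simp add: w_def)
  have w0: "w \<noteq> 0\<^sub>v s'"
  proof
    assume "w = 0\<^sub>v s'"
    then have "f \<in> {v \<in> carrier_vec d. G' *\<^sub>v v = 0\<^sub>v s'}" using f by (simp add: w_def)
    then obtain v where v: "v \<in> carrier_vec r" "F' *\<^sub>v v = f" unfolding G'(3)[symmetric] by auto
    have "F *\<^sub>v ext v 0 = F *\<^sub>v ext (0\<^sub>v r) 1"
      using v f by (simp add: F_ext mult_mat_zero_vec[OF F'] zero_smult_vec'[OF f])
    then have "ext v 0 = ext (0\<^sub>v r) 1" using Suc.prems(2) ext(1) v by (auto dest: inj_onD)
    then show False using ext(3)[OF v(1), of 0] ext(3)[of "0\<^sub>v r" 1] by simp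
  qed
  obtain s where s: "s' = Suc s" using w w0 by (cases s') auto
  obtain H where H: "H \<in> carrier_mat s (Suc s)"
    "\<And>u. u \<in> carrier_vec (Suc s) \<Longrightarrow> H *\<^sub>v u = 0\<^sub>v s \<longleftrightarrow> (\<exists>c. u = c \<cdot>\<^sub>v w)"
    "(\<lambda>v. H *\<^sub>v v) ` carrier_vec (Suc s) = carrier_vec s"
    using line_cokernel[of w s] w w0 s by blast
  note Gc = G'(2)[unfolded s]
  have HG: "H * G' \<in> carrier_mat s d" using H Gc by simp
  have HGv: "H * G' *\<^sub>v v = H *\<^sub>v (G' *\<^sub>v v)" if "v \<in> carrier_vec d" for v
    using H(1) Gc that by simp
  have Gv: "G' *\<^sub>v v \<in> carrier_vec (Suc s)" if "v \<in> carrier_vec d" for v using Gc that by simp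
  show ?case
  proof (intro exI[of _ "H * G'"] exI[of _ s] conjI)
    show "(\<lambda>v. (H * G') *\<^sub>v v) ` carrier_vec d = carrier_vec s"
    proof -
      have "(\<lambda>v. (H * G') *\<^sub>v v) ` carrier_vec d = (\<lambda>v. H *\<^sub>v v) ` (\<lambda>v. G' *\<^sub>v v) ` carrier_vec d"
        unfolding image_image by (rule image_cong) (auto simp: HGv)
      then show ?thesis using G'(4) H(3) s by simp
    qed
    show "(\<lambda>v. F *\<^sub>v v) ` carrier_vec (Suc r) = {v \<in> carrier_vec d. (H * G') *\<^sub>v v = 0\<^sub>v s}"
    proof (intro equalityI subsetI)
      fix y assume "y \<in> (\<lambda>v. F *\<^sub>v v) ` carrier_vec (Suc r)"
      then obtain c where c: "c \<in> carrier_vec (Suc r)" "y = F *\<^sub>v c" by blast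
      have y: "y \<in> carrier_vec d" using c Suc.prems(1) by simp
      have Fv: "F' *\<^sub>v vec r (($) c) \<in> {v \<in> carrier_vec d. G' *\<^sub>v v = 0\<^sub>v s'}"
        unfolding G'(3)[symmetric] by (rule imageI) simp
      have "G' *\<^sub>v y = G' *\<^sub>v (F' *\<^sub>v vec r (($) c)) + G' *\<^sub>v ((c $ r) \<cdot>\<^sub>v f)"
        unfolding c(2) split[OF c(1)] using Fv f by (intro mult_add_distrib_mat_vec[OF G'(2)]) auto
      also have "\<dots> = (c $ r) \<cdot>\<^sub>v w"
        using Fv w by (simp add: w_def mult_mat_vec_smult[OF G'(2) f])
      finally have "H *\<^sub>v (G' *\<^sub>v y) = 0\<^sub>v s" using H(2)[OF Gv[OF y]] by blast
      then show "y \<in> {v \<in> carrier_vec d. (H * G') *\<^sub>v v = 0\<^sub>v s}" using y by (simp add: HGv)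
    next
      fix y assume "y \<in> {v \<in> carrier_vec d. (H * G') *\<^sub>v v = 0\<^sub>v s}"
      then have y: "y \<in> carrier_vec d" "H *\<^sub>v (G' *\<^sub>v y) = 0\<^sub>v s" by (auto simp: HGv)
      then obtain c where c: "G' *\<^sub>v y = c \<cdot>\<^sub>v w" using H(2)[OF Gv[OF y(1)]] by blast
      have "G' *\<^sub>v (y - c \<cdot>\<^sub>v f) = G' *\<^sub>v y - G' *\<^sub>v (c \<cdot>\<^sub>v f)"
        using y f by (intro mult_minus_distrib_mat_vec[OF G'(2)]) auto
      also have "\<dots> = 0\<^sub>v s'" using w by (simp add: c w_def mult_mat_vec_smult[OF G'(2) f])
      finally have "y - c \<cdot>\<^sub>v f \<in> {v \<in> carrier_vec d. G' *\<^sub>v v = 0\<^sub>v s'}" using y f by simp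
      then obtain v where v: "v \<in> carrier_vec r" "F' *\<^sub>v v = y - c \<cdot>\<^sub>v f" unfolding G'(3)[symmetric] by auto
      have "F *\<^sub>v ext v c = y" unfolding F_ext[OF v(1)] v(2) using y f by (intro eq_vecI) auto
      then show "y \<in> (\<lambda>v. F *\<^sub>v v) ` carrier_vec (Suc r)" using ext(1)[OF v(1)] by blast
    qed
  qed (use G'(1) s HG in auto)
qed

lemma intertwine_alg_mat:
  assumes E: "\<And>g. E g \<in> carrier_mat d d" and E': "\<And>g. E' g \<in> carrier_mat r r"
    and F: "F \<in> carrier_mat d r" and int: "\<And>g. E g * F = F * E' g" and f: "finite {w. f w \<noteq> 0}"
  shows "alg_mat d E f * F = F * alg_mat r E' f"
proof -
  have "word_mat d E w * F = F * word_mat r E' w" for w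
  proof (induction w)
    case (Cons g w)
    note W = word_mat_carrier[where E = E, OF E, of w] and W' = word_mat_carrier[where E = E', OF E', of w]
    have "word_mat d E (g # w) * F = E g * (word_mat d E w * F)"
      using assoc_mult_mat[OF E W F] by simp
    also have "\<dots> = E g * F * word_mat r E' w" unfolding Cons by (rule assoc_mult_mat[OF E F W', symmetric])
    also have "\<dots> = F * word_mat r E' (g # w)" unfolding int using assoc_mult_mat[OF F E' W'] by simp
    finally show ?case .
  qed (use F in simp)
  then show ?thesis
    unfolding alg_mat_def by (intro lin_mat_intertwine f F word_mat_carrier E E')
qed

text \<open>The image of an injective intertwiner \<^term>\<open>F\<close> is a submodule; the quotient by it is realised
  on $K^s$ by a cokernel of \<^term>\<open>F\<close>.\<close>

lemma quotient_rep_exists: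
  fixes D :: "'k::field hopf_data"
  assumes rep: "is_rep D d E" "is_rep D r E'" and F: "F \<in> carrier_mat d r"
    and inj: "inj_on (\<lambda>v. F *\<^sub>v v) (carrier_vec r)" and int: "\<And>g. E g * F = F * E' g"
  obtains s E'' where "d = r + s" "is_rep D s E''"
    "short_exact D (mod_of_gens D r E') (mod_of_gens D d E) (mod_of_gens D s E'')"
proof -
  have E: "\<And>g. E g \<in> carrier_mat d d" and E': "\<And>g. E' g \<in> carrier_mat r r"
    using rep by (auto simp: is_rep_def)
  obtain G s where G: "d = r + s" "G \<in> carrier_mat s d"
    "(\<lambda>v. F *\<^sub>v v) ` carrier_vec r = {v \<in> carrier_vec d. G *\<^sub>v v = 0\<^sub>v s}"
    "(\<lambda>v. G *\<^sub>v v) ` carrier_vec d = carrier_vec s"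
    using cokernel_exists[OF F inj] by blast
  obtain R S where RS: "R \<in> carrier_mat r d" "S \<in> carrier_mat d s" "F * R = 1\<^sub>m d - S * G"
    "G * S = 1\<^sub>m s" "R * F = 1\<^sub>m r" "G * F = 0\<^sub>m s r"
    using exact_splitting[OF F G(2) inj G(3,4)] .
  define E'' where "E'' g = G * E g * S" for g
  have E'': "E'' g \<in> carrier_mat s s" for g
    unfolding E''_def using mult_carrier_mat[OF mult_carrier_mat[OF G(2) E] RS(2)] .
  have int': "E'' g * G = G * E g" for g
  proof -
    have GE: "G * E g \<in> carrier_mat s d" using G(2) E by (rule mult_carrier_mat)
    have SG: "S * G \<in> carrier_mat d d" using RS(2) G(2) by (rule mult_carrier_mat)
    have "G * E g * (F * R) = G * (E g * F) * R"
      using assoc_mult_mat[OF GE F RS(1)] assoc_mult_mat[OF G(2) E F] by simp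
    also have "\<dots> = G * F * E' g * R" unfolding int using assoc_mult_mat[OF G(2) F E'] by simp
    also have "\<dots> = 0\<^sub>m s d" unfolding RS(6) using E' RS(1) by (simp add: left_mult_zero_mat[OF E'])
    finally have "G * E g * (1\<^sub>m d - S * G) = 0\<^sub>m s d" unfolding RS(3) .
    then have "G * E g - G * E g * (S * G) = 0\<^sub>m s d"
      using mult_minus_distrib_mat[OF GE one_carrier_mat SG] right_mult_one_mat[OF GE] by simp
    then have "G * E g = G * E g * (S * G)"
      using minus_mat_eq_0_iff[OF GE mult_carrier_mat[OF GE SG]] by simp
    also have "\<dots> = E'' g * G" unfolding E''_def using assoc_mult_mat[OF GE RS(2) G(2)] by simp
    finally show ?thesis by simp
  qed
  have alg: "alg_mat s E'' f * G = G * alg_mat d E f" if "finite {w. f w \<noteq> 0}" for f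
    by (rule intertwine_alg_mat[OF E'' E G(2) int' that])
  have rep'': "is_rep D s E''"
    unfolding is_rep_def
  proof (intro conjI allI ballI E'')
    fix r' assume r': "r' \<in> relators D"
    have "alg_mat s E'' r' * G = 0\<^sub>m s d"
      unfolding alg[OF relators_fin[OF r']] using rep(1) r' G(2) by (simp add: is_rep_def)
    then have "alg_mat s E'' r' * G * S = 0\<^sub>m s s" using RS(2) by simp
    then show "alg_mat s E'' r' = 0\<^sub>m s s"
      using assoc_mult_mat[OF alg_mat_carrier G(2) RS(2), of E'' r'] RS(4)
        right_mult_one_mat[OF alg_mat_carrier, of s E'' r'] by simp
  qed
  have "short_exact D (mod_of_gens D r E') (mod_of_gens D d E) (mod_of_gens D s E'')"
    unfolding short_exact_def fst_mod_of_gens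
  proof (intro exI conjI ballI)
    fix h assume "h \<in> carrier (Halg D)"
    then obtain f where f: "f \<in> carrier free_alg" "h = hcls D f" by (rule Halg_cases)
    then have fin: "finite {w. f w \<noteq> 0}" by (simp add: fa_simps)
    show "F * snd (mod_of_gens D r E') h = snd (mod_of_gens D d E) h * F"
      using intertwine_alg_mat[OF E E' F int fin] f
      by (simp add: snd_mod_of_gens[OF rep(1)] snd_mod_of_gens[OF rep(2)])
    show "G * snd (mod_of_gens D d E) h = snd (mod_of_gens D s E'') h * G"
      using alg[OF fin] f by (simp add: snd_mod_of_gens[OF rep(1)] snd_mod_of_gens[OF rep''])
  qed (use F G inj in auto)
  then show thesis using that G(1) rep'' by blast
qed


section \<open>Roots of unity\<close>

lemma finite_roots_of_unity: "m > 0 \<Longrightarrow> finite {u::'a::field. u ^ m = 1}"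
  and card_roots_of_unity: "m > 0 \<Longrightarrow> card {u::'a::field. u ^ m = 1} \<le> m"
proof -
  assume m: "m > 0"
  let ?p = "monom 1 m + [:- 1:] :: 'a poly"
  have deg: "degree ?p = m" using m by (simp add: degree_add_eq_left degree_monom_eq)
  then have p0: "?p \<noteq> 0" using m by auto
  have eq: "{u. u ^ m = 1} = {u. poly ?p u = 0}" by (auto simp: poly_monom)
  show "finite {u::'a. u ^ m = 1}" unfolding eq using p0 by (rule poly_roots_finite)
  show "card {u::'a. u ^ m = 1} \<le> m" unfolding eq using card_poly_roots_bound[OF p0] deg by simp
qed

lemma primitive_root_nonzero: "primitive_root m z \<Longrightarrow> z \<noteq> 0"
  by (auto simp: primitive_root_def power_0_left split: if_splits)

lemma primitive_root_inj:
  assumes "primitive_root m z"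
  shows "inj_on (\<lambda>j. z ^ j) {..<m}"
proof (rule linorder_inj_onI')
  fix i j assume ij: "i \<in> {..<m}" "j \<in> {..<m}" "i < j"
  show "z ^ i \<noteq> z ^ j"
  proof
    assume "z ^ i = z ^ j"
    also have "z ^ j = z ^ i * z ^ (j - i)" using ij by (simp flip: power_add)
    finally have "z ^ (j - i) = 1" using primitive_root_nonzero[OF assms] by simp
    then show False using assms ij unfolding primitive_root_def by auto
  qed
qed

lemma bij_betw_roots_of_unity:
  assumes "primitive_root m z"
  shows "bij_betw (\<lambda>j. z ^ j) {..<m} {u. u ^ m = 1}"
proof -
  have m: "m > 0" "z ^ m = 1" using assms by (auto simp: primitive_root_def)
  have "(\<lambda>j. z ^ j) ` {..<m} \<subseteq> {u. u ^ m = 1}"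
    using m by (auto simp: mult.commute power_mult simp flip: power_mult)
      (metis m(2) mult.commute power_mult power_one)
  moreover have "card ((\<lambda>j. z ^ j) ` {..<m}) = m"
    by (simp add: card_image[OF primitive_root_inj[OF assms]])
  ultimately have "(\<lambda>j. z ^ j) ` {..<m} = {u. u ^ m = 1}"
    using card_roots_of_unity[OF m(1)] finite_roots_of_unity[OF m(1)] by (intro card_seteq) auto
  then show ?thesis using primitive_root_inj[OF assms] by (simp add: bij_betw_def)
qed


section \<open>Characters of the torus\<close>

text \<open>A triple \<^term>\<open>(\<alpha>, \<beta>, \<gamma>)\<close> is the character of the group generated by $a, b, c$ with these
  values; as the restricted characters of modules, it is extended to words by the value $1$ on
  \<^term>\<open>Gx\<close> and \<^term>\<open>Gy\<close>.\<close>

fun tval :: "'k::field \<times> 'k \<times> 'k \<Rightarrow> gen \<Rightarrow> 'k" where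
  "tval (\<alpha>, \<beta>, \<gamma>) g = (case g of Ga \<Rightarrow> \<alpha> | Ga' \<Rightarrow> inverse \<alpha> | Gb \<Rightarrow> \<beta> | Gb' \<Rightarrow> inverse \<beta>
     | Gc \<Rightarrow> \<gamma> | Gc' \<Rightarrow> inverse \<gamma> | Gx \<Rightarrow> 1 | Gy \<Rightarrow> 1)"

definition chi :: "'k::field \<times> 'k \<times> 'k \<Rightarrow> gen list \<Rightarrow> 'k" where
  "chi t w = prod_list (map (tval t) w)"

text \<open>The value $1$ at \<^term>\<open>Gx\<close> and \<^term>\<open>Gy\<close> matches the omission of these letters in \<^const>\<open>trch\<close>.\<close>

lemma prod_tval_filter: "prod_list (map (tval t) (filter grp w)) = chi t w"
proof (induction w)
  case (Cons g w)
  then show ?case by (cases t; cases g) (auto simp: grp_def chi_def)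
qed (simp add: chi_def)

lemma chi_mult: "chi (\<alpha>, \<beta>, \<gamma>) * chi (\<alpha>', \<beta>', \<gamma>') = chi (\<alpha> * \<alpha>', \<beta> * \<beta>', \<gamma> * \<gamma>')"
proof
  fix w
  show "(chi (\<alpha>, \<beta>, \<gamma>) * chi (\<alpha>', \<beta>', \<gamma>')) w = chi (\<alpha> * \<alpha>', \<beta> * \<beta>', \<gamma> * \<gamma>') w"
  proof (induction w)
    case (Cons g w)
    then show ?case by (cases g) (auto simp: chi_def mult_ac)
  qed (simp add: chi_def)
qed

lemma chi_one: "chi (1, 1, 1) = 1"
proof
  fix w show "chi (1, 1, 1) w = (1 :: gen list \<Rightarrow> 'a) w"
  proof (induction w)
    case (Cons g w)
    then show ?case by (cases g) (auto simp: chi_def)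
  qed (simp add: chi_def)
qed

lemma chi_append: "chi t (u @ v) = chi t u * chi t v"
  by (simp add: chi_def)

lemma inj_chi: "inj chi"
proof (rule injI)
  fix s t :: "'a \<times> 'a \<times> 'a" assume eq: "chi s = chi t"
  obtain a b c a' b' c' where st: "s = (a, b, c)" "t = (a', b', c')" by (metis prod_cases3)
  have "chi s [Ga] = chi t [Ga]" "chi s [Gb] = chi t [Gb]" "chi s [Gc] = chi t [Gc]" using eq by auto
  then show "s = t" by (simp add: st chi_def)
qed

text \<open>Dedekind's independence of characters, here of the monoid of words.\<close>

lemma characters_independent:
  fixes A :: "('m list \<Rightarrow> 'k::field) set"
  assumes "finite A" and mult: "\<And>f u v. f \<in> A \<Longrightarrow> f (u @ v) = f u * f v" and one: "\<And>f. f \<in> A \<Longrightarrow> f [] = 1"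
    and "\<And>w. (\<Sum>f\<in>A. c f * f w) = 0" and "f \<in> A"
  shows "c f = 0"
  using assms
proof (induction A arbitrary: c f rule: finite_induct)
  case (insert e A)
  have zero: "c h = 0" if h: "h \<in> A" for h
  proof -
    have ne: "h \<noteq> e" using h insert.hyps by auto
    then obtain u where u: "h u \<noteq> e u" by auto
    have cancel: "x - y = 0" if "x + z = 0" "y + z = 0" for x y z :: 'k
      using that by (metis add_right_cancel right_minus_eq)
    have "(\<Sum>f\<in>A. (c f * (f u - e u)) * f w) = 0" for w
    proof -
      have "(\<Sum>f\<in>A. c f * f (u @ w)) + c e * e (u @ w) = 0"
        using insert.prems(3)[of "u @ w"] insert.hyps by (simp add: add.commute)
      moreover have "e u * (\<Sum>f\<in>A. c f * f w) + e u * (c e * e w) = 0"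
        using insert.prems(3)[of w] insert.hyps by (simp add: add.commute flip: distrib_left)
      moreover have "(\<Sum>f\<in>A. c f * f (u @ w)) = (\<Sum>f\<in>A. c f * f u * f w)"
        using insert.prems(1) by (intro sum.cong) (auto simp: mult.assoc)
      moreover have "e (u @ w) = e u * e w" using insert.prems(1) by auto
      ultimately have "(\<Sum>f\<in>A. c f * f u * f w) + c e * (e u * e w) = 0"
        "e u * (\<Sum>f\<in>A. c f * f w) + c e * (e u * e w) = 0"
        by (simp_all add: mult.left_commute)
      then have "(\<Sum>f\<in>A. c f * f u * f w) - e u * (\<Sum>f\<in>A. c f * f w) = 0"
        by (rule cancel)
      then show ?thesis
        by (simp add: sum_distrib_left algebra_simps flip: sum_subtractf)
    qed
    then have "c h * (h u - e u) = 0"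
      using insert.IH[of "\<lambda>f. c f * (f u - e u)" h] insert.prems(1,2) h by auto
    then show ?thesis using u by simp
  qed
  have "(\<Sum>f\<in>insert e A. c f * f []) = c e * e []"
    using insert.hyps zero by simp
  then have "c e = 0" using insert.prems(2)[of e] insert.prems(3)[of "[]"] by simp
  then show ?case using zero insert.prems(4) by auto
qed simp

lemma chi_independent:
  assumes "finite S" "(\<Sum>t\<in>S. (\<lambda>w. c t) * chi t) = 0" "s \<in> S"
  shows "c s = 0"
proof -
  have inj: "inj_on chi S" using inj_chi by (rule inj_on_subset) simp
  let ?c = "\<lambda>f. c (inv_into S chi f)"
  have "?c (chi s) = 0"
  proof (rule characters_independent[of "chi ` S" ?c "chi s"])
    fix w
    have "(\<Sum>f\<in>chi ` S. ?c f * f w) = (\<Sum>t\<in>S. c t * chi t w)"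
      by (simp add: sum.reindex[OF inj] inv_into_f_f[OF inj])
    also have "\<dots> = (\<Sum>t\<in>S. (\<lambda>w. c t) * chi t) w"
    proof -
      have "(\<Sum>t\<in>S. F t) w = (\<Sum>t\<in>S. F t w)" for F :: "_ \<Rightarrow> gen list \<Rightarrow> 'a"
        by (induction S rule: infinite_finite_induct) auto
      then show ?thesis by simp
    qed
    finally show "(\<Sum>f\<in>chi ` S. ?c f * f w) = 0" using assms(2) by simp
  qed (use assms in \<open>auto simp: chi_append chi_def\<close>)
  then show ?thesis using inv_into_f_f[OF inj assms(3)] by simp
qed


section \<open>The simple modules\<close>

text \<open>The matrices of the one-dimensional module on which $a, b, c$ act by the given values.\<close>

definition v0_gen :: "'k::field \<times> 'k \<times> 'k \<Rightarrow> gen \<Rightarrow> 'k mat" where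
  "v0_gen t g = mat 1 1 (\<lambda>_. if grp g then tval t g else 0)"

lemma zero_smult_mat: "A \<in> carrier_mat m k \<Longrightarrow> 0 \<cdot>\<^sub>m (A :: 'k::field mat) = 0\<^sub>m m k"
  by (intro eq_matI) auto

text \<open>The matrices of $V_I(\alpha^n,\beta,\gamma;i)$, where $\alpha$ is the eigenvalue of $a$ on
  $m_0$. The generator $y$ acts as zero.\<close>

fun vi_gen :: "'k::field hopf_data \<Rightarrow> 'k \<times> 'k \<times> 'k \<Rightarrow> gen \<Rightarrow> 'k mat" where
  "vi_gen D (\<alpha>, \<beta>, \<gamma>) Gx = mat (dn D) (dn D) (\<lambda>(r, j). if j < dn D - 1 then (if r = j + 1 then 1 else 0)
     else if r = 0 then beta1 D * (\<alpha> ^ (dn D * dn1 D) - \<beta> ^ dn D) else 0)"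
| "vi_gen D (\<alpha>, \<beta>, \<gamma>) Gy = 0\<^sub>m (dn D) (dn D)"
| "vi_gen D (\<alpha>, \<beta>, \<gamma>) g = mat_diag (dn D) (\<lambda>j. tval (\<alpha> * inverse (dq D) ^ j, \<beta>, \<gamma>) g)"

lemma vi_gen_grp:
  "grp g \<Longrightarrow> vi_gen D (\<alpha>, \<beta>, \<gamma>) g = mat_diag (dn D) (\<lambda>j. tval (\<alpha> * inverse (dq D) ^ j, \<beta>, \<gamma>) g)"
  by (cases g) (auto simp: grp_def)

lemma vi_gen_carrier: "vi_gen D t g \<in> carrier_mat (dn D) (dn D)"
  by (cases t; cases g) (auto simp: mat_diag_def)

text \<open>The case $\beta_1 \neq 0$, $\beta_2 = \beta_3 = 0$, with a choice of $n$-th roots.\<close>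

locale half_datum =
  fixes D :: "'k::{alg_closed_field, field_char_0} hopf_data" and rt :: "'k \<Rightarrow> 'k"
  assumes n_ge_2: "dn D \<ge> 2" and prim: "primitive_root (dn D) (dq D)" and n1_pos: "1 \<le> dn1 D"
    and Hopf: "is_Hopf D" and rt: "\<And>\<gamma>. \<gamma> \<noteq> 0 \<Longrightarrow> rt \<gamma> ^ dn D = \<gamma>" and rt_1: "rt 1 = 1"
    and beta1: "beta1 D \<noteq> 0" and beta2: "beta2 D = 0" and beta3: "beta3 D = 0"
begin

abbreviation "n \<equiv> dn D"
abbreviation "n1 \<equiv> dn1 D"
abbreviation "q \<equiv> dq D"

lemma n_pos: "n > 0" using n_ge_2 by simp

lemma q_nonzero: "q \<noteq> 0" using primitive_root_nonzero[OF prim] .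

lemma q_pow_n: "q ^ n = 1" using prim by (simp add: primitive_root_def)

lemma rt_nonzero: "\<gamma> \<noteq> 0 \<Longrightarrow> rt \<gamma> \<noteq> 0"
  using rt[of \<gamma>] n_pos by (metis power_0_left not_gr_zero)

text \<open>The parameters of the one-dimensional modules.\<close>

definition Lam :: "('k \<times> 'k \<times> 'k) set" where
  "Lam = {(\<alpha>, \<beta>, \<gamma>). \<alpha> \<noteq> 0 \<and> \<beta> \<noteq> 0 \<and> \<gamma> \<noteq> 0 \<and> \<alpha> ^ (n * n1) = \<beta> ^ n}"

text \<open>The parameters of all simple modules up to isomorphism: $V_I(\gamma_1,\gamma_2,\gamma_3;i)$ does
  not depend on $i$, and is represented by the chosen $n$-th root of $\gamma_1$.\<close>

definition Idx :: "('k \<times> 'k \<times> 'k) set" where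
  "Idx = {(\<alpha>, \<beta>, \<gamma>). \<alpha> \<noteq> 0 \<and> \<beta> \<noteq> 0 \<and> \<gamma> \<noteq> 0 \<and> (\<alpha> ^ (n * n1) = \<beta> ^ n \<or> rt (\<alpha> ^ n) = \<alpha>)}"

text \<open>The dimension and the matrices of the simple module with parameter \<^term>\<open>t\<close>, and that module:
  a $V_0$ if \<^term>\<open>t \<in> Lam\<close>, a $V_I$ otherwise.\<close>

definition sdim :: "'k \<times> 'k \<times> 'k \<Rightarrow> nat" where
  "sdim t = (if t \<in> Lam then 1 else n)"

definition sgen :: "'k \<times> 'k \<times> 'k \<Rightarrow> gen \<Rightarrow> 'k mat" where
  "sgen t = (if t \<in> Lam then v0_gen t else vi_gen D t)"

definition smod :: "'k \<times> 'k \<times> 'k \<Rightarrow> 'k hmod" where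
  "smod t = mod_of_gens D (sdim t) (sgen t)"

lemma Lam_subset_Idx: "Lam \<subseteq> Idx"
  by (auto simp: Lam_def Idx_def)

lemma sgen_carrier: "sgen t g \<in> carrier_mat (sdim t) (sdim t)"
  by (auto simp: sgen_def sdim_def v0_gen_def vi_gen_carrier)

lemma is_rep_v0:
  assumes "t \<in> Lam"
  shows "is_rep D 1 (v0_gen t)"
proof -
  obtain a b c where t: "t = (a, b, c)" by (metis prod_cases3)
  have "is_rep D 1 (\<lambda>g. mat 1 1 (\<lambda>_. if grp g then tval t g else 0))"
    by (rule is_rep_scalar) (use assms n_pos in \<open>auto simp: t grp_def Lam_def beta2 beta3\<close>)
  then show ?thesis by (simp add: v0_gen_def[abs_def])
qed

lemma word_mat_2: 
  assumes "\<And>g. E g \<in> carrier_mat d d"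
  shows "word_mat d E [g, h] = E g * E h"
  using assms by (simp add: right_mult_one_mat[OF assms])

lemma word_mat_vi_x:
  assumes "k \<le> n"
  shows "word_mat n (vi_gen D (\<alpha>, \<beta>, \<gamma>)) (replicate k Gx) = mat n n (\<lambda>(r, j).
    if j + k < n then (if r = j + k then 1 else 0)
    else if r = j + k - n then beta1 D * (\<alpha> ^ (n * n1) - \<beta> ^ n) else 0)"
  using assms
proof (induction k)
  case 0
  show ?case by (auto intro!: eq_matI)
next
  case (Suc k)
  let ?l = "beta1 D * (\<alpha> ^ (n * n1) - \<beta> ^ n)" and ?E = "vi_gen D (\<alpha>, \<beta>, \<gamma>)"
  let ?N = "word_mat n ?E (replicate k Gx)"
  have N: "?N = mat n n (\<lambda>(r, j). if j + k < n then (if r = j + k then 1 else 0)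
    else if r = j + k - n then ?l else 0)" using Suc by simp
  show ?case
  proof (rule eq_matI)
    let ?R = "mat n n (\<lambda>(r, j). if j + Suc k < n then (if r = j + Suc k then 1 else 0)
      else if r = j + Suc k - n then ?l else 0)"
    fix r j assume "r < dim_row ?R" "j < dim_col ?R"
    then have rj: "r < n" "j < n" by auto
    define \<sigma> where "\<sigma> = (if j + k < n then j + k else j + k - n)"
    define c where "c = (if j + k < n then 1 else ?l)"
    have \<sigma>: "\<sigma> < n" using rj Suc.prems by (auto simp: \<sigma>_def)
    have "word_mat n ?E (replicate (Suc k) Gx) $$ (r, j) = (\<Sum>s<n. ?E Gx $$ (r, s) * ?N $$ (s, j))"
      using rj by (simp add: N scalar_prod_def atLeast0LessThan)
    also have "\<dots> = (\<Sum>s<n. if s = \<sigma> then ?E Gx $$ (r, s) * c else 0)"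
      using rj by (intro sum.cong) (auto simp: N \<sigma>_def c_def)
    also have "\<dots> = ?E Gx $$ (r, \<sigma>) * c" using \<sigma> by simp
    also have "\<dots> = ?R $$ (r, j)"
      using rj \<sigma> Suc.prems by (auto simp: \<sigma>_def c_def)
    finally show "word_mat n ?E (replicate (Suc k) Gx) $$ (r, j) = ?R $$ (r, j)" .
  qed (simp_all add: N)
qed

lemma word_mat_vi_grp:
  assumes "\<forall>g\<in>set w. grp g"
  shows "word_mat n (vi_gen D (\<alpha>, \<beta>, \<gamma>)) w
    = mat_diag n (\<lambda>j. prod_list (map (tval (\<alpha> * inverse q ^ j, \<beta>, \<gamma>)) w))"
  using assms by (induction w) (simp_all add: vi_gen_grp mat_diag_one)

lemma is_rep_vi:
  assumes nz: "\<alpha> \<noteq> 0" "\<beta> \<noteq> 0" "\<gamma> \<noteq> 0"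
  shows "is_rep D n (vi_gen D (\<alpha>, \<beta>, \<gamma>))"
proof -
  let ?E = "vi_gen D (\<alpha>, \<beta>, \<gamma>)"
  define l where "l = beta1 D * (\<alpha> ^ (n * n1) - \<beta> ^ n)"
  have E: "?E g \<in> carrier_mat n n" for g by (rule vi_gen_carrier)
  have an: "(\<alpha> * inverse q ^ j) ^ (n * n1) = \<alpha> ^ (n * n1)" for j
  proof -
    have "(inverse q ^ j) ^ (n * n1) = inverse ((q ^ n) ^ (j * n1))"
      by (simp add: power_inverse mult_ac flip: power_mult)
    then show ?thesis by (simp add: power_mult_distrib q_pow_n)
  qed
  have Gx: "?E Gx = mat n n (\<lambda>(r, j). if j < n - 1 then (if r = j + 1 then 1 else 0) else if r = 0 then l else 0)"
    unfolding l_def by (rule vi_gen.simps(1))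
  have rep_tval: "prod_list (map (tval t) (replicate k g)) = tval t g ^ k" for t :: "'k \<times> 'k \<times> 'k" and k g
    by (induction k) auto
  have diag: "?E Ga = mat_diag n (\<lambda>j. \<alpha> * inverse q ^ j)" "?E Gb = mat_diag n (\<lambda>_. \<beta>)"
    "?E Gc = mat_diag n (\<lambda>_. \<gamma>)" by simp_all
  have comm: "?E Gx * mat_diag n f = t \<cdot>\<^sub>m (mat_diag n f * ?E Gx)"
    if "\<And>r j. r < n \<Longrightarrow> j < n \<Longrightarrow> ?E Gx $$ (r, j) \<noteq> 0 \<Longrightarrow> f j = t * f r" for f t
    unfolding mat_diag_mult_left[OF E] mat_diag_mult_right[OF E]
    using that by (intro eq_matI) (auto simp del: vi_gen.simps simp: mult_ac)
  have comm_const: "?E Gx * mat_diag n (\<lambda>_. c) = mat_diag n (\<lambda>_. c) * ?E Gx" for c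
    unfolding mat_diag_mult_left[OF E] mat_diag_mult_right[OF E] by (simp add: mult.commute del: vi_gen.simps)
  have q1: "inverse q ^ (n - 1) = q"
    using q_nonzero q_pow_n n_pos by (metis inverse_eq_iff_eq inverse_unique left_inverse mult.commute
        power_inverse power_minus_mult)
  show ?thesis
    unfolding is_rep_iff Let_def beta2 beta3
  proof (intro conjI allI E)
    show "word_mat n ?E [Gx, Ga] = q \<cdot>\<^sub>m word_mat n ?E [Ga, Gx]"
      unfolding word_mat_2[OF E] diag
    proof (rule comm)
      fix r j assume rj: "r < n" "j < n" "?E Gx $$ (r, j) \<noteq> 0"
      then consider "r = Suc j" | "r = 0" "j = n - 1" by (auto simp: Gx split: if_splits)
      then show "\<alpha> * inverse q ^ j = q * (\<alpha> * inverse q ^ r)"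
        using q_nonzero q1 by cases auto
    qed
    show "word_mat n ?E [Gb, Gx] = word_mat n ?E [Gx, Gb]"
      "word_mat n ?E [Gc, Gx] = word_mat n ?E [Gx, Gc]"
      unfolding word_mat_2[OF E] diag by (rule comm_const[symmetric])+
    show "word_mat n ?E (replicate n Gx)
        = beta1 D \<cdot>\<^sub>m (word_mat n ?E (replicate (n * n1) Ga) - word_mat n ?E (replicate n Gb))"
      unfolding word_mat_vi_x[OF order_refl]
      by (subst (1 2) word_mat_vi_grp)
         (auto simp: grp_def rep_tval an mat_diag_def right_diff_distrib intro!: eq_matI)
    show "word_mat n ?E (replicate n Gy)
        = 0 \<cdot>\<^sub>m (word_mat n ?E (replicate (n * n1) Ga) - word_mat n ?E (replicate n Gc))"
    proof -
      obtain k where k: "n = Suc k" using n_pos by (cases n) auto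
      have "word_mat n ?E (replicate n Gy) = 0\<^sub>m n n * word_mat n ?E (replicate k Gy)"
        by (simp add: k)
      also have "\<dots> = 0\<^sub>m n n" using word_mat_carrier[where E = ?E, OF E] by (rule left_mult_zero_mat)
      also have "\<dots> = 0 \<cdot>\<^sub>m (word_mat n ?E (replicate (n * n1) Ga) - word_mat n ?E (replicate n Gc))"
        by (rule zero_smult_mat[OF minus_carrier_mat[OF word_mat_carrier[where E = ?E, OF E]], symmetric])
      finally show ?thesis .
    qed
    show "word_mat n ?E [Gy, Gx] - inverse (q ^ n1) \<cdot>\<^sub>m word_mat n ?E [Gx, Gy]
        = 0 \<cdot>\<^sub>m (word_mat n ?E (replicate (2 * n1) Ga) - word_mat n ?E [Gb, Gc])"
      unfolding word_mat_2[OF E] vi_gen.simps(2) left_mult_zero_mat[OF E] right_mult_zero_mat[OF E]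
        zero_smult_mat[OF minus_carrier_mat[OF mult_carrier_mat[OF E E]]]
      by (intro eq_matI) auto
    show "word_mat n ?E [Gy, Ga] = inverse q \<cdot>\<^sub>m word_mat n ?E [Ga, Gy]"
      "word_mat n ?E [Gb, Gy] = word_mat n ?E [Gy, Gb]"
      "word_mat n ?E [Gc, Gy] = word_mat n ?E [Gy, Gc]"
      unfolding word_mat_2[OF E] vi_gen.simps(2) left_mult_zero_mat[OF E] right_mult_zero_mat[OF E]
      by (auto intro!: eq_matI)
  qed (auto simp: word_mat_vi_grp grp_def nz q_nonzero mult_ac mat_diag_one simp flip: mat_diag_one
      simp del: vi_gen.simps word_mat_simps)
qed

lemma is_rep_smod: "t \<in> Idx \<Longrightarrow> is_rep D (sdim t) (sgen t)"
  by (cases t) (auto simp: sdim_def sgen_def is_rep_v0 is_rep_vi Idx_def simp del: One_nat_def)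

lemma smod_in_hmods: "t \<in> Idx \<Longrightarrow> smod t \<in> hmods D"
  unfolding smod_def by (intro mod_of_gens_in_hmods is_rep_smod)

text \<open>The sum of the characters in the orbit of a triple under the shifts of $\alpha$ by powers
  of $q$, that is, by all $n$-th roots of unity.\<close>

fun orb :: "'k \<times> 'k \<times> 'k \<Rightarrow> gen list \<Rightarrow> 'k" where
  "orb (\<alpha>, \<beta>, \<gamma>) = (\<Sum>u | u ^ n = 1. chi (\<alpha> * u, \<beta>, \<gamma>))"

text \<open>The character of the simple module with parameter \<^term>\<open>t\<close>, see \<open>trch_smod\<close>.\<close>

definition tau :: "'k \<times> 'k \<times> 'k \<Rightarrow> gen list \<Rightarrow> 'k" where
  "tau t = (if t \<in> Lam then chi t else orb t)"

lemma sum_apply: "(\<Sum>t\<in>S. F t) w = (\<Sum>t\<in>S. F t w)" for F :: "_ \<Rightarrow> gen list \<Rightarrow> 'k"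
  by (induction S rule: infinite_finite_induct) auto

lemma sum_powers_q: "(\<Sum>j<n. f (q ^ j)) = (\<Sum>u | u ^ n = 1. f u)"
  by (rule sum.reindex_bij_betw[OF bij_betw_roots_of_unity[OF prim]])

lemma trch_smod:
  assumes "t \<in> Idx"
  shows "trch D (smod t) = tau t"
proof
  fix w
  obtain a b c where t: "t = (a, b, c)" by (metis prod_cases3)
  have grp: "\<forall>g\<in>set (filter grp w). grp g" by simp
  have trch: "trch D (smod t) w = mtrace (word_mat (sdim t) (sgen t) (filter grp w))"
    unfolding smod_def by (rule trch_mod_of_gens[OF is_rep_smod[OF assms]])
  show "trch D (smod t) w = tau t w"
  proof (cases "t \<in> Lam")
    case True
    have "word_mat 1 (v0_gen t) (filter grp w) = mat 1 1 (\<lambda>_. prod_list (map (\<lambda>g. if grp g then tval t g else 0) (filter grp w)))"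
      unfolding v0_gen_def[abs_def] by (rule word_mat_scalar)
    also have "map (\<lambda>g. if grp g then tval t g else 0) (filter grp w) = map (tval t) (filter grp w)" by simp
    finally show ?thesis using True by (simp add: trch sdim_def sgen_def tau_def mtrace_def prod_tval_filter)
  next
    case False
    have "trch D (smod t) w = (\<Sum>j<n. chi (a * inverse q ^ j, b, c) w)"
      using False unfolding trch unfolding t
      by (simp add: sdim_def sgen_def word_mat_vi_grp[OF grp] mtrace_def mat_diag_def prod_tval_filter)
    also have "\<dots> = (\<Sum>j<n. chi (a * inverse (q ^ j), b, c) w)" by (simp add: power_inverse)
    also have "\<dots> = (\<Sum>u | u ^ n = 1. chi (a * inverse u, b, c) w)" by (rule sum_powers_q)
    also have "\<dots> = (\<Sum>u | u ^ n = 1. chi (a * u, b, c) w)"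
      by (rule sum.reindex_bij_witness[where i = inverse and j = inverse]) (auto simp: power_inverse)
    also have "\<dots> = tau t w" using False by (simp add: t tau_def sum_apply)
    finally show ?thesis .
  qed
qed

lemma V0_eq:
  assumes "\<gamma>1 \<noteq> 0" "\<gamma>2 \<noteq> 0" "\<gamma>3 \<noteq> 0" "\<gamma>1 ^ n1 = \<gamma>2 ^ n"
  shows "(rt \<gamma>1 * q powi i, \<gamma>2, \<gamma>3) \<in> Lam" "V0 D rt \<gamma>1 \<gamma>2 \<gamma>3 i = smod (rt \<gamma>1 * q powi i, \<gamma>2, \<gamma>3)"
proof -
  have "(q powi i) ^ n = 1"
    by (metis mult.commute power_int_mult power_int_of_nat q_pow_n power_int_1_left)
  then have pow: "(rt \<gamma>1 * q powi i) ^ n = \<gamma>1" using rt[OF assms(1)] by (simp add: power_mult_distrib)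
  show Lam: "(rt \<gamma>1 * q powi i, \<gamma>2, \<gamma>3) \<in> Lam"
    using assms rt_nonzero[OF assms(1)] q_nonzero unfolding Lam_def by (simp add: power_mult pow)
  have "(\<lambda>g. mat 1 1 (\<lambda>_. case g of Ga \<Rightarrow> rt \<gamma>1 * q powi i | Ga' \<Rightarrow> inverse (rt \<gamma>1 * q powi i)
      | Gb \<Rightarrow> \<gamma>2 | Gb' \<Rightarrow> inverse \<gamma>2 | Gc \<Rightarrow> \<gamma>3 | Gc' \<Rightarrow> inverse \<gamma>3 | Gx \<Rightarrow> 0 | Gy \<Rightarrow> 0))
    = v0_gen (rt \<gamma>1 * q powi i, \<gamma>2, \<gamma>3)"
  proof
    fix g show "mat 1 1 (\<lambda>_. case g of Ga \<Rightarrow> rt \<gamma>1 * q powi i | Ga' \<Rightarrow> inverse (rt \<gamma>1 * q powi i)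
      | Gb \<Rightarrow> \<gamma>2 | Gb' \<Rightarrow> inverse \<gamma>2 | Gc \<Rightarrow> \<gamma>3 | Gc' \<Rightarrow> inverse \<gamma>3 | Gx \<Rightarrow> 0 | Gy \<Rightarrow> 0)
      = v0_gen (rt \<gamma>1 * q powi i, \<gamma>2, \<gamma>3) g"
      by (cases g) (simp_all add: v0_gen_def grp_def)
  qed
  then show "V0 D rt \<gamma>1 \<gamma>2 \<gamma>3 i = smod (rt \<gamma>1 * q powi i, \<gamma>2, \<gamma>3)"
    using Lam by (simp add: V0_def Let_def smod_def sdim_def sgen_def)
qed

text \<open>Since all factors but $\kappa$ itself are nonzero multiples of $\kappa$, only $\kappa = 0$ makes the
  product vanish; so $y$ acts as zero on $V_I$.\<close>

lemma VI_k1_eq_0: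
  assumes "VI_scalar D \<gamma>1 \<gamma>2 \<noteq> 0"
  shows "VI_k1 D \<gamma>1 \<gamma>2 = 0"
  unfolding VI_k1_def
proof (rule the_equality)
  show "(\<Prod>l = 1..n. VI_k D \<gamma>1 \<gamma>2 0 l) = 0"
    using n_pos by (intro prod_zero bexI[of _ 1]) (auto simp: VI_k_def)
  show "\<kappa> = 0" if "(\<Prod>l = 1..n. VI_k D \<gamma>1 \<gamma>2 \<kappa> l) = 0" for \<kappa>
    using that assms q_nonzero by (auto simp: VI_k_def split: if_splits)
qed

lemma VI_eq:
  assumes "\<gamma>1 \<noteq> 0" "\<gamma>2 \<noteq> 0" "\<gamma>3 \<noteq> 0" "\<gamma>1 ^ n1 \<noteq> \<gamma>2 ^ n"
  shows "(rt \<gamma>1, \<gamma>2, \<gamma>3) \<in> Idx - Lam" "VI D rt \<gamma>1 \<gamma>2 \<gamma>3 0 = smod (rt \<gamma>1, \<gamma>2, \<gamma>3)"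
proof -
  have pow: "rt \<gamma>1 ^ (n * n1) = \<gamma>1 ^ n1" using rt[OF assms(1)] by (simp add: power_mult)
  show Idx: "(rt \<gamma>1, \<gamma>2, \<gamma>3) \<in> Idx - Lam"
    using assms rt_nonzero[OF assms(1)] by (auto simp: Idx_def Lam_def pow rt)
  have "VI_k1 D \<gamma>1 \<gamma>2 = 0" using assms(4) by (intro VI_k1_eq_0) (simp add: VI_scalar_def beta1)
  then have k: "VI_k D \<gamma>1 \<gamma>2 (VI_k1 D \<gamma>1 \<gamma>2) l = 0" for l by (simp add: VI_k_def)
  have al: "rt \<gamma>1 * q powi (0 - int j) = rt \<gamma>1 * inverse q ^ j" for j
    by (simp add: power_int_minus power_inverse)
  have "mod_of_gens D n (\<lambda>g. mat n n (\<lambda>(r, j). case g of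
        Ga \<Rightarrow> (if r = j then rt \<gamma>1 * inverse q ^ j else 0)
      | Ga' \<Rightarrow> (if r = j then inverse (rt \<gamma>1 * inverse q ^ j) else 0)
      | Gb \<Rightarrow> (if r = j then \<gamma>2 else 0)
      | Gb' \<Rightarrow> (if r = j then inverse \<gamma>2 else 0)
      | Gc \<Rightarrow> (if r = j then \<gamma>3 else 0)
      | Gc' \<Rightarrow> (if r = j then inverse \<gamma>3 else 0)
      | Gx \<Rightarrow> (if j < n - 1 then (if r = j + 1 then 1 else 0)
               else (if r = 0 then (\<gamma>1 ^ n1 - \<gamma>2 ^ n) * beta1 D else 0))
      | Gy \<Rightarrow> (if j = 0 then (if r = n - 1 then 0 else 0)
               else (if r = j - 1 then 0 else 0))))
    = mod_of_gens D n (vi_gen D (rt \<gamma>1, \<gamma>2, \<gamma>3))"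
  proof (rule arg_cong[where f = "mod_of_gens D n"], rule ext, goal_cases)
    case (1 g)
    show ?case by (cases g) (auto simp: mat_diag_def pow mult.commute intro!: eq_matI)
  qed
  then show "VI D rt \<gamma>1 \<gamma>2 \<gamma>3 0 = smod (rt \<gamma>1, \<gamma>2, \<gamma>3)"
    using Idx unfolding VI_def Let_def k al by (simp add: smod_def sdim_def sgen_def)
qed

end


section \<open>Simple submodules\<close>

lemma smult_mat_mult_vec:
  assumes "A \<in> carrier_mat m k" "v \<in> carrier_vec k"
  shows "(c \<cdot>\<^sub>m A) *\<^sub>v v = c \<cdot>\<^sub>v (A *\<^sub>v (v :: 'k::field vec))"
  using assms by (intro eq_vecI) auto

lemma zero_mat_mult_vec: "v \<in> carrier_vec k \<Longrightarrow> 0\<^sub>m m k *\<^sub>v (v :: 'k::field vec) = 0\<^sub>v m"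
  by (intro eq_vecI) auto

lemma smult_minus_smult:
  assumes "x \<in> carrier_vec d" "u \<in> carrier_vec d"
  shows "m \<cdot>\<^sub>v x - c \<cdot>\<^sub>v (m \<cdot>\<^sub>v u) = m \<cdot>\<^sub>v (x - c \<cdot>\<^sub>v (u :: 'k::field vec))"
  using assms by (auto intro!: eq_vecI simp: algebra_simps)

lemma word_mat_mult_vec:
  assumes E: "\<And>g. E g \<in> carrier_mat d d" and v: "v \<in> carrier_vec d"
  shows "word_mat d E w *\<^sub>v v = foldr (\<lambda>g u. E g *\<^sub>v u) w v"
proof (induction w)
  case (Cons g w)
  then show ?case using assoc_mult_mat_vec[OF E word_mat_carrier[where E = E, OF E] v] by simp
qed (use v in simp)

lemma index_mult_cols:
  assumes "A \<in> carrier_mat m d" "\<And>j. j < r \<Longrightarrow> v j \<in> carrier_vec d" "i < m" "j < r"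
  shows "(A * mat d r (\<lambda>(i, j). v j $ i)) $$ (i, j) = (A *\<^sub>v v j) $ i"
proof -
  have "col (mat d r (\<lambda>(i, j). v j $ i)) j = v j" using assms(2)[OF assms(4)] assms(4) by (auto intro!: eq_vecI)
  then show ?thesis using assms by simp
qed

lemma eigenvectors_independent:
  fixes A :: "'k::field mat" and r :: nat
  assumes A: "A \<in> carrier_mat d d" and v: "\<And>j. j < r \<Longrightarrow> v j \<in> carrier_vec d" "\<And>j. j < r \<Longrightarrow> v j \<noteq> 0\<^sub>v d"
    and eig: "\<And>j. j < r \<Longrightarrow> A *\<^sub>v v j = a j \<cdot>\<^sub>v v j" and inj: "inj_on a {..<r}"
    and zero: "\<And>i. i < d \<Longrightarrow> (\<Sum>j<r. c j * v j $ i) = 0" and "j < r"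
  shows "c j = 0"
  using assms
proof (induction r arbitrary: c j)
  case (Suc r)
  have av: "(\<Sum>j<Suc r. c j * (a j * v j $ i)) = 0" if i: "i < d" for i
  proof -
    have "(A *\<^sub>v v j) $ i = a j * v j $ i" if "j < Suc r" for j
      unfolding Suc.prems(4)[OF that] using Suc.prems(2)[OF that] i by simp
    then have "(\<Sum>j<Suc r. c j * (a j * v j $ i)) = (\<Sum>j<Suc r. c j * (A *\<^sub>v v j) $ i)"
      by (intro sum.cong) auto
    also have "\<dots> = (\<Sum>j<Suc r. \<Sum>k<d. A $$ (i, k) * (c j * v j $ k))"
      using i index_mult_mat_vec_sum[OF A Suc.prems(2)]
      by (intro sum.cong) (simp_all add: sum_distrib_left mult.left_commute del: sum.lessThan_Suc)
    also have "\<dots> = (\<Sum>k<d. A $$ (i, k) * (\<Sum>j<Suc r. c j * v j $ k))"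
      by (subst sum.swap) (simp add: sum_distrib_left del: sum.lessThan_Suc)
    also have "\<dots> = 0" using Suc.prems(6) by simp
    finally show ?thesis .
  qed
  have less: "c j = 0" if j: "j < r" for j
  proof -
    have "c j * (a j - a r) = 0"
    proof (rule Suc.IH[of "\<lambda>j. c j * (a j - a r)"])
      fix i assume i: "i < d"
      have "(\<Sum>j<Suc r. c j * (a j - a r) * v j $ i)
          = (\<Sum>j<Suc r. c j * (a j * v j $ i)) - a r * (\<Sum>j<Suc r. c j * v j $ i)"
        unfolding sum_distrib_left sum_subtractf[symmetric] by (intro sum.cong) (auto simp: algebra_simps)
      then show "(\<Sum>j<r. c j * (a j - a r) * v j $ i) = 0"
        unfolding av[OF i] Suc.prems(6)[OF i] by simp
    next
      show "inj_on a {..<r}" using Suc.prems(5) by (rule inj_on_subset) auto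
    qed (use Suc.prems(1-4) j in auto)
    moreover have "a j \<noteq> a r" using Suc.prems(5) j by (auto dest: inj_onD)
    ultimately show ?thesis by simp
  qed
  obtain i where i: "i < d" "v r $ i \<noteq> 0"
    using Suc.prems(2,3)[of r] by (metis eq_vecI carrier_vecD index_zero_vec lessI)
  have "c r * v r $ i = 0" using Suc.prems(6)[OF i(1)] less by simp
  then have "c r = 0" using i by simp
  then show ?case using less Suc.prems(7) by (auto simp: less_Suc_eq)
qed simp

context half_datum
begin

lemma inverse_q_pow_inj: "inj_on (\<lambda>j. inverse q ^ j) {..<n}"
  by (rule primitive_root_inj[OF primitive_root_inverse[OF prim]])

text \<open>Since $y^n = 0$, the kernel of $y$ is nonzero. It is stable under $a, b, c$, which commute with
  each other and with $y$ up to scalars, and so contains a common eigenvector $v$ of them, with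
  eigenvalues $\alpha, \beta, \gamma$. The vectors $x^j v$ are again such eigenvectors, with the eigenvalues
  $\alpha q^{-j}$ of $a$, and $x^n v = \mu v$ for $\mu = \beta_1(\alpha^{n n_1} - \beta^n)$. If $\mu = 0$, the last nonzero
  $x^j v$ spans a one-dimensional submodule. Otherwise $x^i v, \dots, x^{i+n-1} v$ are linearly
  independent for every $i$ and span a $V_I$; a suitable $i$ turns the eigenvalue of $a$ on the
  first of them into the chosen root of $\alpha^n$.\<close>

lemma simple_submodule:
  assumes rep: "is_rep D d E" and d: "d > 0"
  obtains t F where "t \<in> Idx" "F \<in> carrier_mat d (sdim t)"
    "inj_on (\<lambda>v. F *\<^sub>v v) (carrier_vec (sdim t))" "\<And>g. E g * F = F * sgen t g"
proof -
  note thesisI = that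
  have E: "\<And>g. E g \<in> carrier_mat d d" using rep by (simp add: is_rep_def)
  have W: "word_mat d E w \<in> carrier_mat d d" for w by (rule word_mat_carrier[where E = E, OF E])
  let ?act = "\<lambda>g v. E g *\<^sub>v v"
  note R = rep[unfolded is_rep_iff Let_def]
  have actc: "?act g v \<in> carrier_vec d" if "v \<in> carrier_vec d" for g v
    using mult_mat_vec_carrier[OF E that] .
  have act_smult: "?act g (c \<cdot>\<^sub>v v) = c \<cdot>\<^sub>v ?act g v" if "v \<in> carrier_vec d" for g c v
    using mult_mat_vec_smult[OF E that] .
  have fold: "word_mat d E w *\<^sub>v v = foldr ?act w v" if "v \<in> carrier_vec d" for w v
    by (rule word_mat_mult_vec[where E = E, OF E that])
  have vec1: "foldr ?act u v = t \<cdot>\<^sub>v foldr ?act w v"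
    if "word_mat d E u = t \<cdot>\<^sub>m word_mat d E w" "v \<in> carrier_vec d" for u w v t
    unfolding fold[OF that(2), symmetric] that(1) by (rule smult_mat_mult_vec[OF W that(2)])
  have vec2: "foldr ?act u v = 1 \<cdot>\<^sub>v foldr ?act w v"
    if "word_mat d E u = word_mat d E w" "v \<in> carrier_vec d" for u w v
    unfolding fold[OF that(2), symmetric] that(1) by simp
  have yx: "word_mat d E [Gy, Gx] = inverse (q ^ n1) \<cdot>\<^sub>m word_mat d E [Gx, Gy]"
    using R unfolding beta3 zero_smult_mat[OF minus_carrier_mat[OF W]]
      minus_mat_eq_0_iff[OF W smult_carrier_mat[OF W]] by blast
  have comm: "\<exists>t. ?act Gy (?act g v) = t \<cdot>\<^sub>v ?act g (?act Gy v)"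
    if g: "g \<in> {Ga, Gb, Gc, Gx}" and v: "v \<in> carrier_vec d" for g v
  proof -
    have "word_mat d E [Gy, Ga] = inverse q \<cdot>\<^sub>m word_mat d E [Ga, Gy]"
      "word_mat d E [Gy, Gb] = word_mat d E [Gb, Gy]" "word_mat d E [Gy, Gc] = word_mat d E [Gc, Gy]"
      using R by metis+
    note eqs = vec1[OF this(1) v, unfolded foldr.simps o_apply id_apply]
      vec2[OF this(2) v, unfolded foldr.simps o_apply id_apply]
      vec2[OF this(3) v, unfolded foldr.simps o_apply id_apply]
      vec1[OF yx v, unfolded foldr.simps o_apply id_apply]
    consider "g = Ga" | "g = Gb" | "g = Gc" | "g = Gx" using g by blast
    then show ?thesis by cases (simp only:, rule exI, rule eqs)+
  qed
  have comm1: "?act h (?act g v) = ?act g (?act h v)"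
    if "(h, g) \<in> {(Ga, Gb), (Ga, Gc), (Gb, Gc), (Gb, Gx), (Gc, Gx)}" "v \<in> carrier_vec d" for h g v
  proof -
    have "word_mat d E [h, g] = word_mat d E [g, h]" using R that(1) by auto
    then show ?thesis using vec2[OF _ that(2), of "[h, g]" "[g, h]"] by simp
  qed
  have comm_ax: "?act Ga (?act Gx v) = inverse q \<cdot>\<^sub>v ?act Gx (?act Ga v)" if v: "v \<in> carrier_vec d" for v
  proof -
    have "word_mat d E [Gx, Ga] = q \<cdot>\<^sub>m word_mat d E [Ga, Gx]" using R by metis
    from vec1[OF this v] have "?act Gx (?act Ga v) = q \<cdot>\<^sub>v ?act Ga (?act Gx v)" by simp
    then show ?thesis using q_nonzero by (simp add: smult_smult_assoc)
  qed
  \<comment> \<open>the kernel of $y$ and the joint eigenspaces in it are stable under the remaining operators\<close>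
  have eig_stable: "?act h (?act g u - c \<cdot>\<^sub>v u) = \<mu> \<cdot>\<^sub>v (?act g u - c \<cdot>\<^sub>v u)"
    if u: "u \<in> carrier_vec d" and c: "?act h (?act g u) = \<mu> \<cdot>\<^sub>v ?act g u" "?act h u = \<mu> \<cdot>\<^sub>v u" for h g u c \<mu>
  proof -
    have "?act h (?act g u - c \<cdot>\<^sub>v u) = ?act h (?act g u) - ?act h (c \<cdot>\<^sub>v u)"
      using u actc by (intro mult_minus_distrib_mat_vec[OF E]) auto
    also have "\<dots> = \<mu> \<cdot>\<^sub>v ?act g u - c \<cdot>\<^sub>v (\<mu> \<cdot>\<^sub>v u)" unfolding act_smult[OF u] c ..
    also have "\<dots> = \<mu> \<cdot>\<^sub>v (?act g u - c \<cdot>\<^sub>v u)" by (rule smult_minus_smult[OF actc[OF u] u])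
    finally show ?thesis .
  qed
  have y_stable: "?act Gy (?act g u) = 0 \<cdot>\<^sub>v ?act g u"
    if u: "u \<in> carrier_vec d" "?act Gy u = 0 \<cdot>\<^sub>v u" "g \<in> {Ga, Gb, Gc, Gx}" for g u
  proof -
    obtain t where "?act Gy (?act g u) = t \<cdot>\<^sub>v ?act g (?act Gy u)" using comm[OF u(3,1)] by (elim exE)
    then show ?thesis unfolding u(2) act_smult[OF u(1)] by (simp add: smult_smult_assoc)
  qed
  have eig_stable1: "?act h (?act g u) = \<mu> \<cdot>\<^sub>v ?act g u"
    if "u \<in> carrier_vec d" "?act h u = \<mu> \<cdot>\<^sub>v u" "(h, g) \<in> {(Ga, Gb), (Ga, Gc), (Gb, Gc), (Gb, Gx), (Gc, Gx)}" for h g u \<mu>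
    using comm1[OF that(3,1)] that(2) act_smult[OF that(1)] by simp
  have replicate: "foldr ?act (replicate m g) v = ((*\<^sub>v) (E g) ^^ m) v" for m g v
    by (induction m) auto
  have "word_mat d E (replicate n Gy) = 0\<^sub>m d d"
    using R unfolding beta2 zero_smult_mat[OF minus_carrier_mat[OF W]] by blast
  then have "((*\<^sub>v) (E Gy) ^^ n) (unit_vec d 0) = 0\<^sub>v d"
    using fold[of "unit_vec d 0" "replicate n Gy"] unfolding replicate by (simp add: zero_mat_mult_vec)
  moreover have "unit_vec d 0 \<noteq> (0\<^sub>v d :: 'k vec)" using d by (metis index_unit_vec(1) index_zero_vec(1) zero_neq_one)
  ultimately obtain k where k: "((*\<^sub>v) (E Gy) ^^ k) (unit_vec d 0) \<noteq> 0\<^sub>v d"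
    "((*\<^sub>v) (E Gy) ^^ Suc k) (unit_vec d 0) = 0\<^sub>v d"
    using kernel_element_in_orbit[OF E unit_vec_carrier] by metis
  define v0 where "v0 = ((*\<^sub>v) (E Gy) ^^ k) (unit_vec d 0)"
  have v0c: "v0 \<in> carrier_vec d" unfolding v0_def by (rule funpow_mat_carrier[OF E unit_vec_carrier])
  have v0: "v0 \<noteq> 0\<^sub>v d" "?act Gy v0 = 0 \<cdot>\<^sub>v v0"
    using k unfolding zero_smult_vec'[OF v0c] by (simp_all add: v0_def)
  have carr: "?act g u - c \<cdot>\<^sub>v u \<in> carrier_vec d" if "u \<in> carrier_vec d" for g u c
    by (rule minus_carrier_vec[OF actc[OF that]]) (use that in simp)
  have stable_y: "?act Gy (?act g u - c \<cdot>\<^sub>v u) = 0 \<cdot>\<^sub>v (?act g u - c \<cdot>\<^sub>v u)"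
    if "u \<in> carrier_vec d" "?act Gy u = 0 \<cdot>\<^sub>v u" "g \<in> {Ga, Gb, Gc, Gx}" for g u c
    by (rule eig_stable[OF that(1) y_stable[OF that] that(2)])
  have stable_e: "?act h (?act g u - c \<cdot>\<^sub>v u) = \<mu> \<cdot>\<^sub>v (?act g u - c \<cdot>\<^sub>v u)"
    if "u \<in> carrier_vec d" "?act h u = \<mu> \<cdot>\<^sub>v u" "(h, g) \<in> {(Ga, Gb), (Ga, Gc), (Gb, Gc), (Gb, Gx), (Gc, Gx)}"
    for h g u \<mu> c
    by (rule eig_stable[OF that(1) eig_stable1[OF that] that(2)])
  have ex_eig: "\<exists>w \<alpha>. w \<in> U \<and> w \<noteq> 0\<^sub>v d \<and> ?act g w = \<alpha> \<cdot>\<^sub>v w"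
    if "U \<subseteq> carrier_vec d" "\<And>u c. u \<in> U \<Longrightarrow> ?act g u - c \<cdot>\<^sub>v u \<in> U" "x \<in> U" "x \<noteq> 0\<^sub>v d" for U g x
    using eigenvector_in_stable_set[OF E that] by metis
  define U1 where "U1 = {u \<in> carrier_vec d. ?act Gy u = 0 \<cdot>\<^sub>v u}"
  have "\<exists>w \<alpha>. w \<in> U1 \<and> w \<noteq> 0\<^sub>v d \<and> ?act Ga w = \<alpha> \<cdot>\<^sub>v w"
  proof (rule ex_eig)
    show "?act Ga u - c \<cdot>\<^sub>v u \<in> U1" if "u \<in> U1" for u c
      using that carr[of u] stable_y[of u Ga c] by (simp add: U1_def)
  qed (use v0 v0c in \<open>auto simp: U1_def\<close>)
  then obtain v1 \<alpha> where v1: "v1 \<in> U1" "v1 \<noteq> 0\<^sub>v d" "?act Ga v1 = \<alpha> \<cdot>\<^sub>v v1" by blast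
  define U2 where "U2 = {u \<in> U1. ?act Ga u = \<alpha> \<cdot>\<^sub>v u}"
  have "\<exists>w \<beta>. w \<in> U2 \<and> w \<noteq> 0\<^sub>v d \<and> ?act Gb w = \<beta> \<cdot>\<^sub>v w"
  proof (rule ex_eig)
    show "?act Gb u - c \<cdot>\<^sub>v u \<in> U2" if "u \<in> U2" for u c
      using that carr[of u] stable_y[of u Gb c] stable_e[of u Ga \<alpha> Gb c] by (simp add: U1_def U2_def)
  qed (use v1 in \<open>auto simp: U1_def U2_def\<close>)
  then obtain v2 \<beta> where v2: "v2 \<in> U2" "v2 \<noteq> 0\<^sub>v d" "?act Gb v2 = \<beta> \<cdot>\<^sub>v v2" by blast
  define U3 where "U3 = {u \<in> U2. ?act Gb u = \<beta> \<cdot>\<^sub>v u}"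
  have "\<exists>w \<gamma>. w \<in> U3 \<and> w \<noteq> 0\<^sub>v d \<and> ?act Gc w = \<gamma> \<cdot>\<^sub>v w"
  proof (rule ex_eig)
    show "?act Gc u - c \<cdot>\<^sub>v u \<in> U3" if "u \<in> U3" for u c
      using that carr[of u] stable_y[of u Gc c] stable_e[of u Ga \<alpha> Gc c] stable_e[of u Gb \<beta> Gc c]
      by (simp add: U1_def U2_def U3_def)
  qed (use v2 in \<open>auto simp: U1_def U2_def U3_def\<close>)
  then obtain v \<gamma> where v: "v \<in> U3" "v \<noteq> 0\<^sub>v d" "?act Gc v = \<gamma> \<cdot>\<^sub>v v" by blast
  \<comment> \<open>common eigenvectors killed by $y$; only the eigenvalue of $a$ changes under $x$\<close>
  define J where "J a u \<longleftrightarrow> u \<in> carrier_vec d \<and> ?act Ga u = a \<cdot>\<^sub>v u \<and> ?act Gb u = \<beta> \<cdot>\<^sub>v u \<and> ?act Gc u = \<gamma> \<cdot>\<^sub>v u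
    \<and> ?act Gy u = 0 \<cdot>\<^sub>v u" for a u
  have Jv: "J \<alpha> v" using v by (auto simp: J_def U1_def U2_def U3_def)
  have J_step: "J (a * inverse q) (?act Gx u)" if "J a u" for a u
  proof -
    have u: "u \<in> carrier_vec d" using that by (simp add: J_def)
    have "?act Ga (?act Gx u) = (a * inverse q) \<cdot>\<^sub>v ?act Gx u"
      using that comm_ax[OF u] by (simp add: J_def act_smult smult_smult_assoc mult.commute)
    then show ?thesis
      using that y_stable[OF u, of Gx] eig_stable1[OF u, of Gb \<beta> Gx] eig_stable1[OF u, of Gc \<gamma> Gx] actc[OF u]
      by (simp add: J_def)
  qed
  define xp where "xp j u = ((*\<^sub>v) (E Gx) ^^ j) u" for j u
  have J_xp: "J (a * inverse q ^ j) (xp j u)" if "J a u" for a u j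
  proof (induction j)
    case (Suc j)
    then show ?case using J_step[OF Suc] by (simp add: xp_def mult_ac)
  qed (use that in \<open>simp add: xp_def\<close>)
  have inv: "a \<noteq> 0 \<and> ?act h' u = inverse a \<cdot>\<^sub>v u"
    if u: "u \<in> carrier_vec d" "u \<noteq> 0\<^sub>v d" "?act h u = a \<cdot>\<^sub>v u" and h: "(h, h') \<in> {(Ga, Ga'), (Gb, Gb'), (Gc, Gc')}" for h h' a u
  proof -
    have eq1: "word_mat d E [h', h] = 1\<^sub>m d" using R h by auto
    have "foldr ?act [h', h] u = 1\<^sub>m d *\<^sub>v u" unfolding fold[OF u(1), symmetric] eq1 ..
    then have "?act h' (?act h u) = u" using u(1) by simp
    then have eq: "a \<cdot>\<^sub>v ?act h' u = u" unfolding u(3) act_smult[OF u(1)] .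
    have a: "a \<noteq> 0"
    proof
      assume "a = 0"
      then have "u = 0\<^sub>v d" using eq zero_smult_vec'[OF actc[OF u(1)], of h'] by simp
      then show False using u(2) by simp
    qed
    have "?act h' u = inverse a \<cdot>\<^sub>v (a \<cdot>\<^sub>v ?act h' u)" using a by (simp add: smult_smult_assoc)
    then show ?thesis using a unfolding eq by simp
  qed
  have nz: "a \<noteq> 0" "\<beta> \<noteq> 0" "\<gamma> \<noteq> 0" if "J a u" "u \<noteq> 0\<^sub>v d" for a u
    using inv[of u Ga a Ga'] inv[of u Gb \<beta> Gb'] inv[of u Gc \<gamma> Gc'] that by (auto simp: J_def)
  have grp_act: "?act g u = tval (a, \<beta>, \<gamma>) g \<cdot>\<^sub>v u" if "J a u" "u \<noteq> 0\<^sub>v d" "grp g" for a u g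
    using inv[of u Ga a Ga'] inv[of u Gb \<beta> Gb'] inv[of u Gc \<gamma> Gc'] that by (cases g) (auto simp: J_def grp_def)
  have pow_act: "((*\<^sub>v) (E g) ^^ m) u = c ^ m \<cdot>\<^sub>v u" if "u \<in> carrier_vec d" "?act g u = c \<cdot>\<^sub>v u" for g m c u
    by (induction m) (use that in \<open>simp_all add: act_smult smult_smult_assoc mult.commute\<close>)
  have xn: "xp n u = (beta1 D * (a ^ (n * n1) - \<beta> ^ n)) \<cdot>\<^sub>v u" if "J a u" for a u
  proof -
    have u: "u \<in> carrier_vec d" using that by (simp add: J_def)
    have Rx: "word_mat d E (replicate n Gx) = beta1 D \<cdot>\<^sub>m (word_mat d E (replicate (n * n1) Ga) - word_mat d E (replicate n Gb))"
      using R by blast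
    have "xp n u = (beta1 D \<cdot>\<^sub>m (word_mat d E (replicate (n * n1) Ga) - word_mat d E (replicate n Gb))) *\<^sub>v u"
      unfolding xp_def replicate[symmetric] fold[OF u, symmetric] Rx ..
    also have "\<dots> = beta1 D \<cdot>\<^sub>v ((word_mat d E (replicate (n * n1) Ga) - word_mat d E (replicate n Gb)) *\<^sub>v u)"
      by (rule smult_mat_mult_vec[OF minus_carrier_mat[OF W] u])
    also have "(word_mat d E (replicate (n * n1) Ga) - word_mat d E (replicate n Gb)) *\<^sub>v u
        = word_mat d E (replicate (n * n1) Ga) *\<^sub>v u - word_mat d E (replicate n Gb) *\<^sub>v u"
      by (rule minus_mult_distrib_mat_vec[OF W W u])
    also have "\<dots> = a ^ (n * n1) \<cdot>\<^sub>v u - \<beta> ^ n \<cdot>\<^sub>v u"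
      using that pow_act[where g = Ga and c = a, OF u] pow_act[where g = Gb and c = \<beta>, OF u]
      unfolding fold[OF u] replicate by (simp add: J_def)
    finally show ?thesis using u by (auto intro!: eq_vecI simp: algebra_simps)
  qed
  have q_pow: "(a * inverse q ^ j) ^ n = a ^ n" for a j
  proof -
    have "(a * inverse q ^ j) ^ n = a ^ n * inverse ((q ^ n) ^ j)"
      by (simp add: power_mult_distrib power_inverse mult.commute flip: power_mult)
    then show ?thesis by (simp add: q_pow_n)
  qed
  have xpc: "xp j u \<in> carrier_vec d" if "u \<in> carrier_vec d" for j u
    unfolding xp_def by (rule funpow_mat_carrier[OF E that])
  \<comment> \<open>the columns of the embedding are the vectors $x^j u$\<close>
  have main: thesis
    if t: "t = (a, \<beta>, \<gamma>)" "t \<in> Idx" and u: "J a u" "u \<noteq> 0\<^sub>v d" "\<And>j. j < sdim t \<Longrightarrow> xp j u \<noteq> 0\<^sub>v d"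
      and dim: "sdim t \<le> n"
      and xint: "\<And>i j. i < d \<Longrightarrow> j < sdim t \<Longrightarrow> xp (Suc j) u $ i = (\<Sum>s<sdim t. xp s u $ i * sgen t Gx $$ (s, j))"
    for t a u
  proof -
    have uc: "u \<in> carrier_vec d" using u by (simp add: J_def)
    define F where "F = mat d (sdim t) (\<lambda>(i, j). xp j u $ i)"
    have F: "F \<in> carrier_mat d (sdim t)" by (simp add: F_def)
    have inj: "inj_on (\<lambda>v. F *\<^sub>v v) (carrier_vec (sdim t))"
    proof (rule inj_onI)
      fix x y :: "'k vec" assume xy: "x \<in> carrier_vec (sdim t)" "y \<in> carrier_vec (sdim t)" "F *\<^sub>v x = F *\<^sub>v y"
      have "x $ j - y $ j = 0" if j: "j < sdim t" for j
      proof (rule eigenvectors_independent[OF E[of Ga], of "sdim t" "\<lambda>j. xp j u" "\<lambda>j. a * inverse q ^ j" "\<lambda>j. x $ j - y $ j"])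
        show "inj_on (\<lambda>j. a * inverse q ^ j) {..<sdim t}"
          using inverse_q_pow_inj nz(1)[OF u(1,2)] dim by (auto simp: inj_on_def)
        fix i assume i: "i < d"
        have "(\<Sum>j<sdim t. F $$ (i, j) * x $ j) = (\<Sum>j<sdim t. F $$ (i, j) * y $ j)"
          unfolding index_mult_mat_vec_sum[OF F xy(1) i, symmetric] index_mult_mat_vec_sum[OF F xy(2) i, symmetric]
          by (simp only: xy(3))
        then have "(\<Sum>j<sdim t. xp j u $ i * x $ j) = (\<Sum>j<sdim t. xp j u $ i * y $ j)"
          using i by (simp add: F_def)
        then show "(\<Sum>j<sdim t. (x $ j - y $ j) * xp j u $ i) = 0"
          by (simp add: algebra_simps sum_subtractf)
      next
        fix j show "?act Ga (xp j u) = (a * inverse q ^ j) \<cdot>\<^sub>v xp j u"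
          using J_xp[OF u(1), of j] by (simp add: J_def)
      qed (use j u(3) xpc[OF uc] in auto)
      then show "x = y" using xy by (intro eq_vecI) auto
    qed
    have int: "E g * F = F * sgen t g" for g
    proof (rule eq_matI)
      fix i j assume "i < dim_row (F * sgen t g)" "j < dim_col (F * sgen t g)"
      then have ij: "i < d" "j < sdim t" using F sgen_carrier[of t g] by auto
      have L: "(E g * F) $$ (i, j) = (E g *\<^sub>v xp j u) $ i"
        unfolding F_def by (rule index_mult_cols[OF E xpc[OF uc] ij])
      have Rs: "(F * sgen t g) $$ (i, j) = (\<Sum>s<sdim t. xp s u $ i * sgen t g $$ (s, j))"
        using ij F sgen_carrier[of t g] by (simp add: scalar_prod_def atLeast0LessThan) (simp add: F_def)
      consider "grp g" | "g = Gx" | "g = Gy" by (cases g) (auto simp: grp_def)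
      then show "(E g * F) $$ (i, j) = (F * sgen t g) $$ (i, j)"
      proof cases
        case 1
        have "(\<Sum>s<sdim t. xp s u $ i * sgen t g $$ (s, j))
            = (\<Sum>s<sdim t. if s = j then xp j u $ i * tval (a * inverse q ^ j, \<beta>, \<gamma>) g else 0)"
          using ij 1 by (intro sum.cong)
            (auto simp: sgen_def sdim_def v0_gen_def vi_gen_grp mat_diag_def t(1) simp del: tval.simps split: if_splits)
        also have "\<dots> = xp j u $ i * tval (a * inverse q ^ j, \<beta>, \<gamma>) g" using ij by simp
        finally show ?thesis unfolding L Rs
          unfolding grp_act[OF J_xp[OF u(1)] u(3)[OF ij(2)] 1]
          using ij carrier_vecD[OF xpc[OF uc, of j]] by (simp add: mult.commute)
      next
        case 2
        have "E Gx *\<^sub>v xp j u = xp (Suc j) u" by (simp add: xp_def)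
        then show ?thesis using L Rs xint[OF ij] unfolding 2 by simp
      next
        case 3
        have "(\<Sum>s<sdim t. xp s u $ i * sgen t Gy $$ (s, j)) = 0"
          using ij by (intro sum.neutral) (auto simp: sgen_def sdim_def v0_gen_def grp_def t(1) split: if_splits)
        moreover have "E Gy *\<^sub>v xp j u = 0\<^sub>v d"
          using J_xp[OF u(1), of j] by (simp add: J_def zero_smult_vec'[OF xpc[OF uc]])
        ultimately show ?thesis unfolding L Rs using 3 ij by simp
      qed
    qed (use F sgen_carrier[of t g] E[of g] in auto)
    show thesis by (rule thesisI[OF t(2) F inj int])
  qed
  have vc: "v \<in> carrier_vec d" using Jv by (simp add: J_def)
  show thesis
  proof (cases "\<alpha> ^ (n * n1) = \<beta> ^ n")
    case True
    then have "xp n v = 0\<^sub>v d" using xn[OF Jv] by (simp add: zero_smult_vec'[OF vc])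
    then obtain j where j: "xp j v \<noteq> 0\<^sub>v d" "xp (Suc j) v = 0\<^sub>v d"
      using kernel_element_in_orbit[OF E vc v(2), of n Gx] unfolding xp_def by metis
    let ?u = "xp j v" and ?a = "\<alpha> * inverse q ^ j"
    let ?t = "(?a, \<beta>, \<gamma>)"
    have Ju: "J ?a ?u" by (rule J_xp[OF Jv])
    have "?a ^ (n * n1) = \<alpha> ^ (n * n1)" unfolding power_mult q_pow ..
    then have Lam: "?t \<in> Lam" using True nz[OF Ju j(1)] by (simp add: Lam_def)
    show thesis
    proof (rule main[OF refl _ Ju j(1)])
      show "?t \<in> Idx" using Lam Lam_subset_Idx by blast
      show "xp (Suc j') ?u $ i = (\<Sum>s<sdim ?t. xp s ?u $ i * sgen ?t Gx $$ (s, j'))"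
        if "i < d" "j' < sdim ?t" for i j'
        using that Lam j(2) by (simp add: sdim_def sgen_def v0_gen_def grp_def xp_def)
    qed (use Lam j n_pos in \<open>auto simp: sdim_def xp_def\<close>)
  next
    case False
    define \<mu> where "\<mu> = beta1 D * (\<alpha> ^ (n * n1) - \<beta> ^ n)"
    have mu: "\<mu> \<noteq> 0" using False beta1 by (simp add: \<mu>_def)
    have nzv: "\<alpha> \<noteq> 0" using nz(1)[OF Jv v(2)] .
    have "(rt (\<alpha> ^ n) * inverse \<alpha>) ^ n = 1"
      using rt[of "\<alpha> ^ n"] nzv by (simp add: power_mult_distrib power_inverse)
    then have "rt (\<alpha> ^ n) * inverse \<alpha> \<in> (\<lambda>j. inverse q ^ j) ` {..<n}"
      using bij_betw_roots_of_unity[OF primitive_root_inverse[OF prim]] by (auto simp: bij_betw_def)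
    then obtain i where "rt (\<alpha> ^ n) * inverse \<alpha> = inverse q ^ i" by blast
    then have "\<alpha> * inverse q ^ i = \<alpha> * (rt (\<alpha> ^ n) * inverse \<alpha>)" by simp
    also have "\<dots> = rt (\<alpha> ^ n)" using nzv by simp
    finally have i: "\<alpha> * inverse q ^ i = rt (\<alpha> ^ n)" .
    let ?u = "xp i v" and ?a = "\<alpha> * inverse q ^ i"
    let ?t = "(?a, \<beta>, \<gamma>)"
    have Ju: "J ?a ?u" by (rule J_xp[OF Jv])
    have an: "?a ^ (n * n1) = \<alpha> ^ (n * n1)" unfolding power_mult q_pow ..
    \<comment> \<open>as $x^{nj} v = \mu^j v$ is nonzero\<close>
    have ne: "xp j v \<noteq> 0\<^sub>v d" for j
    proof
      assume "xp j v = 0\<^sub>v d"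
      moreover have "xp (k + j) v = xp k (xp j v)" for k by (simp add: xp_def funpow_add)
      moreover have "xp k (0\<^sub>v d) = 0\<^sub>v d" for k
        unfolding xp_def by (induction k) (simp_all add: mult_mat_zero_vec[OF E])
      ultimately have 0: "xp (k + j) v = 0\<^sub>v d" for k by simp
      have "xp (n * m) v = \<mu> ^ m \<cdot>\<^sub>v v" for m
      proof (induction m)
        case (Suc m)
        have "J \<alpha> (xp (n * m) v)" using J_xp[OF Jv, of "n * m"]
          using q_pow_n by (simp add: power_mult power_inverse)
        then have "xp n (xp (n * m) v) = \<mu> \<cdot>\<^sub>v xp (n * m) v" unfolding \<mu>_def by (rule xn)
        moreover have "xp (n * Suc m) v = xp n (xp (n * m) v)" by (simp add: xp_def funpow_add)
        ultimately show ?case unfolding Suc by (simp add: smult_smult_assoc)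
      qed (simp add: xp_def)
      then have "\<mu> ^ j \<cdot>\<^sub>v v = xp (n * j) v" by simp
      also have "n * j = (n - 1) * j + j" using n_pos by (cases n) auto
      finally have "\<mu> ^ j \<cdot>\<^sub>v v = 0\<^sub>v d" using 0 by simp
      then have "inverse (\<mu> ^ j) \<cdot>\<^sub>v (\<mu> ^ j \<cdot>\<^sub>v v) = 0\<^sub>v d" by (auto intro!: eq_vecI)
      then show False using mu v(2) by (simp add: smult_smult_assoc)
    qed
    have nLam: "?t \<notin> Lam" using False by (simp add: Lam_def an)
    have sd: "sdim ?t = n" using nLam by (simp add: sdim_def)
    have add: "xp j ?u = xp (j + i) v" for j by (simp add: xp_def funpow_add)
    show thesis
    proof (rule main[OF refl _ Ju])
      have "rt (?a ^ n) = ?a" unfolding q_pow by (rule i[symmetric])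
      then show "?t \<in> Idx" using nz[OF Ju ne] unfolding Idx_def by simp
      fix r j assume r: "r < d" and j: "j < sdim ?t"
      have j: "j < n" using j sd by simp
      have "(\<Sum>s<n. xp s ?u $ r * sgen ?t Gx $$ (s, j))
        = (\<Sum>s<n. if s = (if j < n - 1 then j + 1 else 0) then xp s ?u $ r * (if j < n - 1 then 1 else \<mu>) else 0)"
        using nLam j by (intro sum.cong) (auto simp: sgen_def an \<mu>_def)
      also have "\<dots> = xp (if j < n - 1 then j + 1 else 0) ?u $ r * (if j < n - 1 then 1 else \<mu>)"
        using j by (subst sum.delta) auto
      also have "\<dots> = xp (Suc j) ?u $ r"
      proof (cases "j < n - 1")
        case False
        then have "Suc j = n" using j by simp
        moreover have "xp n ?u = \<mu> \<cdot>\<^sub>v ?u" using xn[OF Ju] unfolding an \<mu>_def .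
        ultimately show ?thesis using False r carrier_vecD[OF xpc[OF vc, of i]] by (simp add: xp_def[of 0] mult.commute)
      qed simp
      finally show "xp (Suc j) ?u $ r = (\<Sum>s<sdim ?t. xp s ?u $ r * sgen ?t Gx $$ (s, j))"
        unfolding sd by simp
    qed (auto simp: ne add sd)
  qed
qed

end


section \<open>Integral linear combinations\<close>

lemma of_int_fun_apply [simp]: "(of_int k :: 'a \<Rightarrow> 'b::ring_1) w = of_int k"
proof -
  have nat: "(of_nat m :: 'a \<Rightarrow> 'b) w = of_nat m" for m by (induction m) auto
  show ?thesis by (cases k) (auto simp: nat)
qed

text \<open>The additive extension of \<^term>\<open>g\<close> to the free abelian group.\<close>

definition zlin :: "('x \<Rightarrow> 'b::comm_ring_1) \<Rightarrow> ('x \<Rightarrow>\<^sub>0 int) \<Rightarrow> 'b" where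
  "zlin g P = (\<Sum>x\<in>Poly_Mapping.keys P. of_int (Poly_Mapping.lookup P x) * g x)"

lemma zlin_superset:
  assumes "finite A" "Poly_Mapping.keys P \<subseteq> A"
  shows "zlin g P = (\<Sum>x\<in>A. of_int (Poly_Mapping.lookup P x) * g x)"
  unfolding zlin_def using assms by (intro sum.mono_neutral_left) (auto simp: in_keys_iff)

lemma zlin_0 [simp]: "zlin g 0 = 0"
  by (simp add: zlin_def)

lemma zlin_of [simp]: "zlin g (frag_of x) = g x"
  by (simp add: zlin_def keys_frag_of)

lemma zlin_add: "zlin g (P + Q) = zlin g P + zlin g Q"
proof -
  let ?A = "Poly_Mapping.keys P \<union> Poly_Mapping.keys Q"
  have "zlin g (P + Q) = (\<Sum>x\<in>?A. of_int (Poly_Mapping.lookup (P + Q) x) * g x)"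
    by (rule zlin_superset) (auto dest: subsetD[OF Poly_Mapping.keys_add])
  also have "\<dots> = zlin g P + zlin g Q"
    by (simp add: zlin_superset[of ?A] lookup_add distrib_right sum.distrib)
  finally show ?thesis .
qed

lemma zlin_uminus: "zlin g (- P) = - zlin g P"
  by (simp add: zlin_def sum_negf)

lemma zlin_diff: "zlin g (P - Q) = zlin g P - zlin g Q"
  using zlin_add[of g P "- Q"] by (simp add: zlin_uminus)

lemma zlin_cong: "(\<And>x. x \<in> Poly_Mapping.keys P \<Longrightarrow> g x = h x) \<Longrightarrow> zlin g P = zlin h P"
  by (simp add: zlin_def)

lemma zlin_mult_right: "zlin (\<lambda>x. g x * c) P = zlin g P * c"
  by (simp add: zlin_def sum_distrib_right mult.assoc)

lemma zlin_frag_extend: "zlin g (frag_extend h P) = zlin (\<lambda>x. zlin g (h x)) P"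
  using subset_UNIV[of "Poly_Mapping.keys P"]
proof (induction P rule: frag_induction)
  case (diff a b)
  then show ?case by (simp add: frag_extend_diff zlin_diff)
qed auto

lemma keys_diff_subset: "Poly_Mapping.keys a \<subseteq> S \<Longrightarrow> Poly_Mapping.keys b \<subseteq> S \<Longrightarrow> Poly_Mapping.keys (a - b) \<subseteq> S"
  using keys_diff[of a b] by blast

lemma keys_add_subset: "Poly_Mapping.keys a \<subseteq> S \<Longrightarrow> Poly_Mapping.keys b \<subseteq> S \<Longrightarrow> Poly_Mapping.keys (a + b) \<subseteq> S"
  using Poly_Mapping.keys_add[of a b] by blast


section \<open>The Grothendieck ring as a ring of characters\<close>

text \<open>A commutative ring given as a type, as a ring with carrier.\<close>

definition type_ring :: "'a::comm_ring_1 ring" where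
  "type_ring = \<lparr>carrier = UNIV, monoid.mult = (*), one = 1, ring.zero = 0, add = (+)\<rparr>"

lemma cring_type_ring: "cring (type_ring :: 'a::comm_ring_1 ring)"
proof (rule cringI)
  show "abelian_group (type_ring :: 'a ring)"
    by (rule abelian_groupI) (auto simp: type_ring_def ac_simps intro: exI[of _ "- x" for x] left_minus)
  show "comm_monoid (type_ring :: 'a ring)"
    by (rule comm_monoidI) (auto simp: type_ring_def ac_simps)
qed (auto simp: type_ring_def algebra_simps)

lemma type_ring_simps:
  "carrier (type_ring :: 'a::comm_ring_1 ring) = UNIV" "\<one>\<^bsub>type_ring\<^esub> = (1 :: 'a)" "\<zero>\<^bsub>type_ring\<^esub> = (0 :: 'a)"
  "x \<otimes>\<^bsub>type_ring\<^esub> y = (x * y :: 'a)" "x \<oplus>\<^bsub>type_ring\<^esub> y = (x + y :: 'a)"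
  by (simp_all add: type_ring_def)

lemma type_ring_uminus: "\<ominus>\<^bsub>type_ring\<^esub> x = (- x :: 'a::comm_ring_1)"
proof -
  interpret cring "type_ring :: 'a ring" by (rule cring_type_ring)
  show ?thesis by (rule minus_equality) (simp_all add: type_ring_simps)
qed

lemma cring_if_embeds_type:
  fixes h :: "'a \<Rightarrow> 'b::comm_ring_1"
  assumes inj: "inj_on h (carrier R)"
    and closed: "\<And>x y. x \<in> carrier R \<Longrightarrow> y \<in> carrier R \<Longrightarrow> x \<otimes>\<^bsub>R\<^esub> y \<in> carrier R"
      "\<And>x y. x \<in> carrier R \<Longrightarrow> y \<in> carrier R \<Longrightarrow> x \<oplus>\<^bsub>R\<^esub> y \<in> carrier R"
      "\<one>\<^bsub>R\<^esub> \<in> carrier R" "\<zero>\<^bsub>R\<^esub> \<in> carrier R"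
    and hom: "\<And>x y. x \<in> carrier R \<Longrightarrow> y \<in> carrier R \<Longrightarrow> h (x \<otimes>\<^bsub>R\<^esub> y) = h x * h y"
      "\<And>x y. x \<in> carrier R \<Longrightarrow> y \<in> carrier R \<Longrightarrow> h (x \<oplus>\<^bsub>R\<^esub> y) = h x + h y"
      "h \<one>\<^bsub>R\<^esub> = 1" "h \<zero>\<^bsub>R\<^esub> = 0"
    and neg: "\<And>x. x \<in> carrier R \<Longrightarrow> \<exists>y\<in>carrier R. h y = - h x"
  shows "cring R"
proof -
  interpret T: cring "type_ring :: 'b ring" by (rule cring_type_ring)
  have "ring R"
    by (rule ring_if_embeds[OF T.ring_axioms, of R h])
       (use assms in \<open>auto simp: type_ring_simps type_ring_uminus\<close>)
  then interpret R: ring R .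
  show ?thesis
  proof (rule cring.intro[OF R.ring_axioms], rule comm_monoid.intro[OF R.monoid_axioms], rule comm_monoid_axioms.intro)
    fix x y assume "x \<in> carrier R" "y \<in> carrier R"
    then show "x \<otimes>\<^bsub>R\<^esub> y = y \<otimes>\<^bsub>R\<^esub> x"
      using inj_onD[OF inj, of "x \<otimes>\<^bsub>R\<^esub> y" "y \<otimes>\<^bsub>R\<^esub> x"] by (simp add: closed hom mult.commute)
  qed
qed

lemma add_monoid_free_mod_ring: "add_monoid (free_mod_ring D) = free_Abelian_group (hmods D)"
  by (simp add: free_mod_ring_def free_Abelian_group_def)

context half_datum
begin

abbreviation "keys \<equiv> Poly_Mapping.keys"

text \<open>The character of an integral combination of modules.\<close>

abbreviation trz :: "('k hmod \<Rightarrow>\<^sub>0 int) \<Rightarrow> gen list \<Rightarrow> 'k" where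
  "trz \<equiv> zlin (trch D)"

abbreviation "ses \<equiv> ses_subgroup D"

lemma subgroup_ses: "subgroup ses (free_Abelian_group (hmods D))"
  unfolding ses_subgroup_def add_monoid_free_mod_ring
proof (rule group.generate_is_subgroup[OF group_free_Abelian_group], safe)
  fix A B C assume "A \<in> hmods D" "B \<in> hmods D" "C \<in> hmods D"
  then show "frag_of B - (frag_of A + frag_of C) \<in> carrier (free_Abelian_group (hmods D))"
    unfolding carrier_free_Abelian_group_iff
    by (intro keys_diff_subset keys_add_subset) (auto simp: keys_frag_of)
qed

lemma ses_keys: "P \<in> ses \<Longrightarrow> keys P \<subseteq> hmods D"
  using subgroup.mem_carrier[OF subgroup_ses] by simp

lemma ses_add: "P \<in> ses \<Longrightarrow> Q \<in> ses \<Longrightarrow> P + Q \<in> ses"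
  using subgroup.m_closed[OF subgroup_ses] by simp

lemma ses_uminus: "P \<in> ses \<Longrightarrow> - P \<in> ses"
  using subgroup.m_inv_closed[OF subgroup_ses] ses_keys by simp

lemma ses_0: "0 \<in> ses"
  using subgroup.one_closed[OF subgroup_ses] by simp

lemma ses_gen:
  assumes "short_exact D A B C" "A \<in> hmods D" "B \<in> hmods D" "C \<in> hmods D"
  shows "frag_of B - (frag_of A + frag_of C) \<in> ses"
  unfolding ses_subgroup_def by (rule generate.incl) (use assms in blast)

lemma trz_ses:
  assumes "P \<in> ses"
  shows "trz P = 0"
  using assms unfolding ses_subgroup_def add_monoid_free_mod_ring
proof (induction rule: generate.induct)
  case (incl h)
  then show ?case by (auto simp: zlin_diff zlin_add trch_short_exact)
next
  case (inv h)
  then obtain A B C where h: "h = frag_of B - (frag_of A + frag_of C)" "A \<in> hmods D" "B \<in> hmods D" "C \<in> hmods D"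
    "short_exact D A B C" by blast
  then have "keys h \<subseteq> hmods D"
    unfolding h(1) by (intro keys_diff_subset keys_add_subset) (auto simp: keys_frag_of)
  then show ?case using h by (simp add: zlin_uminus zlin_diff zlin_add trch_short_exact)
qed (simp_all add: zlin_add)

lemma zero_module_in_ses:
  assumes "is_rep D 0 E"
  shows "frag_of (mod_of_gens D 0 E) \<in> ses"
proof -
  let ?M = "mod_of_gens D 0 E"
  have M: "?M \<in> hmods D" by (rule mod_of_gens_in_hmods[OF assms])
  have c0: "carrier_vec 0 = {0\<^sub>v 0 :: 'k vec}" by auto
  have z: "0\<^sub>m 0 0 *\<^sub>v 0\<^sub>v 0 = (0\<^sub>v 0 :: 'k vec)" by (intro eq_vecI) auto
  have "short_exact D ?M ?M ?M"
    unfolding short_exact_def fst_mod_of_gens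
  proof (intro exI conjI ballI)
    fix h assume "h \<in> carrier (Halg D)"
    then obtain f where f: "f \<in> carrier free_alg" "h = hcls D f" by (rule Halg_cases)
    have c: "snd ?M h \<in> carrier_mat 0 0" using f by (simp add: snd_mod_of_gens[OF assms])
    show "0\<^sub>m 0 0 * snd ?M h = snd ?M h * 0\<^sub>m 0 0" "0\<^sub>m 0 0 * snd ?M h = snd ?M h * 0\<^sub>m 0 0"
      using c by (auto intro!: eq_matI)
  qed (auto simp: c0 z)
  from ses_gen[OF this M M M] have "- frag_of ?M \<in> ses" by simp
  from ses_uminus[OF this] show ?thesis by simp
qed

lemma sdim_pos: "sdim t > 0"
  using n_pos by (simp add: sdim_def)

text \<open>Every module has a composition series with factors among the chosen simple modules.\<close>

lemma module_decomposition:
  assumes "is_rep D d E"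
  shows "\<exists>f. keys f \<subseteq> Idx \<and> frag_of (mod_of_gens D d E) - frag_extend (\<lambda>t. frag_of (smod t)) f \<in> ses"
  using assms
proof (induction d arbitrary: E rule: less_induct)
  case (less d)
  show ?case
  proof (cases "d = 0")
    case True
    then show ?thesis using zero_module_in_ses less.prems by (intro exI[of _ 0]) auto
  next
    case False
    then have d: "d > 0" by simp
    obtain t F where t: "t \<in> Idx" "F \<in> carrier_mat d (sdim t)"
      "inj_on (\<lambda>v. F *\<^sub>v v) (carrier_vec (sdim t))" "\<And>g. E g * F = F * sgen t g"
      using simple_submodule[OF less.prems d] by metis
    obtain s E'' where s: "d = sdim t + s" "is_rep D s E''"
      "short_exact D (mod_of_gens D (sdim t) (sgen t)) (mod_of_gens D d E) (mod_of_gens D s E'')"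
      using quotient_rep_exists[OF less.prems is_rep_smod[OF t(1)] t(2,3,4)] by metis
    let ?M = "mod_of_gens D d E" and ?N = "mod_of_gens D s E''" and ?e = "frag_extend (\<lambda>t. frag_of (smod t))"
    have "s < d" using s(1) sdim_pos[of t] by simp
    from less.IH[OF this s(2)] obtain f where f: "keys f \<subseteq> Idx" "frag_of ?N - ?e f \<in> ses" by blast
    have "frag_of ?M - (frag_of (smod t) + frag_of ?N) \<in> ses"
      using s less.prems is_rep_smod[OF t(1)] unfolding smod_def by (intro ses_gen mod_of_gens_in_hmods)
    from ses_add[OF this f(2)] have "frag_of ?M - ?e (f + frag_of t) \<in> ses"
      by (simp add: frag_extend_add algebra_simps)
    moreover have "keys (f + frag_of t) \<subseteq> Idx"
      using f t by (intro keys_add_subset) (auto simp: keys_frag_of)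
    ultimately show ?thesis by blast
  qed
qed

lemma decomposition:
  assumes "keys P \<subseteq> hmods D"
  shows "\<exists>f. keys f \<subseteq> Idx \<and> P - frag_extend (\<lambda>t. frag_of (smod t)) f \<in> ses"
  using assms
proof (induction P rule: frag_induction)
  case zero
  show ?case by (intro exI[of _ 0]) (simp add: ses_0)
next
  case (one M)
  then show ?case using module_decomposition by (metis hmods_cases)
next
  case (diff a b)
  let ?e = "frag_extend (\<lambda>t. frag_of (smod t))"
  obtain f g where fg: "keys f \<subseteq> Idx" "a - ?e f \<in> ses" "keys g \<subseteq> Idx" "b - ?e g \<in> ses" using diff by blast
  have "(a - ?e f) + - (b - ?e g) \<in> ses" using fg by (intro ses_add ses_uminus)
  then have "a - b - ?e (f - g) \<in> ses" by (simp add: frag_extend_diff algebra_simps)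
  then show ?case using keys_diff_subset[OF fg(1,3)] by blast
qed

text \<open>The group characters in the character of the simple module with the given parameter.\<close>

fun orbset :: "'k \<times> 'k \<times> 'k \<Rightarrow> ('k \<times> 'k \<times> 'k) set" where
  "orbset (\<alpha>, \<beta>, \<gamma>) = (if (\<alpha>, \<beta>, \<gamma>) \<in> Lam then {(\<alpha>, \<beta>, \<gamma>)} else (\<lambda>u. (\<alpha> * u, \<beta>, \<gamma>)) ` {u. u ^ n = 1})"

lemma finite_orbset: "finite (orbset t)"
  using finite_roots_of_unity[OF n_pos] by (cases t) (auto intro: finite_imageI)

lemma tau_eq_sum_orbset:
  assumes "t \<in> Idx"
  shows "tau t = (\<Sum>s\<in>orbset t. chi s)"
proof -
  obtain a b c where t: "t = (a, b, c)" by (metis prod_cases3)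
  have "inj_on (\<lambda>u. (a * u, b, c)) {u. u ^ n = 1}" using assms by (auto simp: t Idx_def inj_on_def)
  then show ?thesis by (simp add: t tau_def sum.reindex)
qed

lemma orbset_disjoint:
  assumes "t \<in> Idx" "t' \<in> Idx" "s \<in> orbset t" "s \<in> orbset t'"
  shows "t = t'"
proof -
  obtain a b c a' b' c' where t: "t = (a, b, c)" "t' = (a', b', c')" by (metis prod_cases3)
  have pow2: "(x * u) ^ n = x ^ n" if "u ^ n = 1" for x u :: 'k
    using that by (simp add: power_mult_distrib)
  have pow1: "(x * u) ^ (n * n1) = x ^ (n * n1)" if "u ^ n = 1" for x u :: 'k
    unfolding power_mult pow2[OF that] ..
  note pow = pow1 pow2
  show ?thesis
  proof (cases "t \<in> Lam \<or> t' \<in> Lam")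
    case True
    then show ?thesis using assms by (auto simp: t Lam_def Idx_def pow split: if_splits)
  next
    case False
    then obtain u u' where u: "u ^ n = 1" "u' ^ n = 1" "a * u = a' * u'" "b = b'" "c = c'"
      using assms(3,4) by (auto simp: t)
    have "a ^ n = (a * u) ^ n" by (rule pow(2)[OF u(1), symmetric])
    also have "\<dots> = a' ^ n" unfolding u(3) by (rule pow(2)[OF u(2)])
    finally have "rt (a ^ n) = rt (a' ^ n)" by simp
    then show ?thesis using False assms(1,2) u by (auto simp: t Lam_def Idx_def)
  qed
qed

text \<open>Each group character occurs for at most one parameter, so the coefficients of \<^term>\<open>f\<close> are
  those of a vanishing combination of distinct group characters.\<close>

lemma tau_independent:
  assumes "keys f \<subseteq> Idx" "zlin tau f = 0"
  shows "f = 0"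
proof -
  \<comment> \<open>the parameter to whose orbit \<^term>\<open>s\<close> belongs\<close>
  define own where "own s = (THE t. t \<in> keys f \<and> s \<in> orbset t)" for s
  have own: "own s = t" if "t \<in> keys f" "s \<in> orbset t" for s t
    unfolding own_def by (rule the_equality) (use that assms(1) orbset_disjoint in blast)+
  let ?c = "\<lambda>s. of_int (Poly_Mapping.lookup f (own s)) :: 'k"
  let ?S = "\<Union>t\<in>keys f. orbset t"
  have "(\<Sum>s\<in>?S. (\<lambda>w. ?c s) * chi s) = (\<Sum>t\<in>keys f. \<Sum>s\<in>orbset t. (\<lambda>w. ?c s) * chi s)"
  proof (rule sum.UNION_disjoint)
    show "\<forall>t\<in>keys f. \<forall>t'\<in>keys f. t \<noteq> t' \<longrightarrow> orbset t \<inter> orbset t' = {}"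
      using assms(1) orbset_disjoint by blast
  qed (use finite_orbset in simp_all)
  also have "\<dots> = (\<Sum>t\<in>keys f. of_int (Poly_Mapping.lookup f t) * tau t)"
  proof (intro sum.cong refl)
    fix t assume t: "t \<in> keys f"
    have "(\<Sum>s\<in>orbset t. (\<lambda>w. ?c s) * chi s) = (\<Sum>s\<in>orbset t. of_int (Poly_Mapping.lookup f t) * chi s)"
    proof (rule sum.cong[OF refl])
      fix s assume "s \<in> orbset t"
      then show "(\<lambda>w. ?c s) * chi s = of_int (Poly_Mapping.lookup f t) * chi s"
        using own[OF t] by (simp add: fun_eq_iff)
    qed
    also have "\<dots> = of_int (Poly_Mapping.lookup f t) * tau t"
      unfolding tau_eq_sum_orbset[OF subsetD[OF assms(1) t]] by (simp add: sum_distrib_left)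
    finally show "(\<Sum>s\<in>orbset t. (\<lambda>w. ?c s) * chi s) = of_int (Poly_Mapping.lookup f t) * tau t" .
  qed
  also have "\<dots> = 0" using assms(2) by (simp add: zlin_def)
  finally have zero: "(\<Sum>s\<in>?S. (\<lambda>w. ?c s) * chi s) = 0" .
  have fin: "finite ?S" using finite_orbset by simp
  have "Poly_Mapping.lookup f t = 0" if t: "t \<in> keys f" for t
  proof -
    obtain a b c where abc: "t = (a, b, c)" by (metis prod_cases3)
    have "(a * 1, b, c) \<in> (\<lambda>u. (a * u, b, c)) ` {u. u ^ n = 1}" by (rule imageI) simp
    then have s: "t \<in> orbset t" by (auto simp: abc)
    then have "?c t = 0" using t by (intro chi_independent[OF fin zero]) auto
    then show ?thesis using own[OF t s] by simp
  qed
  then have "keys f = {}" by (metis all_not_in_conv in_keys_iff)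
  then show ?thesis by simp
qed

lemma trz_extend_smod:
  assumes "keys f \<subseteq> Idx"
  shows "trz (frag_extend (\<lambda>t. frag_of (smod t)) f) = zlin tau f"
  unfolding zlin_frag_extend by (rule zlin_cong) (use assms trch_smod in auto)

lemma keys_extend_smod:
  assumes "keys f \<subseteq> Idx"
  shows "keys (frag_extend (\<lambda>t. frag_of (smod t)) f) \<subseteq> hmods D"
proof -
  have "keys (frag_extend (\<lambda>t. frag_of (smod t)) f) \<subseteq> (\<Union>t\<in>keys f. keys (frag_of (smod t)))"
    by (rule keys_frag_extend)
  then show ?thesis using assms smod_in_hmods by (fastforce simp: keys_frag_of)
qed

text \<open>Modules have the same class in the Grothendieck group if and only if they have the same
  character on the group generated by $a, b, c$.\<close>

lemma ses_iff: "P \<in> ses \<longleftrightarrow> keys P \<subseteq> hmods D \<and> trz P = 0"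
proof
  assume "P \<in> ses"
  then show "keys P \<subseteq> hmods D \<and> trz P = 0" using ses_keys trz_ses by blast
next
  assume P: "keys P \<subseteq> hmods D \<and> trz P = 0"
  then obtain f where f: "keys f \<subseteq> Idx" "P - frag_extend (\<lambda>t. frag_of (smod t)) f \<in> ses"
    using decomposition by blast
  have "zlin tau f = 0"
    using trz_ses[OF f(2)] P by (simp add: zlin_diff trz_extend_smod[OF f(1)])
  then have "f = 0" by (rule tau_independent[OF f(1)])
  then show "P \<in> ses" using f(2) by simp
qed

text \<open>The virtual characters, and for each of them the set of the combinations of modules which
  have it. For \<^term>\<open>v \<in> Vch\<close> this set is an element of \<^term>\<open>G0 D\<close>.\<close>

definition Vch :: "(gen list \<Rightarrow> 'k) set" where
  "Vch = trz ` {P. keys P \<subseteq> hmods D}"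

definition cls :: "(gen list \<Rightarrow> 'k) \<Rightarrow> ('k hmod \<Rightarrow>\<^sub>0 int) set" where
  "cls v = {P. keys P \<subseteq> hmods D \<and> trz P = v}"

lemma Vch_eq_tau: "Vch = zlin tau ` {f. keys f \<subseteq> Idx}"
proof (intro equalityI subsetI)
  fix v assume "v \<in> Vch"
  then obtain P where P: "keys P \<subseteq> hmods D" "v = trz P" by (auto simp: Vch_def)
  obtain f where f: "keys f \<subseteq> Idx" "P - frag_extend (\<lambda>t. frag_of (smod t)) f \<in> ses"
    using decomposition[OF P(1)] by blast
  have "v = zlin tau f"
    using trz_ses[OF f(2)] P(2) by (simp add: zlin_diff trz_extend_smod[OF f(1)])
  then show "v \<in> zlin tau ` {f. keys f \<subseteq> Idx}" using f(1) by blast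
next
  fix v assume "v \<in> zlin tau ` {f. keys f \<subseteq> Idx}"
  then obtain f where "keys f \<subseteq> Idx" "v = zlin tau f" by blast
  then show "v \<in> Vch" unfolding Vch_def
    by (intro image_eqI[of _ _ "frag_extend (\<lambda>t. frag_of (smod t)) f"]) (auto simp: trz_extend_smod keys_extend_smod)
qed

lemma trz_in_Vch: "keys P \<subseteq> hmods D \<Longrightarrow> trz P \<in> Vch"
  by (auto simp: Vch_def)

lemma trch_in_Vch: "M \<in> hmods D \<Longrightarrow> trch D M \<in> Vch"
  using trz_in_Vch[of "frag_of M"] by (simp add: keys_frag_of)

lemma coset_eq_cls:
  assumes "keys P \<subseteq> hmods D"
  shows "ses +>\<^bsub>free_mod_ring D\<^esub> P = cls (trz P)"
proof -
  have "ses +>\<^bsub>free_mod_ring D\<^esub> P = {i + P | i. i \<in> ses}"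
    unfolding a_r_coset_def' by (auto simp: free_mod_ring_def)
  also have "\<dots> = cls (trz P)"
  proof (intro equalityI subsetI)
    fix Q assume "Q \<in> {i + P | i. i \<in> ses}"
    then obtain i where "Q = i + P" "i \<in> ses" by blast
    then show "Q \<in> cls (trz P)"
      using assms by (simp add: cls_def ses_iff zlin_add keys_add_subset)
  next
    fix Q assume "Q \<in> cls (trz P)"
    then have "Q - P \<in> ses" using assms by (simp add: cls_def ses_iff zlin_diff keys_diff_subset)
    then show "Q \<in> {i + P | i. i \<in> ses}" by (intro CollectI exI[of _ "Q - P"]) simp
  qed
  finally show ?thesis .
qed

lemma inj_cls: "inj_on cls Vch"
proof (rule inj_onI)
  fix v w assume v: "v \<in> Vch" and eq: "cls v = cls w"
  then obtain P where "P \<in> cls v" by (auto simp: Vch_def cls_def)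
  moreover from this have "P \<in> cls w" using eq by simp
  ultimately show "v = w" by (simp add: cls_def)
qed

lemma mcls_eq_cls: "M \<in> hmods D \<Longrightarrow> mcls D M = cls (trch D M)"
  unfolding mcls_def using coset_eq_cls[of "frag_of M"] by (simp add: keys_frag_of)

lemma carrier_G0: "carrier (G0 D) = cls ` Vch"
proof -
  have "carrier (G0 D) = (\<lambda>P. ses +>\<^bsub>free_mod_ring D\<^esub> P) ` carrier (free_mod_ring D)"
    by (auto simp: G0_def FactRing_def A_RCOSETS_def' )
  also have "carrier (free_mod_ring D) = {P. keys P \<subseteq> hmods D}" by (simp add: free_mod_ring_def)
  also have "(\<lambda>P. ses +>\<^bsub>free_mod_ring D\<^esub> P) ` {P. keys P \<subseteq> hmods D} = cls ` Vch"
    unfolding Vch_def image_image by (rule image_cong) (auto simp: coset_eq_cls)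
  finally show ?thesis .
qed

lemma trz_mult:
  assumes "keys P \<subseteq> hmods D" "keys Q \<subseteq> hmods D"
  shows "keys (P \<otimes>\<^bsub>free_mod_ring D\<^esub> Q) \<subseteq> hmods D" "trz (P \<otimes>\<^bsub>free_mod_ring D\<^esub> Q) = trz P * trz Q"
proof -
  have mult: "P \<otimes>\<^bsub>free_mod_ring D\<^esub> Q = frag_extend (\<lambda>M. frag_extend (\<lambda>N. frag_of (tensor_mod D M N)) Q) P"
    by (simp add: free_mod_ring_def)
  have 1: "keys (frag_extend (\<lambda>N. frag_of (tensor_mod D M N)) Q) \<subseteq> hmods D" if "M \<in> hmods D" for M
    using keys_frag_extend[of "\<lambda>N. frag_of (tensor_mod D M N)" Q] assms(2) tensor_mod_closed[OF Hopf that]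
    by (fastforce simp: keys_frag_of)
  show "keys (P \<otimes>\<^bsub>free_mod_ring D\<^esub> Q) \<subseteq> hmods D"
    unfolding mult using keys_frag_extend[of "\<lambda>M. frag_extend (\<lambda>N. frag_of (tensor_mod D M N)) Q" P] 1 assms(1)
    by fastforce
  have "trz (P \<otimes>\<^bsub>free_mod_ring D\<^esub> Q) = zlin (\<lambda>M. zlin (\<lambda>N. trch D (tensor_mod D M N)) Q) P"
    unfolding mult zlin_frag_extend by simp
  also have "\<dots> = zlin (\<lambda>M. trch D M * trz Q) P"
  proof (rule zlin_cong)
    fix M assume M: "M \<in> keys P"
    have "zlin (\<lambda>N. trch D (tensor_mod D M N)) Q = zlin (\<lambda>N. trch D N * trch D M) Q"
    proof (rule zlin_cong)
      fix N assume "N \<in> keys Q"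
      then show "trch D (tensor_mod D M N) = trch D N * trch D M"
        using trch_tensor[OF Hopf subsetD[OF assms(1) M] subsetD[OF assms(2)]] by (simp add: mult.commute)
    qed
    then show "zlin (\<lambda>N. trch D (tensor_mod D M N)) Q = trch D M * trz Q"
      by (simp add: zlin_mult_right mult.commute)
  qed
  finally show "trz (P \<otimes>\<^bsub>free_mod_ring D\<^esub> Q) = trz P * trz Q" by (simp add: zlin_mult_right)
qed

lemma cls_nonempty: "v \<in> Vch \<Longrightarrow> \<exists>P. P \<in> cls v"
  by (auto simp: Vch_def cls_def)

lemma cls_mult:
  assumes "v \<in> Vch" "w \<in> Vch"
  shows "cls v \<otimes>\<^bsub>G0 D\<^esub> cls w = cls (v * w)"
proof -
  have "cls v \<otimes>\<^bsub>G0 D\<^esub> cls w = (\<Union>a\<in>cls v. \<Union>b\<in>cls w. ses +>\<^bsub>free_mod_ring D\<^esub> (a \<otimes>\<^bsub>free_mod_ring D\<^esub> b))"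
    by (simp add: G0_def FactRing_def rcoset_mult_def)
  also have "\<dots> = (\<Union>a\<in>cls v. \<Union>b\<in>cls w. cls (v * w))"
    by (intro SUP_cong refl) (auto simp: cls_def[of v] cls_def[of w] coset_eq_cls trz_mult)
  also have "\<dots> = cls (v * w)" using cls_nonempty assms by auto
  finally show ?thesis .
qed

lemma cls_add:
  assumes "v \<in> Vch" "w \<in> Vch"
  shows "cls v \<oplus>\<^bsub>G0 D\<^esub> cls w = cls (v + w)"
proof -
  have "cls v \<oplus>\<^bsub>G0 D\<^esub> cls w = {a + b | a b. a \<in> cls v \<and> b \<in> cls w}"
    unfolding G0_def FactRing_def by (auto simp: set_add_def' free_mod_ring_def)
  also have "\<dots> = cls (v + w)"
  proof (intro equalityI subsetI)
    fix Q assume "Q \<in> {a + b | a b. a \<in> cls v \<and> b \<in> cls w}"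
    then obtain a b where "Q = a + b" "a \<in> cls v" "b \<in> cls w" by blast
    then show "Q \<in> cls (v + w)" by (simp add: cls_def zlin_add keys_add_subset)
  next
    fix Q assume Q: "Q \<in> cls (v + w)"
    obtain P where P: "P \<in> cls v" using cls_nonempty[OF assms(1)] by blast
    then have "Q - P \<in> cls w" using Q by (simp add: cls_def zlin_diff keys_diff_subset)
    moreover have "Q = P + (Q - P)" by simp
    ultimately show "Q \<in> {a + b | a b. a \<in> cls v \<and> b \<in> cls w}" using P by blast
  qed
  finally show ?thesis .
qed

lemma cls_one: "\<one>\<^bsub>G0 D\<^esub> = cls 1"
proof -
  have t: "trivial_mod D \<in> hmods D" by (rule trivial_mod_closed[OF n_pos])
  have "\<one>\<^bsub>G0 D\<^esub> = ses +>\<^bsub>free_mod_ring D\<^esub> frag_of (trivial_mod D)"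
    by (simp add: G0_def FactRing_def free_mod_ring_def)
  then show ?thesis using t trch_trivial[OF n_pos] by (simp add: coset_eq_cls keys_frag_of)
qed

lemma cls_zero: "\<zero>\<^bsub>G0 D\<^esub> = cls 0"
  by (auto simp: G0_def FactRing_def cls_def ses_iff)

lemma Vch_0: "0 \<in> Vch" using trz_in_Vch[of 0] by simp

lemma Vch_1: "1 \<in> Vch"
  using trch_in_Vch[OF trivial_mod_closed[OF n_pos]] trch_trivial[OF n_pos] by simp

lemma Vch_add: "v \<in> Vch \<Longrightarrow> w \<in> Vch \<Longrightarrow> v + w \<in> Vch"
  using trz_in_Vch[OF keys_add_subset] unfolding Vch_def[abs_def] zlin_add by blast

lemma Vch_uminus: "v \<in> Vch \<Longrightarrow> - v \<in> Vch"
  using trz_in_Vch[of "- _"] unfolding Vch_def zlin_uminus keys_minus by blast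

lemma Vch_mult: "v \<in> Vch \<Longrightarrow> w \<in> Vch \<Longrightarrow> v * w \<in> Vch"
  using trz_in_Vch[OF trz_mult(1)] trz_mult(2) unfolding Vch_def by force

lemma Vch_diff: "v \<in> Vch \<Longrightarrow> w \<in> Vch \<Longrightarrow> v - w \<in> Vch"
  using Vch_add[of v "- w"] Vch_uminus[of w] by simp

text \<open>The virtual character of an element of \<^term>\<open>G0 D\<close>.\<close>

definition val :: "('k hmod \<Rightarrow>\<^sub>0 int) set \<Rightarrow> gen list \<Rightarrow> 'k" where
  "val = inv_into Vch cls"

lemma val_cls [simp]: "v \<in> Vch \<Longrightarrow> val (cls v) = v"
  unfolding val_def by (rule inv_into_f_f[OF inj_cls])

lemma cring_G0: "cring (G0 D)"
proof (rule cring_if_embeds_type[where h = val])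
  show "inj_on val (carrier (G0 D))"
    unfolding carrier_G0 by (rule inj_onI) auto
  show "\<exists>y\<in>carrier (G0 D). val y = - val x" if "x \<in> carrier (G0 D)" for x
  proof -
    obtain v where v: "v \<in> Vch" "x = cls v" using \<open>x \<in> carrier (G0 D)\<close> unfolding carrier_G0 by blast
    then show ?thesis unfolding carrier_G0 by (intro bexI[of _ "cls (- v)"]) (auto simp: Vch_uminus)
  qed
qed (auto simp: carrier_G0 cls_mult cls_add cls_one cls_zero Vch_mult Vch_add Vch_1 Vch_0)

lemma cls_uminus:
  assumes "v \<in> Vch"
  shows "\<ominus>\<^bsub>G0 D\<^esub> cls v = cls (- v)"
proof -
  interpret cring "G0 D" by (rule cring_G0)
  show ?thesis
    using assms by (intro minus_equality) (auto simp: carrier_G0 cls_add cls_zero Vch_uminus)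
qed

end


section \<open>The subring $R_1$ and the products of the generators\<close>

(* From here on characters are elements of a ring, and their values on words play no role. *)
declare plus_fun_apply [simp del] zero_fun_apply [simp del] times_fun_apply [simp del]
  one_fun_apply [simp del] uminus_apply [simp del] minus_apply [simp del] of_nat_fun_apply [simp del]

lemma finsum_additive_image:
  fixes c :: "'b::comm_monoid_add \<Rightarrow> 'a"
  assumes S: "abelian_monoid S" and c: "\<And>v. v \<in> W \<Longrightarrow> c v \<in> carrier S"
    and add: "\<And>v w. v \<in> W \<Longrightarrow> w \<in> W \<Longrightarrow> c v \<oplus>\<^bsub>S\<^esub> c w = c (v + w)" and zero: "c 0 = \<zero>\<^bsub>S\<^esub>"
    and W: "0 \<in> W" "\<And>v w. v \<in> W \<Longrightarrow> w \<in> W \<Longrightarrow> v + w \<in> W"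
    and "finite A" "\<And>p. p \<in> A \<Longrightarrow> v p \<in> W"
  shows "finsum S (\<lambda>p. c (v p)) A = c (\<Sum>p\<in>A. v p) \<and> (\<Sum>p\<in>A. v p) \<in> W"
proof -
  interpret S: abelian_monoid S by (rule S)
  show ?thesis
    using assms(7,8)
  proof (induction A rule: finite_induct)
    case (insert x F)
    then show ?case using c W add by (simp add: Pi_def)
  qed (use W zero in simp)
qed

context half_datum
begin

lemma orb_cong:
  assumes "a ^ n = a' ^ n" "a' \<noteq> 0"
  shows "orb (a, b, c) = orb (a', b, c)"
proof -
  define v where "v = a / a'"
  have v: "v ^ n = 1" "a = a' * v" using assms n_pos by (auto simp: v_def power_divide)
  have v0: "v \<noteq> 0" using v(1) n_pos by (auto simp: power_0_left)
  show ?thesis unfolding orb.simps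
    by (rule sum.reindex_bij_witness[where i = "\<lambda>u. u / v" and j = "\<lambda>u. v * u"])
       (use v v0 in \<open>auto simp: power_mult_distrib power_divide mult_ac\<close>)
qed

lemma chi_mult_orb: "chi (a, b, c) * orb (a', b', c') = orb (a * a', b * b', c * c')"
  by (simp add: sum_distrib_left chi_mult mult.assoc)

lemma card_roots_n: "card {u::'k. u ^ n = 1} = n"
  using bij_betw_same_card[OF bij_betw_roots_of_unity[OF prim]] by simp

text \<open>Each of the $n$ characters in the first orbit maps the second orbit onto the orbit of the
  product.\<close>

lemma orb_mult_orb:
  assumes "a \<noteq> 0" "a' \<noteq> 0"
  shows "orb (a, b, c) * orb (a', b', c') = of_nat n * orb (a * a', b * b', c * c')"
proof -
  have "orb (a, b, c) * orb (a', b', c') = (\<Sum>u | (u::'k) ^ n = 1. orb (a * u * a', b * b', c * c'))"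
    unfolding orb.simps(1)[of a b c] by (simp only: sum_distrib_right chi_mult_orb)
  also have "\<dots> = (\<Sum>u | (u::'k) ^ n = 1. orb (a * a', b * b', c * c'))"
    by (rule sum.cong[OF refl], rule orb_cong) (use assms in \<open>auto simp: power_mult_distrib\<close>)
  also have "\<dots> = of_nat n * orb (a * a', b * b', c * c')"
    by (simp only: sum_constant card_roots_n)
  finally show ?thesis .
qed

lemma Lam_mult: "(a, b, c) \<in> Lam \<Longrightarrow> (a', b', c') \<in> Lam \<Longrightarrow> (a * a', b * b', c * c') \<in> Lam"
  by (simp add: Lam_def power_mult_distrib)

lemma one_Lam: "(1, 1, 1) \<in> Lam"
  by (simp add: Lam_def)

lemma root_of_unity_eq_q_pow:
  assumes "u ^ n = 1"
  obtains j where "j < n" "u = q ^ j"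
  using assms bij_betw_roots_of_unity[OF prim] unfolding bij_betw_def by blast

lemma eq_rt_times_q_pow:
  assumes "a \<noteq> 0"
  obtains j where "a = rt (a ^ n) * q ^ j"
proof -
  have "rt (a ^ n) \<noteq> 0" "rt (a ^ n) ^ n = a ^ n" using assms rt_nonzero rt by auto
  then have "(a / rt (a ^ n)) ^ n = 1" using assms by (simp add: power_divide)
  then obtain j where "a / rt (a ^ n) = q ^ j" using root_of_unity_eq_q_pow by metis
  then show thesis using that \<open>rt (a ^ n) \<noteq> 0\<close> by (simp add: field_simps)
qed

text \<open>The characters in $R_1$: the integral combinations of those of one-dimensional modules.\<close>

definition RV :: "(gen list \<Rightarrow> 'k) set" where
  "RV = zlin chi ` {f. keys f \<subseteq> Lam}"

lemma RV_chi: "t \<in> Lam \<Longrightarrow> chi t \<in> RV"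
  unfolding RV_def by (rule image_eqI[of _ _ "frag_of t"]) (auto simp: keys_frag_of)

lemma RV_diff: "v \<in> RV \<Longrightarrow> w \<in> RV \<Longrightarrow> v - w \<in> RV"
  unfolding RV_def using keys_diff_subset zlin_diff by (smt (verit, best) imageE image_eqI mem_Collect_eq)

lemma RV_0: "0 \<in> RV"
  unfolding RV_def by (rule image_eqI[of _ _ 0]) auto

lemma RV_uminus: "v \<in> RV \<Longrightarrow> - v \<in> RV"
  using RV_diff[OF RV_0, of v] by simp

lemma RV_add: "v \<in> RV \<Longrightarrow> w \<in> RV \<Longrightarrow> v + w \<in> RV"
  using RV_diff[of v "- w"] RV_uminus[of w] by simp

lemma RV_1: "1 \<in> RV"
  using RV_chi[OF one_Lam] by (simp add: chi_one)

lemma RV_induct [consumes 1, case_names zero chi diff]: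
  assumes "v \<in> RV" "P 0" "\<And>t. t \<in> Lam \<Longrightarrow> P (chi t)" "\<And>v w. v \<in> RV \<Longrightarrow> w \<in> RV \<Longrightarrow> P v \<Longrightarrow> P w \<Longrightarrow> P (v - w)"
  shows "P v"
proof -
  obtain f where f: "keys f \<subseteq> Lam" "v = zlin chi f" using assms(1) by (auto simp: RV_def)
  have "zlin chi f \<in> RV \<and> P (zlin chi f)"
    by (rule frag_induction[OF f(1)]) (simp_all add: assms zlin_diff RV_0 RV_chi RV_diff)
  then show ?thesis using f(2) by simp
qed

lemma RV_mult:
  assumes "v \<in> RV" "w \<in> RV"
  shows "v * w \<in> RV"
proof -
  have 1: "chi t * w \<in> RV" if "t \<in> Lam" for t
  proof (rule RV_induct[OF assms(2)])
    fix s assume s: "s \<in> Lam"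
    obtain a b c a' b' c' where "t = (a, b, c)" "s = (a', b', c')" by (metis prod_cases3)
    then show "chi t * chi s \<in> RV" using that s by (simp add: chi_mult RV_chi Lam_mult)
  qed (simp_all add: RV_0 right_diff_distrib RV_diff)
  show ?thesis
    by (rule RV_induct[OF assms(1)]) (simp_all add: RV_0 1 left_diff_distrib RV_diff)
qed

lemma RV_sum: "(\<And>x. x \<in> A \<Longrightarrow> f x \<in> RV) \<Longrightarrow> (\<Sum>x\<in>A. f x) \<in> RV"
  by (induction A rule: infinite_finite_induct) (auto simp: RV_0 RV_add)

lemma tau_Lam: "t \<in> Lam \<Longrightarrow> tau t = chi t"
  by (simp add: tau_def)

lemma tau_in_Vch: "t \<in> Idx \<Longrightarrow> tau t \<in> Vch"
  using trch_in_Vch[OF smod_in_hmods] trch_smod by simp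

lemma chi_in_Vch: "t \<in> Lam \<Longrightarrow> chi t \<in> Vch"
  using tau_in_Vch[of t] Lam_subset_Idx tau_Lam[of t] by auto

lemma RV_subset_Vch: "RV \<subseteq> Vch"
proof
  fix v assume "v \<in> RV"
  then show "v \<in> Vch" by (rule RV_induct) (simp_all add: Vch_0 chi_in_Vch Vch_diff)
qed

lemma Vch_induct [consumes 1, case_names zero tau diff]:
  assumes "v \<in> Vch" "P 0" "\<And>t. t \<in> Idx \<Longrightarrow> P (tau t)" "\<And>v w. v \<in> Vch \<Longrightarrow> w \<in> Vch \<Longrightarrow> P v \<Longrightarrow> P w \<Longrightarrow> P (v - w)"
  shows "P v"
proof -
  obtain f where f: "keys f \<subseteq> Idx" "v = zlin tau f" using assms(1) by (auto simp: Vch_eq_tau)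
  have "zlin tau f \<in> Vch \<and> P (zlin tau f)"
    by (rule frag_induction[OF f(1)]) (simp_all add: assms zlin_diff Vch_0 tau_in_Vch Vch_diff)
  then show ?thesis using f(2) by simp
qed

lemma mcls_smod: "t \<in> Idx \<Longrightarrow> mcls D (smod t) = cls (tau t)"
  by (simp add: mcls_eq_cls smod_in_hmods trch_smod)

lemma mcls_V0:
  assumes "\<gamma>1 \<noteq> 0" "\<gamma>2 \<noteq> 0" "\<gamma>3 \<noteq> 0" "\<gamma>1 ^ n1 = \<gamma>2 ^ n"
  shows "mcls D (V0 D rt \<gamma>1 \<gamma>2 \<gamma>3 i) = cls (chi (rt \<gamma>1 * q powi i, \<gamma>2, \<gamma>3))"
  unfolding V0_eq(2)[OF assms] mcls_smod[OF subsetD[OF Lam_subset_Idx V0_eq(1)[OF assms]]] tau_Lam[OF V0_eq(1)[OF assms]] ..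

lemma R1_generators:
  "{mcls D (V0 D rt \<gamma>1 \<gamma>2 \<gamma>3 i) | \<gamma>1 \<gamma>2 \<gamma>3 i.
      \<gamma>1 \<noteq> 0 \<and> \<gamma>2 \<noteq> 0 \<and> \<gamma>3 \<noteq> 0 \<and> beta1 D * (\<gamma>1 ^ n1 - \<gamma>2 ^ n) = 0} = cls ` chi ` Lam" (is "?L = ?R")
proof (intro equalityI subsetI)
  fix x assume "x \<in> ?L"
  then obtain \<gamma>1 \<gamma>2 \<gamma>3 i where g: "x = mcls D (V0 D rt \<gamma>1 \<gamma>2 \<gamma>3 i)" "\<gamma>1 \<noteq> 0" "\<gamma>2 \<noteq> 0" "\<gamma>3 \<noteq> 0" "\<gamma>1 ^ n1 = \<gamma>2 ^ n"
    using beta1 by auto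
  then show "x \<in> ?R" using V0_eq(1)[OF g(2-5), of i] mcls_V0[OF g(2-5), of i] by auto
next
  fix x assume "x \<in> ?R"
  then obtain a b c where t: "(a, b, c) \<in> Lam" "x = cls (chi (a, b, c))" by auto
  then have nz: "a ^ n \<noteq> 0" "b \<noteq> 0" "c \<noteq> 0" "(a ^ n) ^ n1 = b ^ n" and a: "a \<noteq> 0"
    by (auto simp: Lam_def power_mult)
  obtain j where "a = rt (a ^ n) * q ^ j" by (rule eq_rt_times_q_pow[OF a])
  then have "x = mcls D (V0 D rt (a ^ n) b c (int j))"
    using mcls_V0[OF nz, of "int j"] t(2) by simp
  then have "\<exists>i. x = mcls D (V0 D rt (a ^ n) b c i)" by blast
  moreover have "beta1 D * ((a ^ n) ^ n1 - b ^ n) = 0" using nz by simp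
  ultimately show "x \<in> ?L" using nz by blast
qed

text \<open>A subring of virtual characters that contains the generators contains the ring generated.\<close>

lemma generate_ring_subset_cls:
  assumes "A \<subseteq> cls ` W" "W \<subseteq> Vch" "1 \<in> W" "\<And>v w. v \<in> W \<Longrightarrow> w \<in> W \<Longrightarrow> v + w \<in> W"
    "\<And>v w. v \<in> W \<Longrightarrow> w \<in> W \<Longrightarrow> v * w \<in> W" "\<And>v. v \<in> W \<Longrightarrow> - v \<in> W"
  shows "generate_ring (G0 D) A \<subseteq> cls ` W"
proof
  fix x assume "x \<in> generate_ring (G0 D) A"
  then show "x \<in> cls ` W"
  proof (induction rule: generate_ring.induct)
    case (a_inv h)
    then obtain v where "v \<in> W" "h = cls v" by blast
    then show ?case using assms by (auto simp: cls_uminus)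
  next
    case (eng_add h1 h2)
    then obtain v w where "v \<in> W" "h1 = cls v" "w \<in> W" "h2 = cls w" by blast
    then show ?case using assms(2,4) by (auto simp: cls_add subset_iff)
  next
    case (eng_mult h1 h2)
    then obtain v w where "v \<in> W" "h1 = cls v" "w \<in> W" "h2 = cls w" by blast
    then show ?case using assms(2,5) by (auto simp: cls_mult subset_iff)
  qed (use assms cls_one in auto)
qed

lemma cls_0_in_generate_ring: "cls 0 \<in> generate_ring (G0 D) A"
proof -
  interpret cring "G0 D" by (rule cring_G0)
  show ?thesis using zero_in_generate by (simp add: cls_zero)
qed

lemma cls_diff_in_generate_ring:
  assumes "v \<in> Vch" "w \<in> Vch" "cls v \<in> generate_ring (G0 D) A" "cls w \<in> generate_ring (G0 D) A"
  shows "cls (v - w) \<in> generate_ring (G0 D) A"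
proof -
  have "cls v \<oplus>\<^bsub>G0 D\<^esub> \<ominus>\<^bsub>G0 D\<^esub> cls w \<in> generate_ring (G0 D) A"
    by (intro generate_ring.eng_add generate_ring.a_inv assms)
  then show ?thesis using assms by (simp add: cls_uminus cls_add Vch_uminus)
qed

lemma R1_eq: "R1 D rt = cls ` RV"
proof
  show "R1 D rt \<subseteq> cls ` RV"
    unfolding R1_def R1_generators
    by (rule generate_ring_subset_cls) (use RV_chi RV_subset_Vch RV_1 RV_add RV_mult RV_uminus in auto)
  show "cls ` RV \<subseteq> R1 D rt"
  proof safe
    fix v assume "v \<in> RV"
    then show "cls v \<in> R1 D rt"
      unfolding R1_def R1_generators
    proof (rule RV_induct)
      fix v w assume "v \<in> RV" "w \<in> RV" "cls v \<in> generate_ring (G0 D) (cls ` chi ` Lam)"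
        "cls w \<in> generate_ring (G0 D) (cls ` chi ` Lam)"
      then show "cls (v - w) \<in> generate_ring (G0 D) (cls ` chi ` Lam)"
        using RV_subset_Vch by (intro cls_diff_in_generate_ring) auto
    qed (simp_all add: generate_ring.incl cls_0_in_generate_ring)
  qed
qed

lemma roots_q_Lam: "u ^ n = 1 \<Longrightarrow> (u, 1, 1) \<in> Lam"
  using n_pos by (auto simp: Lam_def power_mult power_0_left)

lemma q_Lam: "(q ^ j, 1, 1) \<in> Lam"
  by (rule roots_q_Lam) (simp add: q_pow_n power_mult[symmetric] mult.commute[of j], simp add: power_mult q_pow_n)

lemma g_elt_eq: "g_elt D rt = cls (chi (q, 1, 1))"
  unfolding g_elt_def using mcls_V0[of 1 1 1 1] by (simp add: rt_1)

lemma s_elt_eq: "s_elt D rt = cls (orb (1, 1, 1))"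
proof -
  interpret G: cring "G0 D" by (rule cring_G0)
  have pow: "g_elt D rt [^]\<^bsub>G0 D\<^esub> p = cls (chi (q ^ p, 1, 1))" for p :: nat
  proof (rule nat.induct[of _ p])
    fix p assume "g_elt D rt [^]\<^bsub>G0 D\<^esub> p = cls (chi (q ^ p, 1, 1))"
    then show "g_elt D rt [^]\<^bsub>G0 D\<^esub> Suc p = cls (chi (q ^ Suc p, 1, 1))"
      using chi_in_Vch[OF q_Lam[of p]] chi_in_Vch[OF q_Lam[of 1]]
      by (simp add: g_elt_eq cls_mult chi_mult mult.commute)
  qed (simp add: chi_one cls_one)
  have "s_elt D rt = (\<Oplus>\<^bsub>G0 D\<^esub>p\<in>{0..n - 1}. cls (chi (q ^ p, 1, 1)))"
    unfolding s_elt_def pow ..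
  also have "\<dots> = cls (\<Sum>p\<in>{0..n - 1}. chi (q ^ p, 1, 1))"
    using finsum_additive_image[OF G.abelian_monoid_axioms, of Vch cls "{0..n - 1}" "\<lambda>p. chi (q ^ p, 1, 1)"]
    by (auto simp: carrier_G0 cls_add cls_zero Vch_0 Vch_add chi_in_Vch q_Lam)
  also have "{0..n - 1} = {..<n}" using n_pos by auto
  also have "(\<Sum>p<n. chi (q ^ p, 1, 1)) = orb (1, 1, 1)"
    using sum_powers_q[of "\<lambda>u. chi (u, 1, 1)"] by simp
  finally show ?thesis .
qed

lemma g3_eq:
  assumes "\<gamma>1 \<noteq> 0" "\<gamma>2 \<noteq> 0" "\<gamma>3 \<noteq> 0" "\<gamma>1 ^ n1 = \<gamma>2 ^ n"
  shows "g3 D rt \<gamma>1 \<gamma>2 \<gamma>3 = cls (chi (rt \<gamma>1, \<gamma>2, \<gamma>3))" "(rt \<gamma>1, \<gamma>2, \<gamma>3) \<in> Lam"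
  unfolding g3_def using mcls_V0[OF assms, of 0] V0_eq(1)[OF assms, of 0] by simp_all

lemma x_elt_eq:
  assumes "\<zeta> \<noteq> 0" "\<zeta> ^ n1 \<noteq> 1"
  shows "x_elt D rt \<zeta> = cls (orb (rt \<zeta>, 1, 1))" "orb (rt \<zeta>, 1, 1) \<in> Vch"
proof -
  have t: "(rt \<zeta>, 1, 1) \<in> Idx - Lam" and eq: "VI D rt \<zeta> 1 1 0 = smod (rt \<zeta>, 1, 1)"
    using VI_eq[of \<zeta> 1 1] assms by simp_all
  show "x_elt D rt \<zeta> = cls (orb (rt \<zeta>, 1, 1))" "orb (rt \<zeta>, 1, 1) \<in> Vch"
    using t tau_in_Vch[of "(rt \<zeta>, 1, 1)"] mcls_smod[of "(rt \<zeta>, 1, 1)"]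
    by (simp_all add: x_elt_def eq tau_def del: orb.simps)
qed

lemma orb_1_in_RV: "orb (1, 1, 1) \<in> RV"
  unfolding orb.simps by (rule RV_sum) (simp add: RV_chi roots_q_Lam)

lemma RV_of_nat: "v \<in> RV \<Longrightarrow> of_nat m * v \<in> RV"
  by (rule nat.induct[of _ m]) (simp_all add: RV_0 RV_add distrib_right)

lemma add_pow_cls:
  assumes "v \<in> Vch"
  shows "add_pow (G0 D) m (cls v) = cls (of_nat m * v)"
proof -
  interpret G: cring "G0 D" by (rule cring_G0)
  have "of_nat m * v \<in> Vch \<and> add_pow (G0 D) m (cls v) = cls (of_nat m * v)"
  proof (rule nat.induct[of _ m])
    fix m assume "of_nat m * v \<in> Vch \<and> add_pow (G0 D) m (cls v) = cls (of_nat m * v)"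
    then show "of_nat (Suc m) * v \<in> Vch \<and> add_pow (G0 D) (Suc m) (cls v) = cls (of_nat (Suc m) * v)"
      using assms by (simp add: cls_add distrib_right Vch_add add.commute carrier_G0 G.add.nat_pow_Suc)
  qed (simp add: Vch_0 cls_zero)
  then show ?thesis ..
qed

lemma rt_mult_pow: "\<zeta> \<noteq> 0 \<Longrightarrow> \<zeta>' \<noteq> 0 \<Longrightarrow> (rt \<zeta> * rt \<zeta>') ^ n = \<zeta> * \<zeta>'"
  by (simp add: power_mult_distrib rt)

lemma x_elt_mult:
  assumes z: "\<zeta> \<noteq> 0" "\<zeta> ^ n1 \<noteq> 1" "\<zeta>' \<noteq> 0" "\<zeta>' ^ n1 \<noteq> 1"
  shows "x_elt D rt \<zeta> \<otimes>\<^bsub>G0 D\<^esub> x_elt D rt \<zeta>' =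
    (if (\<zeta> * \<zeta>') ^ n1 \<noteq> 1 then s_elt D rt \<otimes>\<^bsub>G0 D\<^esub> x_elt D rt (\<zeta> * \<zeta>')
     else add_pow (G0 D) n (s_elt D rt \<otimes>\<^bsub>G0 D\<^esub> g3 D rt (\<zeta> * \<zeta>') 1 1))"
proof -
  have zz: "\<zeta> * \<zeta>' \<noteq> 0" using z by simp
  have nz: "rt \<zeta> \<noteq> 0" "rt \<zeta>' \<noteq> 0" "rt (\<zeta> * \<zeta>') \<noteq> 0" using z by (simp_all add: rt_nonzero)
  have "orb (rt \<zeta> * rt \<zeta>', 1, 1) = orb (rt (\<zeta> * \<zeta>'), 1, 1)"
    by (rule orb_cong[OF _ nz(3)]) (simp add: rt_mult_pow z rt[OF zz])
  then have prod: "orb (rt \<zeta>, 1, 1) * orb (rt \<zeta>', 1, 1) = of_nat n * orb (rt (\<zeta> * \<zeta>'), 1, 1)"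
    using orb_mult_orb[OF nz(1,2), of 1 1 1 1] by (simp del: orb.simps)
  have L: "x_elt D rt \<zeta> \<otimes>\<^bsub>G0 D\<^esub> x_elt D rt \<zeta>' = cls (of_nat n * orb (rt (\<zeta> * \<zeta>'), 1, 1))"
    using x_elt_eq[OF z(1,2)] x_elt_eq[OF z(3,4)] by (simp add: cls_mult prod del: orb.simps)
  have s: "orb (1, 1, 1) \<in> Vch" using orb_1_in_RV RV_subset_Vch by auto
  show ?thesis
  proof (cases "(\<zeta> * \<zeta>') ^ n1 \<noteq> 1")
    case True
    have "orb (1, 1, 1) * orb (rt (\<zeta> * \<zeta>'), 1, 1) = of_nat n * orb (rt (\<zeta> * \<zeta>'), 1, 1)"
      using orb_mult_orb[OF _ nz(3), of 1 1 1 1 1] by (simp del: orb.simps)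
    then show ?thesis using True x_elt_eq[OF zz True] s by (simp add: L s_elt_eq cls_mult del: orb.simps)
  next
    case False
    then have g: "g3 D rt (\<zeta> * \<zeta>') 1 1 = cls (chi (rt (\<zeta> * \<zeta>'), 1, 1))" "(rt (\<zeta> * \<zeta>'), 1, 1) \<in> Lam"
      using g3_eq[of "\<zeta> * \<zeta>'" 1 1] zz by simp_all
    have "orb (1, 1, 1) * chi (rt (\<zeta> * \<zeta>'), 1, 1) = orb (rt (\<zeta> * \<zeta>'), 1, 1)"
      using chi_mult_orb[of "rt (\<zeta> * \<zeta>')" 1 1 1 1 1] by (simp add: mult.commute del: orb.simps)
    then show ?thesis
      using False g s chi_in_Vch[OF g(2)] Vch_mult[OF s chi_in_Vch[OF g(2)]]
      by (simp add: L s_elt_eq cls_mult add_pow_cls del: orb.simps)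
  qed
qed

end

text \<open>In addition, representatives of the classes modulo $n_1$-th roots of unity.\<close>

locale half_presentation = half_datum D rt
  for D :: "'k::{alg_closed_field, field_char_0} hopf_data" and rt +
  fixes \<omega> :: 'k and rep :: "'k set \<Rightarrow> 'k"
  assumes omega: "primitive_root (dn1 D) \<omega>" and rep: "\<And>C. C \<in> K0hat \<omega> \<Longrightarrow> rep C \<in> C"
begin

lemma mu_cls_eq:
  assumes "\<zeta> \<noteq> 0"
  shows "mu_cls \<omega> \<zeta> = {x. x ^ n1 = \<zeta> ^ n1}"
proof -
  have w0: "\<omega> \<noteq> 0" by (rule primitive_root_nonzero[OF omega])
  have w1: "\<omega> ^ n1 = 1" using omega by (simp add: primitive_root_def)
  have "(\<omega> powi r) ^ n1 = 1" for r
  proof -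
    have "(\<omega> powi r) ^ n1 = (\<omega> powi int n1) powi r"
      by (simp only: power_int_mult[symmetric] power_int_of_nat[symmetric] mult.commute)
    then show ?thesis by (simp add: w1)
  qed
  moreover have "\<exists>r. x = \<zeta> * \<omega> powi r" if "x ^ n1 = \<zeta> ^ n1" for x
  proof -
    have "(x / \<zeta>) ^ n1 = 1" using that assms by (simp add: power_divide)
    then obtain j where "x / \<zeta> = \<omega> ^ j" using bij_betw_roots_of_unity[OF omega] unfolding bij_betw_def by blast
    then show ?thesis using assms by (intro exI[of _ "int j"]) (simp add: field_simps)
  qed
  ultimately show ?thesis unfolding mu_cls_def by (auto simp: power_mult_distrib)
qed

lemma mu_cls_in_K0hat_iff:
  assumes "\<zeta> \<noteq> 0"
  shows "mu_cls \<omega> \<zeta> \<in> K0hat \<omega> \<longleftrightarrow> \<zeta> ^ n1 \<noteq> 1"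
proof -
  have "mu_cls \<omega> \<zeta> = mu_cls \<omega> 1 \<longleftrightarrow> \<zeta> ^ n1 = 1"
    unfolding mu_cls_eq[OF assms] mu_cls_eq[OF one_neq_zero] by auto
  then show ?thesis using assms by (auto simp: K0hat_def)
qed

lemma rep_props:
  assumes "C \<in> K0hat \<omega>"
  shows "rep C \<noteq> 0" "rep C ^ n1 \<noteq> 1" "C = {x. x ^ n1 = rep C ^ n1}" "mu_cls \<omega> (rep C) = C"
proof -
  obtain \<zeta> where z: "\<zeta> \<noteq> 0" "C = mu_cls \<omega> \<zeta>" using assms by (auto simp: K0hat_def)
  have "rep C ^ n1 = \<zeta> ^ n1" using rep[OF assms] z mu_cls_eq by auto
  moreover have "\<zeta> ^ n1 \<noteq> 1" using assms z mu_cls_in_K0hat_iff by auto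
  moreover have nz: "\<zeta> ^ n1 \<noteq> 0" using z by simp
  ultimately show "rep C \<noteq> 0" "rep C ^ n1 \<noteq> 1" "C = {x. x ^ n1 = rep C ^ n1}"
    using z mu_cls_eq n1_pos by (auto simp: power_0_left split: if_splits)
  then show "mu_cls \<omega> (rep C) = C" by (simp add: mu_cls_eq)
qed

text \<open>The character of $x_{\zeta,1}$ for the chosen representative $\zeta$ of a class.\<close>

definition xi :: "'k set \<Rightarrow> gen list \<Rightarrow> 'k" where
  "xi C = orb (rt (rep C), 1, 1)"

lemma x_elt_rep: "C \<in> K0hat \<omega> \<Longrightarrow> x_elt D rt (rep C) = cls (xi C)"
  and xi_in_Vch: "C \<in> K0hat \<omega> \<Longrightarrow> xi C \<in> Vch"
  using x_elt_eq[of "rep C"] rep_props[of C] by (simp_all add: xi_def del: orb.simps)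

text \<open>The simple module with parameter $(a, b, c)$, if it is not one-dimensional, has the character of
  the product of a $V_0$, with $b$ and $c$ acting by the same scalars, and of $V_I(\zeta,1,1;0)$ for any
  $\zeta$ with $\zeta^{n_1} = a^{n n_1} / b^n$. These $\zeta$ form one class modulo the $n_1$-th roots of unity,
  and \<open>lam_part\<close> is the parameter of the $V_0$ for the chosen representative $\zeta$.\<close>

fun cof :: "'k \<times> 'k \<times> 'k \<Rightarrow> 'k set" where
  "cof (a, b, c) = {x. x ^ n1 = a ^ (n * n1) / b ^ n}"

fun lam_part :: "'k \<times> 'k \<times> 'k \<Rightarrow> 'k \<times> 'k \<times> 'k" where
  "lam_part (a, b, c) = (rt (a ^ n / rep (cof (a, b, c))), b, c)"

lemma cof_in_K0hat:
  assumes "t \<in> Idx - Lam"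
  shows "cof t \<in> K0hat \<omega>"
proof -
  obtain a b c where t: "t = (a, b, c)" by (metis prod_cases3)
  let ?v = "a ^ (n * n1) / b ^ n"
  have v: "?v \<noteq> 0" "?v \<noteq> 1" using assms by (auto simp: t Idx_def Lam_def)
  obtain \<zeta> where z: "\<zeta> ^ n1 = ?v"
  proof -
    have "degree (monom 1 n1 + [:- ?v:]) = n1" using n1_pos by (simp add: degree_add_eq_left degree_monom_eq)
    then obtain x where "poly (monom 1 n1 + [:- ?v:]) x = 0"
      using alg_closed_imp_poly_has_root[of "monom 1 n1 + [:- ?v:]"] n1_pos by auto
    then show thesis using that[of x] by (simp add: poly_monom)
  qed
  then have "\<zeta> \<noteq> 0" using v n1_pos by (auto simp: power_0_left)
  moreover have "mu_cls \<omega> \<zeta> = cof t" unfolding mu_cls_eq[OF \<open>\<zeta> \<noteq> 0\<close>] z t by simp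
  ultimately show ?thesis using mu_cls_in_K0hat_iff[of \<zeta>] z v by simp
qed

lemma tau_eq_product:
  assumes "t \<in> Idx - Lam"
  shows "lam_part t \<in> Lam" "chi (lam_part t) * xi (cof t) = tau t"
proof -
  obtain a b c where t: "t = (a, b, c)" by (metis prod_cases3)
  let ?r = "rep (cof (a, b, c))"
  have C: "cof (a, b, c) \<in> K0hat \<omega>" using cof_in_K0hat[OF assms] t by simp
  have r: "?r \<noteq> 0" "?r ^ n1 = a ^ (n * n1) / b ^ n"
    using rep_props(1)[OF C] rep[OF C] by auto
  have nz: "a \<noteq> 0" "b \<noteq> 0" "c \<noteq> 0" using assms by (auto simp: t Idx_def)
  have q0: "a ^ n / ?r \<noteq> 0" using nz r by simp
  have "(a ^ n / ?r) ^ n1 = b ^ n" using nz r by (simp add: power_divide power_mult)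
  then show "lam_part t \<in> Lam" using g3_eq(2)[of "a ^ n / ?r" b c] q0 nz by (simp add: t)
  have "orb (rt (a ^ n / ?r) * rt ?r, b, c) = orb (a, b, c)"
    by (rule orb_cong[OF _ nz(1)]) (use r nz in \<open>simp add: rt_mult_pow\<close>)
  then show "chi (lam_part t) * xi (cof t) = tau t"
    using assms chi_mult_orb[of "rt (a ^ n / ?r)" b c "rt ?r" 1 1]
    by (simp add: t xi_def tau_def del: orb.simps cof.simps)
qed

lemma carrier_G0_generated:
  "carrier (G0 D) = generate_ring (G0 D) (R1 D rt \<union> (\<lambda>C. x_elt D rt (rep C)) ` K0hat \<omega>)" (is "_ = generate_ring _ ?A")
proof
  interpret G: cring "G0 D" by (rule cring_G0)
  have "?A \<subseteq> carrier (G0 D)"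
    using RV_subset_Vch xi_in_Vch by (auto simp: R1_eq x_elt_rep carrier_G0)
  then show "generate_ring (G0 D) ?A \<subseteq> carrier (G0 D)" by (rule G.generate_ring_incl)
  show "carrier (G0 D) \<subseteq> generate_ring (G0 D) ?A"
  proof
    fix x assume "x \<in> carrier (G0 D)"
    then obtain v where v: "v \<in> Vch" "x = cls v" by (auto simp: carrier_G0)
    from v(1) have "cls v \<in> generate_ring (G0 D) ?A"
    proof (rule Vch_induct)
      fix t assume tau: "t \<in> Idx"
      show "cls (tau t) \<in> generate_ring (G0 D) ?A"
      proof (cases "t \<in> Lam")
        case True
        then show ?thesis by (intro generate_ring.incl) (auto simp: R1_eq tau_Lam RV_chi)
      next
        case False
        then have t: "t \<in> Idx - Lam" using tau by simp
        have "cls (chi (lam_part t)) \<otimes>\<^bsub>G0 D\<^esub> x_elt D rt (rep (cof t)) \<in> generate_ring (G0 D) ?A"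
          using RV_chi[OF tau_eq_product(1)[OF t]] cof_in_K0hat[OF t]
          by (intro generate_ring.eng_mult generate_ring.incl) (auto simp: R1_eq)
        then show ?thesis
          using tau_eq_product[OF t] cof_in_K0hat[OF t]
          by (simp add: x_elt_rep cls_mult chi_in_Vch xi_in_Vch)
      qed
    qed (simp_all add: cls_0_in_generate_ring cls_diff_in_generate_ring)
    then show "x \<in> generate_ring (G0 D) ?A" using v by simp
  qed
qed

end


section \<open>Polynomial rings over a ring of values\<close>

lemma finite_submultisets: "finite {u. u \<subseteq># m}"
proof (induction m)
  case (add i m)
  have "u \<in> {u. u \<subseteq># m} \<union> add_mset i ` {u. u \<subseteq># m}" if "u \<subseteq># add_mset i m" for u
  proof (cases "i \<in># u")
    case True
    then obtain u' where "u = add_mset i u'" by (metis insert_DiffM)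
    then show ?thesis using that by auto
  next
    case False
    have "count u a \<le> count m a" for a
      using that False mset_subset_eq_count[of u "add_mset i m" a] by (cases "a = i") (auto simp: not_in_iff)
    then show ?thesis by (simp add: mset_subset_eqI)
  qed
  then show ?case using add finite_subset[of "{u. u \<subseteq># add_mset i m}"] by blast
qed simp

lemma lookup_mult_multiset:
  fixes P Q :: "'i multiset \<Rightarrow>\<^sub>0 'b::comm_ring_1"
  shows "Poly_Mapping.lookup (P * Q) m = (\<Sum>u | u \<subseteq># m. Poly_Mapping.lookup P u * Poly_Mapping.lookup Q (m - u))"
proof -
  have inner: "(\<Sum>w. Poly_Mapping.lookup Q w when m = u + w) = (if u \<subseteq># m then Poly_Mapping.lookup Q (m - u) else 0)" for u
  proof (cases "u \<subseteq># m")
    case True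
    then have "(Poly_Mapping.lookup Q w when m = u + w) = (Poly_Mapping.lookup Q w when w = m - u)" for w
      by (auto simp: when_def)
    then show ?thesis using True by simp
  next
    case False
    then have "(Poly_Mapping.lookup Q w when m = u + w) = 0" for w by (auto simp: when_def)
    then show ?thesis using False by simp
  qed
  have "Poly_Mapping.lookup (P * Q) m = (\<Sum>u. Poly_Mapping.lookup P u * (if u \<subseteq># m then Poly_Mapping.lookup Q (m - u) else 0))"
    by (simp only: lookup_mult inner)
  also have "\<dots> = (\<Sum>u | u \<subseteq># m. Poly_Mapping.lookup P u * (if u \<subseteq># m then Poly_Mapping.lookup Q (m - u) else 0))"
    by (rule Sum_any.expand_superset) (auto simp: finite_submultisets)
  also have "\<dots> = (\<Sum>u | u \<subseteq># m. Poly_Mapping.lookup P u * Poly_Mapping.lookup Q (m - u))"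
    by (rule sum.cong) auto
  finally show ?thesis .
qed

lemma sum_single:
  "P = (\<Sum>m\<in>Poly_Mapping.keys P. Poly_Mapping.single m (Poly_Mapping.lookup P m))"
proof (rule poly_mapping_eqI)
  fix k
  have "Poly_Mapping.lookup (\<Sum>m\<in>Poly_Mapping.keys P. Poly_Mapping.single m (Poly_Mapping.lookup P m)) k
      = (\<Sum>m\<in>Poly_Mapping.keys P. if m = k then Poly_Mapping.lookup P m else 0)"
    by (simp add: lookup_sum lookup_single when_def)
  also have "\<dots> = Poly_Mapping.lookup P k" by (simp add: in_keys_iff)
  finally show "Poly_Mapping.lookup P k = Poly_Mapping.lookup (\<Sum>m\<in>Poly_Mapping.keys P. Poly_Mapping.single m (Poly_Mapping.lookup P m)) k" ..
qed

text \<open>The value of a polynomial at a point.\<close>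

definition peval :: "('i \<Rightarrow> 'b::comm_ring_1) \<Rightarrow> ('i multiset \<Rightarrow>\<^sub>0 'b) \<Rightarrow> 'b" where
  "peval x P = (\<Sum>m\<in>Poly_Mapping.keys P. Poly_Mapping.lookup P m * prod_mset (image_mset x m))"

lemma peval_superset:
  assumes "finite A" "Poly_Mapping.keys P \<subseteq> A"
  shows "peval x P = (\<Sum>m\<in>A. Poly_Mapping.lookup P m * prod_mset (image_mset x m))"
  unfolding peval_def by (rule sum.mono_neutral_left[OF assms]) (auto simp: in_keys_iff)

lemma peval_0 [simp]: "peval x 0 = 0"
  by (simp add: peval_def)

lemma peval_single [simp]: "peval x (Poly_Mapping.single m v) = v * prod_mset (image_mset x m)"
  using peval_superset[of "{m}" "Poly_Mapping.single m v" x] by simp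

lemma peval_add: "peval x (P + Q) = peval x P + peval x Q"
proof -
  let ?A = "Poly_Mapping.keys P \<union> Poly_Mapping.keys Q"
  have "peval x (P + Q) = (\<Sum>m\<in>?A. Poly_Mapping.lookup (P + Q) m * prod_mset (image_mset x m))"
    by (rule peval_superset) (use Poly_Mapping.keys_add[of P Q] in auto)
  also have "\<dots> = (\<Sum>m\<in>?A. Poly_Mapping.lookup P m * prod_mset (image_mset x m)) + (\<Sum>m\<in>?A. Poly_Mapping.lookup Q m * prod_mset (image_mset x m))"
    by (simp add: lookup_add distrib_right sum.distrib)
  finally show ?thesis by (simp add: peval_superset[of ?A P] peval_superset[of ?A Q])
qed

lemma peval_diff: "peval x (P - Q) = peval x P - peval x Q"
  using peval_add[of x "P - Q" Q] by simp

lemma peval_sum: "peval x (\<Sum>i\<in>A. f i) = (\<Sum>i\<in>A. peval x (f i))"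
  by (induction A rule: infinite_finite_induct) (simp_all add: peval_add)

lemma peval_mult: "peval x (P * Q) = peval x P * peval x Q"
proof -
  have "P * Q = (\<Sum>m\<in>Poly_Mapping.keys P. \<Sum>m'\<in>Poly_Mapping.keys Q.
      Poly_Mapping.single (m + m') (Poly_Mapping.lookup P m * Poly_Mapping.lookup Q m'))"
    by (subst (1) sum_single[of P], subst (1) sum_single[of Q]) (simp add: sum_product mult_single)
  then have "peval x (P * Q) = (\<Sum>m\<in>Poly_Mapping.keys P. \<Sum>m'\<in>Poly_Mapping.keys Q.
      (Poly_Mapping.lookup P m * prod_mset (image_mset x m)) * (Poly_Mapping.lookup Q m' * prod_mset (image_mset x m')))"
    by (simp add: peval_sum mult_ac)
  then show ?thesis by (simp add: peval_def sum_product)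
qed

lemma peval_zlin: "peval x (zlin f P) = zlin (\<lambda>t. peval x (f t)) P"
  by (rule frag_induction[of P UNIV]) (simp_all add: zlin_diff peval_diff)

text \<open>A ring whose elements are named, injectively, by the elements of a subring
  \<^term>\<open>W\<close> of a commutative ring; the polynomials over it are then named by the polynomials
  with coefficients in \<^term>\<open>W\<close>.\<close>

locale named_ring =
  fixes R :: "'a ring" and c :: "'b::comm_ring_1 \<Rightarrow> 'a" and W :: "'b set" and I :: "'i set"
  assumes R: "ring R" and carrier_R: "carrier R = c ` W" and inj_c: "inj_on c W"
    and W_1: "1 \<in> W" and W_diff: "\<And>v w. v \<in> W \<Longrightarrow> w \<in> W \<Longrightarrow> v - w \<in> W"
    and W_mult: "\<And>v w. v \<in> W \<Longrightarrow> w \<in> W \<Longrightarrow> v * w \<in> W"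
    and c_0: "\<zero>\<^bsub>R\<^esub> = c 0" and c_1: "\<one>\<^bsub>R\<^esub> = c 1"
    and c_add: "\<And>v w. v \<in> W \<Longrightarrow> w \<in> W \<Longrightarrow> c v \<oplus>\<^bsub>R\<^esub> c w = c (v + w)"
    and c_mult: "\<And>v w. v \<in> W \<Longrightarrow> w \<in> W \<Longrightarrow> c v \<otimes>\<^bsub>R\<^esub> c w = c (v * w)"
begin

interpretation R: ring R by (rule R)

abbreviation "\<P> \<equiv> mpoly_ring R I"

text \<open>The polynomials with coefficients in \<^term>\<open>W\<close> and variables in \<^term>\<open>I\<close>, and the elements of
  \<^term>\<open>mpoly_ring R I\<close> that they name.\<close>

definition pols :: "('i multiset \<Rightarrow>\<^sub>0 'b) set" where
  "pols = {P. (\<forall>m. Poly_Mapping.lookup P m \<in> W) \<and> (\<forall>m\<in>Poly_Mapping.keys P. set_mset m \<subseteq> I)}"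

definition pname :: "('i multiset \<Rightarrow>\<^sub>0 'b) \<Rightarrow> 'i multiset \<Rightarrow> 'a" where
  "pname P = (\<lambda>m. c (Poly_Mapping.lookup P m))"

lemma W_0: "0 \<in> W"
  using W_diff[OF W_1 W_1] by simp

lemma W_uminus: "v \<in> W \<Longrightarrow> - v \<in> W"
  using W_diff[OF W_0] by simp

lemma W_add: "v \<in> W \<Longrightarrow> w \<in> W \<Longrightarrow> v + w \<in> W"
  using W_diff[of v "- w"] W_uminus[of w] by simp

lemma W_sum: "(\<And>i. i \<in> A \<Longrightarrow> f i \<in> W) \<Longrightarrow> (\<Sum>i\<in>A. f i) \<in> W"
  by (induction A rule: infinite_finite_induct) (simp_all add: W_0 W_add)

lemma pols_diff: "P \<in> pols \<Longrightarrow> Q \<in> pols \<Longrightarrow> P - Q \<in> pols"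
  using keys_diff[of P Q] by (fastforce simp: pols_def lookup_minus W_diff)

lemma pols_add: "P \<in> pols \<Longrightarrow> Q \<in> pols \<Longrightarrow> P + Q \<in> pols"
  using Poly_Mapping.keys_add[of P Q] by (fastforce simp: pols_def lookup_add W_add)

lemma pols_mult:
  assumes "P \<in> pols" "Q \<in> pols"
  shows "P * Q \<in> pols"
proof -
  have "Poly_Mapping.lookup (P * Q) m \<in> W" for m
    unfolding lookup_mult_multiset by (rule W_sum) (use assms in \<open>auto simp: pols_def W_mult\<close>)
  moreover have "set_mset m \<subseteq> I" if "m \<in> Poly_Mapping.keys (P * Q)" for m
    using that keys_mult[of P Q] assms by (fastforce simp: pols_def)
  ultimately show ?thesis by (simp add: pols_def)
qed

lemma single_in_pols: "v \<in> W \<Longrightarrow> set_mset m \<subseteq> I \<Longrightarrow> Poly_Mapping.single m v \<in> pols"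
  by (auto simp: pols_def lookup_single when_def W_0)

lemma pols_0: "0 \<in> pols"
  by (simp add: pols_def W_0)

lemma pols_induct [consumes 1, case_names const add var]:
  assumes "P \<in> pols" and const: "\<And>v. v \<in> W \<Longrightarrow> A (Poly_Mapping.single {#} v)"
    and add: "\<And>P Q. P \<in> pols \<Longrightarrow> Q \<in> pols \<Longrightarrow> A P \<Longrightarrow> A Q \<Longrightarrow> A (P + Q)"
    and var: "\<And>P i. P \<in> pols \<Longrightarrow> i \<in> I \<Longrightarrow> A P \<Longrightarrow> A (P * Poly_Mapping.single {#i#} 1)"
  shows "A P"
proof -
  have mono: "A (Poly_Mapping.single m v)" if "v \<in> W" "set_mset m \<subseteq> I" for m v
    using that(2)
  proof (induction m)
    case empty
    show ?case by (rule const[OF that(1)])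
  next
    case (add i m)
    then have "A (Poly_Mapping.single m v * Poly_Mapping.single {#i#} 1)"
      using that(1) by (intro var single_in_pols) auto
    then show ?case by (simp add: mult_single)
  qed
  have "(\<Sum>m\<in>B. Poly_Mapping.single m (Poly_Mapping.lookup P m)) \<in> pols \<and> A (\<Sum>m\<in>B. Poly_Mapping.single m (Poly_Mapping.lookup P m))"
    if "B \<subseteq> Poly_Mapping.keys P" for B
  proof -
    have "finite B" using that finite_keys finite_subset by blast
    then show ?thesis using that
    proof (induction B rule: finite_induct)
      case empty
      show ?case using const[OF W_0] pols_0 by simp
    next
      case (insert m B)
      have "Poly_Mapping.lookup P m \<in> W" "set_mset m \<subseteq> I" using assms(1) insert.prems by (auto simp: pols_def)
      then show ?case using insert by (simp add: single_in_pols pols_add add mono)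
    qed
  qed
  from this[OF subset_refl] show ?thesis unfolding sum_single[of P, symmetric] ..
qed

lemma inj_pname: "inj_on pname pols"
proof (rule inj_onI, rule poly_mapping_eqI)
  fix P Q m assume "P \<in> pols" "Q \<in> pols" "pname P = pname Q"
  then show "Poly_Mapping.lookup P m = Poly_Mapping.lookup Q m"
    using inj_onD[OF inj_c, of "Poly_Mapping.lookup P m" "Poly_Mapping.lookup Q m"] by (auto simp: pols_def pname_def fun_eq_iff)
qed

lemma pname_const: "R.indexed_const (c v) = pname (Poly_Mapping.single {#} v)"
  by (auto simp: R.indexed_const_def pname_def lookup_single when_def c_0)

lemma pname_padd: "P \<in> pols \<Longrightarrow> Q \<in> pols \<Longrightarrow> R.indexed_padd (pname P) (pname Q) = pname (P + Q)"
  by (simp add: R.indexed_padd_def pname_def pols_def c_add lookup_add)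

lemma lookup_mult_var:
  "Poly_Mapping.lookup (P * Poly_Mapping.single {#i#} 1) m = (if i \<in># m then Poly_Mapping.lookup P (m - {#i#}) else 0)"
  for P :: "'i multiset \<Rightarrow>\<^sub>0 'b"
proof -
  have "Poly_Mapping.lookup (P * Poly_Mapping.single {#i#} 1) m = Poly_Mapping.lookup (Poly_Mapping.single {#i#} 1 * P) m"
    by (simp add: mult.commute)
  also have "\<dots> = (\<Sum>u | u \<subseteq># m. if u = {#i#} then Poly_Mapping.lookup P (m - {#i#}) else 0)"
    unfolding lookup_mult_multiset by (rule sum.cong) (auto simp: lookup_single when_def)
  finally show ?thesis by (simp add: finite_submultisets)
qed

lemma pname_pmult: "R.indexed_pmult (pname P) i = pname (P * Poly_Mapping.single {#i#} 1)"
  by (auto simp: R.indexed_pmult_def pname_def lookup_mult_var c_0)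

lemma pname_var: "R.indexed_var i = pname (Poly_Mapping.single {#i#} 1)"
  unfolding R.indexed_var_def c_1 pname_const pname_pmult by (simp add: mult_single)

lemma carrier_mpoly: "carrier \<P> = pname ` pols"
proof -
  have "R.indexed_pset I (carrier R) = pname ` pols"
  proof (intro equalityI subsetI)
    fix p assume "p \<in> R.indexed_pset I (carrier R)"
    then show "p \<in> pname ` pols"
    proof (induction rule: R.indexed_pset.induct)
      case (indexed_const k)
      then obtain v where "v \<in> W" "k = c v" by (auto simp: carrier_R)
      then show ?case by (simp add: pname_const single_in_pols)
    next
      case (indexed_padd p p')
      then obtain P P' where "P \<in> pols" "p = pname P" "P' \<in> pols" "p' = pname P'" by blast
      then show ?case by (simp add: pname_padd pols_add)
    next
      case (indexed_pmult p i)
      then obtain P where "P \<in> pols" "p = pname P" by blast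
      then show ?case using indexed_pmult by (simp add: pname_pmult pols_mult single_in_pols W_1)
    qed
  next
    fix p assume "p \<in> pname ` pols"
    then obtain P where "P \<in> pols" "p = pname P" by blast
    moreover from this(1) have "pname P \<in> R.indexed_pset I (carrier R)"
    proof (induction rule: pols_induct)
      case (const v)
      then show ?case unfolding pname_const[symmetric]
        by (intro R.indexed_pset.indexed_const) (simp add: carrier_R)
    next
      case (add P Q)
      then show ?case unfolding pname_padd[OF add(1,2), symmetric] by (intro R.indexed_pset.indexed_padd)
    next
      case (var P i)
      then show ?case unfolding pname_pmult[symmetric] by (intro R.indexed_pset.indexed_pmult)
    qed
    ultimately show "p \<in> R.indexed_pset I (carrier R)" by simp
  qed
  then show ?thesis by (simp add: mpoly_ring_def)
qed

lemma pname_add: "P \<in> pols \<Longrightarrow> Q \<in> pols \<Longrightarrow> pname P \<oplus>\<^bsub>\<P>\<^esub> pname Q = pname (P + Q)"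
  by (simp add: mpoly_ring_def pname_padd)

lemma pname_mult:
  assumes "P \<in> pols" "Q \<in> pols"
  shows "pname P \<otimes>\<^bsub>\<P>\<^esub> pname Q = pname (P * Q)"
proof
  fix m
  have W: "Poly_Mapping.lookup P u \<in> W" "Poly_Mapping.lookup Q u \<in> W" for u using assms by (auto simp: pols_def)
  have "(pname P \<otimes>\<^bsub>\<P>\<^esub> pname Q) m = (\<Oplus>\<^bsub>R\<^esub>u\<in>{u. u \<subseteq># m}. c (Poly_Mapping.lookup P u * Poly_Mapping.lookup Q (m - u)))"
    by (simp add: mpoly_ring_def pname_def c_mult W)
  also have "\<dots> = c (\<Sum>u\<in>{u. u \<subseteq># m}. Poly_Mapping.lookup P u * Poly_Mapping.lookup Q (m - u))"
    using finsum_additive_image[OF R.abelian_monoid_axioms, of W c "{u. u \<subseteq># m}" "\<lambda>u. Poly_Mapping.lookup P u * Poly_Mapping.lookup Q (m - u)"]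
    by (auto simp: carrier_R c_add c_0 W_0 W_add W_mult W finite_submultisets)
  finally show "(pname P \<otimes>\<^bsub>\<P>\<^esub> pname Q) m = pname (P * Q) m"
    by (simp add: pname_def lookup_mult_multiset)
qed

lemma pname_0: "\<zero>\<^bsub>\<P>\<^esub> = pname 0" and pname_1: "\<one>\<^bsub>\<P>\<^esub> = pname 1"
  using pname_const[of 0] pname_const[of 1] by (simp_all add: mpoly_ring_def c_0 c_1 flip: zero_multiset_def)

text \<open>The polynomial with a given name.\<close>

definition pval :: "('i multiset \<Rightarrow> 'a) \<Rightarrow> 'i multiset \<Rightarrow>\<^sub>0 'b" where
  "pval = inv_into pols pname"

lemma pval_pname [simp]: "P \<in> pols \<Longrightarrow> pval (pname P) = P"
  unfolding pval_def by (rule inv_into_f_f[OF inj_pname])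

lemma pols_1: "1 \<in> pols"
  using single_in_pols[OF W_1, of "{#}"] by (simp flip: zero_multiset_def)

lemma cring_mpoly: "cring \<P>"
proof (rule cring_if_embeds_type[where h = pval])
  show "inj_on pval (carrier \<P>)"
    unfolding carrier_mpoly by (rule inj_onI) auto
  fix p assume "p \<in> carrier \<P>"
  then obtain P where "P \<in> pols" "p = pname P" by (auto simp: carrier_mpoly)
  then show "\<exists>y\<in>carrier \<P>. pval y = - pval p"
    using pols_diff[OF pols_0, of P] by (intro bexI[of _ "pname (- P)"]) (auto simp: carrier_mpoly)
qed (auto simp: carrier_mpoly pname_add pname_mult pname_0 pname_1 pols_add pols_mult pols_0 pols_1)

lemma pname_diff:
  assumes "P \<in> pols" "Q \<in> pols"
  shows "pname P \<ominus>\<^bsub>\<P>\<^esub> pname Q = pname (P - Q)"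
proof -
  interpret cring \<P> by (rule cring_mpoly)
  have Q: "- Q \<in> pols" using pols_diff[OF pols_0 assms(2)] by simp
  have "\<ominus>\<^bsub>\<P>\<^esub> pname Q = pname (- Q)"
    by (rule minus_equality) (auto simp: carrier_mpoly assms Q pname_add pname_0)
  then show ?thesis using assms Q by (simp add: a_minus_def pname_add)
qed

end


section \<open>The presentation\<close>

lemma Collect_image_cong:
  assumes "\<And>C. C \<in> K \<Longrightarrow> f C = g C"
  shows "{f C | C. C \<in> K} = {g C | C. C \<in> K}"
  unfolding Setcompr_eq_image by (rule image_cong[OF refl assms])

lemma Collect_image2_cong:
  assumes "\<And>C C'. C \<in> K \<Longrightarrow> C' \<in> K \<Longrightarrow> f C C' = g C C'"
  shows "{f C C' | C C'. C \<in> K \<and> C' \<in> K} = {g C C' | C C'. C \<in> K \<and> C' \<in> K}"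
proof -
  have "\<exists>C C'. f0 B B' = g0 C C' \<and> C \<in> K \<and> C' \<in> K"
    if "\<And>C C'. C \<in> K \<Longrightarrow> C' \<in> K \<Longrightarrow> f0 C C' = g0 C C'" "B \<in> K" "B' \<in> K" for f0 g0 :: "'a \<Rightarrow> 'a \<Rightarrow> 'b" and B B'
    using that by blast
  from this[of f g] this[of g f] show ?thesis using assms by fastforce
qed

context half_presentation
begin

lemma RV_in_Vch: "v \<in> RV \<Longrightarrow> v \<in> Vch"
  using RV_subset_Vch by blast

lemma R1_ring_simps:
  "carrier (R1_ring D rt) = cls ` RV" "\<zero>\<^bsub>R1_ring D rt\<^esub> = cls 0" "\<one>\<^bsub>R1_ring D rt\<^esub> = cls 1"
  "v \<in> RV \<Longrightarrow> w \<in> RV \<Longrightarrow> cls v \<oplus>\<^bsub>R1_ring D rt\<^esub> cls w = cls (v + w)"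
  "v \<in> RV \<Longrightarrow> w \<in> RV \<Longrightarrow> cls v \<otimes>\<^bsub>R1_ring D rt\<^esub> cls w = cls (v * w)"
  by (simp_all add: R1_ring_def R1_eq cls_zero cls_one cls_add cls_mult RV_in_Vch)

lemma ring_R1_ring: "ring (R1_ring D rt)"
proof -
  have "cring (R1_ring D rt)"
  proof (rule cring_if_embeds_type[where h = val])
    show "inj_on val (carrier (R1_ring D rt))"
      unfolding R1_ring_simps by (rule inj_onI) (auto simp: RV_in_Vch)
    fix x assume "x \<in> carrier (R1_ring D rt)"
    then obtain v where "v \<in> RV" "x = cls v" by (auto simp: R1_ring_simps)
    then show "\<exists>y\<in>carrier (R1_ring D rt). val y = - val x"
      by (intro bexI[of _ "cls (- v)"]) (auto simp: R1_ring_simps RV_uminus RV_in_Vch)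
  qed (auto simp: R1_ring_simps RV_in_Vch RV_add RV_mult RV_0 RV_1 Vch_0 Vch_1)
  then show ?thesis by (rule cring.axioms(1))
qed

interpretation pres: named_ring "R1_ring D rt" cls RV "K0hat \<omega>"
proof (rule named_ring.intro)
  show "inj_on cls RV" by (rule inj_on_subset[OF inj_cls RV_subset_Vch])
qed (simp_all add: ring_R1_ring R1_ring_simps RV_1 RV_diff RV_mult)

text \<open>The polynomial ring over $R_1$, and the constants and variables on the side of the
  polynomials which name its elements.\<close>

abbreviation PP :: "('k set multiset \<Rightarrow> ('k hmod \<Rightarrow>\<^sub>0 int) set) ring" where
  "PP \<equiv> R1_poly D rt \<omega>"

abbreviation cst :: "(gen list \<Rightarrow> 'k) \<Rightarrow> 'k set multiset \<Rightarrow>\<^sub>0 (gen list \<Rightarrow> 'k)" where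
  "cst \<equiv> Poly_Mapping.single {#}"

abbreviation vr :: "'k set \<Rightarrow> 'k set multiset \<Rightarrow>\<^sub>0 (gen list \<Rightarrow> 'k)" where
  "vr C \<equiv> Poly_Mapping.single {#C#} 1"

lemmas PP_simps = pres.carrier_mpoly[folded R1_poly_def] pres.pname_add[folded R1_poly_def]
  pres.pname_mult[folded R1_poly_def] pres.pname_diff[folded R1_poly_def]
  pres.pname_0[folded R1_poly_def] pres.pname_1[folded R1_poly_def]

lemma cring_PP: "cring PP"
  using pres.cring_mpoly by (simp add: R1_poly_def)

lemma cst_in_pols: "v \<in> RV \<Longrightarrow> cst v \<in> pres.pols"
  by (rule pres.single_in_pols) auto

lemma vr_in_pols: "C \<in> K0hat \<omega> \<Longrightarrow> vr C \<in> pres.pols"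
  by (rule pres.single_in_pols) (auto simp: RV_1)

lemma peval_in_Vch: "P \<in> pres.pols \<Longrightarrow> peval xi P \<in> Vch"
  by (induction rule: pres.pols_induct) (simp_all add: RV_in_Vch peval_add peval_mult Vch_add Vch_mult xi_in_Vch)

text \<open>The substitution of $x_{\zeta,1}$, where $\zeta$ is the representative of \<^term>\<open>C\<close>, for the variable
  of each class \<^term>\<open>C\<close>.\<close>

definition subst :: "('k set multiset \<Rightarrow> ('k hmod \<Rightarrow>\<^sub>0 int) set) \<Rightarrow> ('k hmod \<Rightarrow>\<^sub>0 int) set" where
  "subst p = cls (peval xi (pres.pval p))"

lemma subst_pname [simp]: "P \<in> pres.pols \<Longrightarrow> subst (pres.pname P) = cls (peval xi P)"
  by (simp add: subst_def)

lemma subst_hom: "ring_hom_ring PP (G0 D) subst"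
proof (rule ring_hom_ringI)
  show "ring PP" "ring (G0 D)" using cring_PP cring_G0 by (simp_all add: cring.axioms(1))
  show "subst \<one>\<^bsub>PP\<^esub> = \<one>\<^bsub>G0 D\<^esub>"
    using peval_single[of xi "{#}" 1] by (simp add: PP_simps pres.pols_1 cls_one flip: zero_multiset_def)
qed (auto simp: PP_simps carrier_G0 peval_in_Vch pres.pols_add pres.pols_mult peval_add peval_mult cls_add cls_mult)

text \<open>Modulo the relators the product of two variables is a constant times a variable, or a
  constant.\<close>

definition xprod :: "'k set \<Rightarrow> 'k set \<Rightarrow> 'k set multiset \<Rightarrow>\<^sub>0 (gen list \<Rightarrow> 'k)" where
  "xprod C C' = (let z = rep C * rep C' in
     if z ^ n1 \<noteq> 1
     then cst (orb (1, 1, 1)) * (cst (chi (rt (z / rep (mu_cls \<omega> z)), 1, 1)) * vr (mu_cls \<omega> z))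
     else cst (of_nat n * (orb (1, 1, 1) * chi (rt z, 1, 1))))"

lemma rep_quotient:
  assumes "z \<noteq> 0" "z ^ n1 \<noteq> 1"
  shows "mu_cls \<omega> z \<in> K0hat \<omega>" "z / rep (mu_cls \<omega> z) \<noteq> 0" "(z / rep (mu_cls \<omega> z)) ^ n1 = 1 ^ n"
proof -
  show K: "mu_cls \<omega> z \<in> K0hat \<omega>" using mu_cls_in_K0hat_iff assms by blast
  show "z / rep (mu_cls \<omega> z) \<noteq> 0" using assms rep_props(1)[OF K] by simp
  have "rep (mu_cls \<omega> z) ^ n1 = z ^ n1" using rep[OF K] mu_cls_eq[OF assms(1)] by auto
  then show "(z / rep (mu_cls \<omega> z)) ^ n1 = 1 ^ n" using assms by (simp add: power_divide)
qed

lemma rep_prod_nonzero: "C \<in> K0hat \<omega> \<Longrightarrow> C' \<in> K0hat \<omega> \<Longrightarrow> rep C * rep C' \<noteq> 0"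
  using rep_props(1) by simp

lemma xprod_cases:
  assumes "C \<in> K0hat \<omega>" "C' \<in> K0hat \<omega>"
  obtains v where "v \<in> RV" "xprod C C' = cst v"
    | v E where "v \<in> RV" "E \<in> K0hat \<omega>" "xprod C C' = Poly_Mapping.single {#E#} v"
proof -
  let ?z = "rep C * rep C'"
  have z: "?z \<noteq> 0" by (rule rep_prod_nonzero[OF assms])
  show thesis
  proof (cases "?z ^ n1 \<noteq> 1")
    case True
    note r = rep_quotient[OF z True]
    show thesis
    proof (rule that(2))
      show "orb (1, 1, 1) * chi (rt (?z / rep (mu_cls \<omega> ?z)), 1, 1) \<in> RV"
        using g3_eq(2)[OF r(2) _ _ r(3)] by (intro RV_mult orb_1_in_RV RV_chi) simp
    qed (use r(1) True in \<open>simp_all add: xprod_def Let_def mult_single mult.assoc del: orb.simps\<close>)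
  next
    case False
    show thesis
    proof (rule that(1))
      show "of_nat n * (orb (1, 1, 1) * chi (rt ?z, 1, 1)) \<in> RV"
        using g3_eq(2)[OF z, of 1 1] False by (intro RV_of_nat RV_mult orb_1_in_RV RV_chi) simp
    qed (use False in \<open>simp add: xprod_def Let_def del: orb.simps\<close>)
  qed
qed

lemma xprod_in_pols:
  assumes "C \<in> K0hat \<omega>" "C' \<in> K0hat \<omega>"
  shows "xprod C C' \<in> pres.pols"
  by (rule xprod_cases[OF assms]) (simp_all add: pres.single_in_pols)

lemma peval_xprod:
  assumes "C \<in> K0hat \<omega>" "C' \<in> K0hat \<omega>"
  shows "peval xi (xprod C C') = xi C * xi C'"
proof -
  let ?z = "rep C * rep C'"
  have nz: "rep C \<noteq> 0" "rep C' \<noteq> 0" and z: "?z \<noteq> 0" using assms rep_props(1) by auto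
  have rz: "rt ?z \<noteq> 0" using rt_nonzero[OF z] .
  have "orb (rt (rep C) * rt (rep C'), 1, 1) = orb (rt ?z, 1, 1)"
    by (rule orb_cong[OF _ rz]) (simp add: rt_mult_pow nz rt[OF z])
  then have R: "xi C * xi C' = of_nat n * orb (rt ?z, 1, 1)"
    using orb_mult_orb[of "rt (rep C)" "rt (rep C')" 1 1 1 1] nz by (simp add: xi_def rt_nonzero del: orb.simps)
  show ?thesis
  proof (cases "?z ^ n1 \<noteq> 1")
    case True
    let ?r = "rep (mu_cls \<omega> ?z)"
    note r = rep_quotient[OF z True]
    have r0: "?r \<noteq> 0" by (rule rep_props(1)[OF r(1)])
    have "orb (rt (?z / ?r) * rt ?r, 1, 1) = orb (rt ?z, 1, 1)"
      by (rule orb_cong[OF _ rz]) (use r(2) r0 in \<open>simp add: rt_mult_pow rt[OF z]\<close>)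
    then have "chi (rt (?z / ?r), 1, 1) * xi (mu_cls \<omega> ?z) = orb (rt ?z, 1, 1)"
      using chi_mult_orb[of "rt (?z / ?r)" 1 1 "rt ?r" 1 1] by (simp add: xi_def del: orb.simps)
    moreover have "orb (1, 1, 1) * orb (rt ?z, 1, 1) = of_nat n * orb (rt ?z, 1, 1)"
      using orb_mult_orb[OF _ rz, of 1 1 1 1 1] by (simp del: orb.simps)
    ultimately show ?thesis using True by (simp add: xprod_def Let_def peval_mult R del: orb.simps)
  next
    case False
    have "orb (1, 1, 1) * chi (rt ?z, 1, 1) = orb (rt ?z, 1, 1)"
      using chi_mult_orb[of "rt ?z" 1 1 1 1 1] by (simp add: mult.commute del: orb.simps)
    then show ?thesis using False by (simp add: xprod_def Let_def R del: orb.simps)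
  qed
qed

text \<open>The polynomials which name the relators, see \<open>x_relators_eq\<close> and \<open>g_relators_eq\<close>.\<close>

definition xrel :: "'k set \<Rightarrow> 'k set \<Rightarrow> 'k set multiset \<Rightarrow>\<^sub>0 (gen list \<Rightarrow> 'k)" where
  "xrel C C' = vr C * vr C' - xprod C C'"

definition grel :: "'k set \<Rightarrow> 'k set multiset \<Rightarrow>\<^sub>0 (gen list \<Rightarrow> 'k)" where
  "grel C = cst (chi (q, 1, 1)) * vr C - vr C"

lemma xrel_in_pols: "C \<in> K0hat \<omega> \<Longrightarrow> C' \<in> K0hat \<omega> \<Longrightarrow> xrel C C' \<in> pres.pols"
  unfolding xrel_def by (intro pres.pols_diff pres.pols_mult vr_in_pols xprod_in_pols)

lemma q1_RV: "chi (q, 1, 1) \<in> RV"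
  using RV_chi[OF q_Lam[of 1]] by simp

lemma grel_in_pols: "C \<in> K0hat \<omega> \<Longrightarrow> grel C \<in> pres.pols"
  unfolding grel_def by (intro pres.pols_diff pres.pols_mult vr_in_pols cst_in_pols q1_RV)

lemma x_relators_eq:
  "x_relators D rt \<omega> rep = {pres.pname (xrel C C') | C C'. C \<in> K0hat \<omega> \<and> C' \<in> K0hat \<omega>}"
proof -
  have "(pvar D rt C \<otimes>\<^bsub>PP\<^esub> pvar D rt C') \<ominus>\<^bsub>PP\<^esub>
        (let z = rep C * rep C' in
         if z ^ n1 \<noteq> 1
         then pconst D rt (s_elt D rt) \<otimes>\<^bsub>PP\<^esub> x_formal D rt \<omega> rep z
         else pconst D rt (add_pow (G0 D) n (s_elt D rt \<otimes>\<^bsub>G0 D\<^esub> g3 D rt z 1 1)))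
      = pres.pname (xrel C C')" if C: "C \<in> K0hat \<omega>" "C' \<in> K0hat \<omega>" for C C'
  proof -
    let ?z = "rep C * rep C'"
    have z: "?z \<noteq> 0" by (rule rep_prod_nonzero[OF C])
    have s: "orb (1, 1, 1) \<in> Vch" by (rule RV_in_Vch[OF orb_1_in_RV])
    have "(if ?z ^ n1 \<noteq> 1
         then pconst D rt (s_elt D rt) \<otimes>\<^bsub>PP\<^esub> x_formal D rt \<omega> rep ?z
         else pconst D rt (add_pow (G0 D) n (s_elt D rt \<otimes>\<^bsub>G0 D\<^esub> g3 D rt ?z 1 1)))
      = pres.pname (xprod C C')"
    proof (cases "?z ^ n1 \<noteq> 1")
      case True
      note r = rep_quotient[OF z True]
      let ?w = "chi (rt (?z / rep (mu_cls \<omega> ?z)), 1, 1)"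
      have w: "cst ?w \<in> pres.pols" using g3_eq(2)[OF r(2) _ _ r(3)] by (intro cst_in_pols RV_chi) simp
      have "x_formal D rt \<omega> rep ?z = pres.pname (cst ?w * vr (mu_cls \<omega> ?z))"
        unfolding x_formal_def
        using g3_eq(1)[OF r(2) _ _ r(3), of 1] w vr_in_pols[OF r(1)]
        by (simp add: pres.pname_const pres.pname_var PP_simps)
      moreover have "cst ?w * vr (mu_cls \<omega> ?z) \<in> pres.pols"
        by (rule pres.pols_mult[OF w vr_in_pols[OF r(1)]])
      ultimately show ?thesis
        using True cst_in_pols[OF orb_1_in_RV]
        by (simp add: xprod_def Let_def s_elt_eq pres.pname_const PP_simps del: orb.simps)
    next
      case False
      then have g: "g3 D rt ?z 1 1 = cls (chi (rt ?z, 1, 1))" "(rt ?z, 1, 1) \<in> Lam"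
        using g3_eq[OF z, of 1 1] by simp_all
      show ?thesis
        using False s chi_in_Vch[OF g(2)]
        by (simp add: xprod_def Let_def g s_elt_eq cls_mult add_pow_cls Vch_mult pres.pname_const del: orb.simps)
    qed
    then show ?thesis
      using C by (simp add: Let_def xrel_def pres.pname_var PP_simps vr_in_pols pres.pols_mult xprod_in_pols)
  qed
  then show ?thesis unfolding x_relators_def by (rule Collect_image2_cong)
qed

lemma g_relators_eq: "g_relators D rt \<omega> = {pres.pname (grel C) | C. C \<in> K0hat \<omega>}"
proof -
  have "(pconst D rt (g_elt D rt) \<otimes>\<^bsub>PP\<^esub> pvar D rt C) \<ominus>\<^bsub>PP\<^esub> pvar D rt C = pres.pname (grel C)"
    if "C \<in> K0hat \<omega>" for C
    using that by (simp add: grel_def g_elt_eq pres.pname_var pres.pname_const PP_simps vr_in_pols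
        pres.pols_mult cst_in_pols q1_RV)
  then show ?thesis unfolding g_relators_def by (rule Collect_image_cong)
qed

abbreviation J :: "('k set multiset \<Rightarrow> ('k hmod \<Rightarrow>\<^sub>0 int) set) set" where
  "J \<equiv> pres_ideal D rt \<omega> rep"

lemma relators_subset: "x_relators D rt \<omega> rep \<union> g_relators D rt \<omega> \<subseteq> carrier PP"
  by (auto simp: x_relators_eq g_relators_eq PP_simps xrel_in_pols grel_in_pols)

lemma ideal_J: "ideal J PP"
proof -
  interpret PP: cring PP by (rule cring_PP)
  show ?thesis unfolding pres_ideal_def by (rule PP.genideal_ideal[OF relators_subset])
qed

lemma relators_in_J:
  shows "C \<in> K0hat \<omega> \<Longrightarrow> C' \<in> K0hat \<omega> \<Longrightarrow> pres.pname (xrel C C') \<in> J"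
    and "C \<in> K0hat \<omega> \<Longrightarrow> pres.pname (grel C) \<in> J"
proof -
  interpret PP: cring PP by (rule cring_PP)
  show "C \<in> K0hat \<omega> \<Longrightarrow> C' \<in> K0hat \<omega> \<Longrightarrow> pres.pname (xrel C C') \<in> J"
    and "C \<in> K0hat \<omega> \<Longrightarrow> pres.pname (grel C) \<in> J"
    using PP.genideal_self[OF relators_subset]
    by (auto simp: pres_ideal_def x_relators_eq g_relators_eq)
qed

lemma peval_xrel: "C \<in> K0hat \<omega> \<Longrightarrow> C' \<in> K0hat \<omega> \<Longrightarrow> peval xi (xrel C C') = 0"
  by (simp add: xrel_def peval_diff peval_mult peval_xprod)

lemma peval_grel: "peval xi (grel C) = 0"
proof -
  have "orb (q * rt (rep C), 1, 1) = orb (rt (rep C), 1, 1)" if "rt (rep C) \<noteq> 0"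
    by (rule orb_cong[OF _ that]) (simp add: power_mult_distrib q_pow_n)
  moreover have "orb (q * rt (rep C), 1, 1) = orb (rt (rep C), 1, 1)" if "rt (rep C) = 0"
    using that by simp
  ultimately have "chi (q, 1, 1) * xi C = xi C"
    using chi_mult_orb[of q 1 1 "rt (rep C)" 1 1] by (cases "rt (rep C) = 0") (simp_all add: xi_def del: orb.simps)
  then show ?thesis by (simp add: grel_def peval_diff peval_mult)
qed

lemma J_subset_kernel: "J \<subseteq> a_kernel PP (G0 D) subst"
proof -
  interpret h: ring_hom_ring PP "G0 D" subst by (rule subst_hom)
  show ?thesis
    unfolding pres_ideal_def
  proof (rule h.R.genideal_minimal[OF h.kernel_is_ideal])
    show "x_relators D rt \<omega> rep \<union> g_relators D rt \<omega> \<subseteq> a_kernel PP (G0 D) subst"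
    proof
      fix p assume "p \<in> x_relators D rt \<omega> rep \<union> g_relators D rt \<omega>"
      then obtain P where "P \<in> pres.pols" "p = pres.pname P" "peval xi P = 0"
        unfolding x_relators_eq g_relators_eq
        using xrel_in_pols grel_in_pols peval_xrel peval_grel by blast
      then have "p \<in> carrier PP" "subst p = \<zero>\<^bsub>G0 D\<^esub>" by (auto simp: PP_simps cls_zero)
      then show "p \<in> a_kernel PP (G0 D) subst" unfolding a_kernel_def' by blast
    qed
  qed
qed

text \<open>The polynomials which name the elements of the ideal.\<close>

definition JP :: "('k set multiset \<Rightarrow>\<^sub>0 (gen list \<Rightarrow> 'k)) set" where
  "JP = {P \<in> pres.pols. pres.pname P \<in> J}"

lemma JP_add: "P \<in> JP \<Longrightarrow> Q \<in> JP \<Longrightarrow> P + Q \<in> JP"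
  using additive_subgroup.a_closed[OF ideal.axioms(1)[OF ideal_J], of "pres.pname P" "pres.pname Q"]
  by (simp add: JP_def PP_simps pres.pols_add)

lemma JP_mult: "P \<in> JP \<Longrightarrow> Q \<in> pres.pols \<Longrightarrow> P * Q \<in> JP"
  using ideal.I_r_closed[OF ideal_J, of "pres.pname P" "pres.pname Q"]
  by (simp add: JP_def PP_simps pres.pols_mult)

lemma JP_0: "0 \<in> JP"
  using additive_subgroup.zero_closed[OF ideal.axioms(1)[OF ideal_J]] by (simp add: JP_def PP_simps pres.pols_0)

lemma JP_uminus:
  assumes "P \<in> JP"
  shows "- P \<in> JP"
  using JP_mult[OF assms, of "cst (- 1)"] cst_in_pols[OF RV_uminus[OF RV_1]]
  by (simp add: single_uminus flip: zero_multiset_def)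

lemma JP_diff: "P \<in> JP \<Longrightarrow> Q \<in> JP \<Longrightarrow> P - Q \<in> JP"
  using JP_add[of P "- Q"] JP_uminus[of Q] by simp

lemma peval_JP:
  assumes "P \<in> JP"
  shows "peval xi P = 0"
proof -
  have "cls (peval xi P) = cls 0"
    using J_subset_kernel assms by (auto simp: JP_def a_kernel_def' cls_zero)
  then show ?thesis
    using inj_onD[OF inj_cls, of "peval xi P" 0] assms by (simp add: JP_def peval_in_Vch Vch_0)
qed

text \<open>A monomial in at most one variable whose value is the character of the simple module with
  parameter \<^term>\<open>t\<close>.\<close>

definition smon :: "'k \<times> 'k \<times> 'k \<Rightarrow> 'k set multiset \<Rightarrow>\<^sub>0 (gen list \<Rightarrow> 'k)" where
  "smon t = (if t \<in> Lam then cst (chi t) else Poly_Mapping.single {#cof t#} (chi (lam_part t)))"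

lemma smon_in_pols: "t \<in> Idx \<Longrightarrow> smon t \<in> pres.pols"
  by (auto simp: smon_def intro!: cst_in_pols pres.single_in_pols RV_chi tau_eq_product cof_in_K0hat)

lemma peval_smon: "t \<in> Idx \<Longrightarrow> peval xi (smon t) = tau t"
  by (simp add: smon_def tau_Lam tau_eq_product)

text \<open>The polynomials congruent modulo the ideal to an integral combination of these monomials.\<close>

definition reduced :: "('k set multiset \<Rightarrow>\<^sub>0 (gen list \<Rightarrow> 'k)) set" where
  "reduced = {P \<in> pres.pols. \<exists>f. keys f \<subseteq> Idx \<and> P - zlin smon f \<in> JP}"

lemma zlin_smon_in_pols: "keys f \<subseteq> Idx \<Longrightarrow> zlin smon f \<in> pres.pols"
  by (rule frag_induction[of f Idx]) (simp_all add: pres.pols_0 smon_in_pols zlin_diff pres.pols_diff)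

lemma reduced_diff:
  assumes "P \<in> reduced" "Q \<in> reduced"
  shows "P - Q \<in> reduced"
proof -
  obtain f g where "keys f \<subseteq> Idx" "P - zlin smon f \<in> JP" "keys g \<subseteq> Idx" "Q - zlin smon g \<in> JP"
    using assms by (auto simp: reduced_def)
  then have "keys (f - g) \<subseteq> Idx" "(P - zlin smon f) - (Q - zlin smon g) \<in> JP"
    by (simp_all add: keys_diff_subset JP_diff)
  moreover have "(P - zlin smon f) - (Q - zlin smon g) = (P - Q) - zlin smon (f - g)" by (simp add: zlin_diff)
  ultimately show ?thesis using assms pres.pols_diff unfolding reduced_def by auto
qed

lemma reduced_smon: "t \<in> Idx \<Longrightarrow> smon t \<in> reduced"
  by (auto simp: reduced_def smon_in_pols JP_0 keys_frag_of intro!: exI[of _ "frag_of t"])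

lemma reduced_0: "0 \<in> reduced"
  by (auto simp: reduced_def pres.pols_0 JP_0 intro!: exI[of _ 0])

lemma reduced_add: "P \<in> reduced \<Longrightarrow> Q \<in> reduced \<Longrightarrow> P + Q \<in> reduced"
  using reduced_diff[of P "0 - Q"] reduced_diff[OF reduced_0, of Q] by simp

lemma reduced_if_congruent:
  assumes "P \<in> pres.pols" "Q \<in> reduced" "P - Q \<in> JP"
  shows "P \<in> reduced"
proof -
  obtain f where "keys f \<subseteq> Idx" "Q - zlin smon f \<in> JP" using assms by (auto simp: reduced_def)
  then have "keys f \<subseteq> Idx" "(P - Q) + (Q - zlin smon f) \<in> JP" using assms(3) JP_add by blast+
  then show ?thesis using assms(1) unfolding reduced_def by auto
qed

lemma reduced_const: "v \<in> RV \<Longrightarrow> cst v \<in> reduced"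
proof (rule RV_induct[of v])
  fix t assume "t \<in> Lam"
  then show "cst (chi t) \<in> reduced" using reduced_smon[of t] Lam_subset_Idx by (auto simp: smon_def)
qed (simp_all add: reduced_0 single_diff reduced_diff)

text \<open>The relator $g X_C - X_C$ allows to multiply the value at $a$ of a coefficient of $X_C$ by $q$.\<close>

lemma q_shift_congruent:
  assumes C: "C \<in> K0hat \<omega>" and t: "(a, b, c) \<in> Lam"
  shows "Poly_Mapping.single {#C#} (chi (a * q ^ j, b, c)) - Poly_Mapping.single {#C#} (chi (a, b, c)) \<in> JP"
proof (induction j)
  case (Suc j)
  let ?t = "(a * q ^ j, b, c)"
  have L: "?t \<in> Lam" using Lam_mult[OF t q_Lam[of j]] by simp
  have "grel C * cst (chi ?t) \<in> JP"
    using relators_in_J(2)[OF C] grel_in_pols[OF C] cst_in_pols[OF RV_chi[OF L]] by (intro JP_mult) (simp add: JP_def)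
  moreover have "grel C * cst (chi ?t) = Poly_Mapping.single {#C#} (chi (a * q ^ Suc j, b, c)) - Poly_Mapping.single {#C#} (chi ?t)"
    by (simp add: grel_def left_diff_distrib right_diff_distrib mult_single chi_mult mult_ac)
  ultimately have "(Poly_Mapping.single {#C#} (chi (a * q ^ Suc j, b, c)) - Poly_Mapping.single {#C#} (chi ?t))
      + (Poly_Mapping.single {#C#} (chi ?t) - Poly_Mapping.single {#C#} (chi (a, b, c))) \<in> JP"
    using Suc by (intro JP_add) simp_all
  then show ?case by simp
qed (simp add: JP_0)

lemma reduced_var:
  assumes C: "C \<in> K0hat \<omega>" and "v \<in> RV"
  shows "Poly_Mapping.single {#C#} v \<in> reduced"
proof (rule RV_induct[OF assms(2)])
  fix t assume t: "t \<in> Lam"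
  obtain a b c where abc: "t = (a, b, c)" by (metis prod_cases3)
  have nz: "a \<noteq> 0" "b \<noteq> 0" "c \<noteq> 0" "a ^ (n * n1) = b ^ n" using t by (auto simp: abc Lam_def)
  note r = rep_props[OF C]
  \<comment> \<open>the simple module whose monomial is $\chi X_C$, where $\chi$ is in the orbit of \<^term>\<open>t\<close>\<close>
  let ?s = "(rt (a ^ n * rep C), b, c)"
  have p0: "a ^ n * rep C \<noteq> 0" using nz r by simp
  have pow: "rt (a ^ n * rep C) ^ (n * n1) = b ^ n * rep C ^ n1"
    unfolding power_mult rt[OF p0] using nz(4) by (simp add: power_mult_distrib power_mult)
  have s: "?s \<in> Idx - Lam"
    using pow nz r(1,2) rt_nonzero[OF p0] rt[OF p0] by (auto simp: Idx_def Lam_def)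
  have cof: "cof ?s = C"
    using pow nz r(3) by simp
  have lam: "lam_part ?s = (rt (a ^ n), b, c)"
    using cof rt[OF p0] r(1) by (simp del: cof.simps)
  have an: "a ^ n \<noteq> 0" using nz by simp
  obtain j where j: "a = rt (a ^ n) * q ^ j" by (rule eq_rt_times_q_pow[OF nz(1)])
  have L: "(rt (a ^ n), b, c) \<in> Lam" using tau_eq_product(1)[OF s] unfolding lam .
  have "Poly_Mapping.single {#C#} (chi t) - smon ?s \<in> JP"
    using q_shift_congruent[OF C L, of j] s j[symmetric] by (simp add: smon_def cof lam abc del: cof.simps lam_part.simps)
  then show "Poly_Mapping.single {#C#} (chi t) \<in> reduced"
    using reduced_if_congruent[OF pres.single_in_pols[OF RV_chi[OF t]] reduced_smon[of ?s]] s C by auto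
qed (simp_all add: reduced_0 single_diff reduced_diff)

text \<open>Multiplication by a variable takes a monomial in one variable to one in two variables, which the
  relators rewrite into a constant or a monomial in one variable.\<close>

lemma reduced_mult_var:
  assumes C: "C \<in> K0hat \<omega>" and P: "P \<in> reduced"
  shows "P * vr C \<in> reduced"
proof -
  obtain f where f: "keys f \<subseteq> Idx" "P - zlin smon f \<in> JP" "P \<in> pres.pols" using P by (auto simp: reduced_def)
  have smon: "smon t * vr C \<in> reduced" if t: "t \<in> Idx" for t
  proof (cases "t \<in> Lam")
    case True
    then show ?thesis using reduced_var[OF C RV_chi[OF True]] by (simp add: smon_def mult_single)
  next
    case False
    then have t': "t \<in> Idx - Lam" using t by simp
    let ?v = "chi (lam_part t)"
    have v: "?v \<in> RV" by (rule RV_chi[OF tau_eq_product(1)[OF t']])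
    have K: "cof t \<in> K0hat \<omega>" by (rule cof_in_K0hat[OF t'])
    have "xrel (cof t) C * cst ?v \<in> JP"
      using relators_in_J(1)[OF K C] xrel_in_pols[OF K C] cst_in_pols[OF v] by (intro JP_mult) (simp add: JP_def)
    moreover have "xrel (cof t) C * cst ?v = smon t * vr C - xprod (cof t) C * cst ?v"
      using False by (simp add: xrel_def smon_def left_diff_distrib mult_single add_mset_commute)
    moreover have "xprod (cof t) C * cst ?v \<in> reduced"
      using K C
    proof (cases rule: xprod_cases)
      case (1 w)
      then show ?thesis by (simp add: mult_single reduced_const RV_mult v)
    next
      case (2 w E)
      then show ?thesis by (simp add: mult_single reduced_var RV_mult v)
    qed
    ultimately show ?thesis
      using reduced_if_congruent[of "smon t * vr C"] pres.pols_mult[OF smon_in_pols[OF t] vr_in_pols[OF C]] by simp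
  qed
  have "zlin smon f * vr C \<in> reduced"
    by (rule frag_induction[OF f(1)]) (simp_all add: reduced_0 smon zlin_diff left_diff_distrib reduced_diff)
  moreover have "P * vr C - zlin smon f * vr C \<in> JP"
    using JP_mult[OF f(2) vr_in_pols[OF C]] by (simp add: left_diff_distrib)
  ultimately show ?thesis
    using reduced_if_congruent pres.pols_mult[OF f(3) vr_in_pols[OF C]] by blast
qed

lemma pols_reduced: "P \<in> pres.pols \<Longrightarrow> P \<in> reduced"
  by (induction rule: pres.pols_induct) (simp_all add: reduced_const reduced_add reduced_mult_var)

lemma kernel_eq_J: "a_kernel PP (G0 D) subst = J"
proof
  show "a_kernel PP (G0 D) subst \<subseteq> J"
  proof
    fix p assume "p \<in> a_kernel PP (G0 D) subst"
    then obtain P where P: "P \<in> pres.pols" "p = pres.pname P" "cls (peval xi P) = cls 0"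
      by (auto simp: a_kernel_def' PP_simps cls_zero)
    have ev: "peval xi P = 0"
      using inj_onD[OF inj_cls, of "peval xi P" 0] P(3) peval_in_Vch[OF P(1)] Vch_0 by simp
    obtain f where f: "keys f \<subseteq> Idx" "P - zlin smon f \<in> JP"
      using pols_reduced[OF P(1)] by (auto simp: reduced_def)
    have "zlin tau f = zlin (\<lambda>t. peval xi (smon t)) f"
      by (rule zlin_cong) (use f(1) peval_smon in auto)
    also have "\<dots> = peval xi (zlin smon f)" by (simp add: peval_zlin)
    also have "\<dots> = 0" using peval_JP[OF f(2)] ev by (simp add: peval_diff)
    finally have "f = 0" by (rule tau_independent[OF f(1)])
    then show "p \<in> J" using f(2) P(2) by (simp add: JP_def)
  qed
qed (rule J_subset_kernel)

lemma subst_surj: "subst ` carrier PP = carrier (G0 D)"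
proof
  show "subst ` carrier PP \<subseteq> carrier (G0 D)"
    by (auto simp: PP_simps carrier_G0 peval_in_Vch)
  show "carrier (G0 D) \<subseteq> subst ` carrier PP"
  proof
    fix x assume "x \<in> carrier (G0 D)"
    then obtain f where f: "keys f \<subseteq> Idx" "x = cls (zlin tau f)" by (auto simp: carrier_G0 Vch_eq_tau)
    have "zlin tau f = zlin (\<lambda>t. peval xi (smon t)) f"
      by (rule zlin_cong) (use f(1) peval_smon in auto)
    then have "x = subst (pres.pname (zlin smon f))"
      by (simp add: zlin_smon_in_pols[OF f(1)] f(2) peval_zlin)
    moreover have "pres.pname (zlin smon f) \<in> carrier PP"
      using zlin_smon_in_pols[OF f(1)] by (simp add: PP_simps)
    ultimately show "x \<in> subst ` carrier PP" by blast
  qed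
qed

lemma presentation:
  "\<exists>\<phi> \<in> ring_iso (R2' D rt \<omega> rep) (G0 D).
     (\<forall>r \<in> R1 D rt. \<phi> (J +>\<^bsub>PP\<^esub> pconst D rt r) = r) \<and>
     (\<forall>C \<in> K0hat \<omega>. \<phi> (J +>\<^bsub>PP\<^esub> pvar D rt C) = x_elt D rt (rep C))"
proof -
  interpret h: ring_hom_ring PP "G0 D" subst by (rule subst_hom)
  let ?\<phi> = "\<lambda>S. the_elem (subst ` S)"
  have "?\<phi> \<in> ring_iso (R2' D rt \<omega> rep) (G0 D)"
    using h.FactRing_iso_set[OF subst_surj] by (simp add: R2'_def kernel_eq_J)
  moreover have val: "?\<phi> (J +>\<^bsub>PP\<^esub> pres.pname P) = cls (peval xi P)" if "P \<in> pres.pols" for P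
    using h.the_elem_simp[of "pres.pname P"] that by (simp add: kernel_eq_J PP_simps)
  have "?\<phi> (J +>\<^bsub>PP\<^esub> pconst D rt r) = r" if r: "r \<in> R1 D rt" for r
  proof -
    obtain v where "v \<in> RV" "r = cls v" using r by (auto simp: R1_eq)
    then show ?thesis using val[OF cst_in_pols[of v]] by (simp add: pres.pname_const)
  qed
  moreover have "?\<phi> (J +>\<^bsub>PP\<^esub> pvar D rt C) = x_elt D rt (rep C)" if "C \<in> K0hat \<omega>" for C
    using val[OF vr_in_pols[OF that]] that by (simp add: pres.pname_var x_elt_rep)
  ultimately show ?thesis by (intro bexI[of _ ?\<phi>]) auto
qed

end

theorem theorem5p12:
  fixes n n1 :: nat
    and q \<beta>1 \<beta>2 \<beta>3 \<omega> :: "'k :: {alg_closed_field, field_char_0}"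
    and rt :: "'k \<Rightarrow> 'k"
    and rep :: "'k set \<Rightarrow> 'k"
    and D :: "'k hopf_data"
  assumes "n \<ge> 2" and "primitive_root n q"
    and "1 \<le> n1" and "n1 \<le> n" and "\<not> 2 dvd gcd n n1"
    and D: "D = \<lparr>dn = n, dn1 = n1, dq = q, beta1 = \<beta>1, beta2 = \<beta>2, beta3 = \<beta>3\<rparr>"
    and Hopf: "is_Hopf D"
    and rt: "\<And>\<gamma>. \<gamma> \<noteq> 0 \<Longrightarrow> rt \<gamma> ^ n = \<gamma>" and rt_1: "rt 1 = 1"
    and \<omega>: "primitive_root n1 \<omega>"
    and rep: "\<And>C. C \<in> K0hat \<omega> \<Longrightarrow> rep C \<in> C"
    and "\<beta>1 \<noteq> 0" and "\<beta>2 = 0" and "\<beta>3 = 0"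
  shows "carrier (G0 D) =
           generate_ring (G0 D) (R1 D rt \<union> (\<lambda>C. x_elt D rt (rep C)) ` K0hat \<omega>)
       \<and> (\<forall>\<zeta> \<zeta>'. \<zeta> \<noteq> 0 \<longrightarrow> \<zeta>' \<noteq> 0 \<longrightarrow> mu_cls \<omega> \<zeta> \<in> K0hat \<omega> \<longrightarrow> mu_cls \<omega> \<zeta>' \<in> K0hat \<omega> \<longrightarrow>
            x_elt D rt \<zeta> \<otimes>\<^bsub>G0 D\<^esub> x_elt D rt \<zeta>' =
              (if (\<zeta> * \<zeta>') ^ n1 \<noteq> 1
               then s_elt D rt \<otimes>\<^bsub>G0 D\<^esub> x_elt D rt (\<zeta> * \<zeta>')
               else add_pow (G0 D) n (s_elt D rt \<otimes>\<^bsub>G0 D\<^esub> g3 D rt (\<zeta> * \<zeta>') 1 1)))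
       \<and> (\<exists>\<phi> \<in> ring_iso (R2' D rt \<omega> rep) (G0 D).
            (\<forall>r \<in> R1 D rt.
               \<phi> (pres_ideal D rt \<omega> rep +>\<^bsub>R1_poly D rt \<omega>\<^esub> pconst D rt r) = r) \<and>
            (\<forall>C \<in> K0hat \<omega>.
               \<phi> (pres_ideal D rt \<omega> rep +>\<^bsub>R1_poly D rt \<omega>\<^esub> pvar D rt C) = x_elt D rt (rep C)))"
proof -
  have half: "half_presentation D rt \<omega> rep"
    by unfold_locales (use assms in simp_all)
  then interpret half_presentation D rt \<omega> rep .
  have n1: "dn1 D = n1" and n: "dn D = n" by (simp_all add: D)
  have "x_elt D rt \<zeta> \<otimes>\<^bsub>G0 D\<^esub> x_elt D rt \<zeta>' =
      (if (\<zeta> * \<zeta>') ^ n1 \<noteq> 1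
       then s_elt D rt \<otimes>\<^bsub>G0 D\<^esub> x_elt D rt (\<zeta> * \<zeta>')
       else add_pow (G0 D) n (s_elt D rt \<otimes>\<^bsub>G0 D\<^esub> g3 D rt (\<zeta> * \<zeta>') 1 1))"
    if "\<zeta> \<noteq> 0" "\<zeta>' \<noteq> 0" "mu_cls \<omega> \<zeta> \<in> K0hat \<omega>" "mu_cls \<omega> \<zeta>' \<in> K0hat \<omega>" for \<zeta> \<zeta>'
    using x_elt_mult[of \<zeta> \<zeta>'] that mu_cls_in_K0hat_iff unfolding n n1 by blast
  then show ?thesis using carrier_G0_generated presentation by blast
qed

end
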